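(* Let $\Omega$ be the three-dimensional flat torus with a tetrahedral mesh $\mathcal T_h$, and let the discrete spaces, the interpolants $I_h^k$, the isomorphisms $J_h^k$ and the maps $\mathsf r_0,\mathsf r_1,\mathsf r_2$ be as defined in the context. Put $E_h^k=J_h^kI_h^k$ for $k=0,1,2,3$. Then the diagram with top row $$C^\infty(\Omega)\otimes\mathbb V\xrightarrow{\varepsilon}C^\infty(\Omega)\otimes\mathbb S\xrightarrow{\operatorname{inc}}C^\infty(\Omega)\otimes\mathbb S\xrightarrow{\operatorname{div}}C^\infty(\Omega)\otimes\mathbb V,$$ bottom row $$\mathcal C^0\otimes\mathbb V\xrightarrow{\mathsf r_0}\mathcal C^1\xrightarrow{\mathsf r_1}\mathcal C_1\xrightarrow{\mathsf r_2}\mathcal C_0\otimes\mathbb V,$$ and vertical maps $E_h^0,E_h^1,E_h^2,E_h^3$ commutes, i.e. $$\mathsf r_0E_h^0=E_h^1\varepsilon,\qquad \mathsf r_1E_h^1=E_h^2\operatorname{inc},\qquad \mathsf r_2E_h^2=E_h^3\operatorname{div}.$$ Explicitly, the vertical maps are given as follows. - $E_h^0:C^\infty(\Omega)\otimes\mathbb V\to\mathcal C^0\otimes\mathbb V$, $\langle E_h^0u,L\,y\rangle=L\cdot u(y)$ for $y\in\Delta_0$, $L\in\mathbb V$; - $E_h^1:C^\infty(\Omega)\otimes\mathbb S\to\mathcal C^1$, $\langle E_h^1u,e\rangle=\int_et_e^Tu\,t_e$ for $e\in\Delta_1$; - $E_h^2:C^\infty(\Omega)\otimes\mathbb S\to\mathcal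 C_1$, $\langle e^*,E_h^2w\rangle=(w,\psi_e)$ for $e\in\Delta_1$; - $E_h^3:C^\infty(\Omega)\otimes\mathbb V\to\mathcal C_0\otimes\mathbb V$, $\langle L\,y^*,E_h^3u\rangle=(u,L\lambda_y)$ for $y\in\Delta_0$, $L\in\mathbb V$.
   Context: Setting. $\Omega$ is the three-dimensional flat torus (the unit cube with opposite faces glued), and $\mathcal T_h$ is a tetrahedral mesh of the cube whose faces match under the gluing, so that it is a valid simplicial complex of the torus. $\Delta_\ell$ is the set of $\ell$-dimensional simplices of $\mathcal T_h$, and $\Delta_\ell(T)$ the set of $\ell$-dimensional subsimplices of a simplex $T$. Simplices $[x_0,\dots,x_k]$ are oriented: permuting two vertices gives the negative simplex. For an edge $e=[x,z]$, $t_e$ is the unit tangent vector pointing from $x$ to $z$. $\mathbb V=\mathbb R^3$ and $\mathbb S$ is the space of symmetric $3\times3$ real matrices. $(\cdot,\cdot)$ is the $L^2(\Omega)$ inner product of vector or matrix fields. $P^k(T)$ is the space of polynomials of degree at most $k$ on $T$. Operators. $\varepsilon=\operatorname{sym}\operatorname{grad}$. For matrix fields $\operatorname{curl}$ and $\operatorname{div}$ act row-wise, and $\operatorname{inc}u=\operatorname{curl}\big((\operatorname{curl}u)^T\big)$. Christiansen's discrete spaces. - $X_h^0=\{v\in C(\Omega)\otimes\mathbb V: v|_T\in P^1(T)\otimes\mathbb V\ \forall T\in\mathcal T_h\}$. - $X_h^1=\{m\in L^2(\Omega)\otimes\mathbb S: m|_T\in P^0(T)\otimes\mathbb S\ \forall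 T\in\mathcal T_h,\ \int_e t_e^Tm\,t_e \text{ is single-valued } \forall e\in\Delta_1\}$. - $X_h^2=\{\sum_{e}a_e\,t_et_e^T\delta_e: a_e\in\mathbb R\}$, where $\langle\delta_e,v\rangle=\int_e v$ and $\langle\sum_e a_et_et_e^T\delta_e,m\rangle=\sum_e a_e\int_e t_e^Tm\,t_e$ for $m\in C^\infty(\Omega)\otimes\mathbb S$; the same formula is used to pair with $m\in X_h^1$. - $X_h^3=\{\sum_{y}a_y\delta_y: a_y\in\mathbb V\}$, where $\langle\delta_y,v\rangle=v(y)$ and $\langle\sum_y a_y\delta_y,u\rangle=\sum_y a_y\cdot u(y)$ for $u\in C^\infty(\Omega)\otimes\mathbb V$; the same formula is used to pair with $u\in X_h^0$. Christiansen's discrete complex is $X_h^0\xrightarrow{\varepsilon}X_h^1\xrightarrow{\operatorname{inc}}X_h^2\xrightarrow{\operatorname{div}}X_h^3$. For $u\in X_h^1$, $\operatorname{inc}u$ is the distribution $\langle\operatorname{inc}u,v\rangle=(u,\operatorname{inc}v)$ for all $v\in C^\infty(\Omega)\otimes\mathbb S$; Christiansen's result, as recalled in the source, is $\operatorname{inc}u=\sum_{e\in\Delta_1}[\![u]\!]_e\,t_et_e^T\delta_e$, where $$[\![u]\!]_e=\sum_{F\in\Delta_2,\ e\in\Delta_1(F)}m_{eF}^T\,[\![u]\!]_{eF}\,n_{eF}.$$ Here $m_{eF}$ is the unit vector tangent to $F$, perpendicular to $t_e$, pointing into $F$; $n_{eF}$ is perpendicular to $F$ with $t_e\times m_{eF}=n_{eF}$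 and $t_e\times n_{eF}=-m_{eF}$; and if $T_1,T_2$ are the two tetrahedra sharing $F$ and $n_{eF}$ points into $T_1$ (out of $T_2$), then $[\![u]\!]_{eF}=u|_{T_1}-u|_{T_2}$. On $X_h^2$, $\operatorname{div}$ is given by $\operatorname{div}(t_et_e^T\delta_e)=t_e(\delta_z-\delta_x)$ for $e=[x,z]\in\Delta_1$. Basis functions. For $y\in\Delta_0$, $\lambda_y$ is the continuous piecewise linear function on $\mathcal T_h$ with $\lambda_y(y)=1$ and $\lambda_y(z)=0$ for every other vertex $z$. For $e\in\Delta_1$, $\psi_e$ is the unique element of $X_h^1$ with $\int_g t_g^T\psi_e t_g=1$ if $g=e$ and $=0$ if $g\in\Delta_1$, $g\neq\pm e$. Interpolants. - $I_h^0:C^\infty(\Omega)\otimes\mathbb V\to X_h^0$, $I_h^0u(y)=u(y)$ for all $y\in\Delta_0$; - $I_h^1:C^\infty(\Omega)\otimes\mathbb S\to X_h^1$, $\int_et_e^T(I_h^1m)t_e=\int_et_e^Tm\,t_e$ for all $e\in\Delta_1$; - $I_h^2:C^\infty(\Omega)\otimes\mathbb S\to X_h^2$, $\langle I_h^2w,m\rangle=(w,m)$ for all $m\in X_h^1$; - $I_h^3:C^\infty(\Omega)\otimes\mathbb V\to X_h^3$, $\langle I_h^3v,u\rangle=(v,u)$ for all $u\in X_h^0$. Chains and co-chains. $\mathcal C_1=\{\sum_{\sigma\in\Delta_1}a_\sigma\sigma:a_\sigma\in\mathbb R\}$ and $\mathcal C^1$ is the space of linear functionals on $\mathcal C_1$;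 for $\sigma\in\Delta_1$, $\sigma^*\in\mathcal C^1$ satisfies $\langle\sigma^*,\sigma\rangle=1$ and $\langle\sigma^*,\tau\rangle=0$ if $\tau\in\Delta_1$ is not a permutation of $\sigma$. $\mathcal C_0\otimes\mathbb V$ is the space of vector-valued $0$-chains $\sum_{z\in\Delta_0}b_z\,z$ with $b_z\in\mathbb V$, and $\mathcal C^0\otimes\mathbb V$ is the space of vector-valued $0$-co-chains $\sum_{y\in\Delta_0}c_y\,y^*$ with $c_y\in\mathbb V$, with $\langle\sum_y c_yy^*,\sum_z b_zz\rangle=\sum_y c_y\cdot b_y$. The isomorphisms $J_h^0:X_h^0\to\mathcal C^0\otimes\mathbb V$, $J_h^1:X_h^1\to\mathcal C^1$, $J_h^2:X_h^2\to\mathcal C_1$, $J_h^3:X_h^3\to\mathcal C_0\otimes\mathbb V$ are defined by: - $\langle J_h^0u,L\,y\rangle=L\cdot u(y)$ for $y\in\Delta_0$, $L\in\mathbb V$; - $\langle J_h^1u,e\rangle=\int_et_e^Tu\,t_e$ for $e\in\Delta_1$; - $\langle e^*,J_h^2w\rangle=\langle w,\psi_e\rangle$ for $e\in\Delta_1$; - $\langle L\,y^*,J_h^3u\rangle=\langle u,L\lambda_y\rangle$ for $y\in\Delta_0$, $L\in\mathbb V$. The linear maps $\mathsf r_k$ are defined by $\mathsf r_0J_h^0=J_h^1\varepsilon$ on $X_h^0$, $\mathsf r_1J_h^1=J_h^2\operatorname{inc}$ on $X_h^1$, and $\mathsf r_2J_h^2=J_h^3\operatorname{div}$ on $X_h^2$.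 Explicitly, $$\mathsf r_0(L\,y^* )=\sum_{e=[x,y]\in\Delta_1}(L\cdot t_e)\,e^*\ \ (y\in\Delta_0,\ L\in\mathbb V),\qquad \mathsf r_1e^*=\sum_{g\in\mathfrak B(e)}[\![\psi_e]\!]_g\,g\ \ (e\in\Delta_1),\qquad \mathsf r_2e=t_e(z-x)\ \ (e=[x,z]\in\Delta_1),$$ where $\mathfrak B(e)$ is the set of edges $g\in\Delta_1$ such that some tetrahedron of $\mathcal T_h$ has both $e$ and $g$ as edges, and $t_e(z-x)$ denotes the vector-valued $0$-chain $t_e\,z-t_e\,x$.
   Formalization: The sign of div on X_h^2 is corrected to div(t_e t_e^T δ_e)=t_e(δ_x−δ_z), so r_2 e=t_e(x−z); with the stated sign the third square anticommutes. inc on X_h^1 and r_1 follow ⟨inc u,v⟩=(u,inc v), not the recalled jump formula, whose sign is opposite. *)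

theory Defs
  imports "HOL-Analysis.Analysis"
begin

section \<open>The flat torus: fields and operators\<close>

text \<open>
  A function on the flat torus is a function on \<open>real ^ 3\<close> that is invariant under
  translations by integer vectors.
\<close>

definition lattice :: "(real ^ 3) set" where
  "lattice = {k. \<forall>i. k $ i \<in> \<int>}"

definition periodic :: "(real ^ 3 \<Rightarrow> 'a) \<Rightarrow> bool" where
  "periodic f \<longleftrightarrow> (\<forall>x. \<forall>k\<in>lattice. f (x + k) = f x)"

definition pd :: "3 \<Rightarrow> (real ^ 3 \<Rightarrow> 'a::real_normed_vector) \<Rightarrow> real ^ 3 \<Rightarrow> 'a" where
  "pd j f x = frechet_derivative f (at x) (axis j 1)"

definition smooth :: "(real ^ 3 \<Rightarrow> 'a::real_normed_vector) \<Rightarrow> bool" where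
  "smooth f \<longleftrightarrow> (\<forall>js. foldr pd js f differentiable_on UNIV)"

definition smoothV :: "(real ^ 3 \<Rightarrow> real ^ 3) set" where
  "smoothV = {u. periodic u \<and> smooth u}"

definition smoothS :: "(real ^ 3 \<Rightarrow> real ^ 3 ^ 3) set" where
  "smoothS = {m. periodic m \<and> smooth m \<and> (\<forall>x. transpose (m x) = m x)}"

definition grad :: "(real ^ 3 \<Rightarrow> real ^ 3) \<Rightarrow> real ^ 3 \<Rightarrow> real ^ 3 ^ 3" where
  "grad u x = (\<chi> i j. pd j u x $ i)"

definition sym_grad :: "(real ^ 3 \<Rightarrow> real ^ 3) \<Rightarrow> real ^ 3 \<Rightarrow> real ^ 3 ^ 3" where
  "sym_grad u x = (1 / 2) *\<^sub>R (grad u x + transpose (grad u x))"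

definition vec_curl :: "(real ^ 3 \<Rightarrow> real ^ 3) \<Rightarrow> real ^ 3 \<Rightarrow> real ^ 3" where
  "vec_curl w x = vector [pd 2 w x $ 3 - pd 3 w x $ 2,
                          pd 3 w x $ 1 - pd 1 w x $ 3,
                          pd 1 w x $ 2 - pd 2 w x $ 1]"

definition mat_curl :: "(real ^ 3 \<Rightarrow> real ^ 3 ^ 3) \<Rightarrow> real ^ 3 \<Rightarrow> real ^ 3 ^ 3" where
  "mat_curl m x = (\<chi> i. vec_curl (\<lambda>y. m y $ i) x)"

definition mat_div :: "(real ^ 3 \<Rightarrow> real ^ 3 ^ 3) \<Rightarrow> real ^ 3 \<Rightarrow> real ^ 3" where
  "mat_div m x = (\<chi> i. \<Sum>j\<in>UNIV. pd j m x $ i $ j)"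

definition inc :: "(real ^ 3 \<Rightarrow> real ^ 3 ^ 3) \<Rightarrow> real ^ 3 \<Rightarrow> real ^ 3 ^ 3" where
  "inc m = mat_curl (\<lambda>x. transpose (mat_curl m x))"

definition l2 :: "(real ^ 3 \<Rightarrow> 'a::real_inner) \<Rightarrow> (real ^ 3 \<Rightarrow> 'a) \<Rightarrow> real" where
  "l2 f g = integral (cbox 0 1) (\<lambda>x. f x \<bullet> g x)"

section \<open>Edges\<close>

text \<open>An oriented edge \<open>[x, z]\<close> is the pair \<open>(x, z)\<close>.\<close>

type_synonym edge = "(real ^ 3) \<times> (real ^ 3)"

definition tangent :: "edge \<Rightarrow> real ^ 3" where
  "tangent e = (1 / norm (snd e - fst e)) *\<^sub>R (snd e - fst e)"

definition edge_integral :: "edge \<Rightarrow> (real ^ 3 \<Rightarrow> real) \<Rightarrow> real" where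
  "edge_integral e f =
     norm (snd e - fst e) * integral {0..1} (\<lambda>s. f (linepath (fst e) (snd e) s))"

definition tt_integral :: "edge \<Rightarrow> (real ^ 3 \<Rightarrow> real ^ 3 ^ 3) \<Rightarrow> real" where
  "tt_integral e m = edge_integral e (\<lambda>p. tangent e \<bullet> (m p *v tangent e))"

section \<open>Meshes of the torus\<close>

text \<open>
  A tetrahedron is given by its set of vertices. \<open>\<T>\<close> is the mesh of the unit cube,
  \<open>periodic_mesh \<T>\<close> consists of all its translates by integer vectors.
\<close>

definition periodic_mesh :: "(real ^ 3) set set \<Rightarrow> (real ^ 3) set set" where
  "periodic_mesh \<T> = {(+) k ` T | k T. k \<in> lattice \<and> T \<in> \<T>}"

text \<open>
  The fourth condition says that the mesh of the cube is face-to-face and that its boundary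
  triangulations match under the gluing. The last condition says that the glued mesh is
  a simplicial complex: given the fourth one, it means that every tetrahedron embeds into the
  torus and that the images of any two tetrahedra intersect in a single common face (if at all).
\<close>

definition torus_mesh :: "(real ^ 3) set set \<Rightarrow> bool" where
  "torus_mesh \<T> \<longleftrightarrow>
     finite \<T> \<and>
     (\<forall>T\<in>\<T>. card T = 4 \<and> \<not> affine_dependent T) \<and>
     (\<Union>T\<in>\<T>. convex hull T) = cbox 0 1 \<and>
     (\<forall>T\<in>periodic_mesh \<T>. \<forall>T'\<in>periodic_mesh \<T>.
        convex hull T \<inter> convex hull T' = convex hull (T \<inter> T')) \<and>
     (\<forall>T\<in>\<T>. \<forall>T'\<in>\<T>. \<exists>k. \<forall>x\<in>T. \<forall>y\<in>T'. x - y \<in> lattice \<longrightarrow> x - y = k)"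

text \<open>A vertex of the torus mesh is represented by its unique lift to \<open>[0,1)\<^sup>3\<close>.\<close>

definition vertices :: "(real ^ 3) set set \<Rightarrow> (real ^ 3) set" where
  "vertices \<T> = {y. (\<exists>T\<in>periodic_mesh \<T>. y \<in> T) \<and> (\<forall>i. 0 \<le> y $ i \<and> y $ i < 1)}"

text \<open>
  \<open>edge_system \<T> \<E>\<close>: the set \<open>\<E>\<close> contains exactly one oriented lift of each edge of the torus
  mesh. The reversed edge is minus the corresponding basis element of the space of chains.
  The choice is needed because \<open>tt_integral\<close> takes the same value on \<open>(x, z)\<close> and \<open>(z, x)\<close>.
\<close>

definition edge_system :: "(real ^ 3) set set \<Rightarrow> edge set \<Rightarrow> bool" where
  "edge_system \<T> \<E> \<longleftrightarrow>
     (\<forall>(x, z)\<in>\<E>. x \<noteq> z \<and> (\<exists>T\<in>periodic_mesh \<T>. {x, z} \<subseteq> T)) \<and>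
     (\<forall>T\<in>periodic_mesh \<T>. \<forall>x\<in>T. \<forall>z\<in>T. x \<noteq> z \<longrightarrow>
        (\<exists>!e. e \<in> \<E> \<and> (\<exists>k\<in>lattice. e = (x + k, z + k) \<or> e = (z + k, x + k))))"

definition mesh_interior :: "(real ^ 3) set set \<Rightarrow> (real ^ 3) set" where
  "mesh_interior \<T> = (\<Union>T\<in>periodic_mesh \<T>. interior (convex hull T))"

definition single :: "'a \<Rightarrow> 'b \<Rightarrow> 'a \<Rightarrow> 'b::zero" where
  "single x a = (\<lambda>y. if y = x then a else 0)"

context
  fixes \<T> :: "(real ^ 3) set set" and \<E> :: "edge set"
begin

section \<open>Discrete spaces\<close>

definition pw_linear :: "(real ^ 3 \<Rightarrow> 'a::real_normed_vector) \<Rightarrow> bool" where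
  "pw_linear f \<longleftrightarrow> continuous_on UNIV f \<and> periodic f \<and>
     (\<forall>T\<in>\<T>. \<exists>A b. linear A \<and> (\<forall>x\<in>convex hull T. f x = A x + b))"

definition X0 :: "(real ^ 3 \<Rightarrow> real ^ 3) set" where
  "X0 = {v. pw_linear v}"

definition elem_value :: "(real ^ 3 \<Rightarrow> real ^ 3 ^ 3) \<Rightarrow> (real ^ 3) set \<Rightarrow> real ^ 3 ^ 3" where
  "elem_value m T = (THE M. \<forall>x\<in>interior (convex hull T). m x = M)"

text \<open>
  Elements of \<open>X1\<close> are classes of functions modulo null sets; they are represented by
  the function that vanishes outside the interiors of the tetrahedra.
\<close>

definition X1 :: "(real ^ 3 \<Rightarrow> real ^ 3 ^ 3) set" where
  "X1 = {m. periodic m \<and> (\<forall>x. transpose (m x) = m x) \<and>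
     (\<forall>T\<in>periodic_mesh \<T>. \<exists>M. \<forall>x\<in>interior (convex hull T). m x = M) \<and>
     (\<forall>x. x \<notin> mesh_interior \<T> \<longrightarrow> m x = 0) \<and>
     (\<forall>T\<in>periodic_mesh \<T>. \<forall>T'\<in>periodic_mesh \<T>. \<forall>x\<in>T \<inter> T'. \<forall>z\<in>T \<inter> T'. x \<noteq> z \<longrightarrow>
        tt_integral (x, z) (\<lambda>_. elem_value m T) = tt_integral (x, z) (\<lambda>_. elem_value m T'))}"

text \<open>The single value of the edge integral of an element of \<open>X1\<close>.\<close>

definition edge_dof :: "(real ^ 3 \<Rightarrow> real ^ 3 ^ 3) \<Rightarrow> edge \<Rightarrow> real" where
  "edge_dof m e = (THE a. \<forall>T\<in>periodic_mesh \<T>. {fst e, snd e} \<subseteq> T \<longrightarrow>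
     tt_integral e (\<lambda>_. elem_value m T) = a)"

text \<open>Distributions are functionals on the smooth fields, taken to be extensional.\<close>

definition edge_dist :: "(edge \<Rightarrow> real) \<Rightarrow> (real ^ 3 \<Rightarrow> real ^ 3 ^ 3) \<Rightarrow> real" where
  "edge_dist a = (\<lambda>m\<in>smoothS. \<Sum>e\<in>\<E>. a e * tt_integral e m)"

definition X2 :: "((real ^ 3 \<Rightarrow> real ^ 3 ^ 3) \<Rightarrow> real) set" where
  "X2 = range edge_dist"

definition pair2 :: "((real ^ 3 \<Rightarrow> real ^ 3 ^ 3) \<Rightarrow> real) \<Rightarrow> (real ^ 3 \<Rightarrow> real ^ 3 ^ 3) \<Rightarrow> real" where
  "pair2 w m = (THE s. \<exists>a. w = edge_dist a \<and> s = (\<Sum>e\<in>\<E>. a e * edge_dof m e))"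

definition point_dist :: "(real ^ 3 \<Rightarrow> real ^ 3) \<Rightarrow> (real ^ 3 \<Rightarrow> real ^ 3) \<Rightarrow> real" where
  "point_dist a = (\<lambda>v\<in>smoothV. \<Sum>y\<in>vertices \<T>. a y \<bullet> v y)"

definition X3 :: "((real ^ 3 \<Rightarrow> real ^ 3) \<Rightarrow> real) set" where
  "X3 = range point_dist"

definition pair3 :: "((real ^ 3 \<Rightarrow> real ^ 3) \<Rightarrow> real) \<Rightarrow> (real ^ 3 \<Rightarrow> real ^ 3) \<Rightarrow> real" where
  "pair3 w u = (THE s. \<exists>a. w = point_dist a \<and> s = (\<Sum>y\<in>vertices \<T>. a y \<bullet> u y))"

section \<open>Operators of the discrete complex\<close>

definition sym_grad_h :: "(real ^ 3 \<Rightarrow> real ^ 3) \<Rightarrow> real ^ 3 \<Rightarrow> real ^ 3 ^ 3" where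
  "sym_grad_h u = (\<lambda>x. if x \<in> mesh_interior \<T> then sym_grad u x else 0)"

definition inc_h ::
  "(real ^ 3 \<Rightarrow> real ^ 3 ^ 3) \<Rightarrow> (real ^ 3 \<Rightarrow> real ^ 3 ^ 3) \<Rightarrow> real" where
  "inc_h u = (\<lambda>v\<in>smoothS. l2 u (inc v))"

text \<open>
  The distributional divergence. On the measure \<open>t\<^sub>e t\<^sub>e\<^sup>T \<delta>\<^sub>e\<close> of an edge \<open>e = [x, z]\<close> it is
  \<open>t\<^sub>e (\<delta>\<^sub>x - \<delta>\<^sub>z)\<close>, since the fundamental theorem of calculus gives
  \<open>tt_integral e (sym_grad v) = t\<^sub>e \<bullet> (v z - v x)\<close>. With the opposite sign, the last square of the
  diagram would anticommute.
\<close>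

definition div_h ::
  "((real ^ 3 \<Rightarrow> real ^ 3 ^ 3) \<Rightarrow> real) \<Rightarrow> (real ^ 3 \<Rightarrow> real ^ 3) \<Rightarrow> real" where
  "div_h w = (\<lambda>v\<in>smoothV. - w (sym_grad v))"

section \<open>Basis functions and interpolants\<close>

definition hat :: "real ^ 3 \<Rightarrow> real ^ 3 \<Rightarrow> real" where
  "hat y = (THE f. pw_linear f \<and> f y = 1 \<and> (\<forall>z\<in>vertices \<T> - {y}. f z = 0))"

definition psi :: "edge \<Rightarrow> real ^ 3 \<Rightarrow> real ^ 3 ^ 3" where
  "psi e = (THE m. m \<in> X1 \<and> edge_dof m e = 1 \<and> (\<forall>g\<in>\<E> - {e}. edge_dof m g = 0))"

definition I0 :: "(real ^ 3 \<Rightarrow> real ^ 3) \<Rightarrow> real ^ 3 \<Rightarrow> real ^ 3" where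
  "I0 u = (THE v. v \<in> X0 \<and> (\<forall>y\<in>vertices \<T>. v y = u y))"

definition I1 :: "(real ^ 3 \<Rightarrow> real ^ 3 ^ 3) \<Rightarrow> real ^ 3 \<Rightarrow> real ^ 3 ^ 3" where
  "I1 m = (THE n. n \<in> X1 \<and> (\<forall>e\<in>\<E>. edge_dof n e = tt_integral e m))"

definition I2 :: "(real ^ 3 \<Rightarrow> real ^ 3 ^ 3) \<Rightarrow> (real ^ 3 \<Rightarrow> real ^ 3 ^ 3) \<Rightarrow> real" where
  "I2 w = (THE W. W \<in> X2 \<and> (\<forall>m\<in>X1. pair2 W m = l2 w m))"

definition I3 :: "(real ^ 3 \<Rightarrow> real ^ 3) \<Rightarrow> (real ^ 3 \<Rightarrow> real ^ 3) \<Rightarrow> real" where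
  "I3 v = (THE W. W \<in> X3 \<and> (\<forall>u\<in>X0. pair3 W u = l2 v u))"

section \<open>Chains and co-chains\<close>

text \<open>
  Chains are given by their coefficients: \<open>single e 1\<close> is the edge \<open>e\<close> as a chain, and
  \<open>single y L\<close> is \<open>L y\<close> as a vector-valued chain and \<open>L y\<^sup>*\<close> as a vector-valued co-chain.
\<close>

definition chains1 :: "(edge \<Rightarrow> real) set" where
  "chains1 = {c. \<forall>e. e \<notin> \<E> \<longrightarrow> c e = 0}"

definition cochains1 :: "((edge \<Rightarrow> real) \<Rightarrow> real) set" where
  "cochains1 = {\<phi> \<in> extensional chains1.
     (\<forall>c\<in>chains1. \<forall>d\<in>chains1. \<phi> (\<lambda>e. c e + d e) = \<phi> c + \<phi> d) \<and>
     (\<forall>r. \<forall>c\<in>chains1. \<phi> (\<lambda>e. r * c e) = r * \<phi> c)}"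

definition dual_edge :: "edge \<Rightarrow> (edge \<Rightarrow> real) \<Rightarrow> real" where
  "dual_edge e = (\<lambda>c\<in>chains1. c e)"

definition chains0V :: "(real ^ 3 \<Rightarrow> real ^ 3) set" where
  "chains0V = {b. \<forall>y. y \<notin> vertices \<T> \<longrightarrow> b y = 0}"

definition cochains0V :: "(real ^ 3 \<Rightarrow> real ^ 3) set" where
  "cochains0V = {c. \<forall>y. y \<notin> vertices \<T> \<longrightarrow> c y = 0}"

definition pair0V :: "(real ^ 3 \<Rightarrow> real ^ 3) \<Rightarrow> (real ^ 3 \<Rightarrow> real ^ 3) \<Rightarrow> real" where
  "pair0V c b = (\<Sum>y\<in>vertices \<T>. c y \<bullet> b y)"

definition J0 :: "(real ^ 3 \<Rightarrow> real ^ 3) \<Rightarrow> real ^ 3 \<Rightarrow> real ^ 3" where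
  "J0 u = (THE c. c \<in> cochains0V \<and>
     (\<forall>y\<in>vertices \<T>. \<forall>L. pair0V c (single y L) = L \<bullet> u y))"

definition J1 :: "(real ^ 3 \<Rightarrow> real ^ 3 ^ 3) \<Rightarrow> (edge \<Rightarrow> real) \<Rightarrow> real" where
  "J1 u = (THE \<phi>. \<phi> \<in> cochains1 \<and> (\<forall>e\<in>\<E>. \<phi> (single e 1) = edge_dof u e))"

definition J2 :: "((real ^ 3 \<Rightarrow> real ^ 3 ^ 3) \<Rightarrow> real) \<Rightarrow> edge \<Rightarrow> real" where
  "J2 w = (THE c. c \<in> chains1 \<and> (\<forall>e\<in>\<E>. dual_edge e c = pair2 w (psi e)))"

definition J3 :: "((real ^ 3 \<Rightarrow> real ^ 3) \<Rightarrow> real) \<Rightarrow> real ^ 3 \<Rightarrow> real ^ 3" where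
  "J3 w = (THE b. b \<in> chains0V \<and>
     (\<forall>y\<in>vertices \<T>. \<forall>L. pair0V (single y L) b = pair3 w (\<lambda>x. hat y x *\<^sub>R L)))"

definition r0 :: "(real ^ 3 \<Rightarrow> real ^ 3) \<Rightarrow> (edge \<Rightarrow> real) \<Rightarrow> real" where
  "r0 c = J1 (sym_grad_h (inv_into X0 J0 c))"

definition r1 :: "((edge \<Rightarrow> real) \<Rightarrow> real) \<Rightarrow> edge \<Rightarrow> real" where
  "r1 \<phi> = J2 (inc_h (inv_into X1 J1 \<phi>))"

definition r2 :: "(edge \<Rightarrow> real) \<Rightarrow> real ^ 3 \<Rightarrow> real ^ 3" where
  "r2 c = J3 (div_h (inv_into X2 J2 c))"

definition E0 :: "(real ^ 3 \<Rightarrow> real ^ 3) \<Rightarrow> real ^ 3 \<Rightarrow> real ^ 3" where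
  "E0 = J0 \<circ> I0"

definition E1 :: "(real ^ 3 \<Rightarrow> real ^ 3 ^ 3) \<Rightarrow> (edge \<Rightarrow> real) \<Rightarrow> real" where
  "E1 = J1 \<circ> I1"

definition E2 :: "(real ^ 3 \<Rightarrow> real ^ 3 ^ 3) \<Rightarrow> edge \<Rightarrow> real" where
  "E2 = J2 \<circ> I2"

definition E3 :: "(real ^ 3 \<Rightarrow> real ^ 3) \<Rightarrow> real ^ 3 \<Rightarrow> real ^ 3" where
  "E3 = J3 \<circ> I3"

end

end

theory Submission
  imports Defs
begin

text \<open>
  The maps \<open>J\<close> identify the discrete spaces with the spaces of chains and co-chains, so the three
  squares say that the interpolants commute with the operators:
  \<open>sym_grad_h (I0 u) = I1 (sym_grad u)\<close>, \<open>inc_h (I1 u) = I2 (inc u)\<close> and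
  \<open>div_h (I2 w) = I3 (mat_div w)\<close>.

  The first identity is the fundamental theorem of calculus: the edge value of both sides on
  \<open>[x, z]\<close> is \<open>t \<bullet> (u z - u x)\<close>, and the edge values determine an element of \<open>X1\<close>.

  The third one is dual to the first. Tested with a smooth \<open>v\<close> its left-hand side is
  \<open>- l2 w (I1 (sym_grad v)) = - l2 w (sym_grad_h (I0 v))\<close>, which is \<open>l2 (mat_div w) (I0 v)\<close> by
  integration by parts against a continuous piecewise linear field (\<open>weak_divergence\<close>).

  Tested with a smooth \<open>v\<close>, the second identity reads \<open>l2 (I1 u) (inc v) = l2 (I1 v) (inc u)\<close>,
  because \<open>I2 (inc u)\<close> sees \<open>v\<close> only through its edge integrals, that is, through \<open>I1 v\<close>. So it is
  the symmetry of a bilinear form (\<open>l2_inc_I1_symmetric\<close>), which is proved one tetrahedron at a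
  time. A constant symmetric matrix is a combination of products of barycentric gradients, with the
  edge values as coefficients (\<open>mat_inner_expand\<close>). On barycentric gradients \<open>inc v\<close> is a
  combination of second derivatives of \<open>v\<close> along edges (\<open>inc_contravariant\<close>), and repeated use
  of the fundamental theorem of calculus turns its integral into edge means of \<open>v\<close> plus terms on the
  faces (\<open>integral_bgrad_inc\<close>). The edge part is symmetric in the two families of edge values
  (\<open>local_form_sym\<close>). The face terms involve the tetrahedron only through an area vector that is
  normal to the face. Each face of the torus has one tetrahedron on either side
  (\<open>across_exists\<close>, \<open>across_unique\<close>), with opposite area vectors (\<open>across_normal\<close>), so the face
  terms cancel in the sum over the mesh (\<open>flag_cancellation\<close>). The same cancellation gives
  \<open>weak_divergence\<close>.

  It remains to see that the definite descriptions in the interpolants and pairings denote. For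
  \<open>X0\<close> and \<open>X1\<close> this is unisolvence of the nodal values and of the edge values. For \<open>X2\<close> and \<open>X3\<close> the
  edge measures and the point evaluations have to be linearly independent on smooth periodic
  fields; high powers of a trigonometric polynomial that peaks at one point of the torus single
  out a vertex or an edge (\<open>point_dist_inj\<close>, \<open>edge_functionals_independent\<close>).
\<close>

section \<open>Smooth fields and directional derivatives\<close>

text \<open>
  The partial derivatives of a product are sums of products, so closure of \<^const>\<open>smooth\<close> under products
  needs an induction on the order of differentiation in which both factors vary; \<open>Ck\<close> supplies it.
\<close>

primrec Ck :: "nat \<Rightarrow> (real ^ 3 \<Rightarrow> 'a::real_normed_vector) \<Rightarrow> bool" where
  "Ck 0 f \<longleftrightarrow> f differentiable_on UNIV"
| "Ck (Suc n) f \<longleftrightarrow> f differentiable_on UNIV \<and> (\<forall>j. Ck n (pd j f))"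

lemma Ck_iff: "Ck n f \<longleftrightarrow> (\<forall>js. length js \<le> n \<longrightarrow> foldr pd js f differentiable_on UNIV)"
proof (induction n arbitrary: f)
  case (Suc n)
  have "Ck (Suc n) f \<longleftrightarrow> f differentiable_on UNIV \<and>
      (\<forall>j js. length js \<le> n \<longrightarrow> foldr pd (js @ [j]) f differentiable_on UNIV)"
    by (simp add: Suc.IH)
  also have "\<dots> \<longleftrightarrow> (\<forall>js. length js \<le> Suc n \<longrightarrow> foldr pd js f differentiable_on UNIV)"
  proof (safe, goal_cases)
    case (1 js)
    then show ?case by (cases js rule: rev_cases) auto
  next
    case 2
    then show ?case by (drule_tac x="[]" in spec) simp
  next
    case (3 j js)
    then show ?case by (drule_tac x="js @ [j]" in spec) simp
  qed
  finally show ?case .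
qed simp

lemma smooth_iff_Ck: "smooth f \<longleftrightarrow> (\<forall>n. Ck n f)"
  unfolding smooth_def Ck_iff by blast

lemma Ck_D: "Ck n f \<Longrightarrow> f differentiable (at x)"
  by (cases n) (auto simp: differentiable_on_def)

lemma Ck_SucD: "Ck (Suc n) f \<Longrightarrow> Ck n f"
  by (induction n arbitrary: f) auto

lemma smooth_differentiable: "smooth f \<Longrightarrow> f differentiable (at x)"
  using Ck_D smooth_iff_Ck by blast

lemma smooth_pd: "smooth f \<Longrightarrow> smooth (pd j f)"
  unfolding smooth_iff_Ck by (metis Ck.simps(2))

lemma smooth_continuous_on: "smooth f \<Longrightarrow> continuous_on S f"
  by (meson continuous_at_imp_continuous_on differentiable_imp_continuous_within smooth_differentiable)

lemma pd_unique: "(f has_derivative D) (at x) \<Longrightarrow> pd j f x = D (axis j 1)"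
  unfolding pd_def by (metis frechet_derivative_at)

lemma pd_bounded_linear:
  assumes "bounded_linear L" "f differentiable (at x)"
  shows "pd j (\<lambda>x. L (f x)) x = L (pd j f x)"
proof -
  obtain D where D: "(f has_derivative D) (at x)" using assms(2) by (auto simp: differentiable_def)
  show ?thesis
    using pd_unique[OF D, of j] pd_unique[OF bounded_linear.has_derivative[OF assms(1) D], of j] by simp
qed

lemma pd_add:
  assumes "f differentiable (at x)" "g differentiable (at x)"
  shows "pd j (\<lambda>x. f x + g x) x = pd j f x + pd j g x"
proof -
  obtain D E where D: "(f has_derivative D) (at x)" "(g has_derivative E) (at x)"
    using assms by (auto simp: differentiable_def)
  show ?thesis
    using pd_unique[OF D(1), of j] pd_unique[OF D(2), of j] pd_unique[OF has_derivative_add[OF D], of j]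
    by simp
qed

lemma pd_bilinear:
  assumes "bounded_bilinear bop" "f differentiable (at x)" "g differentiable (at x)"
  shows "pd j (\<lambda>x. bop (f x) (g x)) x = bop (pd j f x) (g x) + bop (f x) (pd j g x)"
proof -
  obtain D E where D: "(f has_derivative D) (at x)" "(g has_derivative E) (at x)"
    using assms by (auto simp: differentiable_def)
  show ?thesis
    using pd_unique[OF D(1), of j] pd_unique[OF D(2), of j]
      pd_unique[OF bounded_bilinear.FDERIV[OF assms(1) D], of j]
    by simp
qed

lemma Ck_cong_linear: "bounded_linear L \<Longrightarrow> Ck n f \<Longrightarrow> Ck n (\<lambda>x. L (f x))"
proof (induction n arbitrary: f)
  case 0
  then show ?case
    by (auto simp: differentiable_on_def intro: differentiable_compose[of L, unfolded o_def]
        bounded_linear_imp_differentiable)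
next
  case (Suc n)
  have "pd j (\<lambda>x. L (f x)) = (\<lambda>x. L (pd j f x))" for j
    using Ck_D[OF Suc.prems(2)] by (auto simp: pd_bounded_linear[OF Suc.prems(1)])
  then show ?case using Suc
    by (auto simp: differentiable_on_def intro: differentiable_compose[of L, unfolded o_def]
        bounded_linear_imp_differentiable)
qed

lemma Ck_add: "Ck n f \<Longrightarrow> Ck n g \<Longrightarrow> Ck n (\<lambda>x. f x + g x)"
proof (induction n arbitrary: f g)
  case (Suc n)
  have "pd j (\<lambda>x. f x + g x) = (\<lambda>x. pd j f x + pd j g x)" for j
    using Ck_D[OF Suc.prems(1)] Ck_D[OF Suc.prems(2)] by (auto simp: pd_add)
  then show ?case using Suc by auto
qed auto

lemma differentiable_bilinear:
  assumes "bounded_bilinear bop" "f differentiable (at x)" "g differentiable (at x)"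
  shows "(\<lambda>x. bop (f x) (g x)) differentiable (at x)"
  using assms(2,3) bounded_bilinear.FDERIV[OF assms(1)] unfolding differentiable_def by blast

lemma Ck_bilinear:
  "bounded_bilinear bop \<Longrightarrow> Ck n f \<Longrightarrow> Ck n g \<Longrightarrow> Ck n (\<lambda>x. bop (f x) (g x))"
proof (induction n arbitrary: f g)
  case 0
  then show ?case
    by (simp add: differentiable_on_def differentiable_bilinear)
next
  case (Suc n)
  have d: "(\<lambda>x. bop (f x) (g x)) differentiable_on UNIV"
    using Suc.prems by (simp add: differentiable_on_def differentiable_bilinear)
  have "pd j (\<lambda>x. bop (f x) (g x)) = (\<lambda>x. bop (pd j f x) (g x) + bop (f x) (pd j g x))" for j
    using Ck_D[OF Suc.prems(2)] Ck_D[OF Suc.prems(3)] by (auto simp: pd_bilinear[OF Suc.prems(1)])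
  moreover have "Ck n f" "Ck n g" using Suc.prems Ck_SucD by blast+
  ultimately show ?case using Suc d by (auto intro!: Ck_add Suc.IH)
qed

lemma smooth_linear: "bounded_linear L \<Longrightarrow> smooth f \<Longrightarrow> smooth (\<lambda>x. L (f x))"
  by (simp add: smooth_iff_Ck Ck_cong_linear)

lemma smooth_add: "smooth f \<Longrightarrow> smooth g \<Longrightarrow> smooth (\<lambda>x. f x + g x)"
  by (simp add: smooth_iff_Ck Ck_add)

lemma smooth_bilinear:
  "bounded_bilinear bop \<Longrightarrow> smooth f \<Longrightarrow> smooth g \<Longrightarrow> smooth (\<lambda>x. bop (f x) (g x))"
  by (simp add: smooth_iff_Ck Ck_bilinear)

lemma smooth_scaleR: "smooth f \<Longrightarrow> smooth (\<lambda>x. c *\<^sub>R f x)"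
  by (rule smooth_linear[OF bounded_linear_scaleR_right])

lemma smooth_diff: "smooth f \<Longrightarrow> smooth g \<Longrightarrow> smooth (\<lambda>x. f x - g x)"
  using smooth_add[of f "\<lambda>x. (-1) *\<^sub>R g x"] smooth_scaleR[of g "-1"] by simp

lemma Ck_const: "Ck n (\<lambda>x. c)"
proof (induction n arbitrary: c)
  case (Suc n)
  have "pd j (\<lambda>x. c) = (\<lambda>x. 0)" for j
    by (intro ext) (rule pd_unique[OF has_derivative_const])
  then show ?case using Suc[of 0] by simp
qed auto

lemma smooth_const: "smooth (\<lambda>x. c)"
  by (simp add: smooth_iff_Ck Ck_const)

lemma smooth_sum: "(\<And>i. i \<in> A \<Longrightarrow> smooth (f i)) \<Longrightarrow> smooth (\<lambda>x. \<Sum>i\<in>A. f i x)"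
  by (induction A rule: infinite_finite_induct) (auto intro: smooth_const smooth_add)

lemma smooth_mult: "smooth f \<Longrightarrow> smooth g \<Longrightarrow> smooth (\<lambda>x. f x * g x :: real)"
  by (rule smooth_bilinear[OF bounded_bilinear_mult])

lemma smooth_scaleR_vec: "smooth f \<Longrightarrow> smooth (\<lambda>x. f x *\<^sub>R c)" for f :: "_ \<Rightarrow> real"
  by (rule smooth_linear[OF bounded_linear_scaleR_left])

lemma smooth_power: "smooth f \<Longrightarrow> smooth (\<lambda>x. f x ^ n :: real)"
  by (induction n) (auto intro: smooth_const smooth_mult)

lemma smooth_vec_nth: "smooth f \<Longrightarrow> smooth (\<lambda>x. f x $ i)"
  by (rule smooth_linear[OF bounded_linear_vec_nth])

lemma vec_axis_sum: "w = (\<Sum>j\<in>UNIV. w $ j *\<^sub>R axis j 1)" for w :: "real ^ 'n"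
  using basis_expansion[of w] by (simp add: scalar_mult_eq_scaleR)

lemma smooth_vecI:
  fixes f :: "real ^ 3 \<Rightarrow> 'a::euclidean_space ^ 'n"
  assumes "\<And>i. smooth (\<lambda>x. f x $ i)"
  shows "smooth f"
proof -
  have lin: "bounded_linear (axis i :: 'a \<Rightarrow> 'a ^ 'n)" for i
    unfolding linear_conv_bounded_linear[symmetric]
    by (rule linearI) (auto simp: vec_eq_iff axis_def)
  have "f = (\<lambda>x. \<Sum>i\<in>UNIV. axis i (f x $ i))"
    by (auto simp: fun_eq_iff vec_eq_iff axis_def)
  moreover have "smooth (\<lambda>x. \<Sum>i\<in>UNIV. axis i (f x $ i))"
    by (intro smooth_sum smooth_linear[OF lin] assms)
  ultimately show ?thesis by simp
qed

lemma smooth_matI: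
  fixes f :: "real ^ 3 \<Rightarrow> real ^ 'n ^ 'm"
  assumes "\<And>i j. smooth (\<lambda>x. f x $ i $ j)"
  shows "smooth f"
  by (intro smooth_vecI assms)

lemma pd_vec_nth: "smooth f \<Longrightarrow> pd j f x $ i = pd j (\<lambda>y. f y $ i) x"
  by (subst pd_bounded_linear[OF bounded_linear_vec_nth smooth_differentiable]) auto

lemma pd_diff: "smooth f \<Longrightarrow> smooth g \<Longrightarrow> pd j (\<lambda>x. f x - g x) x = pd j f x - pd j g x"
proof -
  assume a: "smooth f" "smooth g"
  have "pd j (\<lambda>x. f x + (-1) *\<^sub>R g x) x = pd j f x + pd j (\<lambda>x. (-1) *\<^sub>R g x) x"
    using a by (intro pd_add smooth_differentiable smooth_scaleR)
  also have "pd j (\<lambda>x. (-1) *\<^sub>R g x) x = - pd j g x"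
    using a by (subst pd_bounded_linear[OF bounded_linear_scaleR_right smooth_differentiable]) auto
  finally show ?thesis by simp
qed

text \<open>
  The directional analogue of \<^const>\<open>pd\<close>. Edge vectors of a tetrahedron are the natural directions, since the
  fundamental theorem of calculus then maps an integral over a simplex to integrals over its faces.
\<close>

definition dd :: "real ^ 3 \<Rightarrow> (real ^ 3 \<Rightarrow> 'a::real_normed_vector) \<Rightarrow> real ^ 3 \<Rightarrow> 'a" where
  "dd w f x = (\<Sum>j\<in>UNIV. w $ j *\<^sub>R pd j f x)"

lemma smooth_dd: "smooth f \<Longrightarrow> smooth (dd w f)"
  unfolding dd_def[abs_def] by (intro smooth_sum smooth_scaleR smooth_pd)

lemma dd_has_derivative:
  assumes "f differentiable (at x)"
  shows "(f has_derivative (\<lambda>w. dd w f x)) (at x)"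
proof -
  obtain D where D: "(f has_derivative D) (at x)" using assms by (auto simp: differentiable_def)
  have lin: "linear D" using D has_derivative_linear by blast
  have "D w = dd w f x" for w
  proof -
    have "D w = D (\<Sum>j\<in>UNIV. w $ j *\<^sub>R axis j 1)" using vec_axis_sum[of w] by simp
    also have "\<dots> = dd w f x"
      unfolding dd_def using lin by (simp add: linear_sum linear_scale pd_unique[OF D])
    finally show ?thesis .
  qed
  then show ?thesis using D by presburger
qed

lemma dd_unique: "(f has_derivative D) (at x) \<Longrightarrow> dd w f x = D w"
  using dd_has_derivative[of f x] has_derivative_unique differentiable_def by metis

lemma dd_line:
  assumes "smooth f"
  shows "((\<lambda>s. f (a + s *\<^sub>R w)) has_vector_derivative dd w f (a + s *\<^sub>R w)) (at s within S)"
proof -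
  have "((\<lambda>s. f (a + s *\<^sub>R w)) has_derivative (\<lambda>h. dd (h *\<^sub>R w) f (a + s *\<^sub>R w))) (at s within S)"
    by (rule has_derivative_compose[of "\<lambda>s. a + s *\<^sub>R w" _ s S f])
       (auto intro!: derivative_eq_intros dd_has_derivative smooth_differentiable assms)
  moreover have "dd (h *\<^sub>R w) f y = h *\<^sub>R dd w f y" for h y
    by (simp add: dd_def scaleR_sum_right)
  ultimately show ?thesis by (simp add: has_vector_derivative_def)
qed

lemma dd_vec_add: "dd (a + b) f x = dd a f x + dd b f x"
  by (simp add: dd_def scaleR_add_left sum.distrib)

lemma dd_vec_scaleR: "dd (c *\<^sub>R a) f x = c *\<^sub>R dd a f x"
  by (simp add: dd_def scaleR_sum_right)

lemma dd_vec_minus: "dd (- a) f x = - dd a f x"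
  using dd_vec_scaleR[of "-1"] by simp

lemma dd_vec_diff: "dd (a - b) f x = dd a f x - dd b f x"
  using dd_vec_add[of a "-b"] by (simp add: dd_vec_minus)

lemma dd_add: "smooth f \<Longrightarrow> smooth g \<Longrightarrow> dd w (\<lambda>x. f x + g x) x = dd w f x + dd w g x"
  by (simp add: dd_def pd_add smooth_differentiable scaleR_add_right sum.distrib)

lemma dd_linear: "bounded_linear L \<Longrightarrow> smooth f \<Longrightarrow> dd w (\<lambda>x. L (f x)) x = L (dd w f x)"
  by (simp add: dd_def pd_bounded_linear smooth_differentiable linear_sum[OF bounded_linear.linear]
      linear_scale[OF bounded_linear.linear])

lemma dd_scaleR: "smooth f \<Longrightarrow> dd w (\<lambda>x. c *\<^sub>R f x) x = c *\<^sub>R dd w f x"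
  by (rule dd_linear[OF bounded_linear_scaleR_right])

lemma dd_minus: "smooth f \<Longrightarrow> dd w (\<lambda>x. - f x) x = - dd w f x"
  using dd_scaleR[of f w "-1"] by simp

lemma dd_diff: "smooth f \<Longrightarrow> smooth g \<Longrightarrow> dd w (\<lambda>x. f x - g x) x = dd w f x - dd w g x"
  using dd_add[of f "\<lambda>x. (-1) *\<^sub>R g x" w x] dd_scaleR[of g w "-1"] smooth_scaleR[of g "-1"] by simp

lemma dd_sum: "finite A \<Longrightarrow> (\<And>i. i \<in> A \<Longrightarrow> smooth (f i)) \<Longrightarrow>
    dd w (\<lambda>x. \<Sum>i\<in>A. f i x) x = (\<Sum>i\<in>A. dd w (f i) x)"
  by (induction A rule: finite_induct)
     (auto simp: dd_add smooth_sum dd_unique[OF has_derivative_const])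

lemma dd_mult: "smooth f \<Longrightarrow> smooth g \<Longrightarrow> dd w (\<lambda>x. f x * g x :: real) x = dd w f x * g x + f x * dd w g x"
  by (simp add: dd_def pd_bilinear[OF bounded_bilinear_mult] smooth_differentiable distrib_left
      sum.distrib sum_distrib_left sum_distrib_right mult.assoc mult.left_commute)

text \<open>
  The mean value theorem, first in direction \<open>a\<close> and then in direction \<open>b\<close>.
\<close>

lemma double_difference:
  fixes f :: "real ^ 3 \<Rightarrow> real"
  assumes f: "smooth f" and h: "h > 0"
  shows "\<exists>s t. 0 < s \<and> s < h \<and> 0 < t \<and> t < h \<and>
     f (x + h *\<^sub>R a + h *\<^sub>R b) - f (x + h *\<^sub>R a) - f (x + h *\<^sub>R b) + f x = h * h * dd b (dd a f) (x + s *\<^sub>R a + t *\<^sub>R b)"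
proof -
  let ?g = "\<lambda>s. f ((x + h *\<^sub>R b) + s *\<^sub>R a) - f (x + s *\<^sub>R a)"
  have 1: "(?g has_real_derivative (dd a f ((x + h *\<^sub>R b) + s *\<^sub>R a) - dd a f (x + s *\<^sub>R a))) (at s)" for s
    unfolding has_real_derivative_iff_has_vector_derivative
    by (intro has_vector_derivative_diff dd_line f)
  obtain s where s: "0 < s" "s < h" "?g h - ?g 0 = (h - 0) * (dd a f ((x + h *\<^sub>R b) + s *\<^sub>R a) - dd a f (x + s *\<^sub>R a))"
    using MVT2[OF h 1] by blast
  let ?k = "\<lambda>t. dd a f ((x + s *\<^sub>R a) + t *\<^sub>R b)"
  have 2: "(?k has_real_derivative (dd b (dd a f) ((x + s *\<^sub>R a) + t *\<^sub>R b))) (at t)" for t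
    unfolding has_real_derivative_iff_has_vector_derivative
    by (intro dd_line smooth_dd f)
  obtain t where t: "0 < t" "t < h" "?k h - ?k 0 = (h - 0) * dd b (dd a f) ((x + s *\<^sub>R a) + t *\<^sub>R b)"
    using MVT2[OF h 2] by blast
  have "?g h - ?g 0 = h * (?k h - ?k 0)" using s(3) by (simp add: algebra_simps)
  also have "\<dots> = h * h * dd b (dd a f) (x + s *\<^sub>R a + t *\<^sub>R b)" using t(3) by simp
  finally show ?thesis using s t by (intro exI[of _ s] exI[of _ t]) (simp add: algebra_simps)
qed

text \<open>
  The second difference quotient does not depend on the order of \<open>a\<close> and \<open>b\<close>, and by the mean value
  theorem it tends to either iterated derivative.
\<close>

lemma dd_commute_real:
  fixes f :: "real ^ 3 \<Rightarrow> real"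
  assumes f: "smooth f"
  shows "dd a (dd b f) x = dd b (dd a f) x"
proof -
  define h where "h n = 1 / real (Suc n)" for n
  have h: "h n > 0" for n by (simp add: h_def)
  have h0: "h \<longlonglongrightarrow> 0" unfolding h_def using LIMSEQ_inverse_real_of_nat by (simp add: inverse_eq_divide)
  have lim: "\<exists>X. (\<forall>n. X n = (f (x + h n *\<^sub>R a + h n *\<^sub>R b) - f (x + h n *\<^sub>R a) - f (x + h n *\<^sub>R b) + f x) / (h n * h n))
      \<and> X \<longlonglongrightarrow> dd b (dd a f) x" for a b
  proof -
    have "\<forall>n. \<exists>s t. 0 < s \<and> s < h n \<and> 0 < t \<and> t < h n \<and>
     f (x + h n *\<^sub>R a + h n *\<^sub>R b) - f (x + h n *\<^sub>R a) - f (x + h n *\<^sub>R b) + f x = h n * h n * dd b (dd a f) (x + s *\<^sub>R a + t *\<^sub>R b)"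
      using double_difference[OF f h] by blast
    then obtain s t where st: "\<And>n. 0 < s n \<and> s n < h n \<and> 0 < t n \<and> t n < h n \<and>
     f (x + h n *\<^sub>R a + h n *\<^sub>R b) - f (x + h n *\<^sub>R a) - f (x + h n *\<^sub>R b) + f x = h n * h n * dd b (dd a f) (x + s n *\<^sub>R a + t n *\<^sub>R b)"
      by metis
    have s0: "s \<longlonglongrightarrow> 0" by (rule tendsto_sandwich[OF _ _ tendsto_const h0]) (use st less_imp_le in \<open>auto intro!: always_eventually\<close>)
    have t0: "t \<longlonglongrightarrow> 0" by (rule tendsto_sandwich[OF _ _ tendsto_const h0]) (use st less_imp_le in \<open>auto intro!: always_eventually\<close>)
    have "(\<lambda>n. x + s n *\<^sub>R a + t n *\<^sub>R b) \<longlonglongrightarrow> x + 0 *\<^sub>R a + 0 *\<^sub>R b"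
      by (intro tendsto_intros s0 t0)
    then have "(\<lambda>n. dd b (dd a f) (x + s n *\<^sub>R a + t n *\<^sub>R b)) \<longlonglongrightarrow> dd b (dd a f) x"
      using isCont_tendsto_compose[OF differentiable_imp_continuous_within[OF smooth_differentiable[OF smooth_dd[OF smooth_dd[OF f]]]]]
      by fastforce
    then show ?thesis using st h by (intro exI[of _ "\<lambda>n. dd b (dd a f) (x + s n *\<^sub>R a + t n *\<^sub>R b)"]) (simp add: less_imp_neq[symmetric] nonzero_eq_divide_eq less_imp_neq[THEN not_sym])
  qed
  obtain X where X: "\<forall>n. X n = (f (x + h n *\<^sub>R a + h n *\<^sub>R b) - f (x + h n *\<^sub>R a) - f (x + h n *\<^sub>R b) + f x) / (h n * h n)"
      "X \<longlonglongrightarrow> dd b (dd a f) x" using lim by blast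
  obtain Y where Y: "\<forall>n. Y n = (f (x + h n *\<^sub>R b + h n *\<^sub>R a) - f (x + h n *\<^sub>R b) - f (x + h n *\<^sub>R a) + f x) / (h n * h n)"
      "Y \<longlonglongrightarrow> dd a (dd b f) x" using lim by blast
  have "X = Y" using X(1) Y(1) by (intro ext) (simp add: algebra_simps)
  then show ?thesis using X(2) Y(2) LIMSEQ_unique by blast
qed

lemma pd_dd: "pd j f = dd (axis j 1) f"
  by (auto simp: fun_eq_iff dd_def axis_def if_distrib if_distribR cong: if_cong)

lemma pd_commute_real: "smooth f \<Longrightarrow> pd i (pd j f) x = pd j (pd i f) x" for f :: "real ^ 3 \<Rightarrow> real"
  by (metis pd_dd dd_commute_real)

lemma periodic_dd:
  assumes "periodic f" "smooth f"
  shows "periodic (dd w f)"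
  unfolding periodic_def
proof (intro allI ballI)
  fix x k assume k: "k \<in> lattice"
  have "((\<lambda>y. f (y + k)) has_derivative (\<lambda>w. dd w f (x + k))) (at x)"
    by (rule has_derivative_compose[of "\<lambda>y. y + k" "\<lambda>h. h"])
       (auto intro!: derivative_eq_intros dd_has_derivative smooth_differentiable assms)
  moreover have "(\<lambda>y. f (y + k)) = f" using assms(1) k by (auto simp: periodic_def)
  ultimately show "dd w f (x + k) = dd w f x"
    using dd_has_derivative[OF smooth_differentiable[OF assms(2)], of x] has_derivative_unique by metis
qed

lemma periodic_pd: "periodic f \<Longrightarrow> smooth f \<Longrightarrow> periodic (pd j f)"
  by (simp add: pd_dd periodic_dd)

lemma Ck_cos: "Ck n (\<lambda>x. cos (a * x $ i + c))"
proof (induction n arbitrary: c)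
  case 0
  show ?case unfolding Ck.simps differentiable_on_def
    by (intro ballI) (auto simp: differentiable_def intro!: derivative_eq_intros exI
        bounded_linear.has_derivative[OF bounded_linear_vec_nth])
next
  case (Suc n)
  have *: "((\<lambda>x. cos (a * x $ i + c)) has_derivative (\<lambda>h. a * h $ i * cos (a * x $ i + (c + pi/2)))) (at x)" for x :: "real^3"
    by (auto intro!: derivative_eq_intros bounded_linear.has_derivative[OF bounded_linear_vec_nth]
        simp: cos_add cos_pi_half sin_add algebra_simps fun_eq_iff)
  have "pd j (\<lambda>x. cos (a * x $ i + c)) = (\<lambda>x. (a * axis j 1 $ i) * cos (a * x $ i + (c + pi/2)))" for j
    by (intro ext) (rule pd_unique[OF *])
  moreover have "Ck n (\<lambda>x::real^3. (a * axis j 1 $ i) * cos (a * x $ i + (c + pi/2)))" for j :: 3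
    by (rule Ck_cong_linear[OF bounded_linear_mult_right Suc])
  ultimately show ?case using * by (auto simp: differentiable_on_def differentiable_def)
qed

lemma smooth_cos: "smooth (\<lambda>x. cos (a * x $ i + c))"
  by (simp add: smooth_iff_Ck Ck_cos)

lemma sym_grad_nth: "smooth u \<Longrightarrow> sym_grad u x $ i $ j = (pd j (\<lambda>y. u y $ i) x + pd i (\<lambda>y. u y $ j) x) / 2"
  by (simp add: sym_grad_def grad_def transpose_def pd_vec_nth)

lemma mat_div_nth: "smooth m \<Longrightarrow> mat_div m x $ i = (\<Sum>j\<in>UNIV. pd j (\<lambda>y. m y $ i $ j) x)"
  by (simp add: mat_div_def pd_vec_nth smooth_vec_nth)

lemma vec_curl_nth:
  assumes "smooth w"
  shows "vec_curl w x $ 1 = pd 2 (\<lambda>y. w y $ 3) x - pd 3 (\<lambda>y. w y $ 2) x"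
    "vec_curl w x $ 2 = pd 3 (\<lambda>y. w y $ 1) x - pd 1 (\<lambda>y. w y $ 3) x"
    "vec_curl w x $ 3 = pd 1 (\<lambda>y. w y $ 2) x - pd 2 (\<lambda>y. w y $ 1) x"
  by (simp_all add: vec_curl_def pd_vec_nth assms)

lemma smooth_vec_curl: "smooth w \<Longrightarrow> smooth (vec_curl w)"
proof (rule smooth_vecI)
  fix i :: 3 assume w: "smooth w"
  show "smooth (\<lambda>x. vec_curl w x $ i)"
    using exhaust_3[of i]
    by (elim disjE) (simp_all add: vec_curl_nth[OF w] smooth_diff smooth_pd smooth_vec_nth w)
qed

lemma smooth_mat_curl: "smooth m \<Longrightarrow> smooth (mat_curl m)"
  unfolding mat_curl_def[abs_def]
  by (rule smooth_matI, simp) (intro smooth_vec_nth smooth_vec_curl)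

lemma smooth_transpose: "smooth m \<Longrightarrow> smooth (\<lambda>x. transpose (m x))" for m :: "_ \<Rightarrow> real^3^3"
  by (rule smooth_matI) (simp add: transpose_def, intro smooth_vec_nth)

lemma smooth_inc: "smooth m \<Longrightarrow> smooth (inc m)"
  unfolding inc_def by (intro smooth_mat_curl smooth_transpose)

lemma periodic_mat_curl: "periodic m \<Longrightarrow> smooth m \<Longrightarrow> periodic (mat_curl m)"
proof -
  assume m: "periodic m" "smooth m"
  have "pd j (\<lambda>y. m y $ i) (x + k) = pd j (\<lambda>y. m y $ i) x" if "k \<in> lattice" for i j x k
    using periodic_pd[of "\<lambda>y. m y $ i" j] m that by (auto simp: periodic_def smooth_vec_nth)
  then show ?thesis
    by (auto simp: periodic_def mat_curl_def vec_curl_def vec_eq_iff)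
qed

section \<open>Means over simplices and the fundamental theorem of calculus\<close>

text \<open>
  The means below are integrals over reference simplices, so they are the averages divided by \<open>1\<close>,
  \<open>2\<close> and \<open>6\<close> respectively. With these weights the derivative formulas \<open>mean1_deriv\<close>,
  \<open>mean2_deriv\<close> and \<open>mean3_deriv\<close> have no constants.
\<close>

definition Tri :: "(real \<times> real) set" where
  "Tri = {p. 0 \<le> fst p \<and> 0 \<le> snd p \<and> fst p + snd p \<le> 1}"

definition mean1 :: "real ^ 3 \<Rightarrow> real ^ 3 \<Rightarrow> (real ^ 3 \<Rightarrow> real) \<Rightarrow> real" where
  "mean1 a b f = (\<integral>s. indicator {0..1} s *\<^sub>R f (a + s *\<^sub>R (b - a)) \<partial>lborel)"

definition mean2 :: "real ^ 3 \<Rightarrow> real ^ 3 \<Rightarrow> real ^ 3 \<Rightarrow> (real ^ 3 \<Rightarrow> real) \<Rightarrow> real" where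
  "mean2 a b c f = (\<integral>p. indicator Tri p *\<^sub>R f (a + fst p *\<^sub>R (b - a) + snd p *\<^sub>R (c - a)) \<partial>lborel)"

definition vol6 :: "real ^ 3 \<Rightarrow> real ^ 3 \<Rightarrow> real ^ 3 \<Rightarrow> real ^ 3 \<Rightarrow> real" where
  "vol6 a b c d = \<bar>(cross3 (b - a) (c - a)) \<bullet> (d - a)\<bar>"

definition mean3 :: "real ^ 3 \<Rightarrow> real ^ 3 \<Rightarrow> real ^ 3 \<Rightarrow> real ^ 3 \<Rightarrow> (real ^ 3 \<Rightarrow> real) \<Rightarrow> real" where
  "mean3 a b c d f = integral (convex hull {a, b, c, d}) f / vol6 a b c d"

lemma compact_Tri: "compact Tri"
proof -
  have "Tri \<subseteq> cbox (0,0) (1,1)" by (auto simp: Tri_def mem_box Basis_prod_def cbox_Pair_eq)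
  moreover have "closed Tri" unfolding Tri_def
    by (intro closed_Collect_conj closed_Collect_le continuous_intros)
  ultimately show ?thesis by (meson bounded_cbox bounded_subset compact_eq_bounded_closed)
qed

lemma continuous_compose_UNIV:
  "continuous_on UNIV f \<Longrightarrow> continuous_on S g \<Longrightarrow> continuous_on S (\<lambda>x. f (g x))"
  by (rule continuous_on_compose2[of UNIV f]) auto

lemma mean1_integrable:
  assumes f: "continuous_on UNIV (f :: real ^ 3 \<Rightarrow> real)"
  shows "integrable lborel (\<lambda>s. indicator {0..1::real} s *\<^sub>R f (a + s *\<^sub>R (b - a)))"
proof -
  have "continuous_on {0..1} (\<lambda>s. f (a + s *\<^sub>R (b - a)))"
    by (rule continuous_compose_UNIV[OF f]) (intro continuous_intros)
  then show ?thesis by (rule borel_integrable_compact[OF compact_Icc])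
qed

lemma mean2_integrable:
  assumes f: "continuous_on UNIV (f :: real ^ 3 \<Rightarrow> real)"
  shows "integrable lborel (\<lambda>p. indicator Tri p *\<^sub>R f (a + fst p *\<^sub>R b + snd p *\<^sub>R c))"
proof -
  have "continuous_on Tri (\<lambda>p. f (a + fst p *\<^sub>R b + snd p *\<^sub>R c))"
    by (rule continuous_compose_UNIV[OF f]) (intro continuous_intros)
  then show ?thesis by (rule borel_integrable_compact[OF compact_Tri])
qed

lemma mean1_add: "continuous_on UNIV f \<Longrightarrow> continuous_on UNIV g \<Longrightarrow> mean1 a b (\<lambda>x. f x + g x) = mean1 a b f + mean1 a b g"
  unfolding mean1_def using Bochner_Integration.integral_add[OF mean1_integrable mean1_integrable, of f g a b a b]
  by (simp add: scaleR_add_right distrib_left)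

lemma mean1_cmult: "mean1 a b (\<lambda>x. c * f x) = c * mean1 a b f"
  unfolding mean1_def by (simp add: mult.left_commute)

lemma mean2_add: "continuous_on UNIV f \<Longrightarrow> continuous_on UNIV g \<Longrightarrow> mean2 a b c (\<lambda>x. f x + g x) = mean2 a b c f + mean2 a b c g"
  unfolding mean2_def using Bochner_Integration.integral_add[OF mean2_integrable mean2_integrable, of f g a "b-a" "c-a" a "b-a" "c-a"]
  by (simp add: scaleR_add_right distrib_left)

lemma mean2_cmult: "mean2 a b c (\<lambda>x. r * f x) = r * mean2 a b c f"
  unfolding mean2_def by (simp add: mult.left_commute)

lemma mean1_swap: "mean1 a b f = mean1 b a f"
proof -
  have "mean1 a b f = (\<integral>s. indicator {0..1} (1 + (-1) * s) *\<^sub>R f (a + (1 + (-1) * s) *\<^sub>R (b - a)) \<partial>lborel)"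
    unfolding mean1_def by (subst lborel_integral_real_affine[where c="-1" and t=1]) simp_all
  also have "\<dots> = mean1 b a f"
    unfolding mean1_def
    by (rule Bochner_Integration.integral_cong) (auto simp: indicator_def algebra_simps)
  finally show ?thesis .
qed

lemma mean2_swap23: "continuous_on UNIV f \<Longrightarrow> mean2 a b c f = mean2 a c b f"
proof -
  assume f: "continuous_on UNIV f"
  let ?h = "\<lambda>p. indicator Tri p *\<^sub>R f (a + fst p *\<^sub>R (b - a) + snd p *\<^sub>R (c - a))"
  have "integrable (lborel \<Otimes>\<^sub>M lborel) ?h" using mean2_integrable[OF f] by (simp add: lborel_prod)
  then have "(\<integral>(x,y). ?h (y,x) \<partial>(lborel \<Otimes>\<^sub>M lborel)) = integral\<^sup>L (lborel \<Otimes>\<^sub>M lborel) ?h"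
    by (intro lborel_pair.integral_product_swap) auto
  moreover have "(\<lambda>(x,y). ?h (y,x)) = (\<lambda>p. indicator Tri p *\<^sub>R f (a + fst p *\<^sub>R (c - a) + snd p *\<^sub>R (b - a)))"
    by (auto simp: fun_eq_iff Tri_def indicator_def algebra_simps)
  ultimately show ?thesis by (simp add: mean2_def lborel_prod)
qed

lemma mean2_iterated:
  assumes "continuous_on UNIV f"
  shows "mean2 a b c f = (\<integral>t. \<integral>s. indicator Tri (s, t) *\<^sub>R f (a + s *\<^sub>R (b - a) + t *\<^sub>R (c - a)) \<partial>lborel \<partial>lborel)"
  unfolding mean2_def
  using lborel_pair.integral_snd[of "\<lambda>s t. indicator Tri (s, t) *\<^sub>R f (a + s *\<^sub>R (b - a) + t *\<^sub>R (c - a))"]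
    mean2_integrable[OF assms, of a "b-a" "c-a"]
  by (simp add: lborel_prod case_prod_unfold)

lemma mean2_swap12:
  assumes f: "continuous_on UNIV f"
  shows "mean2 a b c f = mean2 b a c f"
proof -
  have "(\<integral>s. indicator Tri (s, t) *\<^sub>R f (a + s *\<^sub>R (b - a) + t *\<^sub>R (c - a)) \<partial>lborel)
      = (\<integral>s. indicator Tri (s, t) *\<^sub>R f (b + s *\<^sub>R (a - b) + t *\<^sub>R (c - b)) \<partial>lborel)" for t
  proof -
    have "(\<integral>s. indicator Tri (s, t) *\<^sub>R f (a + s *\<^sub>R (b - a) + t *\<^sub>R (c - a)) \<partial>lborel)
      = (\<integral>s. indicator Tri ((1 - t) + (-1) * s, t) *\<^sub>R f (a + ((1 - t) + (-1) * s) *\<^sub>R (b - a) + t *\<^sub>R (c - a)) \<partial>lborel)"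
      by (subst lborel_integral_real_affine[where c="-1" and t="1 - t"]) simp_all
    also have "\<dots> = (\<integral>s. indicator Tri (s, t) *\<^sub>R f (b + s *\<^sub>R (a - b) + t *\<^sub>R (c - b)) \<partial>lborel)"
      by (rule Bochner_Integration.integral_cong) (auto simp: indicator_def Tri_def algebra_simps)
    finally show ?thesis .
  qed
  then show ?thesis by (simp add: mean2_iterated[OF f])
qed

lemma line_FTC:
  fixes f :: "real ^ 3 \<Rightarrow> real"
  assumes "smooth f" "0 \<le> u"
  shows "(\<integral>s. indicator {0..u} s *\<^sub>R dd w f (a + s *\<^sub>R w) \<partial>lborel) = f (a + u *\<^sub>R w) - f a"
proof -
  have "continuous_on {0..u} (\<lambda>s. dd w f (a + s *\<^sub>R w))"
    by (rule continuous_compose_UNIV[OF smooth_continuous_on[OF smooth_dd[OF assms(1)]]]) (intro continuous_intros)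
  then show ?thesis
    using integral_FTC_Icc[of 0 u "\<lambda>s. f (a + s *\<^sub>R w)" "\<lambda>s. dd w f (a + s *\<^sub>R w)"] assms
    by (simp add: dd_line)
qed

lemma mean1_deriv: "smooth f \<Longrightarrow> mean1 a b (dd (b - a) f) = f b - f a"
  unfolding mean1_def using line_FTC[of f 1 "b - a" a] by simp

text \<open>
  Along each line parallel to \<open>b - a\<close> the inner integral telescopes to the difference of the values on
  the two other sides.
\<close>

lemma mean2_deriv:
  assumes f: "smooth f"
  shows "mean2 a b c (dd (b - a) f) = mean1 b c f - mean1 a c f"
proof -
  have inner: "(\<integral>s. indicator Tri (s, t) *\<^sub>R dd (b - a) f (a + s *\<^sub>R (b - a) + t *\<^sub>R (c - a)) \<partial>lborel)
     = indicator {0..1} t *\<^sub>R f (b + t *\<^sub>R (c - b)) - indicator {0..1} t *\<^sub>R f (a + t *\<^sub>R (c - a))" for t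
  proof (cases "t \<in> {0..1}")
    case True
    have "(\<integral>s. indicator Tri (s, t) *\<^sub>R dd (b - a) f (a + s *\<^sub>R (b - a) + t *\<^sub>R (c - a)) \<partial>lborel)
       = (\<integral>s. indicator {0..1-t} s *\<^sub>R dd (b - a) f ((a + t *\<^sub>R (c - a)) + s *\<^sub>R (b - a)) \<partial>lborel)"
      using True by (intro Bochner_Integration.integral_cong) (auto simp: indicator_def Tri_def add_ac)
    also have "\<dots> = f ((a + t *\<^sub>R (c - a)) + (1 - t) *\<^sub>R (b - a)) - f (a + t *\<^sub>R (c - a))"
      using True by (intro line_FTC f) auto
    also have "(a + t *\<^sub>R (c - a)) + (1 - t) *\<^sub>R (b - a) = b + t *\<^sub>R (c - b)"
      by (simp add: algebra_simps)
    finally show ?thesis using True by simp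
  next
    case False
    then have "indicator Tri (s, t) = (0::real)" for s by (auto simp: indicator_def Tri_def)
    then show ?thesis using False by simp
  qed
  show ?thesis
    unfolding mean2_iterated[OF smooth_continuous_on[OF smooth_dd[OF f]]] inner
    by (subst Bochner_Integration.integral_diff) (simp_all only: mean1_def mean1_integrable[OF smooth_continuous_on[OF f]])
qed

text \<open>
  The first coordinate comes last in the pair: it becomes the inner variable in Fubini's theorem.
\<close>

definition vec3 :: "(real \<times> real) \<times> real \<Rightarrow> real ^ 3" where
  "vec3 p = vector [snd p, fst (fst p), snd (fst p)]"

lemma vec3_nth [simp]: "vec3 p $ 1 = snd p" "vec3 p $ 2 = fst (fst p)" "vec3 p $ 3 = snd (fst p)"
  by (simp_all add: vec3_def)

lemma continuous_vec3: "continuous_on UNIV vec3"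
proof -
  have "continuous_on UNIV (\<lambda>p. \<chi> i. vec3 p $ i)"
  proof (rule continuous_on_vec_lambda)
    fix i :: 3
    show "continuous_on UNIV (\<lambda>p. vec3 p $ i)"
      using exhaust_3[of i] by (elim disjE) (simp_all, (intro continuous_intros)+)
  qed
  then show ?thesis by simp
qed

lemma measurable_vec3[measurable]: "vec3 \<in> borel_measurable borel"
  by (rule borel_measurable_continuous_onI[OF continuous_vec3])

lemma lborel_vec3: "lborel = distr lborel borel vec3"
proof (rule lborel_eqI)
  fix l u :: "real ^ 3" assume "\<And>b. b \<in> Basis \<Longrightarrow> l \<bullet> b \<le> u \<bullet> b"
  then have le: "l $ i \<le> u $ i" for i by (metis axis_in_Basis_iff[of i 1] cart_eq_inner_axis Basis_real_def insertI1)
  have v: "vec3 -` box l u \<inter> space lborel = ({l$2<..<u$2} \<times> {l$3<..<u$3}) \<times> {l$1<..<u$1}"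
    by (auto simp: mem_box_cart forall_3)
  have B: "(\<Prod>b\<in>Basis. (u - l) \<bullet> b) = (u$2-l$2) * (u$3-l$3) * (u$1-l$1)"
  proof -
    have "(\<Prod>b\<in>Basis. (u - l) \<bullet> b) = (\<Prod>i\<in>UNIV. (u - l) $ i)"
      unfolding Basis_vec_def
      by (subst prod.UNION_disjoint) (auto simp: cart_eq_inner_axis axis_eq_axis)
    also have "\<dots> = (u$2-l$2) * (u$3-l$3) * (u$1-l$1)"
      unfolding UNIV_3 by simp
    finally show ?thesis .
  qed
  have len: "emeasure lborel {l$i<..<u$i} = ennreal (u$i - l$i)" "0 \<le> u$i - l$i" for i
    using le[of i] by simp_all
  have pair: "emeasure lborel (A \<times> B) = emeasure lborel A * emeasure lborel B"
    if "A \<in> sets borel" "B \<in> sets borel" for A :: "'c::euclidean_space set" and B :: "'d::euclidean_space set"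
    using lborel.emeasure_pair_measure_Times[of A lborel B] that by (simp add: lborel_prod)
  have "emeasure (distr lborel borel vec3) (box l u) = emeasure lborel (({l$2<..<u$2} \<times> {l$3<..<u$3}) \<times> {l$1<..<u$1})"
    unfolding v[symmetric] by (rule emeasure_distr) simp_all
  also have "\<dots> = emeasure lborel ({l$2<..<u$2} \<times> {l$3<..<u$3}) * emeasure lborel {l$1<..<u$1}"
    by (rule pair) (simp_all add: borel_open open_Times)
  also have "emeasure lborel ({l$2<..<u$2} \<times> {l$3<..<u$3}) = emeasure lborel {l$2<..<u$2} * emeasure lborel {l$3<..<u$3}"
    by (rule pair) simp_all
  also have "\<dots> * emeasure lborel {l$1<..<u$1} = ennreal ((u$2-l$2) * (u$3-l$3) * (u$1-l$1))"
    unfolding len(1) using len(2) by (simp only: ennreal_mult mult_nonneg_nonneg)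
  finally show "emeasure (distr lborel borel vec3) (box l u) = (\<Prod>b\<in>Basis. (u - l) \<bullet> b)"
    by (simp only: B)
qed simp

definition Tet :: "(real ^ 3) set" where
  "Tet = convex hull (insert 0 Basis)"

lemma Tet_iff: "y \<in> Tet \<longleftrightarrow> 0 \<le> y$1 \<and> 0 \<le> y$2 \<and> 0 \<le> y$3 \<and> y$1 + y$2 + y$3 \<le> 1"
proof -
  have "(\<Sum>b\<in>Basis. y \<bullet> b) = (\<Sum>i\<in>UNIV. y $ i)"
    unfolding Basis_vec_def
    by (subst sum.UNION_disjoint) (auto simp: cart_eq_inner_axis axis_eq_axis)
  moreover have "(\<forall>i\<in>Basis. 0 \<le> y \<bullet> i) \<longleftrightarrow> (\<forall>i. 0 \<le> y $ i)"
    by (auto simp: Basis_vec_def cart_eq_inner_axis)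
  ultimately show ?thesis
    unfolding Tet_def std_simplex by (simp add: sum_3 forall_3)
qed

lemma compact_Tet: "compact Tet"
  unfolding Tet_def by (intro finite_imp_compact_convex_hull) auto

definition frame :: "real ^ 3 \<Rightarrow> real ^ 3 \<Rightarrow> real ^ 3 \<Rightarrow> real ^ 3 \<Rightarrow> real ^ 3" where
  "frame u v w y = y$1 *\<^sub>R u + y$2 *\<^sub>R v + y$3 *\<^sub>R w"

lemma linear_frame: "linear (frame u v w)"
  by (rule linearI) (simp_all add: frame_def algebra_simps)

lemma det_frame: "\<bar>det (matrix (frame u v w))\<bar> = \<bar>cross3 u v \<bullet> w\<bar>"
proof -
  have "det (matrix (frame u v w)) = cross3 u v \<bullet> w"
    by (simp add: det_3 matrix_def frame_def axis_def cross3_simps)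
  then show ?thesis by simp
qed

lemma Basis_real3: "(Basis :: (real^3) set) = {axis 1 1, axis 2 1, axis 3 1}"
  by (auto simp: Basis_vec_def UNIV_3)

lemma hull_eq_frame_image:
  "convex hull {a, b, c, d} = (+) a ` frame (b - a) (c - a) (d - a) ` Tet"
proof -
  have "{a, b, c, d} = (+) a ` frame (b - a) (c - a) (d - a) ` insert 0 Basis"
    by (simp add: Basis_real3 frame_def axis_def)
  then show ?thesis
    by (simp only: Tet_def convex_hull_translation convex_hull_linear_image[OF linear_frame])
qed

lemma integral_eq_lborel:
  fixes f :: "real ^ 3 \<Rightarrow> real"
  assumes "compact S" "continuous_on UNIV f"
  shows "integral S f = (\<integral>x. indicator S x *\<^sub>R f x \<partial>lborel)"
proof -
  have "set_integrable lborel S f"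
    unfolding set_integrable_def
    by (rule borel_integrable_compact[OF assms(1) continuous_on_subset[OF assms(2)]]) simp
  then show ?thesis using set_borel_integral_eq_integral(2)[of S f] by (simp add: set_lebesgue_integral_def)
qed

lemma integral_translation:
  fixes f :: "real ^ 3 \<Rightarrow> real"
  assumes S: "compact S" and f: "continuous_on UNIV f"
  shows "integral ((+) a ` S) f = integral S (\<lambda>x. f (a + x))"
proof -
  have c: "continuous_on UNIV (\<lambda>x. f (a + x))" by (rule continuous_compose_UNIV[OF f]) (intro continuous_intros)
  have S': "compact ((+) a ` S)" using S by (rule compact_translation)
  have "integral ((+) a ` S) f = (\<integral>x. indicator ((+) a ` S) x *\<^sub>R f x \<partial>distr lborel borel ((+) a))"
    by (simp only: integral_eq_lborel[OF S' f] lborel_distr_plus)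
  also have "\<dots> = (\<integral>x. indicator ((+) a ` S) (a + x) *\<^sub>R f (a + x) \<partial>lborel)"
    by (rule integral_distr)
       (use compact_imp_closed[OF S'] borel_measurable_continuous_onI[OF f] in \<open>auto intro!: borel_measurable_times borel_measurable_indicator\<close>)
  also have "\<dots> = (\<integral>x. indicator S x *\<^sub>R f (a + x) \<partial>lborel)"
    by (rule Bochner_Integration.integral_cong) (auto simp: indicator_def)
  finally show ?thesis by (simp only: integral_eq_lborel[OF S c])
qed

text \<open>
  A scalar function is regarded as a field with values in \<open>real ^ 1\<close>, to which
  \<open>integral_change_of_variables_linear\<close> applies.
\<close>

lemma integral_linear_image:
  fixes f :: "real ^ 3 \<Rightarrow> real"
  assumes S: "compact S" and f: "continuous_on UNIV f" and g: "linear g"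
  shows "integral (g ` S) f = \<bar>det (matrix g)\<bar> * integral S (\<lambda>x. f (g x))"
proof -
  define F where "F x = (vec (f x) :: real ^ 1)" for x
  have cF: "continuous_on T F" for T
    unfolding F_def vec_def
    by (intro continuous_on_vec_lambda continuous_on_subset[OF f]) auto
  have cg: "continuous_on T g" for T using g linear_continuous_on linear_linear by blast
  have "F absolutely_integrable_on (g ` S)"
    unfolding set_integrable_def
    using borel_integrable_compact[OF compact_continuous_image[OF cg S] cF]
    by (intro integrable_completion[THEN iffD2]) auto
  then have eq: "integral (g ` S) F = \<bar>det (matrix g)\<bar> *\<^sub>R integral S (F \<circ> g)"
    using integral_change_of_variables_linear[OF g] by blast
  have i1: "F integrable_on (g ` S)"
    by (rule set_lebesgue_integral_eq_integral(1)) fact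
  have "set_integrable lborel S (F \<circ> g)"
    unfolding set_integrable_def o_def
    by (rule borel_integrable_compact[OF S continuous_on_compose2[OF cF[of UNIV] cg]]) simp
  then have i2: "(F \<circ> g) integrable_on S" by (rule set_borel_integral_eq_integral(1))
  have "integral (g ` S) f = integral (g ` S) F $ 1"
    by (subst integral_component_eq_cart[OF i1, symmetric]) (simp add: F_def)
  also have "\<dots> = \<bar>det (matrix g)\<bar> * (integral S (F \<circ> g) $ 1)" by (simp add: eq)
  also have "integral S (F \<circ> g) $ 1 = integral S (\<lambda>x. f (g x))"
    by (subst integral_component_eq_cart[OF i2, symmetric]) (simp add: F_def)
  finally show ?thesis .
qed

lemma integral_hull_Tet:
  fixes f :: "real ^ 3 \<Rightarrow> real"
  assumes f: "continuous_on UNIV f"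
  shows "integral (convex hull {a, b, c, d}) f
     = vol6 a b c d * integral Tet (\<lambda>y. f (a + frame (b - a) (c - a) (d - a) y))"
proof -
  let ?g = "frame (b - a) (c - a) (d - a)"
  have c1: "compact (?g ` Tet)"
    by (intro compact_continuous_image compact_Tet linear_continuous_on linear_frame[unfolded linear_conv_bounded_linear])
  have c: "continuous_on UNIV (\<lambda>x. f (a + x))" by (rule continuous_compose_UNIV[OF f]) (intro continuous_intros)
  show ?thesis
    unfolding hull_eq_frame_image integral_translation[OF c1 f] integral_linear_image[OF compact_Tet c linear_frame]
      det_frame vol6_def ..
qed

lemma Tet_integral_iterated:
  fixes f :: "real ^ 3 \<Rightarrow> real"
  assumes f: "continuous_on UNIV f"
  shows "integral Tet f = (\<integral>p. indicator Tri p *\<^sub>R (\<integral>r. indicator {0..1 - fst p - snd p} r *\<^sub>R f (vec3 (p, r)) \<partial>lborel) \<partial>lborel)"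
proof -
  let ?h = "\<lambda>x. indicator Tet x *\<^sub>R f x"
  have h: "integrable lborel ?h"
    by (rule borel_integrable_compact[OF compact_Tet continuous_on_subset[OF f]]) simp
  have hm: "?h \<in> borel_measurable borel" using borel_measurable_integrable[OF h] by simp
  have h': "integrable lborel (\<lambda>p. ?h (vec3 p))"
    using h unfolding lborel_vec3 by (subst (asm) integrable_distr_eq) (use hm in auto)
  have "integral Tet f = integral\<^sup>L (distr lborel borel vec3) ?h"
    by (simp only: integral_eq_lborel[OF compact_Tet f] lborel_vec3[symmetric])
  also have "\<dots> = (\<integral>p. ?h (vec3 p) \<partial>lborel)"
    using hm by (intro integral_distr) auto
  also have "\<dots> = (\<integral>p. \<integral>r. ?h (vec3 (p, r)) \<partial>lborel \<partial>lborel)"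
    using lborel_pair.integral_fst'[of "\<lambda>p. ?h (vec3 p)"] h' unfolding lborel_prod by simp
  also have "\<dots> = (\<integral>p. indicator Tri p *\<^sub>R (\<integral>r. indicator {0..1 - fst p - snd p} r *\<^sub>R f (vec3 (p, r)) \<partial>lborel) \<partial>lborel)"
  proof (rule Bochner_Integration.integral_cong[OF refl])
    fix p :: "real \<times> real"
    have "indicator Tet (vec3 (p, r)) = (indicator Tri p * indicator {0..1 - fst p - snd p} r :: real)" for r
      by (auto simp: indicator_def Tet_iff Tri_def)
    then show "(\<integral>r. ?h (vec3 (p, r)) \<partial>lborel) = indicator Tri p *\<^sub>R (\<integral>r. indicator {0..1 - fst p - snd p} r *\<^sub>R f (vec3 (p, r)) \<partial>lborel)"
      by (simp add: mult.assoc)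
  qed
  finally show ?thesis .
qed

text \<open>
  Fubini with the edge \<open>[a, b]\<close> as inner direction: each line parallel to it enters through the face
  \<open>[a, c, d]\<close> and leaves through the face \<open>[b, c, d]\<close>.
\<close>

lemma mean3_deriv:
  assumes f: "smooth f" and v: "vol6 a b c d \<noteq> 0"
  shows "mean3 a b c d (dd (b - a) f) = mean2 b c d f - mean2 a c d f"
proof -
  let ?F = "\<lambda>y. dd (b - a) f (a + frame (b - a) (c - a) (d - a) y)"
  have cd: "continuous_on UNIV (dd (b - a) f)" by (intro smooth_continuous_on smooth_dd f)
  have cF: "continuous_on UNIV ?F"
    by (rule continuous_compose_UNIV[OF cd])
       (intro continuous_intros linear_continuous_on linear_frame[unfolded linear_conv_bounded_linear])
  have inner: "(\<integral>r. indicator {0..1 - fst p - snd p} r *\<^sub>R ?F (vec3 (p, r)) \<partial>lborel)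
      = f (b + fst p *\<^sub>R (c - b) + snd p *\<^sub>R (d - b)) - f (a + fst p *\<^sub>R (c - a) + snd p *\<^sub>R (d - a))"
    if "p \<in> Tri" for p
  proof -
    let ?q = "a + fst p *\<^sub>R (c - a) + snd p *\<^sub>R (d - a)"
    have "?F (vec3 (p, r)) = dd (b - a) f (?q + r *\<^sub>R (b - a))" for r
      by (simp add: frame_def add_ac)
    then have "(\<integral>r. indicator {0..1 - fst p - snd p} r *\<^sub>R ?F (vec3 (p, r)) \<partial>lborel)
       = f (?q + (1 - fst p - snd p) *\<^sub>R (b - a)) - f ?q"
      using line_FTC[OF f, of "1 - fst p - snd p" "b - a" ?q] that by (simp add: Tri_def)
    also have "?q + (1 - fst p - snd p) *\<^sub>R (b - a) = b + fst p *\<^sub>R (c - b) + snd p *\<^sub>R (d - b)"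
      by (simp add: algebra_simps)
    finally show ?thesis .
  qed
  have "mean3 a b c d (dd (b - a) f) = integral Tet ?F"
    using v by (simp add: mean3_def integral_hull_Tet[OF cd])
  also have "\<dots> = (\<integral>p. indicator Tri p *\<^sub>R (\<integral>r. indicator {0..1 - fst p - snd p} r *\<^sub>R ?F (vec3 (p, r)) \<partial>lborel) \<partial>lborel)"
    by (rule Tet_integral_iterated[OF cF])
  also have "\<dots> = (\<integral>p. indicator Tri p *\<^sub>R f (b + fst p *\<^sub>R (c - b) + snd p *\<^sub>R (d - b)) -
         indicator Tri p *\<^sub>R f (a + fst p *\<^sub>R (c - a) + snd p *\<^sub>R (d - a)) \<partial>lborel)"
  proof (rule Bochner_Integration.integral_cong[OF refl])
    fix p :: "real \<times> real"
    show "indicator Tri p *\<^sub>R (\<integral>r. indicator {0..1 - fst p - snd p} r *\<^sub>R ?F (vec3 (p, r)) \<partial>lborel)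
      = indicator Tri p *\<^sub>R f (b + fst p *\<^sub>R (c - b) + snd p *\<^sub>R (d - b)) -
         indicator Tri p *\<^sub>R f (a + fst p *\<^sub>R (c - a) + snd p *\<^sub>R (d - a))"
      using inner[of p] by (cases "p \<in> Tri") simp_all
  qed
  also have "\<dots> = mean2 b c d f - mean2 a c d f"
    unfolding mean2_def by (intro Bochner_Integration.integral_diff mean2_integrable smooth_continuous_on f)
  finally show ?thesis .
qed

lemma integral_hull_mean3:
  assumes "vol6 a b c d \<noteq> 0"
  shows "integral (convex hull {a, b, c, d}) f = vol6 a b c d * mean3 a b c d f"
  using assms by (simp add: mean3_def)

lemma vol6_perm: "vol6 a c b d = vol6 a b c d" "vol6 b a c d = vol6 a b c d" "vol6 a b d c = vol6 a b c d"
proof -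
  have "cross3 (c - a) (b - a) \<bullet> (d - a) = - (cross3 (b - a) (c - a) \<bullet> (d - a))"
    "cross3 (a - b) (c - b) \<bullet> (d - b) = - (cross3 (b - a) (c - a) \<bullet> (d - a))"
    "cross3 (b - a) (d - a) \<bullet> (c - a) = - (cross3 (b - a) (c - a) \<bullet> (d - a))"
    by (simp_all add: cross3_simps)
  then show "vol6 a c b d = vol6 a b c d" "vol6 b a c d = vol6 a b c d" "vol6 a b d c = vol6 a b c d"
    unfolding vol6_def by (simp_all only: abs_minus_cancel)
qed

lemma mean3_perm: "mean3 a c b d f = mean3 a b c d f" "mean3 b a c d f = mean3 a b c d f" "mean3 a b d c f = mean3 a b c d f"
  by (simp_all add: mean3_def vol6_perm insert_commute)

lemma continuous_integrable_hull:
  fixes f :: "real ^ 3 \<Rightarrow> real"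
  assumes "continuous_on UNIV f" "finite S"
  shows "f integrable_on (convex hull S)"
proof -
  have "set_integrable lborel (convex hull S) f"
    unfolding set_integrable_def
    by (rule borel_integrable_compact[OF finite_imp_compact_convex_hull[OF assms(2)] continuous_on_subset[OF assms(1)]]) simp
  then show ?thesis by (rule set_borel_integral_eq_integral(1))
qed

lemma mean3_add:
  assumes "continuous_on UNIV f" "continuous_on UNIV g"
  shows "mean3 a b c d (\<lambda>x. f x + g x) = mean3 a b c d f + mean3 a b c d g"
  unfolding mean3_def by (subst Henstock_Kurzweil_Integration.integral_add)
    (simp_all add: continuous_integrable_hull assms add_divide_distrib)

lemma mean3_cmult: "mean3 a b c d (\<lambda>x. r * f x) = r * mean3 a b c d f"
  by (simp add: mean3_def)

section \<open>The differential operators in coordinates\<close>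

text \<open>
  Indices of type \<open>3\<close> are integers modulo \<open>3\<close>, so that \<open>j + 1\<close>, \<open>j + 2\<close> run through the cyclic
  successors of \<open>j\<close>.
\<close>

lemma vec_curl_nth_cyclic:
  assumes "smooth w"
  shows "vec_curl w x $ i = pd (i + 1) (\<lambda>y. w y $ (i + 2)) x - pd (i + 2) (\<lambda>y. w y $ (i + 1)) x"
proof -
  have [simp]: "(4::3) = 1" "(5::3) = 2" by simp_all
  show ?thesis using exhaust_3[of i] by (elim disjE) (simp_all add: vec_curl_nth[OF assms])
qed

lemma mat_curl_nth:
  "smooth m \<Longrightarrow> mat_curl m x $ i $ j = pd (j + 1) (\<lambda>y. m y $ i $ (j + 2)) x - pd (j + 2) (\<lambda>y. m y $ i $ (j + 1)) x"
  by (simp add: mat_curl_def vec_curl_nth_cyclic[OF smooth_vec_nth])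

lemma inc_nth:
  fixes m :: "real ^ 3 \<Rightarrow> real ^ 3 ^ 3" and x :: "real ^ 3"
  assumes m: "smooth m"
  defines "P \<equiv> \<lambda>a b k l. pd a (pd b (\<lambda>y. m y $ k $ l)) x"
  shows "inc m x $ i $ j = P (j + 1) (i + 1) (j + 2) (i + 2) - P (j + 1) (i + 2) (j + 2) (i + 1)
       - P (j + 2) (i + 1) (j + 1) (i + 2) + P (j + 2) (i + 2) (j + 1) (i + 1)"
proof -
  have s: "smooth (\<lambda>y. m y $ k $ l)" for k l by (intro smooth_vec_nth m)
  have C: "(\<lambda>y. transpose (mat_curl m y) $ i $ k) =
      (\<lambda>y. pd (i + 1) (\<lambda>y. m y $ k $ (i + 2)) y - pd (i + 2) (\<lambda>y. m y $ k $ (i + 1)) y)" for k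
    by (simp add: fun_eq_iff transpose_def mat_curl_nth[OF m])
  have "inc m x $ i $ j = pd (j + 1) (\<lambda>y. transpose (mat_curl m y) $ i $ (j + 2)) x
        - pd (j + 2) (\<lambda>y. transpose (mat_curl m y) $ i $ (j + 1)) x"
    unfolding inc_def by (rule mat_curl_nth[OF smooth_transpose[OF smooth_mat_curl[OF m]]])
  also have "\<dots> = P (j + 1) (i + 1) (j + 2) (i + 2) - P (j + 1) (i + 2) (j + 2) (i + 1)
       - (P (j + 2) (i + 1) (j + 1) (i + 2) - P (j + 2) (i + 2) (j + 1) (i + 1))"
    unfolding C P_def by (simp only: pd_diff[OF smooth_pd[OF s] smooth_pd[OF s]])
  finally show ?thesis by simp
qed

lemma smoothS_nth_sym: "m \<in> smoothS \<Longrightarrow> m x $ i $ j = m x $ j $ i"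
  by (auto simp: smoothS_def transpose_def vec_eq_iff)

lemma smoothS_smooth: "m \<in> smoothS \<Longrightarrow> smooth m" and smoothV_smooth: "u \<in> smoothV \<Longrightarrow> smooth u"
  by (auto simp: smoothS_def smoothV_def)

lemma transpose_eqI: "(\<And>i j. A $ i $ j = A $ j $ i) \<Longrightarrow> transpose A = A"
  by (simp add: transpose_def vec_eq_iff)

lemma inc_smoothS:
  assumes m: "m \<in> smoothS"
  shows "inc m \<in> smoothS"
proof -
  have sm: "smooth m" and per: "periodic m" using m by (auto simp: smoothS_def)
  have s: "smooth (\<lambda>y. m y $ k $ l)" for k l by (intro smooth_vec_nth sm)
  have sym: "(\<lambda>y. m y $ k $ l) = (\<lambda>y. m y $ l $ k)" for k l using smoothS_nth_sym[OF m] by blast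
  have "inc m x $ i $ j = inc m x $ j $ i" for x i j
    unfolding inc_nth[OF sm]
    using pd_commute_real[OF s] sym
    by (simp add: algebra_simps)
  moreover have "periodic (\<lambda>x. transpose (mat_curl m x))"
    using periodic_mat_curl[OF per sm] by (auto simp: periodic_def)
  ultimately show ?thesis
    unfolding smoothS_def
    by (auto intro!: smooth_inc sm transpose_eqI)
       (simp add: inc_def periodic_mat_curl smooth_transpose smooth_mat_curl sm)
qed

lemma sym_grad_smoothS:
  assumes u: "u \<in> smoothV"
  shows "sym_grad u \<in> smoothS"
proof -
  have sm: "smooth u" and per: "periodic u" using u by (auto simp: smoothV_def)
  have s: "smooth (\<lambda>y. u y $ k)" for k by (intro smooth_vec_nth sm)
  have p: "periodic (\<lambda>y. u y $ k)" for k using per by (auto simp: periodic_def)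
  have "smooth (\<lambda>x. sym_grad u x $ i $ j)" for i j
    unfolding sym_grad_nth[OF sm]
    using smooth_scaleR[OF smooth_add[OF smooth_pd[OF s[of i], of j] smooth_pd[OF s[of j], of i]], of "1/2"] by simp
  then have "smooth (sym_grad u)" by (rule smooth_matI)
  moreover have "periodic (sym_grad u)"
    using periodic_pd[OF p s] by (auto simp: periodic_def vec_eq_iff sym_grad_nth[OF sm])
  ultimately show ?thesis by (auto simp: smoothS_def sym_grad_nth[OF sm] intro!: transpose_eqI)
qed

lemma mat_div_smoothV:
  assumes m: "m \<in> smoothS"
  shows "mat_div m \<in> smoothV"
proof -
  have sm: "smooth m" and per: "periodic m" using m by (auto simp: smoothS_def)
  have s: "smooth (\<lambda>y. m y $ k $ l)" for k l by (intro smooth_vec_nth sm)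
  have p: "periodic (\<lambda>y. m y $ k $ l)" for k l using per by (auto simp: periodic_def)
  have "smooth (\<lambda>x. mat_div m x $ i)" for i
    unfolding mat_div_nth[OF sm] by (intro smooth_sum smooth_pd s)
  then have "smooth (mat_div m)" by (rule smooth_vecI)
  moreover have "periodic (mat_div m)"
    using periodic_pd[OF p s] by (auto simp: periodic_def vec_eq_iff mat_div_nth[OF sm])
  ultimately show ?thesis by (auto simp: smoothV_def)
qed

section \<open>The incompatibility operator on a tetrahedron\<close>

definition form :: "(real ^ 3 \<Rightarrow> real ^ 3 ^ 3) \<Rightarrow> real ^ 3 \<Rightarrow> real ^ 3 \<Rightarrow> real ^ 3 \<Rightarrow> real" where
  "form v a b x = a \<bullet> (v x *v b)"

lemma form_nth: "form v a b x = (\<Sum>k\<in>UNIV. \<Sum>l\<in>UNIV. (a $ k * b $ l) * v x $ k $ l)"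
  by (simp add: form_def inner_vec_def matrix_vector_mult_def sum_distrib_left algebra_simps)

lemma smooth_form: "smooth v \<Longrightarrow> smooth (form v a b)"
proof -
  assume v: "smooth v"
  have "smooth (\<lambda>x. \<Sum>k\<in>UNIV. \<Sum>l\<in>UNIV. (a $ k * b $ l) * v x $ k $ l)"
    by (intro smooth_sum smooth_linear[OF bounded_linear_mult_right] smooth_vec_nth v)
  then show ?thesis by (simp add: form_nth[abs_def])
qed

lemma form_add_left: "form v (a + a') b = (\<lambda>x. form v a b x + form v a' b x)"
  and form_add_right: "form v a (b + b') = (\<lambda>x. form v a b x + form v a b' x)"
  and form_scaleR_left: "form v (c *\<^sub>R a) b = (\<lambda>x. c * form v a b x)"
  and form_scaleR_right: "form v a (c *\<^sub>R b) = (\<lambda>x. c * form v a b x)"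
  and form_minus_left: "form v (- a) b = (\<lambda>x. - form v a b x)"
  and form_minus_right: "form v a (- b) = (\<lambda>x. - form v a b x)"
  and form_diff_left: "form v (a - a') b = (\<lambda>x. form v a b x - form v a' b x)"
  and form_diff_right: "form v a (b - b') = (\<lambda>x. form v a b x - form v a b' x)"
  by (simp_all add: form_nth sum_3 fun_eq_iff algebra_simps)

lemmas form_bilinear = form_add_left form_add_right form_scaleR_left form_scaleR_right form_minus_left form_minus_right
  form_diff_left form_diff_right

lemma form_sym: "v \<in> smoothS \<Longrightarrow> form v a b = form v b a"
proof (intro ext)
  fix x assume v: "v \<in> smoothS"
  have "form v a b x = (\<Sum>k\<in>UNIV. \<Sum>l\<in>UNIV. (b $ k * a $ l) * v x $ k $ l)"
    unfolding form_nth by (subst sum.swap) (simp add: smoothS_nth_sym[OF v, of x] mult.commute[of "a $ _"])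
  then show "form v a b x = form v b a x" by (simp add: form_nth)
qed

definition dform :: "(real ^ 3 \<Rightarrow> real ^ 3 ^ 3) \<Rightarrow> real ^ 3 \<Rightarrow> real ^ 3 \<Rightarrow> real ^ 3 \<Rightarrow> real ^ 3 \<Rightarrow> real" where
  "dform v w a b x = dd w (form v a b) x"

lemma smooth_cmult: "smooth f \<Longrightarrow> smooth (\<lambda>x. c * f x :: real)"
  by (rule smooth_linear[OF bounded_linear_mult_right])

lemma dd_cmult: "smooth f \<Longrightarrow> dd w (\<lambda>x. c * f x :: real) x = c * dd w f x"
  by (rule dd_linear[OF bounded_linear_mult_right])

lemma dform_trilinear:
  assumes v: "smooth v"
  shows "dform v w (a + a') b x = dform v w a b x + dform v w a' b x"
    "dform v w a (b + b') x = dform v w a b x + dform v w a b' x"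
    "dform v (w + w') a b x = dform v w a b x + dform v w' a b x"
    "dform v w (a - a') b x = dform v w a b x - dform v w a' b x"
    "dform v w a (b - b') x = dform v w a b x - dform v w a b' x"
    "dform v (w - w') a b x = dform v w a b x - dform v w' a b x"
    "dform v w (c *\<^sub>R a) b x = c * dform v w a b x"
    "dform v w a (c *\<^sub>R b) x = c * dform v w a b x"
    "dform v (c *\<^sub>R w) a b x = c * dform v w a b x"
    "dform v w (- a) b x = - dform v w a b x"
    "dform v w a (- b) x = - dform v w a b x"
    "dform v (- w) a b x = - dform v w a b x"
  by (simp_all add: dform_def form_bilinear dd_add dd_diff dd_minus dd_cmult smooth_form v dd_vec_add dd_vec_diff dd_vec_minus dd_vec_scaleR)

lemma smooth_dform: "smooth v \<Longrightarrow> smooth (dform v w a b)"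
  unfolding dform_def[abs_def] by (intro smooth_dd smooth_form)

lemma dform_sym: "v \<in> smoothS \<Longrightarrow> dform v w a b x = dform v w b a x"
  unfolding dform_def by (simp add: form_sym[of v a b])

lemma dd_form_nth:
  assumes v: "smooth v"
  shows "dd w (form v a b) x = (\<Sum>j\<in>UNIV. \<Sum>k\<in>UNIV. \<Sum>l\<in>UNIV. (w $ j * a $ k * b $ l) * pd j (\<lambda>y. v y $ k $ l) x)"
proof -
  have s: "smooth (\<lambda>y. v y $ k $ l)" for k l by (intro smooth_vec_nth v)
  have "dd w (form v a b) x = (\<Sum>k\<in>UNIV. \<Sum>l\<in>UNIV. (a $ k * b $ l) * dd w (\<lambda>y. v y $ k $ l) x)"
    unfolding form_nth[abs_def] by (simp add: dd_sum smooth_sum smooth_cmult s dd_cmult)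
  also have "\<dots> = (\<Sum>j\<in>UNIV. \<Sum>k\<in>UNIV. \<Sum>l\<in>UNIV. (w $ j * a $ k * b $ l) * pd j (\<lambda>y. v y $ k $ l) x)"
    by (simp add: dd_def sum_3 algebra_simps)
  finally show ?thesis .
qed

lemma dd_dd_form_nth:
  assumes v: "smooth v"
  shows "dd p (dd w (form v a b)) x = (\<Sum>i\<in>UNIV. \<Sum>j\<in>UNIV. \<Sum>k\<in>UNIV. \<Sum>l\<in>UNIV. (p $ i * w $ j * a $ k * b $ l) * pd i (pd j (\<lambda>y. v y $ k $ l)) x)"
proof -
  have s: "smooth (pd j (\<lambda>y. v y $ k $ l))" for j k l by (intro smooth_pd smooth_vec_nth v)
  have "dd p (dd w (form v a b)) x = (\<Sum>j\<in>UNIV. \<Sum>k\<in>UNIV. \<Sum>l\<in>UNIV. (w $ j * a $ k * b $ l) * dd p (pd j (\<lambda>y. v y $ k $ l)) x)"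
    unfolding dd_form_nth[OF v, abs_def] by (simp add: dd_sum smooth_sum smooth_cmult s dd_cmult)
  also have "\<dots> = (\<Sum>i\<in>UNIV. \<Sum>j\<in>UNIV. \<Sum>k\<in>UNIV. \<Sum>l\<in>UNIV. (p $ i * w $ j * a $ k * b $ l) * pd i (pd j (\<lambda>y. v y $ k $ l)) x)"
    by (simp add: dd_def sum_3 algebra_simps)
  finally show ?thesis .
qed

text \<open>
  The polynomial identity behind \<open>inc_contravariant\<close>: \<open>P a b k l\<close> stands for the second derivative
  \<open>\<partial>\<^sub>a \<partial>\<^sub>b\<close> of the entry \<open>(k, l)\<close>, 
  and its symmetries are those of second derivatives and of the matrix.
\<close>

lemma inc_contravariant_entries:
  fixes P :: "3 \<Rightarrow> 3 \<Rightarrow> 3 \<Rightarrow> 3 \<Rightarrow> real" and p q r :: "real ^ 3"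
  assumes P1: "\<And>a b k l. P a b k l = P b a k l" and P2: "\<And>a b k l. P a b k l = P a b l k"
  defines "H \<equiv> \<lambda>p w a b. \<Sum>i\<in>UNIV. \<Sum>j\<in>UNIV. \<Sum>k\<in>UNIV. \<Sum>l\<in>UNIV. ((p::real^3) $ i * (w::real^3) $ j * (a::real^3) $ k * (b::real^3) $ l) * P i j k l"
  shows "(\<Sum>i\<in>UNIV. \<Sum>j\<in>UNIV. cross3 q r $ i * cross3 r p $ j *
     (P (j + 1) (i + 1) (j + 2) (i + 2) - P (j + 1) (i + 2) (j + 2) (i + 1)
       - P (j + 2) (i + 1) (j + 1) (i + 2) + P (j + 2) (i + 2) (j + 1) (i + 1)))
    = H r q p r + H r p q r - H r r p q - H p q r r"
proof -
  have [simp]: "(4::3) = 1" "(5::3) = 2" by simp_all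
  have P: "P 2 1 k l = P 1 2 k l" "P 3 1 k l = P 1 3 k l" "P 3 2 k l = P 2 3 k l"
      "P a b 2 1 = P a b 1 2" "P a b 3 1 = P a b 1 3" "P a b 3 2 = P a b 2 3" for a b k l
    using P1 P2 by blast+
  show ?thesis
    unfolding H_def sum_3 cross_components
    by (simp add: P algebra_simps)
qed

text \<open>
  Like the linearized curvature of a metric perturbation, \<open>inc v\<close> takes simple values on
  cross products: the two curls in \<open>inc\<close> become antisymmetrizations in \<open>(q, r)\<close> and \<open>(r, p)\<close>, and the
  result consists of second derivatives of \<open>v\<close> in which directions and arguments are all among \<open>p, q, r\<close>.
\<close>

lemma inc_contravariant:
  assumes v: "v \<in> smoothS"
  shows "cross3 q r \<bullet> (inc v x *v cross3 r p)
    = dd r (dform v q p r) x + dd r (dform v p q r) x - dd r (dform v r p q) x - dd p (dform v q r r) x"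
proof -
  have sm: "smooth v" by (rule smoothS_smooth[OF v])
  define P where "P a b k l = pd a (pd b (\<lambda>y. v y $ k $ l)) x" for a b k l
  have P1: "P a b k l = P b a k l" for a b k l
    unfolding P_def by (intro pd_commute_real smooth_vec_nth sm)
  have P2: "P a b k l = P a b l k" for a b k l
    unfolding P_def using smoothS_nth_sym[OF v] by simp
  have "cross3 q r \<bullet> (inc v x *v cross3 r p) = (\<Sum>i\<in>UNIV. \<Sum>j\<in>UNIV. cross3 q r $ i * cross3 r p $ j * inc v x $ i $ j)"
    using form_nth[of "inc v" "cross3 q r" "cross3 r p" x] by (simp add: form_def)
  then show ?thesis
    unfolding inc_nth[OF sm] dform_def[abs_def] dd_dd_form_nth[OF sm] P_def[symmetric] inc_contravariant_entries[of P q r p, OF P1 P2] .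
qed

definition edge_mean :: "real ^ 3 \<Rightarrow> real ^ 3 \<Rightarrow> (real ^ 3 \<Rightarrow> real ^ 3 ^ 3) \<Rightarrow> real" where
  "edge_mean a b v = mean1 a b (form v (b - a) (b - a))"

text \<open>
  Twice the linearized Christoffel symbol of the metric perturbation \<open>v\<close> for the sides \<open>a - o'\<close>,
  \<open>b - o'\<close> of a face and a third vector \<open>w\<close>. When \<open>w\<close> is normal to the face this is the linearized
  second fundamental form; when \<open>w\<close> is tangential it can be integrated once more.
\<close>

definition christoffel :: "real ^ 3 \<Rightarrow> real ^ 3 \<Rightarrow> real ^ 3 \<Rightarrow> (real ^ 3 \<Rightarrow> real ^ 3 ^ 3) \<Rightarrow> real ^ 3 \<Rightarrow> real ^ 3 \<Rightarrow> real" where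
  "christoffel o' a b v w x = dform v (b - o') (a - o') w x + dform v (a - o') (b - o') w x - dform v w (a - o') (b - o') x"

lemma smooth_christoffel: "smooth v \<Longrightarrow> smooth (christoffel p a b v w)"
  unfolding christoffel_def[abs_def] by (intro smooth_add smooth_diff smooth_dform)

lemma mean2_diff: "continuous_on UNIV f \<Longrightarrow> continuous_on UNIV g \<Longrightarrow> mean2 a b c (\<lambda>x. f x - g x) = mean2 a b c f - mean2 a b c g"
  using mean2_add[of f "\<lambda>x. (-1) * g x"] mean2_cmult[of a b c "-1" g] continuous_on_minus[of UNIV g] by simp

lemma mean3_diff: "continuous_on UNIV f \<Longrightarrow> continuous_on UNIV g \<Longrightarrow> mean3 a b c d (\<lambda>x. f x - g x) = mean3 a b c d f - mean3 a b c d g"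
  using mean3_add[of f "\<lambda>x. (-1) * g x"] mean3_cmult[of a b c d "-1" g] continuous_on_minus[of UNIV g] by simp

lemma edge_mean_swap: "edge_mean a b v = edge_mean b a v"
proof -
  have "form v (b - a) (b - a) = form v (a - b) (a - b)"
    using form_minus_left[of v "a - b" "b - a"] form_minus_right[of v "a - b" "a - b"] by simp
  then show ?thesis by (simp add: edge_mean_def mean1_swap[of a b])
qed

text \<open>
  By \<open>inc_contravariant\<close> the integrand is \<open>\<partial>\<^sub>r \<phi> - \<partial>\<^sub>p \<psi>\<close> with \<open>\<phi>\<close> a Christoffel symbol and
  \<open>\<psi> = \<partial>\<^sub>q (r \<bullet> v r)\<close>. Integrating along \<open>r\<close> and \<open>p\<close> leaves face means of \<open>\<phi>\<close> and \<open>\<psi>\<close>. On the face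
  opposite to \<open>z1\<close>, \<open>\<psi>\<close> integrates to edge means; on the face opposite to \<open>z0\<close> it combines with
  \<open>\<phi>\<close> to the Christoffel symbol of that face. Only the two faces containing \<open>[z1, z2]\<close> survive, and
  they enter symmetrically.
\<close>

lemma mean3_inc_parts:
  assumes v: "v \<in> smoothS" and vol: "vol6 z0 z1 z2 z3 \<noteq> 0"
  shows "mean3 z0 z1 z2 z3 (\<lambda>x. cross3 (z2 - z0) (z3 - z0) \<bullet> (inc v x *v cross3 (z3 - z0) (z1 - z0)))
    = - edge_mean z0 z3 v + mean1 z1 z2 (form v (z3 - z0) (z3 - z0))
      - mean2 z0 z1 z2 (christoffel z0 z1 z2 v (z3 - z0)) - mean2 z3 z1 z2 (christoffel z3 z1 z2 v (z0 - z3))"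
proof -
  have sm: "smooth v" by (rule smoothS_smooth[OF v])
  let ?p = "z1 - z0" and ?q = "z2 - z0" and ?r = "z3 - z0"
  let ?\<phi> = "christoffel z0 z1 z2 v ?r" and ?\<psi> = "dform v ?q ?r ?r" and ?V = "form v ?r ?r"
  note c = smooth_continuous_on[where S=UNIV]
  have s\<phi>: "smooth ?\<phi>" by (rule smooth_christoffel[OF sm])
  have s\<psi>: "smooth ?\<psi>" by (rule smooth_dform[OF sm])
  have sV: "smooth ?V" by (rule smooth_form[OF sm])
  have "(\<lambda>x. cross3 ?q ?r \<bullet> (inc v x *v cross3 ?r ?p)) = (\<lambda>x. dd ?r ?\<phi> x - dd ?p ?\<psi> x)"
    unfolding inc_contravariant[OF v] christoffel_def[abs_def]
    by (simp add: dd_add dd_diff smooth_add smooth_dform sm)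
  then have "mean3 z0 z1 z2 z3 (\<lambda>x. cross3 ?q ?r \<bullet> (inc v x *v cross3 ?r ?p))
      = mean3 z0 z1 z2 z3 (dd ?r ?\<phi>) - mean3 z0 z1 z2 z3 (dd ?p ?\<psi>)"
    by (simp add: mean3_diff c smooth_dd s\<phi> s\<psi>)
  also have "mean3 z0 z1 z2 z3 (dd ?r ?\<phi>) = mean3 z0 z3 z1 z2 (dd ?r ?\<phi>)" by (metis mean3_perm)
  also have "\<dots> = mean2 z3 z1 z2 ?\<phi> - mean2 z0 z1 z2 ?\<phi>"
    by (rule mean3_deriv[OF s\<phi>]) (metis vol vol6_perm)
  also have "mean3 z0 z1 z2 z3 (dd ?p ?\<psi>) = mean2 z1 z2 z3 ?\<psi> - mean2 z0 z2 z3 ?\<psi>"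
    by (rule mean3_deriv[OF s\<psi> vol])
  also have "mean2 z1 z2 z3 ?\<psi> = mean2 z3 z1 z2 ?\<psi>"
    by (metis mean2_swap12 mean2_swap23 c s\<psi>)
  also have "mean2 z0 z2 z3 ?\<psi> = mean1 z2 z3 ?V - edge_mean z0 z3 v"
    unfolding dform_def[abs_def] edge_mean_def by (rule mean2_deriv[OF sV])
  \<comment> \<open>The Christoffel symbol at \<open>z0\<close> is minus the one at \<open>z3\<close>, plus \<open>\<psi>\<close>, which cancels, plus
     a derivative along the side \<open>[z3, z1]\<close>.\<close>
  also have "mean2 z3 z1 z2 ?\<phi> = mean2 z3 z1 z2 ?\<psi> + mean2 z3 z1 z2 (\<lambda>x. dd (z1 - z3) ?V x - christoffel z3 z1 z2 v (z0 - z3) x)"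
  proof -
    have id: "dform v q p r x + dform v p q r x - dform v r p q x
        = dform v q r r x + (dform v (p - r) r r x - (dform v (q - r) (p - r) (- r) x + dform v (p - r) (q - r) (- r) x - dform v (- r) (p - r) (q - r) x))"
      for p q r x
      by (simp add: dform_trilinear[OF sm] dform_sym[OF v, of _ r p] dform_sym[OF v, of _ r q] dform_sym[OF v, of _ q p])
    have z: "z1 - z3 = ?p - ?r" "z2 - z3 = ?q - ?r" "z0 - z3 = - ?r" by simp_all
    have "?\<phi> = (\<lambda>x. ?\<psi> x + (dd (z1 - z3) ?V x - christoffel z3 z1 z2 v (z0 - z3) x))"
      unfolding christoffel_def z dform_def[symmetric] by (rule ext) (rule id)
    then show ?thesis
      by (subst mean2_add[symmetric]) (simp_all add: c s\<psi> continuous_on_diff smooth_dd sV smooth_christoffel sm)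
  qed
  also have "mean2 z3 z1 z2 (\<lambda>x. dd (z1 - z3) ?V x - christoffel z3 z1 z2 v (z0 - z3) x)
     = mean2 z3 z1 z2 (dd (z1 - z3) ?V) - mean2 z3 z1 z2 (christoffel z3 z1 z2 v (z0 - z3))"
    by (intro mean2_diff c smooth_dd sV smooth_christoffel sm)
  also have "mean2 z3 z1 z2 (dd (z1 - z3) ?V) = mean1 z1 z2 ?V - mean1 z3 z2 ?V"
    by (rule mean2_deriv[OF sV])
  finally show ?thesis by (simp add: mean1_swap[of z3 z2])
qed

text \<open>
  The tangential part of \<open>w\<close> contributes derivatives of \<open>v\<close> along sides of the face, since
  \<open>\<partial>\<^sub>B v(A,A) + \<partial>\<^sub>A v(B,A) - \<partial>\<^sub>A v(A,B) = \<partial>\<^sub>B v(A,A)\<close>; these integrate to edge means.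
\<close>

lemma face_tangential:
  assumes v: "v \<in> smoothS" and w: "w = N + \<alpha> *\<^sub>R (a - p) + \<beta> *\<^sub>R (b - p)"
  shows "mean2 p a b (christoffel p a b v w) = mean2 p a b (christoffel p a b v N)
     + \<alpha> * (mean1 a b (form v (a - p) (a - p)) - edge_mean p a v) + \<beta> * (mean1 a b (form v (b - p) (b - p)) - edge_mean p b v)"
proof -
  have sm: "smooth v" by (rule smoothS_smooth[OF v])
  note c = smooth_continuous_on[where S=UNIV]
  have eq: "christoffel p a b v w = (\<lambda>x. christoffel p a b v N x + (\<alpha> * dd (b - p) (form v (a - p) (a - p)) x + \<beta> * dd (a - p) (form v (b - p) (b - p)) x))"
  proof -
    have id: "dform v B A (N + \<alpha> *\<^sub>R A + \<beta> *\<^sub>R B) x + dform v A B (N + \<alpha> *\<^sub>R A + \<beta> *\<^sub>R B) x - dform v (N + \<alpha> *\<^sub>R A + \<beta> *\<^sub>R B) A B x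
       = dform v B A N x + dform v A B N x - dform v N A B x + (\<alpha> * dform v B A A x + \<beta> * dform v A B B x)" for A B x
      by (simp add: dform_trilinear[OF sm] dform_sym[OF v, of _ B A])
    show ?thesis unfolding w christoffel_def dform_def[symmetric] by (rule ext) (rule id)
  qed
  have s1: "smooth (dd (b - p) (form v (a - p) (a - p)))" and s2: "smooth (dd (a - p) (form v (b - p) (b - p)))"
    by (intro smooth_dd smooth_form sm)+
  have "mean2 p a b (christoffel p a b v w) = mean2 p a b (christoffel p a b v N)
       + (\<alpha> * mean2 p a b (dd (b - p) (form v (a - p) (a - p))) + \<beta> * mean2 p a b (dd (a - p) (form v (b - p) (b - p))))"
    unfolding eq by (simp add: mean2_add mean2_cmult c smooth_christoffel sm s1 s2 continuous_on_add continuous_on_mult_left)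
  also have "mean2 p a b (dd (b - p) (form v (a - p) (a - p))) = mean2 p b a (dd (b - p) (form v (a - p) (a - p)))"
    by (rule mean2_swap23[OF c[OF s1]])
  also have "\<dots> = mean1 b a (form v (a - p) (a - p)) - edge_mean p a v"
    unfolding edge_mean_def by (rule mean2_deriv[OF smooth_form[OF sm]])
  also have "mean2 p a b (dd (a - p) (form v (b - p) (b - p))) = mean1 a b (form v (b - p) (b - p)) - edge_mean p b v"
    unfolding edge_mean_def by (rule mean2_deriv[OF smooth_form[OF sm]])
  finally show ?thesis by (simp add: mean1_swap[of b a])
qed

definition perp :: "real ^ 3 \<Rightarrow> real ^ 3 \<Rightarrow> real ^ 3" where
  "perp t q = q - ((q \<bullet> t) / (t \<bullet> t)) *\<^sub>R t"

text \<open>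
  The contribution of the face \<open>[p, a, b]\<close> and its edge \<open>[a, b]\<close> for a normal vector \<open>N\<close>: the second
  fundamental form on the face, and on the edge the component of \<open>v\<close> between \<open>N\<close> and the
  direction in the face that is perpendicular to the edge.
\<close>

definition face_term :: "real ^ 3 \<Rightarrow> real ^ 3 \<Rightarrow> real ^ 3 \<Rightarrow> (real ^ 3 \<Rightarrow> real ^ 3 ^ 3) \<Rightarrow> real ^ 3 \<Rightarrow> real" where
  "face_term p a b v N = - mean2 p a b (christoffel p a b v N) - mean1 a b (form v (perp (b - a) (p - a)) N)"

lemma face_term_scale: "smooth v \<Longrightarrow> face_term p a b v (c *\<^sub>R N) = c * face_term p a b v N"
proof -
  assume sm: "smooth v"
  have "christoffel p a b v (c *\<^sub>R N) = (\<lambda>x. c * christoffel p a b v N x)"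
    by (simp add: christoffel_def fun_eq_iff dform_trilinear[OF sm] algebra_simps)
  then show ?thesis by (simp add: face_term_def mean2_cmult mean1_cmult form_scaleR_right algebra_simps)
qed

text \<open>
  All edge integrals over \<open>[a, b]\<close> that remain after \<open>mean3_inc_parts\<close> and \<open>face_tangential\<close>, at one
  point of the edge. Here \<open>q\<close> and \<open>r\<close> point from \<open>a\<close> to the other two vertices and \<open>t\<close> points to \<open>b\<close>.
  Splitting off the height vectors \<open>N\<close>, \<open>N'\<close> of the two faces leaves one term for each
  face and a multiple of \<open>v(t, t)\<close>, the density of the edge mean.
\<close>

lemma edge_identity:
  assumes V: "V \<in> smoothS"
    and N: "r = N + (1 - \<alpha> - \<beta>) *\<^sub>R q + \<beta> *\<^sub>R t" "N \<bullet> q = 0" "N \<bullet> t = 0"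
    and N': "q = N' + (1 - \<alpha>' - \<beta>') *\<^sub>R r + \<beta>' *\<^sub>R t" "N' \<bullet> r = 0" "N' \<bullet> t = 0"
    and t: "t \<noteq> 0"
  shows "form V (r - q) (r - q) x - \<alpha> * form V (- q) (- q) x - \<beta> * form V (t - q) (t - q) x
     - \<alpha>' * form V (- r) (- r) x - \<beta>' * form V (t - r) (t - r) x
     = - form V (perp t q) N x - form V (perp t r) N' x
       + (\<beta> * ((q \<bullet> t) / (t \<bullet> t)) + \<beta>' * ((r \<bullet> t) / (t \<bullet> t)) - \<beta> - \<beta>') * form V t t x"
proof -
  define B where "B a b = form V a b x" for a b
  have lin: "B (a + a') b = B a b + B a' b" "B a (b + b') = B a b + B a b'"
    "B (c *\<^sub>R a) b = c * B a b" "B a (c *\<^sub>R b) = c * B a b" "B (a - a') b = B a b - B a' b"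
    "B a (b - b') = B a b - B a b'" "B (- a) b = - B a b" "B a (- b) = - B a b"
    for a a' b b' c by (simp_all add: B_def form_bilinear)
  have sym: "B a b = B b a" for a b unfolding B_def using form_sym[OF V] by metis
  define qt where "qt = (q \<bullet> t) / (t \<bullet> t)"
  define rt where "rt = (r \<bullet> t) / (t \<bullet> t)"
  define \<gamma> where "\<gamma> = 1 - \<alpha> - \<beta>"
  define \<gamma>' where "\<gamma>' = 1 - \<alpha>' - \<beta>'"
  have tt: "t \<bullet> t \<noteq> 0" using t by simp
  have b: "\<beta> = rt - \<gamma> * qt"
  proof -
    have "r \<bullet> t = \<gamma> * (q \<bullet> t) + \<beta> * (t \<bullet> t)"
      by (subst N(1)) (simp add: inner_add_left N(3) \<gamma>_def)
    then show ?thesis using tt by (simp add: rt_def qt_def field_simps)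
  qed
  have b': "\<beta>' = qt - \<gamma>' * rt"
  proof -
    have "q \<bullet> t = \<gamma>' * (r \<bullet> t) + \<beta>' * (t \<bullet> t)"
      by (subst N'(1)) (simp add: inner_add_left N'(3) \<gamma>'_def)
    then show ?thesis using tt by (simp add: rt_def qt_def field_simps)
  qed
  have Ne: "N = r - \<gamma> *\<^sub>R q - \<beta> *\<^sub>R t" using N(1) by (simp add: \<gamma>_def algebra_simps)
  have Ne': "N' = q - \<gamma>' *\<^sub>R r - \<beta>' *\<^sub>R t" using N'(1) by (simp add: \<gamma>'_def algebra_simps)
  have a: "\<alpha> = 1 - \<gamma> - \<beta>" "\<alpha>' = 1 - \<gamma>' - \<beta>'" by (simp_all add: \<gamma>_def \<gamma>'_def)
  have p: "perp t q = q - qt *\<^sub>R t" "perp t r = r - rt *\<^sub>R t" by (simp_all add: perp_def qt_def rt_def)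
  have s: "B r q = B q r" "B t q = B q t" "B t r = B r t" using sym by blast+
  have "B (r - q) (r - q) - \<alpha> * B (- q) (- q) - \<beta> * B (t - q) (t - q)
     - \<alpha>' * B (- r) (- r) - \<beta>' * B (t - r) (t - r)
     = - B (perp t q) N - B (perp t r) N' + (\<beta> * qt + \<beta>' * rt - \<beta> - \<beta>') * B t t"
    unfolding p Ne Ne' a lin s unfolding b b' by algebra
  then show ?thesis unfolding B_def qt_def rt_def .
qed

section \<open>Barycentric gradients and the formula on one tetrahedron\<close>

definition tet :: "(real ^ 3) set \<Rightarrow> bool" where
  "tet T \<longleftrightarrow> card T = 4 \<and> \<not> affine_dependent T"

lemma tet_finite: "tet T \<Longrightarrow> finite T"
  unfolding tet_def by (metis card.infinite zero_neq_numeral)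

lemma tet_obtain:
  assumes "tet T" "z \<in> T"
  obtains b c d where "T = {z, b, c, d}" "distinct [z, b, c, d]"
proof -
  have "card (T - {z}) = 3" using assms tet_finite by (simp add: tet_def)
  then obtain b c d where "T - {z} = {b, c, d}" "b \<noteq> c" "b \<noteq> d" "c \<noteq> d"
    by (auto simp: card_3_iff)
  then show ?thesis using assms(2) by (intro that[of b c d]) auto
qed

lemma tet_distinct: "tet {a, b, c, d} \<Longrightarrow> distinct [a, b, c, d]"
  using card_distinct[of "[a, b, c, d]"] by (simp add: tet_def)

lemma tet_vol6: 
  assumes "tet {a, b, c, d}"
  shows "vol6 a b c d \<noteq> 0"
proof
  assume "vol6 a b c d = 0"
  then have "det (matrix (frame (b - a) (c - a) (d - a))) = 0"
    using det_frame[of "b - a" "c - a" "d - a"] by (simp add: vol6_def)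
  then have "\<not> inj (frame (b - a) (c - a) (d - a))"
    using det_nz_iff_inj[OF linear_frame] by blast
  then obtain y where y: "frame (b - a) (c - a) (d - a) y = 0" "y \<noteq> 0"
    using linear_injective_0[OF linear_frame] by blast
  have dist: "distinct [a, b, c, d]" by (rule tet_distinct[OF assms])
  define U where "U x = (if x = a then - (y$1 + y$2 + y$3) else if x = b then y$1 else if x = c then y$2 else y$3)" for x
  have U: "U a = - (y$1 + y$2 + y$3)" "U b = y$1" "U c = y$2" "U d = y$3"
    using dist by (auto simp: U_def)
  have "sum U {a, b, c, d} = 0" using dist by (simp add: U)
  moreover have "(\<Sum>v\<in>{a, b, c, d}. U v *\<^sub>R v) = frame (b - a) (c - a) (d - a) y"
    using dist by (simp add: U) (simp add: frame_def algebra_simps)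
  moreover have "\<exists>v\<in>{a, b, c, d}. U v \<noteq> 0"
  proof -
    have "y$1 \<noteq> 0 \<or> y$2 \<noteq> 0 \<or> y$3 \<noteq> 0" using y(2) by (auto simp: vec_eq_iff forall_3)
    then show ?thesis by (auto simp: U)
  qed
  ultimately have "affine_dependent {a, b, c, d}"
    using y(1) by (subst affine_dependent_explicit_finite) auto
  then show False using assms by (simp add: tet_def)
qed

text \<open>
  The increments along edges that characterize the gradient of the barycentric coordinate of \<open>z\<close>.
\<close>

definition is_bgrad :: "(real ^ 3) set \<Rightarrow> real ^ 3 \<Rightarrow> real ^ 3 \<Rightarrow> bool" where
  "is_bgrad T z g \<longleftrightarrow> (\<forall>x\<in>T. \<forall>y\<in>T. g \<bullet> (x - y) = of_bool (x = z) - of_bool (y = z))"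

definition bgrad :: "(real ^ 3) set \<Rightarrow> real ^ 3 \<Rightarrow> real ^ 3" where
  "bgrad T z = (THE g. is_bgrad T z g)"

lemma tet_affine_comb:
  assumes "tet T"
  obtains u where "sum u T = 1" "(\<Sum>z\<in>T. u z *\<^sub>R z) = x"
proof -
  have "affine hull T = UNIV"
    using assms by (intro affine_independent_span_eq) (auto simp: tet_def)
  then show ?thesis using that tet_finite[OF assms] by (auto simp: affine_hull_finite)
qed

lemma is_bgrad_comb:
  assumes T: "tet T" and g: "is_bgrad T z g" "z \<in> T" and u: "sum u T = 1"
  shows "g \<bullet> ((\<Sum>y\<in>T. u y *\<^sub>R y) - z) = u z - 1"
proof -
  have "(\<Sum>y\<in>T. u y *\<^sub>R y) - z = (\<Sum>y\<in>T. u y *\<^sub>R (y - z))"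
    using u by (simp add: scaleR_diff_right sum_subtractf flip: scaleR_sum_left)
  then have "g \<bullet> ((\<Sum>y\<in>T. u y *\<^sub>R y) - z) = (\<Sum>y\<in>T. u y * (of_bool (y = z) - 1))"
    using g by (simp add: inner_sum_right is_bgrad_def)
  also have "\<dots> = u z - 1"
    using u g(2) tet_finite[OF T]
    by (simp add: right_diff_distrib sum_subtractf of_bool_def if_distrib[of "(*) _"] sum.If_cases cong: if_cong)
  finally show ?thesis .
qed

lemma is_bgrad_unique:
  assumes T: "tet T" and z: "z \<in> T" and g: "is_bgrad T z g" "is_bgrad T z g'"
  shows "g = g'"
proof -
  have "g \<bullet> (x - z) = g' \<bullet> (x - z)" for x
  proof -
    obtain u where u: "sum u T = 1" "(\<Sum>z\<in>T. u z *\<^sub>R z) = x" using tet_affine_comb[OF T] by blast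
    show ?thesis
      using is_bgrad_comb[OF T g(1) z u(1)] is_bgrad_comb[OF T g(2) z u(1)] unfolding u(2) by simp
  qed
  from this[of "z + (g - g')"] have "(g - g') \<bullet> (g - g') = 0" by (simp add: inner_diff_left)
  then show ?thesis by simp
qed

lemma is_bgrad_cross:
  assumes T: "tet {z, a, b, c}"
  shows "is_bgrad {z, a, b, c} z ((1 / (cross3 (b - a) (c - a) \<bullet> (z - a))) *\<^sub>R cross3 (b - a) (c - a))"
proof -
  have "vol6 a b c z \<noteq> 0" using tet_vol6[of a b c z] T by (simp add: insert_commute)
  then have d: "cross3 (b - a) (c - a) \<bullet> (z - a) \<noteq> 0" by (simp add: vol6_def)
  let ?n = "cross3 (b - a) (c - a)"
  have n: "?n \<bullet> (b - a) = 0" "?n \<bullet> (c - a) = 0" by (simp_all add: dot_cross_self)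
  have e: "?n \<bullet> b = ?n \<bullet> a" "?n \<bullet> c = ?n \<bullet> a" using n by (simp_all add: inner_diff_right)
  have d': "?n \<bullet> z - ?n \<bullet> a \<noteq> 0" using d by (simp add: inner_diff_right)
  show ?thesis
    using tet_distinct[OF T] d' unfolding is_bgrad_def
    by (auto simp: inner_diff_right e divide_simps)
qed

lemma is_bgrad_bgrad: "tet T \<Longrightarrow> z \<in> T \<Longrightarrow> is_bgrad T z (bgrad T z)"
proof -
  assume T: "tet T" "z \<in> T"
  obtain a b c where "T = {z, a, b, c}" using tet_obtain[OF T] by metis
  then have "\<exists>g. is_bgrad T z g" using is_bgrad_cross T(1) by blast
  then show ?thesis unfolding bgrad_def using is_bgrad_unique[OF T] by (metis theI)
qed

lemma bgrad_diff: "tet T \<Longrightarrow> z \<in> T \<Longrightarrow> x \<in> T \<Longrightarrow> y \<in> T \<Longrightarrow> bgrad T z \<bullet> (x - y) = of_bool (x = z) - of_bool (y = z)"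
  using is_bgrad_bgrad unfolding is_bgrad_def by blast

lemma bgrad_unique: "tet T \<Longrightarrow> z \<in> T \<Longrightarrow> is_bgrad T z g \<Longrightarrow> bgrad T z = g"
  using is_bgrad_unique is_bgrad_bgrad by blast

lemma bgrad_cross:
  assumes "tet {z, a, b, c}"
  shows "bgrad {z, a, b, c} z = (1 / (cross3 (b - a) (c - a) \<bullet> (z - a))) *\<^sub>R cross3 (b - a) (c - a)"
  by (rule bgrad_unique[OF assms _ is_bgrad_cross[OF assms]]) simp

definition bary :: "(real ^ 3) set \<Rightarrow> real ^ 3 \<Rightarrow> real ^ 3 \<Rightarrow> real" where
  "bary T z x = 1 + bgrad T z \<bullet> (x - z)"

lemma bary_comb: "tet T \<Longrightarrow> z \<in> T \<Longrightarrow> sum u T = 1 \<Longrightarrow> bary T z (\<Sum>y\<in>T. u y *\<^sub>R y) = u z"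
  unfolding bary_def by (subst is_bgrad_comb) (auto intro: is_bgrad_bgrad)

lemma bary_sum: "tet T \<Longrightarrow> (\<Sum>z\<in>T. bary T z x) = 1"
  and bary_point: "tet T \<Longrightarrow> (\<Sum>z\<in>T. bary T z x *\<^sub>R z) = x"
proof -
  assume T: "tet T"
  obtain u where u: "sum u T = 1" "(\<Sum>z\<in>T. u z *\<^sub>R z) = x" using tet_affine_comb[OF T] by blast
  have "bary T z x = u z" if "z \<in> T" for z using bary_comb[OF T that u(1)] u(2) by simp
  then show "(\<Sum>z\<in>T. bary T z x) = 1" "(\<Sum>z\<in>T. bary T z x *\<^sub>R z) = x" using u by simp_all
qed

lemma bary_face_centroid:
  assumes T: "tet {j, a, b, c}" and d: "distinct [j, a, b, c]" and z: "z \<in> {j, a, b, c}"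
  shows "bary {j, a, b, c} z ((1/3) *\<^sub>R a + (1/3) *\<^sub>R b + (1/3) *\<^sub>R c) = (if z = j then 0 else 1/3)"
proof -
  define u where "u z = (if z = j then 0 else 1/3 :: real)" for z
  have "sum u {j, a, b, c} = 1"
    "(\<Sum>z\<in>{j, a, b, c}. u z *\<^sub>R z) = (1/3) *\<^sub>R a + (1/3) *\<^sub>R b + (1/3) *\<^sub>R c"
    using d by (auto simp: u_def)
  then have "bary {j, a, b, c} z ((1/3) *\<^sub>R a + (1/3) *\<^sub>R b + (1/3) *\<^sub>R c) = u z"
    using bary_comb[OF T z, of u] by simp
  then show ?thesis by (simp only: u_def)
qed

lemma bary_diff: "bary T z x - bary T z y = bgrad T z \<bullet> (x - y)"
  by (simp add: bary_def inner_diff_right)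

lemma bary_vertex: "tet T \<Longrightarrow> z \<in> T \<Longrightarrow> y \<in> T \<Longrightarrow> bary T z y = of_bool (y = z)"
  by (simp add: bary_def bgrad_diff)

text \<open>
  The identity matrix is the sum of the products of vertices and barycentric gradients. Together
  with \<open>bgrad_sum\<close> this resolves vectors and matrices into edge quantities.
\<close>

lemma bgrad_sum_scaleR: "tet T \<Longrightarrow> (\<Sum>z\<in>T. (bgrad T z \<bullet> w) *\<^sub>R z) = w"
proof -
  assume T: "tet T"
  have "(\<Sum>z\<in>T. (bgrad T z \<bullet> w) *\<^sub>R z) = (\<Sum>z\<in>T. bary T z w *\<^sub>R z) - (\<Sum>z\<in>T. bary T z 0 *\<^sub>R z)"
    by (simp add: sum_subtractf[symmetric] scaleR_diff_left[symmetric] bary_diff)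
  then show ?thesis by (simp add: bary_point[OF T])
qed

lemma bgrad_sum: "tet T \<Longrightarrow> (\<Sum>z\<in>T. bgrad T z) = 0"
proof -
  assume T: "tet T"
  have "(\<Sum>z\<in>T. bgrad T z) \<bullet> w = 0" for w
  proof -
    have "(\<Sum>z\<in>T. bgrad T z) \<bullet> w = (\<Sum>z\<in>T. bary T z w) - (\<Sum>z\<in>T. bary T z 0)"
      by (simp add: sum_subtractf[symmetric] bary_diff inner_sum_left)
    then show ?thesis by (simp add: bary_sum[OF T])
  qed
  then show ?thesis using inner_eq_zero_iff by blast
qed

lemma bgrad_eqI:
  assumes "tet T" "\<And>z. z \<in> T \<Longrightarrow> bgrad T z \<bullet> x = bgrad T z \<bullet> y"
  shows "x = y"
proof -
  have "(\<Sum>z\<in>T. (bgrad T z \<bullet> x) *\<^sub>R z) = (\<Sum>z\<in>T. (bgrad T z \<bullet> y) *\<^sub>R z)"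
    by (intro sum.cong refl) (simp add: assms(2))
  then show ?thesis by (simp only: bgrad_sum_scaleR[OF assms(1)])
qed

lemma bgrad_nonzero: "tet T \<Longrightarrow> z \<in> T \<Longrightarrow> bgrad T z \<noteq> 0"
proof
  assume a: "tet T" "z \<in> T" "bgrad T z = 0"
  obtain b c d where "T = {z, b, c, d}" "distinct [z, b, c, d]" using tet_obtain[OF a(1,2)] .
  then show False using bgrad_diff[OF a(1,2), of z b] a(3) by simp
qed

text \<open>
  Six times the volume, as a function of the vertex set. The normalization by the reference
  tetrahedron makes it agree with \<^const>\<open>vol6\<close> for every enumeration of the vertices.
\<close>

definition hull_vol6 :: "(real ^ 3) set \<Rightarrow> real" where
  "hull_vol6 T = integral (convex hull T) (\<lambda>_. 1) / integral Tet (\<lambda>_. 1)"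

lemma integral_Tet_nonzero: "integral Tet (\<lambda>_. 1::real) \<noteq> 0"
proof -
  have m: "Tet \<in> lmeasurable" by (rule lmeasurable_compact[OF compact_Tet])
  have "interior Tet \<noteq> {}" unfolding Tet_def using interior_std_simplex_nonempty by blast
  then have "\<not> negligible Tet"
    using open_not_negligible[OF open_interior] negligible_subset[OF _ interior_subset] by blast
  then show ?thesis using m negligible_iff_measure lmeasure_integral by metis
qed

lemma hull_vol6_eq: "hull_vol6 {a, b, c, d} = vol6 a b c d"
  unfolding hull_vol6_def using integral_hull_Tet[of "\<lambda>_. 1" a b c d] integral_Tet_nonzero by simp

lemma hull_vol6_pos: "tet T \<Longrightarrow> hull_vol6 T > 0"
proof -
  assume T: "tet T"
  then obtain a where "a \<in> T" by (metis tet_def card.empty ex_in_conv zero_neq_numeral)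
  then obtain b c d where "T = {a, b, c, d}" using tet_obtain[OF T] by metis
  then show ?thesis using tet_vol6 T hull_vol6_eq by (metis abs_ge_zero order_le_less vol6_def)
qed

text \<open>
  Volume times barycentric gradient is an area vector: its length depends only on the opposite
  face, its sign on the side of that face on which \<open>z\<close> lies.
\<close>

lemma hull_vol6_bgrad:
  assumes T: "tet {z, a, b, c}"
  shows "hull_vol6 {z, a, b, c} *\<^sub>R bgrad {z, a, b, c} z
     = sgn (cross3 (b - a) (c - a) \<bullet> (z - a)) *\<^sub>R cross3 (b - a) (c - a)"
proof -
  have "hull_vol6 {z, a, b, c} = \<bar>cross3 (b - a) (c - a) \<bullet> (z - a)\<bar>"
    using hull_vol6_eq[of a b c z] by (simp add: insert_commute vol6_def)
  moreover have "cross3 (b - a) (c - a) \<bullet> (z - a) \<noteq> 0"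
    using tet_vol6[of a b c z] T by (simp add: insert_commute vol6_def)
  ultimately show ?thesis unfolding bgrad_cross[OF T] by (simp add: sgn_if)
qed

text \<open>
  The barycentric coordinate at \<open>c\<close> of the orthogonal projection of the vertex \<open>j\<close> to the opposite
  face, see \<open>height_decomposition\<close>.
\<close>

definition foot :: "(real ^ 3) set \<Rightarrow> real ^ 3 \<Rightarrow> real ^ 3 \<Rightarrow> real" where
  "foot T c j = - (bgrad T c \<bullet> bgrad T j) / (bgrad T j \<bullet> bgrad T j)"

text \<open>
  The height vector of \<open>j\<close> over the face is the volume times the area vector divided by its squared length.
  Since \<^const>\<open>face_term\<close> is homogeneous in \<open>N\<close>, dividing by the squared area lets the area vector itself
  be used as the argument, which changes only its sign when the face is seen from the other side.
\<close>

definition face_flux :: "real ^ 3 \<Rightarrow> real ^ 3 \<Rightarrow> real ^ 3 \<Rightarrow> (real ^ 3 \<Rightarrow> real ^ 3 ^ 3) \<Rightarrow> real ^ 3 \<Rightarrow> real" where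
  "face_flux p a b v N = face_term p a b v N / (cross3 (a - p) (b - p) \<bullet> cross3 (a - p) (b - p))"

lemma height_decomposition:
  assumes T: "tet {p, a, b, j}"
  defines "g \<equiv> bgrad {p, a, b, j}"
  shows "j - p = (1 / (g j \<bullet> g j)) *\<^sub>R g j + foot {p, a, b, j} a j *\<^sub>R (a - p) + foot {p, a, b, j} b j *\<^sub>R (b - p)"
proof (rule bgrad_eqI[OF T], fold g_def)
  let ?T = "{p, a, b, j}"
  have d: "distinct [p, a, b, j]" by (rule tet_distinct[OF T])
  have nz: "g j \<bullet> g j \<noteq> 0" using bgrad_nonzero[OF T, of j] by (simp add: g_def)
  have pr: "foot ?T c j = - (g c \<bullet> g j) / (g j \<bullet> g j)" for c by (simp add: foot_def g_def)
  have "g p + (g a + (g b + g j)) = 0" using bgrad_sum[OF T] d by (simp add: g_def)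
  then have s: "g p = - (g a + (g b + g j))" by (rule eq_neg_iff_add_eq_0[THEN iffD2])
  have gd: "g z \<bullet> (x - y) = of_bool (x = z) - of_bool (y = z)" if "z \<in> ?T" "x \<in> ?T" "y \<in> ?T" for x y z
    unfolding g_def using bgrad_diff[OF T that] .
  have main: "g z \<bullet> (j - p) = g z \<bullet> ((1 / (g j \<bullet> g j)) *\<^sub>R g j + foot ?T a j *\<^sub>R (a - p) + foot ?T b j *\<^sub>R (b - p))"
    if "z \<in> {a, b, j}" for z
    unfolding inner_add_right inner_scaleR_right using that d nz by (auto simp: gd pr)
  fix z assume "z \<in> ?T"
  then consider "z = p" | "z \<in> {a, b, j}" by blast
  then show "g z \<bullet> (j - p) = g z \<bullet> ((1 / (g j \<bullet> g j)) *\<^sub>R g j + foot ?T a j *\<^sub>R (a - p) + foot ?T b j *\<^sub>R (b - p))"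
  proof cases
    case 1
    show ?thesis
      using main[of a] main[of b] main[of j] unfolding 1 s inner_minus_left inner_add_left by simp
  qed (rule main)
qed

text \<open>
  Up to normalization the gradients of \<open>a\<close> and \<open>b\<close> are cross products of edge vectors starting at
  \<open>p\<close>, so \<open>mean3_inc_parts\<close> applies; the two faces containing \<open>[a, b]\<close> are then split into height and
  tangential directions. The coefficient of the mean over \<open>[a, b]\<close> itself is left unspecified: it will
  multiply a product that is symmetric anyway. It has to be the same for all fields \<open>v\<close>.
\<close>

lemma integral_bgrad_inc:
  assumes T: "tet {p, a, b, j}"
  defines "T \<equiv> {p, a, b, j}"
  shows "\<exists>\<kappa>. \<forall>v\<in>smoothS. integral (convex hull T) (\<lambda>x. bgrad T a \<bullet> (inc v x *v bgrad T b))
     = (- edge_mean p j v + foot T a j * edge_mean p a v + foot T b j * edge_mean p b v + foot T a p * edge_mean j a v + foot T b p * edge_mean j b v) / hull_vol6 T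
       + \<kappa> * edge_mean a b v + face_flux p a b v (hull_vol6 T *\<^sub>R bgrad T j) + face_flux j a b v (hull_vol6 T *\<^sub>R bgrad T p)"
proof -
  note T' = T[folded T_def]
  have d: "distinct [p, a, b, j]" by (rule tet_distinct[OF T])
  have d': "a \<noteq> p" "b \<noteq> p" "j \<noteq> p" "b \<noteq> a" "j \<noteq> a" "j \<noteq> b" using d by auto
  have vol: "vol6 p a b j \<noteq> 0" by (rule tet_vol6[OF T])
  have hull_vol6: "hull_vol6 T = vol6 p a b j" unfolding T_def by (rule hull_vol6_eq)
  define \<delta> where "\<delta> = cross3 (a - p) (b - p) \<bullet> (j - p)"
  have v\<delta>: "vol6 p a b j = \<bar>\<delta>\<bar>" by (simp add: vol6_def \<delta>_def)
  have \<delta>0: "\<delta> \<noteq> 0" using vol v\<delta> by simp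
  have T1: "{a, p, b, j} = T" "{b, p, j, a} = T" "{j, a, b, p} = T" "{j, p, a, b} = T" "{p, j, a, b} = T" "{j, a, b, p} = T"
    by (auto simp: T_def)
  have d1: "cross3 (b - p) (j - p) \<bullet> (a - p) = \<delta>" "cross3 (j - p) (a - p) \<bullet> (b - p) = \<delta>"
    unfolding \<delta>_def by (simp_all add: cross3_simps)
  have ga: "bgrad T a = (1 / \<delta>) *\<^sub>R cross3 (b - p) (j - p)"
    using bgrad_cross[of a p b j] T' by (simp add: T1 d1)
  have gB: "bgrad T b = (1 / \<delta>) *\<^sub>R cross3 (j - p) (a - p)"
    using bgrad_cross[of b p j a] T' by (simp add: T1 d1)
  define q where "q = p - a"
  define r where "r = j - a"
  define t where "t = b - a"
  \<comment> \<open>The height vectors over the faces \<open>[p, a, b]\<close> and \<open>[j, a, b]\<close>.\<close>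
  define N where "N = (1 / (bgrad T j \<bullet> bgrad T j)) *\<^sub>R bgrad T j"
  define N' where "N' = (1 / (bgrad T p \<bullet> bgrad T p)) *\<^sub>R bgrad T p"
  define \<kappa> where "\<kappa> = foot T b j * ((q \<bullet> t) / (t \<bullet> t)) + foot T b p * ((r \<bullet> t) / (t \<bullet> t)) - foot T b j - foot T b p"
  have hd: "j - p = N + foot T a j *\<^sub>R (a - p) + foot T b j *\<^sub>R (b - p)"
    using height_decomposition[OF T] by (simp add: N_def T_def)
  have hd': "p - j = N' + foot T a p *\<^sub>R (a - j) + foot T b p *\<^sub>R (b - j)"
    using height_decomposition[of j a b p] T' by (simp add: N'_def T1)
  have orth: "bgrad T j \<bullet> (p - a) = 0" "bgrad T j \<bullet> (b - a) = 0" "bgrad T p \<bullet> (j - a) = 0" "bgrad T p \<bullet> (b - a) = 0"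
    using d d' bgrad_diff[OF T', of j p a] bgrad_diff[OF T', of j b a] bgrad_diff[OF T', of p j a] bgrad_diff[OF T', of p b a]
    by (simp_all add: T_def)
  have scaleN: "face_flux p a b v (hull_vol6 T *\<^sub>R bgrad T j) = face_term p a b v N / hull_vol6 T" if "smooth v" for v
  proof -
    let ?c = "cross3 (a - p) (b - p)"
    have e: "hull_vol6 T *\<^sub>R bgrad T j = sgn (?c \<bullet> (j - p)) *\<^sub>R ?c"
      using hull_vol6_bgrad[of j p a b] T' by (simp add: T1)
    have "(hull_vol6 T *\<^sub>R bgrad T j) \<bullet> (hull_vol6 T *\<^sub>R bgrad T j) = ?c \<bullet> ?c"
      unfolding e using \<delta>0 by (simp add: \<delta>_def sgn_if)
    then have c: "?c \<bullet> ?c = hull_vol6 T * hull_vol6 T * (bgrad T j \<bullet> bgrad T j)" by simp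
    show ?thesis
      unfolding face_flux_def c N_def face_term_scale[OF that] using hull_vol6_pos[OF T'] by (simp add: field_simps)
  qed
  have scaleN': "face_flux j a b v (hull_vol6 T *\<^sub>R bgrad T p) = face_term j a b v N' / hull_vol6 T" if "smooth v" for v
  proof -
    let ?c = "cross3 (a - j) (b - j)"
    have e: "hull_vol6 T *\<^sub>R bgrad T p = sgn (?c \<bullet> (p - j)) *\<^sub>R ?c"
      using hull_vol6_bgrad[of p j a b] T' by (simp add: T1)
    have "?c \<bullet> (p - j) \<noteq> 0" using tet_vol6[of j a b p] T' by (simp add: T1 vol6_def)
    then have "(hull_vol6 T *\<^sub>R bgrad T p) \<bullet> (hull_vol6 T *\<^sub>R bgrad T p) = ?c \<bullet> ?c"
      unfolding e by (simp add: sgn_if)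
    then have c: "?c \<bullet> ?c = hull_vol6 T * hull_vol6 T * (bgrad T p \<bullet> bgrad T p)" by simp
    show ?thesis
      unfolding face_flux_def c N'_def face_term_scale[OF that] using hull_vol6_pos[OF T'] by (simp add: field_simps)
  qed
  have "integral (convex hull T) (\<lambda>x. bgrad T a \<bullet> (inc v x *v bgrad T b))
     = (- edge_mean p j v + foot T a j * edge_mean p a v + foot T b j * edge_mean p b v + foot T a p * edge_mean j a v + foot T b p * edge_mean j b v) / hull_vol6 T
       + (\<kappa> / hull_vol6 T) * edge_mean a b v + face_flux p a b v (hull_vol6 T *\<^sub>R bgrad T j) + face_flux j a b v (hull_vol6 T *\<^sub>R bgrad T p)"
    if v: "v \<in> smoothS" for v
  proof -
    have sm: "smooth v" by (rule smoothS_smooth[OF v])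
    let ?f = "\<lambda>x. cross3 (b - p) (j - p) \<bullet> (inc v x *v cross3 (j - p) (a - p))"
    have "(\<lambda>x. bgrad T a \<bullet> (inc v x *v bgrad T b)) = (\<lambda>x. (1 / (\<delta> * \<delta>)) * ?f x)"
      unfolding ga gB by (simp add: matrix_vector_mult_scaleR)
    then have "integral (convex hull T) (\<lambda>x. bgrad T a \<bullet> (inc v x *v bgrad T b))
       = (1 / (\<delta> * \<delta>)) * integral (convex hull {p, a, b, j}) ?f" by (simp add: T_def)
    also have "\<dots> = mean3 p a b j ?f / hull_vol6 T"
    proof -
      have "1 / (\<delta> * \<delta>) * (\<bar>\<delta>\<bar> * I) = I / \<bar>\<delta>\<bar>" for I using \<delta>0 by (simp add: abs_if)
      then show ?thesis by (simp add: integral_hull_mean3[OF vol] hull_vol6 v\<delta>)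
    qed
    also have "mean3 p a b j ?f = - edge_mean p j v + mean1 a b (form v (j - p) (j - p))
      - mean2 p a b (christoffel p a b v (j - p)) - mean2 j a b (christoffel j a b v (p - j))"
      by (rule mean3_inc_parts[OF v vol])
    also have "mean2 p a b (christoffel p a b v (j - p)) = mean2 p a b (christoffel p a b v N)
       + foot T a j * (mean1 a b (form v (a - p) (a - p)) - edge_mean p a v) + foot T b j * (mean1 a b (form v (b - p) (b - p)) - edge_mean p b v)"
      by (rule face_tangential[OF v hd])
    also have "mean2 j a b (christoffel j a b v (p - j)) = mean2 j a b (christoffel j a b v N')
       + foot T a p * (mean1 a b (form v (a - j) (a - j)) - edge_mean j a v) + foot T b p * (mean1 a b (form v (b - j) (b - j)) - edge_mean j b v)"
      by (rule face_tangential[OF v hd'])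
    finally have A0: "integral (convex hull T) (\<lambda>x. bgrad T a \<bullet> (inc v x *v bgrad T b)) =
       (- edge_mean p j v + mean1 a b (form v (j - p) (j - p))
        - (mean2 p a b (christoffel p a b v N) + foot T a j * (mean1 a b (form v (a - p) (a - p)) - edge_mean p a v) + foot T b j * (mean1 a b (form v (b - p) (b - p)) - edge_mean p b v))
        - (mean2 j a b (christoffel j a b v N') + foot T a p * (mean1 a b (form v (a - j) (a - j)) - edge_mean j a v) + foot T b p * (mean1 a b (form v (b - j) (b - j)) - edge_mean j b v))) / hull_vol6 T" .
    have A: "integral (convex hull T) (\<lambda>x. bgrad T a \<bullet> (inc v x *v bgrad T b)) =
       ((- edge_mean p j v + foot T a j * edge_mean p a v + foot T b j * edge_mean p b v + foot T a p * edge_mean j a v + foot T b p * edge_mean j b v)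
       + (mean1 a b (form v (j - p) (j - p)) - foot T a j * mean1 a b (form v (a - p) (a - p)) - foot T b j * mean1 a b (form v (b - p) (b - p))
          - foot T a p * mean1 a b (form v (a - j) (a - j)) - foot T b p * mean1 a b (form v (b - j) (b - j)))
       - mean2 p a b (christoffel p a b v N) - mean2 j a b (christoffel j a b v N')) / hull_vol6 T"
      unfolding A0 by (rule arg_cong[where f="\<lambda>z. z / hull_vol6 T"]) (simp add: algebra_simps)
    have "mean1 a b (form v (j - p) (j - p)) - foot T a j * mean1 a b (form v (a - p) (a - p)) - foot T b j * mean1 a b (form v (b - p) (b - p))
          - foot T a p * mean1 a b (form v (a - j) (a - j)) - foot T b p * mean1 a b (form v (b - j) (b - j))
        = - mean1 a b (form v (perp (b - a) (p - a)) N) - mean1 a b (form v (perp (b - a) (j - a)) N') + \<kappa> * edge_mean a b v"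
    proof -
      have r1: "r = N + (1 - foot T a j - foot T b j) *\<^sub>R q + foot T b j *\<^sub>R t"
      proof -
        have "r = (N + foot T a j *\<^sub>R (- q) + foot T b j *\<^sub>R (t - q)) + q"
          by (simp add: r_def q_def t_def hd[symmetric])
        then show ?thesis by (simp add: algebra_simps)
      qed
      have r2: "q = N' + (1 - foot T a p - foot T b p) *\<^sub>R r + foot T b p *\<^sub>R t"
      proof -
        have "q = (N' + foot T a p *\<^sub>R (- r) + foot T b p *\<^sub>R (t - r)) + r"
          by (simp add: r_def q_def t_def hd'[symmetric])
        then show ?thesis by (simp add: algebra_simps)
      qed
      have vec: "j - p = r - q" "a - p = - q" "b - p = t - q" "a - j = - r" "b - j = t - r" "b - a = t" "p - a = q" "j - a = r"
        by (simp_all add: r_def q_def t_def)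
      have t0: "t \<noteq> 0" using d' by (simp add: t_def)
      have or: "N \<bullet> q = 0" "N \<bullet> t = 0" "N' \<bullet> r = 0" "N' \<bullet> t = 0"
        using orth by (simp_all add: N_def N'_def q_def r_def t_def)
      have pt: "form v (r - q) (r - q) x - foot T a j * form v (- q) (- q) x - foot T b j * form v (t - q) (t - q) x
           - foot T a p * form v (- r) (- r) x - foot T b p * form v (t - r) (t - r) x
          = - form v (perp t q) N x - form v (perp t r) N' x + \<kappa> * form v t t x" for x
        unfolding \<kappa>_def by (rule edge_identity[OF v r1 or(1,2) r2 or(3,4) t0])
      have c: "continuous_on UNIV (form v x y)" for x y by (intro smooth_continuous_on smooth_form sm)
      have mean1_lin: "mean1 a b (\<lambda>x. f x - g x) = mean1 a b f - mean1 a b g" if "continuous_on UNIV f" "continuous_on UNIV g" for f g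
        using mean1_add[of f "\<lambda>x. (-1) * g x" a b] mean1_cmult[of a b "-1" g] that continuous_on_minus[of UNIV g] by simp
      have mean1_neg: "mean1 a b (\<lambda>x. - f x) = - mean1 a b f" for f using mean1_cmult[of a b "-1" f] by simp
      have "mean1 a b (\<lambda>x. form v (r - q) (r - q) x - foot T a j * form v (- q) (- q) x - foot T b j * form v (t - q) (t - q) x
           - foot T a p * form v (- r) (- r) x - foot T b p * form v (t - r) (t - r) x)
        = mean1 a b (\<lambda>x. - form v (perp t q) N x - form v (perp t r) N' x + \<kappa> * form v t t x)"
        by (intro arg_cong[where f="mean1 a b"] ext pt)
      then show ?thesis unfolding vec edge_mean_def
        by (simp add: mean1_lin mean1_add mean1_cmult mean1_neg c continuous_on_diff continuous_on_mult_left continuous_on_minus)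
    qed
    then show ?thesis
      unfolding A scaleN[OF sm] scaleN'[OF sm] face_term_def by (simp add: add_divide_distrib diff_divide_distrib)
  qed
  then show ?thesis by blast
qed

section \<open>Summation over the edges of a tetrahedron\<close>

text \<open>
  Sums over ordered vertices make the permutations behind the symmetry of \<open>local_form\<close> mere
  reindexings.
\<close>

definition enum4 :: "'a set \<Rightarrow> ('a \<times> 'a \<times> 'a \<times> 'a) set" where
  "enum4 T = Sigma T (\<lambda>a. Sigma (T - {a}) (\<lambda>b. Sigma (T - {a, b}) (\<lambda>c. T - {a, b, c})))"

definition enum3 :: "'a set \<Rightarrow> ('a \<times> 'a \<times> 'a) set" where
  "enum3 F = Sigma F (\<lambda>a. Sigma (F - {a}) (\<lambda>b. F - {a, b}))"

lemma mem_enum4: "(a, b, c, d) \<in> enum4 T \<longleftrightarrow> {a, b, c, d} \<subseteq> T \<and> distinct [a, b, c, d]"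
  by (auto simp: enum4_def)

lemma mem_enum3: "(a, b, c) \<in> enum3 F \<longleftrightarrow> {a, b, c} \<subseteq> F \<and> distinct [a, b, c]"
  by (auto simp: enum3_def)

lemma enum4_tet: "card T = 4 \<Longrightarrow> (a, b, c, d) \<in> enum4 T \<longleftrightarrow> T = {a, b, c, d} \<and> distinct [a, b, c, d]"
proof -
  assume T: "card T = 4"
  then have "finite T" by (metis card.infinite zero_neq_numeral)
  then have "T = {a, b, c, d}" if "{a, b, c, d} \<subseteq> T" "distinct [a, b, c, d]"
    using card_subset_eq[OF _ that(1)] T distinct_card[OF that(2)] by simp
  then show ?thesis unfolding mem_enum4 by blast
qed

lemma sum_enum4_swap_34: "(\<Sum>(a, b, p, j)\<in>enum4 T. f a b p j) = (\<Sum>(a, b, p, j)\<in>enum4 T. f a b j p)"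
  by (rule sum.reindex_bij_witness[where i="\<lambda>(a, b, p, j). (a, b, j, p)" and j="\<lambda>(a, b, p, j). (a, b, j, p)"])
     (auto simp: mem_enum4)

lemma sum_enum4_swap_23: "(\<Sum>(a, b, p, j)\<in>enum4 T. f a b p j) = (\<Sum>(a, b, p, j)\<in>enum4 T. f a p b j)"
  by (rule sum.reindex_bij_witness[where i="\<lambda>(a, b, p, j). (a, p, b, j)" and j="\<lambda>(a, b, p, j). (a, p, b, j)"])
     (auto simp: mem_enum4)

lemma sum_enum4_swap_13: "(\<Sum>(a, b, p, j)\<in>enum4 T. f a b p j) = (\<Sum>(a, b, p, j)\<in>enum4 T. f p b a j)"
  by (rule sum.reindex_bij_witness[where i="\<lambda>(a, b, p, j). (p, b, a, j)" and j="\<lambda>(a, b, p, j). (p, b, a, j)"])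
     (auto simp: mem_enum4)

lemma sum_enum4_swap_pairs: "(\<Sum>(a, b, p, j)\<in>enum4 T. f a b p j) = (\<Sum>(a, b, p, j)\<in>enum4 T. f p j a b)"
  by (rule sum.reindex_bij_witness[where i="\<lambda>(a, b, p, j). (p, j, a, b)" and j="\<lambda>(a, b, p, j). (p, j, a, b)"])
     (auto simp: mem_enum4)

lemma sum_enum4_faces:
  assumes "finite T"
  shows "(\<Sum>(a, b, p, j)\<in>enum4 T. f a b p j) = (\<Sum>j\<in>T. \<Sum>(a, b, p)\<in>enum3 (T - {j}). f a b p j)"
proof -
  have fin: "finite (enum3 (T - {j}))" for j
    unfolding enum3_def using assms by (intro finite_SigmaI) auto
  have "(\<Sum>(a, b, p, j)\<in>enum4 T. f a b p j) = (\<Sum>(j, a, b, p)\<in>Sigma T (\<lambda>j. enum3 (T - {j})). f a b p j)"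
    by (rule sum.reindex_bij_witness[where i="\<lambda>(j, a, b, p). (a, b, p, j)" and j="\<lambda>(a, b, p, j). (j, a, b, p)"])
       (auto simp: mem_enum4 mem_enum3)
  also have "\<dots> = (\<Sum>j\<in>T. \<Sum>(a, b, p)\<in>enum3 (T - {j}). f a b p j)"
    using assms fin by (subst sum.Sigma) (auto simp: case_prod_unfold)
  finally show ?thesis .
qed

lemma sum_enum4_pairs:
  fixes f :: "'a \<Rightarrow> 'a \<Rightarrow> real"
  assumes T: "card T = 4" and f: "\<And>a. f a a = 0"
  shows "(\<Sum>a\<in>T. \<Sum>b\<in>T. f a b) = (1/2) * (\<Sum>(a, b, p, j)\<in>enum4 T. f a b)"
proof -
  have fin: "finite T" using T by (metis card.infinite zero_neq_numeral)
  have "(\<Sum>(a, b, p, j)\<in>enum4 T. f a b) = (\<Sum>a\<in>T. \<Sum>b\<in>T-{a}. \<Sum>p\<in>T-{a,b}. \<Sum>j\<in>T-{a,b,p}. f a b)"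
  proof -
    have "(\<Sum>(a, b, p, j)\<in>enum4 T. f a b) = (\<Sum>a\<in>T. \<Sum>(b, p, j)\<in>Sigma (T - {a}) (\<lambda>b. Sigma (T - {a, b}) (\<lambda>c. T - {a, b, c})). f a b)"
      unfolding enum4_def using fin by (subst sum.Sigma) auto
    also have "\<dots> = (\<Sum>a\<in>T. \<Sum>b\<in>T-{a}. \<Sum>(p, j)\<in>Sigma (T - {a, b}) (\<lambda>c. T - {a, b, c}). f a b)"
      using fin by (intro sum.cong refl, subst sum.Sigma) auto
    also have "\<dots> = (\<Sum>a\<in>T. \<Sum>b\<in>T-{a}. \<Sum>p\<in>T-{a,b}. \<Sum>j\<in>T-{a,b,p}. f a b)"
      using fin by (intro sum.cong[OF refl], subst sum.Sigma) auto
    finally show ?thesis .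
  qed
  also have "\<dots> = (\<Sum>a\<in>T. \<Sum>b\<in>T-{a}. 2 * f a b)"
  proof (intro sum.cong refl)
    fix a b assume a: "a \<in> T" and b: "b \<in> T - {a}"
    have "(\<Sum>p\<in>T-{a,b}. \<Sum>j\<in>T-{a,b,p}. f a b) = (\<Sum>p\<in>T-{a,b}. f a b)"
    proof (intro sum.cong refl)
      fix p assume p: "p \<in> T - {a, b}"
      have "card (T - {a,b,p}) = 1" using a b p fin T by (subst card_Diff_subset) auto
      then show "(\<Sum>j\<in>T-{a,b,p}. f a b) = f a b" by simp
    qed
    also have "card (T - {a,b}) = 2" using a b fin T by (subst card_Diff_subset) auto
    then have "(\<Sum>p\<in>T-{a,b}. f a b) = 2 * f a b" by simp
    finally show "(\<Sum>p\<in>T-{a,b}. \<Sum>j\<in>T-{a,b,p}. f a b) = 2 * f a b" .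
  qed
  also have "\<dots> = (\<Sum>a\<in>T. 2 * (\<Sum>b\<in>T. f a b))"
    using fin f by (intro sum.cong refl) (simp add: sum_distrib_left[symmetric] sum_diff1)
  finally show ?thesis by (simp add: sum_distrib_left[symmetric])
qed

text \<open>
  The matrix \<open>M\<close> is \<open>- 1/2\<close> times the sum of \<open>(a - b) \<bullet> M (a - b)\<close> times the product of the
  gradients at \<open>a\<close> and \<open>b\<close>. Expanding the quadratic form, the square terms vanish because the
  gradients add up to zero, and the mixed terms give \<open>M\<close> by the resolution of the identity.
\<close>

lemma mat_inner_expand:
  fixes M W :: "real ^ 3 ^ 3"
  assumes T: "tet T" and M: "transpose M = M"
  shows "M \<bullet> W = - (1/2) * (\<Sum>a\<in>T. \<Sum>b\<in>T. ((a - b) \<bullet> (M *v (a - b))) * (bgrad T a \<bullet> (W *v bgrad T b)))"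
proof -
  define w where "w a b = bgrad T a \<bullet> (W *v bgrad T b)" for a b
  have comp: "(\<Sum>b\<in>T. (bgrad T b \<bullet> y) * b $ j) = y $ j" for y j
    using arg_cong[OF bgrad_sum_scaleR[OF T, of y], of "\<lambda>z. z $ j"] by (simp add: sum_component)
  have w1: "(\<Sum>b\<in>T. w a b * b $ j) = bgrad T a \<bullet> column j W" for a j
  proof -
    have "(\<Sum>b\<in>T. w a b * b $ j) = (\<Sum>b\<in>T. (bgrad T b \<bullet> (transpose W *v bgrad T a)) * b $ j)"
      unfolding w_def by (intro sum.cong refl) (metis dot_lmul_matrix inner_commute transpose_matrix_vector)
    also have "\<dots> = bgrad T a \<bullet> column j W"
      unfolding comp by (simp add: matrix_vector_mult_def inner_vec_def column_def transpose_def mult.commute)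
    finally show ?thesis .
  qed
  have w2: "(\<Sum>a\<in>T. \<Sum>b\<in>T. w a b * (a $ i * b $ j)) = W $ i $ j" for i j
  proof -
    have "(\<Sum>a\<in>T. \<Sum>b\<in>T. w a b * (a $ i * b $ j)) = (\<Sum>a\<in>T. (bgrad T a \<bullet> column j W) * a $ i)"
      unfolding w1[symmetric] by (simp add: sum_distrib_left sum_distrib_right algebra_simps)
    then show ?thesis unfolding comp by (simp add: column_def)
  qed
  have wb: "(\<Sum>b\<in>T. w a b) = 0" for a
  proof -
    have "(\<Sum>b\<in>T. w a b) = bgrad T a \<bullet> (W *v (\<Sum>b\<in>T. bgrad T b))"
      by (simp add: w_def inner_sum_right[symmetric] linear_sum[OF matrix_vector_mul_linear])
    then show ?thesis by (simp add: bgrad_sum[OF T])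
  qed
  have wa: "(\<Sum>a\<in>T. w a b) = 0" for b
    by (simp add: w_def inner_sum_left[symmetric] bgrad_sum[OF T])
  have MW: "(\<Sum>a\<in>T. \<Sum>b\<in>T. w a b * (a \<bullet> (M *v b))) = M \<bullet> W"
  proof -
    have "(\<Sum>a\<in>T. \<Sum>b\<in>T. w a b * (a \<bullet> (M *v b)))
        = (\<Sum>a\<in>T. \<Sum>b\<in>T. \<Sum>i\<in>UNIV. \<Sum>j\<in>UNIV. M $ i $ j * (w a b * (a $ i * b $ j)))"
      by (simp add: inner_vec_def matrix_vector_mult_def sum_distrib_left algebra_simps)
    also have "\<dots> = (\<Sum>a\<in>T. \<Sum>i\<in>UNIV. \<Sum>b\<in>T. \<Sum>j\<in>UNIV. M $ i $ j * (w a b * (a $ i * b $ j)))"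
      by (intro sum.cong[OF refl] sum.swap)
    also have "\<dots> = (\<Sum>i\<in>UNIV. \<Sum>a\<in>T. \<Sum>b\<in>T. \<Sum>j\<in>UNIV. M $ i $ j * (w a b * (a $ i * b $ j)))"
      by (rule sum.swap)
    also have "\<dots> = (\<Sum>i\<in>UNIV. \<Sum>a\<in>T. \<Sum>j\<in>UNIV. \<Sum>b\<in>T. M $ i $ j * (w a b * (a $ i * b $ j)))"
      by (rule sum.cong[OF refl], rule sum.cong[OF refl], rule sum.swap)
    also have "\<dots> = (\<Sum>i\<in>UNIV. \<Sum>j\<in>UNIV. \<Sum>a\<in>T. \<Sum>b\<in>T. M $ i $ j * (w a b * (a $ i * b $ j)))"
      by (rule sum.cong[OF refl], rule sum.swap)
    also have "\<dots> = (\<Sum>i\<in>UNIV. \<Sum>j\<in>UNIV. M $ i $ j * W $ i $ j)"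
      by (simp only: sum_distrib_left[symmetric] w2)
    finally show ?thesis by (simp add: inner_vec_def)
  qed
  have sym: "a \<bullet> (M *v b) = b \<bullet> (M *v a)" for a b
    by (metis M dot_lmul_matrix inner_commute transpose_matrix_vector)
  have "(\<Sum>a\<in>T. \<Sum>b\<in>T. ((a - b) \<bullet> (M *v (a - b))) * w a b)
     = (\<Sum>a\<in>T. \<Sum>b\<in>T. (a \<bullet> (M *v a)) * w a b) + (\<Sum>a\<in>T. \<Sum>b\<in>T. (b \<bullet> (M *v b)) * w a b)
       - 2 * (\<Sum>a\<in>T. \<Sum>b\<in>T. w a b * (a \<bullet> (M *v b)))"
  proof -
    have "((a - b) \<bullet> (M *v (a - b))) * w a b
       = (a \<bullet> (M *v a)) * w a b + (b \<bullet> (M *v b)) * w a b - 2 * (w a b * (a \<bullet> (M *v b)))" for a b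
      using sym[of b a]
      by (simp add: matrix_vector_mult_diff_distrib inner_diff_left inner_diff_right algebra_simps)
    then show ?thesis by (simp only: sum.distrib sum_subtractf sum_distrib_left)
  qed
  also have "(\<Sum>a\<in>T. \<Sum>b\<in>T. (a \<bullet> (M *v a)) * w a b) = 0"
    by (simp add: sum_distrib_left[symmetric] wb)
  also have "(\<Sum>a\<in>T. \<Sum>b\<in>T. (b \<bullet> (M *v b)) * w a b) = 0"
    by (subst sum.swap) (simp add: sum_distrib_left[symmetric] wa)
  finally show ?thesis using MW by (simp add: w_def)
qed

text \<open>
  The half of the right-hand side of \<open>integral_bgrad_inc\<close> that belongs to the face \<open>[p, a, b]\<close>; the
  other half is obtained by exchanging \<open>p\<close> and \<open>j\<close>.
\<close>

definition tetra_half :: "real \<Rightarrow> (real ^ 3) set \<Rightarrow> real ^ 3 \<Rightarrow> real ^ 3 \<Rightarrow> real ^ 3 \<Rightarrow> real ^ 3 \<Rightarrow> (real ^ 3 \<Rightarrow> real ^ 3 ^ 3) \<Rightarrow> real" where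
  "tetra_half \<kappa> T p a b j v =
      ((- 1/2) * edge_mean p j v + foot T a j * edge_mean p a v + foot T b j * edge_mean p b v) / hull_vol6 T
       + \<kappa> / 2 * edge_mean a b v + face_flux p a b v (hull_vol6 T *\<^sub>R bgrad T j)"

definition self_coeff :: "(real ^ 3) set \<Rightarrow> real ^ 3 \<Rightarrow> real ^ 3 \<Rightarrow> real" where
  "self_coeff T a b = (SOME \<kappa>. \<forall>v\<in>smoothS. \<forall>p j. (a, b, p, j) \<in> enum4 T \<longrightarrow>
     integral (convex hull T) (\<lambda>x. bgrad T a \<bullet> (inc v x *v bgrad T b)) = tetra_half \<kappa> T p a b j v + tetra_half \<kappa> T j a b p v)"

lemma integral_bgrad_inc_halves:
  assumes T: "tet T" and e: "(a, b, p, j) \<in> enum4 T" and v: "v \<in> smoothS"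
  shows "integral (convex hull T) (\<lambda>x. bgrad T a \<bullet> (inc v x *v bgrad T b))
     = tetra_half (self_coeff T a b) T p a b j v + tetra_half (self_coeff T a b) T j a b p v"
proof -
  have card: "card T = 4" using T by (simp add: tet_def)
  have eq: "T = {p, a, b, j}" and d: "distinct [a, b, p, j]"
    using e unfolding enum4_tet[OF card] by auto
  obtain \<kappa> where k: "\<forall>v\<in>smoothS. integral (convex hull T) (\<lambda>x. bgrad T a \<bullet> (inc v x *v bgrad T b))
     = (- edge_mean p j v + foot T a j * edge_mean p a v + foot T b j * edge_mean p b v + foot T a p * edge_mean j a v + foot T b p * edge_mean j b v) / hull_vol6 T
       + \<kappa> * edge_mean a b v + face_flux p a b v (hull_vol6 T *\<^sub>R bgrad T j) + face_flux j a b v (hull_vol6 T *\<^sub>R bgrad T p)"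
    using integral_bgrad_inc[of p a b j] T unfolding eq by blast
  have "\<exists>\<kappa>. \<forall>v\<in>smoothS. \<forall>p j. (a, b, p, j) \<in> enum4 T \<longrightarrow>
     integral (convex hull T) (\<lambda>x. bgrad T a \<bullet> (inc v x *v bgrad T b)) = tetra_half \<kappa> T p a b j v + tetra_half \<kappa> T j a b p v"
  proof (rule exI[of _ \<kappa>], intro ballI allI impI)
    fix v p' j' assume v: "v \<in> smoothS" and e': "(a, b, p', j') \<in> enum4 T"
    have half: "integral (convex hull T) (\<lambda>x. bgrad T a \<bullet> (inc v x *v bgrad T b)) = tetra_half \<kappa> T p a b j v + tetra_half \<kappa> T j a b p v"
      using bspec[OF k v] edge_mean_swap[of j p v] unfolding tetra_half_def
      by (simp add: add_divide_distrib diff_divide_distrib)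
    have "{p', j'} = {p, j}" using e' d unfolding enum4_tet[OF card] unfolding eq by auto
    then have "p' = p \<and> j' = j \<or> p' = j \<and> j' = p" by (auto simp: doubleton_eq_iff)
    then show "integral (convex hull T) (\<lambda>x. bgrad T a \<bullet> (inc v x *v bgrad T b)) = tetra_half \<kappa> T p' a b j' v + tetra_half \<kappa> T j' a b p' v"
      using half by auto
  qed
  then have "\<forall>v\<in>smoothS. \<forall>p j. (a, b, p, j) \<in> enum4 T \<longrightarrow>
     integral (convex hull T) (\<lambda>x. bgrad T a \<bullet> (inc v x *v bgrad T b)) = tetra_half (self_coeff T a b) T p a b j v + tetra_half (self_coeff T a b) T j a b p v"
    unfolding self_coeff_def by (rule someI_ex)
  then show ?thesis using v e by blast
qed

text \<open>
  The edge part of the integral of \<open>M \<bullet> inc v\<close> over \<open>T\<close>, as a function of the edge values \<open>d\<close> of \<open>M\<close>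
  and the edge means \<open>D\<close> of \<open>v\<close>.
\<close>

definition local_form :: "(real ^ 3) set \<Rightarrow> (real ^ 3 \<Rightarrow> real ^ 3 \<Rightarrow> real) \<Rightarrow> (real ^ 3 \<Rightarrow> real ^ 3 \<Rightarrow> real) \<Rightarrow> real" where
  "local_form T d D = - (1/2) * (\<Sum>(a, b, p, j)\<in>enum4 T. d a b *
     (((- 1/2) * D p j + foot T a j * D p a + foot T b j * D p b) / hull_vol6 T + self_coeff T a b / 2 * D a b))"

definition face_sum :: "(real ^ 3) set \<Rightarrow> (real ^ 3 \<Rightarrow> real ^ 3 \<Rightarrow> real) \<Rightarrow> (real ^ 3 \<Rightarrow> real ^ 3 ^ 3) \<Rightarrow> real ^ 3 \<Rightarrow> real" where
  "face_sum F d v N = (\<Sum>(a, b, p)\<in>enum3 F. d a b * face_flux p a b v N)"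

text \<open>
  Each of the four sums is symmetric by itself. Opposite edges are exchanged by
  \<open>(a, b) \<leftrightarrow> (p, j)\<close>. For two edges meeting in \<open>a\<close> the coefficient \<open>foot T a j\<close> belongs to the
  common vertex and the vertex off both edges, so exchanging \<open>b\<close> and \<open>p\<close> leaves it unchanged; likewise
  for \<open>a\<close> and \<open>p\<close>. The last sum is diagonal.
\<close>

lemma local_form_sym:
  assumes d: "\<And>a b. d a b = d b a" and D: "\<And>a b. D a b = D b a"
  shows "local_form T d D = local_form T D d"
proof -
  have lin: "local_form T d D = - (1/2) * ((- 1/2 / hull_vol6 T) * (\<Sum>(a, b, p, j)\<in>enum4 T. d a b * D p j)
      + (\<Sum>(a, b, p, j)\<in>enum4 T. foot T a j / hull_vol6 T * (d a b * D p a))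
      + (\<Sum>(a, b, p, j)\<in>enum4 T. foot T b j / hull_vol6 T * (d a b * D p b))
      + (\<Sum>(a, b, p, j)\<in>enum4 T. self_coeff T a b / 2 * (d a b * D a b)))" for d D
    unfolding local_form_def sum_distrib_left sum.distrib[symmetric]
    by (intro sum.cong refl) (auto simp: algebra_simps add_divide_distrib diff_divide_distrib)
  have 1: "(\<Sum>(a, b, p, j)\<in>enum4 T. d a b * D p j) = (\<Sum>(a, b, p, j)\<in>enum4 T. D a b * d p j)"
    by (subst sum_enum4_swap_pairs) (simp add: mult.commute)
  have 2: "(\<Sum>(a, b, p, j)\<in>enum4 T. foot T a j / hull_vol6 T * (d a b * D p a))
      = (\<Sum>(a, b, p, j)\<in>enum4 T. foot T a j / hull_vol6 T * (D a b * d p a))"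
    by (subst sum_enum4_swap_23) (intro sum.cong refl, auto simp: d[of _ "fst _"] mult.commute, metis d D mult.commute)
  have 3: "(\<Sum>(a, b, p, j)\<in>enum4 T. foot T b j / hull_vol6 T * (d a b * D p b))
      = (\<Sum>(a, b, p, j)\<in>enum4 T. foot T b j / hull_vol6 T * (D a b * d p b))"
    by (subst sum_enum4_swap_13) (simp add: mult.commute)
  have 4: "(\<Sum>(a, b, p, j)\<in>enum4 T. self_coeff T a b / 2 * (d a b * D a b)) = (\<Sum>(a, b, p, j)\<in>enum4 T. self_coeff T a b / 2 * (D a b * d a b))"
    by (simp add: mult.commute)
  show ?thesis unfolding lin[of d D] lin[of D d] 1 2 3 4 ..
qed

lemma local_form_cong:
  assumes "\<And>a b. a \<in> T \<Longrightarrow> b \<in> T \<Longrightarrow> a \<noteq> b \<Longrightarrow> d a b = d' a b" "\<And>a b. a \<in> T \<Longrightarrow> b \<in> T \<Longrightarrow> a \<noteq> b \<Longrightarrow> D a b = D' a b"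
  shows "local_form T d D = local_form T d' D'"
  unfolding local_form_def
  by (intro arg_cong[where f="\<lambda>x. - (1/2) * x"] sum.cong refl) (auto simp: mem_enum4 assms)

lemma integral_inc_tet:
  assumes T: "tet T" and M: "transpose M = M" and v: "v \<in> smoothS"
  defines "d \<equiv> \<lambda>a b. (a - b) \<bullet> (M *v (a - b))"
  shows "integral (convex hull T) (\<lambda>x. M \<bullet> inc v x)
    = local_form T d (\<lambda>a b. edge_mean a b v) - (1/2) * (\<Sum>j\<in>T. face_sum (T - {j}) d v (hull_vol6 T *\<^sub>R bgrad T j))"
proof -
  have fin: "finite T" by (rule tet_finite[OF T])
  have card: "card T = 4" using T by (simp add: tet_def)
  define J where "J a b = integral (convex hull T) (\<lambda>x. bgrad T a \<bullet> (inc v x *v bgrad T b))" for a b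
  have int: "(\<lambda>x. bgrad T a \<bullet> (inc v x *v bgrad T b)) integrable_on (convex hull T)" for a b
    using continuous_integrable_hull[OF smooth_continuous_on[OF smooth_form[OF smooth_inc[OF smoothS_smooth[OF v]]]] fin]
    by (simp add: form_def[abs_def])
  have "integral (convex hull T) (\<lambda>x. M \<bullet> inc v x) = - (1/2) * (\<Sum>a\<in>T. \<Sum>b\<in>T. d a b * J a b)"
    unfolding mat_inner_expand[OF T M] J_def d_def
    by (simp add: Henstock_Kurzweil_Integration.integral_sum fin int integrable_sum integrable_on_mult_right)
  also have "(\<Sum>a\<in>T. \<Sum>b\<in>T. d a b * J a b) = (1/2) * (\<Sum>(a, b, p, j)\<in>enum4 T. d a b * J a b)"
    by (rule sum_enum4_pairs[OF card]) (simp add: d_def)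
  also have "(\<Sum>(a, b, p, j)\<in>enum4 T. d a b * J a b)
      = (\<Sum>(a, b, p, j)\<in>enum4 T. d a b * tetra_half (self_coeff T a b) T p a b j v)
      + (\<Sum>(a, b, p, j)\<in>enum4 T. d a b * tetra_half (self_coeff T a b) T j a b p v)"
    unfolding sum.distrib[symmetric]
    by (intro sum.cong refl) (auto simp: J_def integral_bgrad_inc_halves[OF T _ v] distrib_left)
  also have "(\<Sum>(a, b, p, j)\<in>enum4 T. d a b * tetra_half (self_coeff T a b) T j a b p v)
     = (\<Sum>(a, b, p, j)\<in>enum4 T. d a b * tetra_half (self_coeff T a b) T p a b j v)"
    by (rule sum_enum4_swap_34)
  also have "(\<Sum>(a, b, p, j)\<in>enum4 T. d a b * tetra_half (self_coeff T a b) T p a b j v)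
     = (\<Sum>(a, b, p, j)\<in>enum4 T. d a b *
     (((- 1/2) * edge_mean p j v + foot T a j * edge_mean p a v + foot T b j * edge_mean p b v) / hull_vol6 T + self_coeff T a b / 2 * edge_mean a b v))
     + (\<Sum>(a, b, p, j)\<in>enum4 T. d a b * face_flux p a b v (hull_vol6 T *\<^sub>R bgrad T j))"
    unfolding sum.distrib[symmetric] tetra_half_def
    by (intro sum.cong refl) (auto simp: distrib_left)
  also have "(\<Sum>(a, b, p, j)\<in>enum4 T. d a b * face_flux p a b v (hull_vol6 T *\<^sub>R bgrad T j))
      = (\<Sum>j\<in>T. face_sum (T - {j}) d v (hull_vol6 T *\<^sub>R bgrad T j))"
    unfolding face_sum_def by (rule sum_enum4_faces[OF fin])
  finally show ?thesis unfolding local_form_def by (simp add: algebra_simps)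
qed

section \<open>Geometry of the periodic mesh\<close>

lemma lattice_0: "0 \<in> lattice" and lattice_add: "k \<in> lattice \<Longrightarrow> l \<in> lattice \<Longrightarrow> k + l \<in> lattice"
  and lattice_minus: "k \<in> lattice \<Longrightarrow> - k \<in> lattice" and lattice_diff: "k \<in> lattice \<Longrightarrow> l \<in> lattice \<Longrightarrow> k - l \<in> lattice"
  by (auto simp: lattice_def)

lemma finite_lattice_bounded: "finite {k \<in> lattice. norm k \<le> r}"
proof -
  define A where "A = {x \<in> \<int>. - r \<le> x \<and> x \<le> r}"
  have A: "finite A" unfolding A_def by (rule finite_int_segment)
  have "(\<lambda>k::real^3. (k$1, k$2, k$3)) ` {k \<in> lattice. norm k \<le> r} \<subseteq> A \<times> A \<times> A"
  proof (clarify)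
    fix k :: "real ^ 3" assume k: "k \<in> lattice" "norm k \<le> r"
    have "k $ i \<in> A" for i
      using k component_le_norm_cart[of k i] by (auto simp: A_def lattice_def)
    then show "k $ 1 \<in> A \<and> (k $ 2, k $ 3) \<in> A \<times> A" by auto
  qed
  then have "finite ((\<lambda>k::real^3. (k$1, k$2, k$3)) ` {k \<in> lattice. norm k \<le> r})"
    using A by (meson finite_SigmaI finite_subset)
  moreover have "inj_on (\<lambda>k::real^3. (k$1, k$2, k$3)) {k \<in> lattice. norm k \<le> r}"
    by (rule inj_onI) (auto simp: vec_eq_iff forall_3)
  ultimately show ?thesis by (rule finite_imageD)
qed

text \<open>
  The lift to \<open>[0,1)\<^sup>3\<close> of the point of the torus given by \<open>x\<close>, as in \<^const>\<open>vertices\<close>.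
\<close>

definition torus_rep :: "real ^ 3 \<Rightarrow> real ^ 3" where
  "torus_rep x = (\<chi> i. frac (x $ i))"

lemma torus_rep_diff: "x - torus_rep x \<in> lattice" "torus_rep x - x \<in> lattice"
  by (simp_all add: torus_rep_def lattice_def frac_def)

lemma torus_rep_range: "0 \<le> torus_rep x $ i" "torus_rep x $ i < 1"
  by (simp_all add: torus_rep_def frac_lt_1)

lemma torus_rep_add: "k \<in> lattice \<Longrightarrow> torus_rep (x + k) = torus_rep x" "k \<in> lattice \<Longrightarrow> torus_rep (k + x) = torus_rep x"
  by (auto simp: torus_rep_def lattice_def vec_eq_iff frac_def elim!: Ints_cases)

lemma torus_rep_id: "(\<And>i. 0 \<le> x $ i \<and> x $ i < 1) \<Longrightarrow> torus_rep x = x"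
  by (simp add: torus_rep_def vec_eq_iff frac_eq)

lemma periodic_torus_rep: "periodic f \<Longrightarrow> f (torus_rep x) = f x"
  using torus_rep_diff(2)[of x] unfolding periodic_def by (metis add.commute diff_add_cancel)

lemma bary_affine: "tet T' \<Longrightarrow> bary T j x = (\<Sum>z\<in>T'. bary T' z x * bary T j z)"
proof -
  assume T': "tet T'"
  have "(\<Sum>z\<in>T'. bary T' z x * bary T j z) = (\<Sum>z\<in>T'. bary T' z x) + bgrad T j \<bullet> (\<Sum>z\<in>T'. bary T' z x *\<^sub>R (z - j))"
    by (simp add: bary_def[of T j] distrib_left sum.distrib inner_sum_right)
  also have "(\<Sum>z\<in>T'. bary T' z x *\<^sub>R (z - j)) = x - j"
    by (simp add: scaleR_diff_right sum_subtractf bary_point[OF T'] scaleR_sum_left[symmetric] bary_sum[OF T'])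
  finally show ?thesis by (simp add: bary_sum[OF T'] bary_def[of T j])
qed

lemma hull_iff_bary: "tet T \<Longrightarrow> x \<in> convex hull T \<longleftrightarrow> (\<forall>z\<in>T. 0 \<le> bary T z x)"
proof
  assume T: "tet T"
  {
    assume "x \<in> convex hull T"
    then obtain u where "\<forall>z\<in>T. 0 \<le> u z" "sum u T = 1" "(\<Sum>z\<in>T. u z *\<^sub>R z) = x"
      unfolding convex_hull_finite[OF tet_finite[OF T]] by blast
    then show "\<forall>z\<in>T. 0 \<le> bary T z x" using bary_comb[OF T] by metis
  next
    assume "\<forall>z\<in>T. 0 \<le> bary T z x"
    then show "x \<in> convex hull T"
      unfolding convex_hull_finite[OF tet_finite[OF T]]
      using bary_sum[OF T, of x] bary_point[OF T, of x]
      by (intro CollectI exI[of _ "\<lambda>z. bary T z x"]) simp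
  }
qed

text \<open>
  A point of the hull of some of the vertices is a combination of these vertices only, and barycentric
  coordinates are unique.
\<close>

lemma bary_subface:
  assumes T: "tet T" and S: "S \<subseteq> T" and x: "x \<in> convex hull S"
  shows "z \<in> T - S \<Longrightarrow> bary T z x = 0"
    and "\<exists>u. (\<forall>z\<in>S. bary T z x = u z) \<and> sum u S = 1 \<and> (\<Sum>z\<in>S. u z *\<^sub>R z) = x"
proof -
  have fS: "finite S" using S tet_finite[OF T] finite_subset by blast
  obtain u where u: "\<forall>z\<in>S. 0 \<le> u z" "sum u S = 1" "(\<Sum>z\<in>S. u z *\<^sub>R z) = x"
    using x unfolding convex_hull_finite[OF fS] by blast
  define w where "w z = (if z \<in> S then u z else 0)" for z
  have w1: "sum w T = 1" using u(2) S tet_finite[OF T] by (simp add: w_def sum.If_cases Int_absorb2[OF S] Int_commute)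
  have w2: "(\<Sum>z\<in>T. w z *\<^sub>R z) = x"
  proof -
    have "(\<Sum>z\<in>T. w z *\<^sub>R z) = (\<Sum>z\<in>S. w z *\<^sub>R z)"
      by (rule sum.mono_neutral_right[OF tet_finite[OF T] S]) (simp add: w_def)
    then show ?thesis using u(3) by (simp add: w_def)
  qed
  have b: "bary T z x = w z" if "z \<in> T" for z using bary_comb[OF T that w1] w2 by simp
  show "z \<in> T - S \<Longrightarrow> bary T z x = 0" using b[of z] by (simp add: w_def)
  show "\<exists>u. (\<forall>z\<in>S. bary T z x = u z) \<and> sum u S = 1 \<and> (\<Sum>z\<in>S. u z *\<^sub>R z) = x"
    using b u S by (intro exI[of _ u]) (auto simp: w_def)
qed

lemma interior_iff_bary: "tet T \<Longrightarrow> x \<in> interior (convex hull T) \<longleftrightarrow> (\<forall>z\<in>T. 0 < bary T z x)"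
proof
  assume T: "tet T"
  have c: "\<not> affine_dependent T" "\<not> card T \<le> DIM(real ^ 3)" using T by (auto simp: tet_def)
  {
    assume "x \<in> interior (convex hull T)"
    then obtain u where "\<forall>z\<in>T. 0 < u z" "sum u T = 1" "(\<Sum>z\<in>T. u z *\<^sub>R z) = x"
      unfolding interior_convex_hull_explicit_minimal[OF c(1)] using c(2) by auto
    then show "\<forall>z\<in>T. 0 < bary T z x" using bary_comb[OF T] by metis
  next
    assume "\<forall>z\<in>T. 0 < bary T z x"
    then show "x \<in> interior (convex hull T)"
      unfolding interior_convex_hull_explicit_minimal[OF c(1)]
      using c(2) bary_sum[OF T, of x] bary_point[OF T, of x] by auto
  }
qed

lemma tet_translation: "tet ((+) k ` T) \<longleftrightarrow> tet T"
  by (simp add: tet_def card_image affine_dependent_translation_eq[symmetric])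

lemma bgrad_translation: "tet T \<Longrightarrow> z \<in> T \<Longrightarrow> bgrad ((+) k ` T) (k + z) = bgrad T z"
  by (rule bgrad_unique) (auto simp: tet_translation is_bgrad_def bgrad_diff)

lemma hull_vol6_translation: "hull_vol6 ((+) k ` T) = hull_vol6 T" if "finite T"
  unfolding hull_vol6_def convex_hull_translation
  using integral_translation[OF finite_imp_compact_convex_hull[OF that], of "\<lambda>_. 1"] by simp

lemma bary_translation: "tet T \<Longrightarrow> z \<in> T \<Longrightarrow> bary ((+) k ` T) (k + z) (k + x) = bary T z x"
  by (simp add: bary_def bgrad_translation)

lemma sum_zero_by_pairing:
  fixes f :: "'a \<Rightarrow> real"
  assumes ex1: "\<And>x. x \<in> S \<Longrightarrow> \<exists>!y. y \<in> S \<and> R x y"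
    and sym: "\<And>x y. R x y \<Longrightarrow> R y x"
    and neg: "\<And>x y. x \<in> S \<Longrightarrow> y \<in> S \<Longrightarrow> R x y \<Longrightarrow> f y = - f x"
  shows "sum f S = 0"
proof -
  define \<sigma> where "\<sigma> x = (THE y. y \<in> S \<and> R x y)" for x
  have \<sigma>: "\<sigma> x \<in> S \<and> R x (\<sigma> x)" if "x \<in> S" for x
    unfolding \<sigma>_def by (rule theI'[OF ex1[OF that]])
  have inv: "\<sigma> (\<sigma> x) = x" if "x \<in> S" for x
    using ex1[of "\<sigma> x"] \<sigma>[OF that] \<sigma>[of "\<sigma> x"] sym that by blast
  have "sum f S = sum (\<lambda>x. - f x) S"
    by (rule sum.reindex_bij_witness[where i=\<sigma> and j=\<sigma>]) (use \<sigma> inv neg in auto)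
  then show ?thesis by (simp add: sum_negf)
qed

locale mesh =
  fixes \<T> :: "(real ^ 3) set set"
  assumes mesh: "torus_mesh \<T>"
begin

abbreviation "PM \<equiv> periodic_mesh \<T>"

lemma finite_mesh: "finite \<T>" using mesh by (simp add: torus_mesh_def)

lemma tet_mesh: "T \<in> \<T> \<Longrightarrow> tet T" using mesh by (auto simp: torus_mesh_def tet_def)

lemma PM_D: "T \<in> PM \<Longrightarrow> \<exists>k\<in>lattice. \<exists>T0\<in>\<T>. T = (+) k ` T0"
  by (auto simp: periodic_mesh_def)

lemma PM_I: "k \<in> lattice \<Longrightarrow> T \<in> \<T> \<Longrightarrow> (+) k ` T \<in> PM"
  by (auto simp: periodic_mesh_def)

lemma mesh_PM: "T \<in> \<T> \<Longrightarrow> T \<in> PM"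
  using PM_I[OF lattice_0, of T] by simp

lemma PM_translate: "T \<in> PM \<Longrightarrow> k \<in> lattice \<Longrightarrow> (+) k ` T \<in> PM"
proof -
  assume "T \<in> PM" and k: "k \<in> lattice"
  then obtain l T0 where "l \<in> lattice" "T0 \<in> \<T>" "T = (+) l ` T0" using PM_D by blast
  then show ?thesis using PM_I[OF lattice_add[OF k], of l T0] by (simp add: image_image add.assoc)
qed

lemma tet_PM: "T \<in> PM \<Longrightarrow> tet T"
  using PM_D tet_mesh tet_translation by metis

lemma cover_cube: "(\<Union>T\<in>\<T>. convex hull T) = cbox 0 1" using mesh by (simp add: torus_mesh_def)

lemma PM_inter: "T \<in> PM \<Longrightarrow> T' \<in> PM \<Longrightarrow> convex hull T \<inter> convex hull T' = convex hull (T \<inter> T')"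
  using mesh unfolding torus_mesh_def by blast

lemma torus_rep_cube: "torus_rep x \<in> cbox 0 1"
  using torus_rep_range by (simp add: mem_box_cart less_imp_le)

lemma cover: "\<exists>T\<in>PM. x \<in> convex hull T"
proof -
  obtain T where T: "T \<in> \<T>" "torus_rep x \<in> convex hull T" using torus_rep_cube[of x] cover_cube by blast
  then have "x \<in> (+) (x - torus_rep x) ` (convex hull T)" by (auto intro: image_eqI[of _ _ "torus_rep x"])
  then show ?thesis using PM_I[OF torus_rep_diff(1) T(1)] by (metis convex_hull_translation)
qed

text \<open>
  The hulls of \<open>T\<close> and \<open>T'\<close> meet in the hull of the common vertices, and an interior point of \<open>T\<close> needs
  all vertices of \<open>T\<close>.
\<close>

lemma same_tet:
  assumes T: "T \<in> PM" "T' \<in> PM" and x: "x \<in> interior (convex hull T)" "x \<in> convex hull T'"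
  shows "T = T'"
proof -
  have "x \<in> convex hull (T \<inter> T')" using PM_inter[OF T] x interior_subset by blast
  then have "T - (T \<inter> T') = {}"
    using bary_subface(1)[OF tet_PM[OF T(1)], of "T \<inter> T'"] x(1)
    unfolding interior_iff_bary[OF tet_PM[OF T(1)]] by (metis Diff_iff Int_lower1 equals0I less_irrefl)
  then have "T \<subseteq> T'" by blast
  moreover have "card T = card T'" "finite T'" using tet_PM T by (auto simp: tet_def intro: tet_finite tet_PM)
  ultimately show ?thesis using card_subset_eq by blast
qed

lemma cube_subset: "T \<in> \<T> \<Longrightarrow> convex hull T \<subseteq> cbox 0 1" using cover_cube by blast

lemma cube_vertex: "T \<in> \<T> \<Longrightarrow> x \<in> T \<Longrightarrow> 0 \<le> x $ i \<and> x $ i \<le> 1"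
  using cube_subset[of T] hull_subset[of T convex] by (auto simp: mem_box_cart)

text \<open>
  Two tetrahedra of the unit cube that differ by an integer vector with nonzero \<open>i\<close>-th entry lie in opposite
  sides of the cube, hence would be flat.
\<close>

lemma mesh_unique_lift:
  assumes T: "T \<in> \<T>" "T' \<in> \<T>" and k: "k \<in> lattice" and eq: "T = (+) k ` T'"
  shows "k = 0"
proof (rule ccontr)
  assume "k \<noteq> 0"
  then obtain i where i: "k $ i \<noteq> 0" by (auto simp: vec_eq_iff)
  have "k $ i \<in> \<int>" using k by (simp add: lattice_def)
  then have ge: "k $ i \<ge> 1 \<or> k $ i \<le> -1" using i by (auto elim!: Ints_cases)
  obtain c where c: "\<forall>x\<in>T. x $ i = c"
  proof
    show "\<forall>x\<in>T. x $ i = (if k $ i \<ge> 1 then 1 else 0)"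
    proof
      fix x assume x: "x \<in> T"
      then obtain y where "y \<in> T'" "x = k + y" using eq by auto
      then show "x $ i = (if k $ i \<ge> 1 then 1 else 0)"
        using cube_vertex[OF T(1) x, of i] cube_vertex[OF T(2), of y i] ge by auto
    qed
  qed
  have tT: "tet T" by (rule tet_mesh[OF T(1)])
  have "axis i 1 \<bullet> x = axis i 1 \<bullet> y" if "x \<in> T" "y \<in> T" for x y :: "real ^ 3"
    using c that by (simp add: inner_axis' )
  then have "(\<Sum>z\<in>T. (bgrad T z \<bullet> axis i 1) * (axis i 1 \<bullet> z)) = (\<Sum>z\<in>T. (bgrad T z \<bullet> axis i 1) * c)"
    using c by (intro sum.cong refl) (simp add: inner_axis')
  moreover have "(\<Sum>z\<in>T. (bgrad T z \<bullet> axis i 1) * (axis i 1 \<bullet> z)) = axis i 1 \<bullet> (axis i 1 :: real ^ 3)"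
    using arg_cong[OF bgrad_sum_scaleR[OF tT, of "axis i 1"], of "\<lambda>v. axis i 1 \<bullet> v"] by (simp add: inner_sum_right)
  moreover have "(\<Sum>z\<in>T. (bgrad T z \<bullet> axis i 1) * c) = 0"
    by (simp add: sum_distrib_right[symmetric] inner_sum_left[symmetric] bgrad_sum[OF tT])
  ultimately show False by (simp add: inner_axis_axis)
qed

lemma PM_lift_unique:
  assumes T: "T \<in> \<T>" "T' \<in> \<T>" and k: "k \<in> lattice" "k' \<in> lattice" and eq: "(+) k ` T = (+) k' ` T'"
  shows "k = k'" "T = T'"
proof -
  have "(+) (- k) ` (+) k ` T = (+) (- k) ` (+) k' ` T'" using eq by simp
  also have "(+) (- k) ` (+) k' ` T' = (+) (k' - k) ` T'" unfolding image_image by (rule image_cong) simp_all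
  finally have e: "T = (+) (k' - k) ` T'" by (simp add: image_image)
  then have "k' - k = 0" by (rule mesh_unique_lift[OF T lattice_diff[OF k(2,1)]])
  then show "k = k'" "T = T'" using e by simp_all
qed

lemma locally_finite:
  assumes "bounded B"
  shows "finite {T \<in> PM. convex hull T \<inter> B \<noteq> {}}"
proof -
  obtain r where r: "\<And>x. x \<in> B \<Longrightarrow> norm x \<le> r" using assms by (auto simp: bounded_iff)
  obtain s where s: "\<And>x. x \<in> cbox (0::real^3) 1 \<Longrightarrow> norm x \<le> s"
    using bounded_cbox[of "0::real^3" 1] by (auto simp: bounded_iff)
  have "{T \<in> PM. convex hull T \<inter> B \<noteq> {}} \<subseteq> (\<lambda>(k, T). (+) k ` T) ` ({k \<in> lattice. norm k \<le> r + s} \<times> \<T>)"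
  proof
    fix T assume "T \<in> {T \<in> PM. convex hull T \<inter> B \<noteq> {}}"
    then obtain x where "T \<in> PM" and x: "x \<in> convex hull T" "x \<in> B" by blast
    then obtain k T0 where k: "k \<in> lattice" "T0 \<in> \<T>" "T = (+) k ` T0" using PM_D by blast
    then obtain y where y: "y \<in> convex hull T0" "x = k + y" using x(1) by (auto simp: convex_hull_translation)
    have "norm k \<le> norm x + norm y" using y(2) norm_triangle_ineq4[of x y] by simp
    also have "\<dots> \<le> r + s" using r[OF x(2)] s cube_subset[OF k(2)] y(1) by (meson add_mono subsetD)
    finally show "T \<in> (\<lambda>(k, T). (+) k ` T) ` ({k \<in> lattice. norm k \<le> r + s} \<times> \<T>)"
      using k by (intro image_eqI[of _ _ "(k, T0)"]) auto
  qed
  then show ?thesis using finite_lattice_bounded finite_mesh by (meson finite_SigmaI finite_imageI finite_subset)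
qed

text \<open>
  A point slightly beyond the centroid \<open>x0\<close> of the face lies in some other tetrahedron. By local
  finiteness that tetrahedron also contains \<open>x0\<close>, and since the mesh is face-to-face it contains every
  vertex of the face.
\<close>

lemma across_exists:
  assumes T: "T \<in> PM" and j: "j \<in> T"
  shows "\<exists>T'\<in>PM. T' \<noteq> T \<and> T - {j} \<subseteq> T'"
proof -
  have tT: "tet T" by (rule tet_PM[OF T])
  obtain a b c where eq: "T = {j, a, b, c}" and d: "distinct [j, a, b, c]" using tet_obtain[OF tT j] .
  define x0 where "x0 = (1/3) *\<^sub>R a + (1/3) *\<^sub>R b + (1/3) *\<^sub>R c"
  have bx0: "bary T z x0 = (if z = j then 0 else 1/3)" if "z \<in> T" for z
    unfolding eq x0_def by (rule bary_face_centroid[OF tT[unfolded eq] d that[unfolded eq]])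
  define S where "S = {T' \<in> PM. convex hull T' \<inter> cball x0 1 \<noteq> {} \<and> x0 \<notin> convex hull T'}"
  have "finite S" unfolding S_def by (rule finite_subset[OF _ locally_finite[OF bounded_cball]]) auto
  then have "closed (\<Union>T'\<in>S. convex hull T')"
    by (intro closed_UN) (auto simp: S_def intro: compact_imp_closed finite_imp_compact_convex_hull tet_finite tet_PM)
  moreover have "x0 \<notin> (\<Union>T'\<in>S. convex hull T')" by (auto simp: S_def)
  ultimately obtain e where e: "e > 0" "ball x0 e \<inter> (\<Union>T'\<in>S. convex hull T') = {}"
    by (metis open_Compl open_contains_ball ComplI disjoint_eq_subset_Compl)
  have nz: "norm (j - x0) > 0"
  proof -
    have "bary T j j \<noteq> bary T j x0" using bx0[OF j] bary_vertex[OF tT j j] by simp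
    then show ?thesis by auto
  qed
  define r where "r = min e 1 / 2 / norm (j - x0)"
  have r: "r > 0" using e nz by (simp add: r_def)
  \<comment> \<open>On the far side of the face, and so close to \<open>x0\<close> that every tetrahedron containing \<open>y\<close> contains \<open>x0\<close>.\<close>
  define y where "y = x0 - r *\<^sub>R (j - x0)"
  have dist: "dist x0 y < e" "dist x0 y \<le> 1"
    using e nz by (auto simp: y_def dist_norm r_def)
  obtain T' where T': "T' \<in> PM" "y \<in> convex hull T'" using cover by blast
  have "T' \<notin> S" using e(2) T'(2) dist(1) by (auto simp: dist_commute)
  then have x0T': "x0 \<in> convex hull T'" using T' dist(2) by (auto simp: S_def)
  have "bary T j y = bary T j x0 + bgrad T j \<bullet> (y - x0)" using bary_diff[of T j y x0] by simp
  also have "\<dots> = - r * (bary T j j - bary T j x0)" unfolding bary_diff by (simp add: y_def bx0[OF j])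
  also have "\<dots> < 0" using r bx0[OF j] bary_vertex[OF tT j j] by simp
  finally have "y \<notin> convex hull T" using hull_iff_bary[OF tT] j by force
  then have ne: "T' \<noteq> T" using T'(2) by blast
  have "x0 \<in> convex hull T" unfolding hull_iff_bary[OF tT] using bx0 by simp
  then have "x0 \<in> convex hull (T \<inter> T')" using x0T' PM_inter[OF T T'(1)] by blast
  then have "z \<in> T \<inter> T'" if "z \<in> T - {j}" for z
    using bary_subface(1)[OF tT Int_lower1, of x0 T' z] bx0[of z] that by auto
  then show ?thesis using T'(1) ne by blast
qed

text \<open>
  Moving from the centroid of the common face towards \<open>j'\<close> one stays in \<open>T'\<close> and, if \<open>j'\<close> is on the same
  side as \<open>j\<close>, enters the interior of \<open>T\<close>.
\<close>

lemma across_same_side: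
  assumes T: "T \<in> PM" "T' \<in> PM" and j: "j \<in> T" "j' \<in> T'" and F: "T - {j} = T' - {j'}"
    and pos: "bary T j j' > 0"
  shows "T = T'"
proof -
  have tT: "tet T" and tT': "tet T'" by (auto intro: tet_PM T)
  obtain a b c where eq: "T = {j, a, b, c}" and d: "distinct [j, a, b, c]" using tet_obtain[OF tT j(1)] .
  define x0 where "x0 = (1/3) *\<^sub>R a + (1/3) *\<^sub>R b + (1/3) *\<^sub>R c"
  have bx0: "bary T z x0 = (if z = j then 0 else 1/3)" if "z \<in> T" for z
    unfolding eq x0_def by (rule bary_face_centroid[OF tT[unfolded eq] d that[unfolded eq]])
  have x0': "x0 \<in> convex hull T'"
  proof -
    have "x0 \<in> convex hull {a, b, c}" unfolding convex_hull_3 x0_def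
      by (intro CollectI exI[of _ "1/3 :: real"]) simp
    moreover have "{a, b, c} \<subseteq> T'" using F d eq by auto
    ultimately show ?thesis using hull_mono by blast
  qed
  have "\<forall>z\<in>T. \<exists>e>0. \<forall>s. 0 < s \<and> s < e \<longrightarrow> 0 < bary T z (x0 + s *\<^sub>R (j' - x0))"
  proof
    fix z assume z: "z \<in> T"
    define m where "m = bary T z j' - bary T z x0"
    have f: "bary T z (x0 + s *\<^sub>R (j' - x0)) = bary T z x0 + s * m" for s
      using bary_diff[of T z "x0 + s *\<^sub>R (j' - x0)" x0] bary_diff[of T z j' x0] by (simp add: m_def)
    show "\<exists>e>0. \<forall>s. 0 < s \<and> s < e \<longrightarrow> 0 < bary T z (x0 + s *\<^sub>R (j' - x0))"
    proof (cases "z = j")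
      case True
      then show ?thesis using pos f bx0[OF z] by (intro exI[of _ 1]) (simp add: m_def)
    next
      case False
      have "1/3 + s * m > 0" if "0 < s" "s < 1 / (3 * (1 + \<bar>m\<bar>))" for s
      proof -
        have "s * \<bar>m\<bar> \<le> s * (1 + \<bar>m\<bar>)" using that by (simp add: mult_left_mono)
        also have "\<dots> < 1/3" using that(2) by (simp add: field_simps)
        finally have "\<bar>s * m\<bar> < 1/3" using that(1) by (simp add: abs_mult)
        then show ?thesis by linarith
      qed
      then show ?thesis using False f bx0[OF z] by (intro exI[of _ "1 / (3 * (1 + \<bar>m\<bar>))"]) auto
    qed
  qed
  then obtain e where e: "\<And>z. z \<in> T \<Longrightarrow> e z > 0 \<and> (\<forall>s. 0 < s \<and> s < e z \<longrightarrow> 0 < bary T z (x0 + s *\<^sub>R (j' - x0)))"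
    by metis
  define s where "s = min 1 (Min (e ` T)) / 2"
  have fin: "finite (e ` T)" "e ` T \<noteq> {}" using tet_finite[OF tT] j by auto
  have "Min (e ` T) > 0" using fin e by simp
  then have s: "s > 0" "s < 1" by (auto simp: s_def)
  have sz: "s < e z" if "z \<in> T" for z
    using Min_le[OF fin(1), of "e z"] that e[OF that] by (auto simp: s_def)
  have "x0 + s *\<^sub>R (j' - x0) \<in> interior (convex hull T)"
    unfolding interior_iff_bary[OF tT] using e s sz by blast
  moreover have "x0 + s *\<^sub>R (j' - x0) \<in> convex hull T'"
  proof -
    have "j' \<in> convex hull T'" using j(2) hull_inc by fast
    then have "(1 - s) *\<^sub>R x0 + s *\<^sub>R j' \<in> convex hull T'"
      using x0' s by (intro convexD_alt convex_convex_hull) auto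
    then show ?thesis by (simp add: algebra_simps)
  qed
  ultimately show ?thesis by (rule same_tet[OF T])
qed

text \<open>
  Both coordinates are affine functions that vanish on the common face.
\<close>

lemma across_bary:
  assumes T: "T \<in> PM" "T' \<in> PM" and j: "j \<in> T" "j' \<in> T'" and F: "T - {j} = T' - {j'}"
  shows "bary T j x = bary T j j' * bary T' j' x"
proof -
  have tT: "tet T" and tT': "tet T'" by (auto intro: tet_PM T)
  have "bary T j x = (\<Sum>z\<in>T'. bary T' z x * bary T j z)" by (rule bary_affine[OF tT'])
  also have "\<dots> = bary T' j' x * bary T j j' + (\<Sum>z\<in>T' - {j'}. bary T' z x * bary T j z)"
    using sum.remove[OF tet_finite[OF tT'] j(2)] by blast
  also have "(\<Sum>z\<in>T' - {j'}. bary T' z x * bary T j z) = 0"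
    using bary_vertex[OF tT j(1)] unfolding F[symmetric] by (intro sum.neutral) auto
  finally show ?thesis by simp
qed

lemma across_opposite:
  assumes T: "T \<in> PM" "T' \<in> PM" and j: "j \<in> T" "j' \<in> T'" and F: "T - {j} = T' - {j'}" and ne: "T \<noteq> T'"
  shows "bary T j j' < 0"
proof -
  have "bary T j j = 1" using bary_vertex[OF tet_PM[OF T(1)] j(1) j(1)] by simp
  then have "bary T j j' \<noteq> 0" using across_bary[OF T j F, of j] by auto
  moreover have "\<not> bary T j j' > 0" using across_same_side[OF T j F] ne by blast
  ultimately show ?thesis by simp
qed

lemma PM_face_complement:
  assumes T: "T \<in> PM" "T' \<in> PM" and j: "j \<in> T" and ne: "T' \<noteq> T" and F: "T - {j} \<subseteq> T'"
  shows "\<exists>j'\<in>T'. T - {j} = T' - {j'}"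
proof -
  have c: "card T = 4" "card T' = 4" "finite T" "finite T'" using tet_PM T tet_finite by (auto simp: tet_def)
  then have "card (T' - (T - {j})) = 1" using F j by (subst card_Diff_subset) auto
  then obtain j' where j': "T' - (T - {j}) = {j'}" by (auto simp: card_1_singleton_iff)
  then have "T - {j} = T' - {j'}" using F by blast
  then show ?thesis using j' by blast
qed

text \<open>
  Two tetrahedra other than \<open>T\<close> would both lie on the opposite side of the face, hence on the same side
  as each other.
\<close>

lemma across_unique:
  assumes T: "T \<in> PM" and j: "j \<in> T"
    and T1: "T1 \<in> PM" "T1 \<noteq> T" "T - {j} \<subseteq> T1" and T2: "T2 \<in> PM" "T2 \<noteq> T" "T - {j} \<subseteq> T2"
  shows "T1 = T2"
proof -
  obtain j1 where j1: "j1 \<in> T1" "T - {j} = T1 - {j1}" using PM_face_complement[OF T T1(1) j T1(2,3)] by blast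
  obtain j2 where j2: "j2 \<in> T2" "T - {j} = T2 - {j2}" using PM_face_complement[OF T T2(1) j T2(2,3)] by blast
  have n1: "bary T j j1 < 0" using across_opposite[OF T T1(1) j j1] T1(2) by blast
  have n2: "bary T j j2 < 0" using across_opposite[OF T T2(1) j j2] T2(2) by blast
  have "bary T j j2 = bary T j j1 * bary T1 j1 j2" by (rule across_bary[OF T T1(1) j j1])
  then have "bary T1 j1 j2 > 0" using n1 n2 by (metis mult_nonpos_nonpos not_le order_less_imp_le)
  then show ?thesis using across_same_side[OF T1(1) T2(1) j1(1) j2(1)] j1(2) j2(2) by simp
qed

text \<open>
  The gradients are negative multiples of each other by \<open>across_bary\<close>, and by \<open>hull_vol6_bgrad\<close> both area
  vectors are plus or minus the same cross product.
\<close>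

lemma across_normal:
  assumes T: "T \<in> PM" "T' \<in> PM" and j: "j \<in> T" "j' \<in> T'" and F: "T - {j} = T' - {j'}" and ne: "T \<noteq> T'"
  shows "hull_vol6 T' *\<^sub>R bgrad T' j' = - (hull_vol6 T *\<^sub>R bgrad T j)"
proof -
  have tT: "tet T" and tT': "tet T'" by (auto intro: tet_PM T)
  obtain a b c where eq: "T = {j, a, b, c}" and d: "distinct [j, a, b, c]" using tet_obtain[OF tT j(1)] .
  have eq': "T' = {j', a, b, c}" using F j(2) eq d by auto
  define \<beta> where "\<beta> = bary T j j'"
  have \<beta>: "\<beta> < 0" unfolding \<beta>_def by (rule across_opposite[OF T j F ne])
  have "(bgrad T j - \<beta> *\<^sub>R bgrad T' j') \<bullet> w = 0" for w
    using across_bary[OF T j F, of w] across_bary[OF T j F, of 0] bary_diff[of T j w 0] bary_diff[of T' j' w 0]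
    by (simp add: \<beta>_def inner_diff_left right_diff_distrib[symmetric])
  from this[of "bgrad T j - \<beta> *\<^sub>R bgrad T' j'"] have g: "bgrad T j = \<beta> *\<^sub>R bgrad T' j'" by simp
  let ?n = "cross3 (b - a) (c - a)"
  obtain s where s: "hull_vol6 T *\<^sub>R bgrad T j = s *\<^sub>R ?n" "\<bar>s\<bar> = 1"
    using hull_vol6_bgrad[of j a b c] tT tet_vol6[of a b c j] unfolding eq
    by (metis abs_sgn_eq abs_eq_0_iff insert_commute vol6_def)
  obtain s' where s': "hull_vol6 T' *\<^sub>R bgrad T' j' = s' *\<^sub>R ?n" "\<bar>s'\<bar> = 1"
    using hull_vol6_bgrad[of j' a b c] tT' tet_vol6[of a b c j'] unfolding eq'
    by (metis abs_sgn_eq abs_eq_0_iff insert_commute vol6_def)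
  have v: "hull_vol6 T > 0" "hull_vol6 T' > 0" by (auto intro: hull_vol6_pos tT tT')
  have n0: "?n \<noteq> 0" using s(1) v(1) bgrad_nonzero[OF tT j(1)] by auto
  have "s *\<^sub>R ?n = (hull_vol6 T * \<beta> / hull_vol6 T') *\<^sub>R (hull_vol6 T' *\<^sub>R bgrad T' j')"
    using s(1) v(2) by (simp add: g)
  also have "\<dots> = (hull_vol6 T * \<beta> / hull_vol6 T' * s') *\<^sub>R ?n" by (simp add: s'(1))
  finally have e: "s = hull_vol6 T * \<beta> / hull_vol6 T' * s'" using n0 by simp
  have neg: "hull_vol6 T * \<beta> / hull_vol6 T' < 0" using v \<beta> by (simp add: divide_neg_pos mult_pos_neg)
  have "s' = - s"
  proof -
    have "s' = 1 \<or> s' = -1" "s = 1 \<or> s = -1" using s(2) s'(2) by linarith+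
    then show ?thesis using e neg by auto
  qed
  then show ?thesis using s(1) s'(1) by simp
qed

text \<open>
  A flag is a tetrahedron of the mesh with one of its faces, given by the opposite vertex. Each face of the
  torus carries exactly two flags, whose area vectors are opposite. The partner of a tetrahedron of the
  unit cube may lie in a neighbouring cube, which is why flags are paired up to translation.
\<close>

lemma flag_cancellation:
  fixes \<Phi> :: "(real ^ 3) set \<Rightarrow> real ^ 3 \<Rightarrow> real"
  assumes odd: "\<And>F N. \<Phi> F (- N) = - \<Phi> F N"
    and per: "\<And>T j k N. T \<in> PM \<Longrightarrow> j \<in> T \<Longrightarrow> k \<in> lattice \<Longrightarrow> \<Phi> ((+) k ` (T - {j})) N = \<Phi> (T - {j}) N"
  shows "(\<Sum>T\<in>\<T>. \<Sum>j\<in>T. \<Phi> (T - {j}) (hull_vol6 T *\<^sub>R bgrad T j)) = 0"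
proof -
  define S where "S = Sigma \<T> (\<lambda>T. T)"
  \<comment> \<open>After a translation the two tetrahedra are different and share the face.\<close>
  define R where "R = (\<lambda>(T, j) (T', j'). \<exists>k\<in>lattice. (+) k ` T' \<noteq> T \<and> T - {j} = (+) k ` (T' - {j' :: real ^ 3}))"
  have R_iff: "R (T, j) (T', j') \<longleftrightarrow> (\<exists>k\<in>lattice. (+) k ` T' \<noteq> T \<and> T - {j} = (+) k ` (T' - {j'}))" for T j T' j'
    by (simp add: R_def)
  have tr: "(+) (- k) ` (+) k ` A = A" for A and k :: "real ^ 3" by (simp add: image_image)
  have tr': "(+) k ` (A - {z}) = (+) k ` A - {k + z}" for A and k z :: "real ^ 3"
    by auto
  have "(\<Sum>T\<in>\<T>. \<Sum>j\<in>T. \<Phi> (T - {j}) (hull_vol6 T *\<^sub>R bgrad T j)) = (\<Sum>(T, j)\<in>S. \<Phi> (T - {j}) (hull_vol6 T *\<^sub>R bgrad T j))"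
    unfolding S_def using finite_mesh tet_finite[OF tet_mesh] by (subst sum.Sigma) auto
  also have "\<dots> = 0"
  proof (rule sum_zero_by_pairing[where R=R])
    fix x assume "x \<in> S"
    then obtain T j where x: "x = (T, j)" "T \<in> \<T>" "j \<in> T" by (auto simp: S_def)
    have T: "T \<in> PM" by (rule mesh_PM[OF x(2)])
    obtain T1 where T1: "T1 \<in> PM" "T1 \<noteq> T" "T - {j} \<subseteq> T1" using across_exists[OF T x(3)] by blast
    obtain j1 where j1: "j1 \<in> T1" "T - {j} = T1 - {j1}" using PM_face_complement[OF T T1(1) x(3) T1(2,3)] by blast
    obtain k T' where k: "k \<in> lattice" "T' \<in> \<T>" "T1 = (+) k ` T'" using PM_D[OF T1(1)] by blast
    obtain j' where j': "j' \<in> T'" "j1 = k + j'" using j1(1) k(3) by auto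
    have "(T', j') \<in> S \<and> R x (T', j')"
      using k j' T1(2) j1(2) unfolding S_def R_def x(1) by (auto simp: tr')
    moreover have "y = (T', j')" if y: "y \<in> S \<and> R x y" for y
    proof -
      obtain T2 j2 where y1: "y = (T2, j2)" by (cases y)
      then have yy: "T2 \<in> \<T>" "j2 \<in> T2" "\<exists>l\<in>lattice. (+) l ` T2 \<noteq> T \<and> T - {j} = (+) l ` (T2 - {j2})"
        using y by (simp_all add: S_def R_def x(1))
      then obtain l where l: "l \<in> lattice" "(+) l ` T2 \<noteq> T" "T - {j} = (+) l ` (T2 - {j2})" by blast
      note y2 = y1 yy(1,2) l
      have "(+) l ` T2 = T1"
        by (rule across_unique[OF T x(3) PM_I[OF y2(4,2)] y2(5) _ T1]) (use y2(6) in auto)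
      then have e: "l = k" "T2 = T'" using PM_lift_unique[OF y2(2) k(2) y2(4) k(1)] k(3) by auto
      then have "(+) (- k) ` (+) k ` (T' - {j2}) = (+) (- k) ` (+) k ` (T' - {j'})"
        using y2(6) j1(2) k(3) j'(2) by (simp add: tr')
      then have "T' - {j2} = T' - {j'}" unfolding tr .
      then have "j2 = j'" using j'(1) y2(3) e(2) by blast
      then show ?thesis using y2(1) e by simp
    qed
    ultimately show "\<exists>!y. y \<in> S \<and> R x y" by blast
  next
    fix x y assume "R x y"
    obtain T j T' j' where x1: "x = (T, j)" "y = (T', j')" by (cases x, cases y)
    have "R (T, j) (T', j')" using \<open>R x y\<close> by (simp only: x1)
    then obtain k where xk: "k \<in> lattice" "(+) k ` T' \<noteq> T" "T - {j} = (+) k ` (T' - {j'})"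
      unfolding R_iff by blast
    note xy = x1 xk
    have "T' - {j'} = (+) (- k) ` (T - {j})" using xy(5) tr[of k "T' - {j'}"] by simp
    moreover have "(+) (- k) ` T \<noteq> T'" using xy(4) tr[of "- k" T] by auto
    ultimately show "R y x" using lattice_minus[OF xy(3)] unfolding xy(1,2) R_iff by blast
  next
    fix x y assume "x \<in> S" "y \<in> S" "R x y"
    obtain T j T' j' where x1: "x = (T, j)" "y = (T', j')" by (cases x, cases y)
    have "R (T, j) (T', j')" using \<open>R x y\<close> by (simp only: x1)
    then obtain k where xk: "k \<in> lattice" "(+) k ` T' \<noteq> T" "T - {j} = (+) k ` (T' - {j'})"
      unfolding R_iff by blast
    have xS: "T \<in> \<T>" "T' \<in> \<T>" "j \<in> T" "j' \<in> T'"
      using \<open>x \<in> S\<close> \<open>y \<in> S\<close> by (simp_all add: S_def x1)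
    note xy = x1 xk xS
    have tT': "tet T'" by (rule tet_mesh[OF xy(7)])
    have "hull_vol6 T' *\<^sub>R bgrad T' j' = hull_vol6 ((+) k ` T') *\<^sub>R bgrad ((+) k ` T') (k + j')"
      by (simp add: bgrad_translation[OF tT' xy(9)] hull_vol6_translation[OF tet_finite[OF tT']])
    also have "\<dots> = - (hull_vol6 T *\<^sub>R bgrad T j)"
      by (rule across_normal[OF mesh_PM[OF xy(6)] PM_I[OF xy(3,7)] xy(8)]) (use xy in \<open>auto simp: tr'\<close>)
    finally have "\<Phi> (T' - {j'}) (hull_vol6 T' *\<^sub>R bgrad T' j') = - \<Phi> (T' - {j'}) (hull_vol6 T *\<^sub>R bgrad T j)"
      by (simp add: odd)
    also have "\<Phi> (T' - {j'}) (hull_vol6 T *\<^sub>R bgrad T j) = \<Phi> (T - {j}) (hull_vol6 T *\<^sub>R bgrad T j)"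
      using per[OF mesh_PM[OF xy(7)] xy(9,3)] xy(5) by simp
    finally show "(case y of (T, j) \<Rightarrow> \<Phi> (T - {j}) (hull_vol6 T *\<^sub>R bgrad T j)) = - (case x of (T, j) \<Rightarrow> \<Phi> (T - {j}) (hull_vol6 T *\<^sub>R bgrad T j))"
      by (simp add: xy(1,2))
  qed
  finally show ?thesis .
qed

lemma negligible_overlap:
  assumes "T \<in> \<T>" "T' \<in> \<T>" "T \<noteq> T'"
  shows "negligible (convex hull T \<inter> convex hull T')"
proof -
  have "interior (convex hull T) \<inter> convex hull T' = {}"
    using same_tet[OF mesh_PM mesh_PM] assms by blast
  then have "convex hull T \<inter> convex hull T' \<subseteq> frontier (convex hull T)"
    unfolding frontier_def using closure_subset by fast
  then show ?thesis using negligible_convex_frontier[OF convex_convex_hull] negligible_subset by blast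
qed

lemma has_integral_cube:
  fixes f :: "real ^ 3 \<Rightarrow> 'a::banach"
  assumes "\<And>T. T \<in> \<T> \<Longrightarrow> (f has_integral I T) (convex hull T)"
  shows "(f has_integral (\<Sum>T\<in>\<T>. I T)) (cbox 0 1)"
proof -
  have "(f has_integral (\<Sum>T\<in>\<T>. I T)) (\<Union>T\<in>\<T>. convex hull T)"
    by (rule has_integral_UN[OF finite_mesh]) (use assms negligible_overlap in \<open>auto simp: pairwise_def\<close>)
  then show ?thesis by (simp add: cover_cube)
qed

end

section \<open>Piecewise linear fields and the weak divergence\<close>

lemma enum3_eq:
  assumes d: "distinct [a, b, c]"
  shows "enum3 {a, b, c} = {(a,b,c),(a,c,b),(b,a,c),(b,c,a),(c,a,b),(c,b,a)}"
proof
  show "enum3 {a, b, c} \<subseteq> {(a,b,c),(a,c,b),(b,a,c),(b,c,a),(c,a,b),(c,b,a)}"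
  proof
    fix x assume x: "x \<in> enum3 {a, b, c}"
    obtain p q r where pqr: "x = (p, q, r)" by (cases x)
    then have "p \<in> {a, b, c}" "q \<in> {a, b, c}" "r \<in> {a, b, c}" "p \<noteq> q" "p \<noteq> r" "q \<noteq> r"
      using x by (simp_all add: mem_enum3)
    then show "x \<in> {(a,b,c),(a,c,b),(b,a,c),(b,c,a),(c,a,b),(c,b,a)}"
      unfolding pqr by (elim insertE emptyE) simp_all
  qed
  show "{(a,b,c),(a,c,b),(b,a,c),(b,c,a),(c,a,b),(c,b,a)} \<subseteq> enum3 {a, b, c}"
    using d by (simp add: mem_enum3) metis
qed

text \<open>
  Averaging over the orderings of the vertices makes the mean a function of the vertex set, as
  \<open>flag_cancellation\<close> requires.
\<close>

definition face_mean :: "(real ^ 3) set \<Rightarrow> (real ^ 3 \<Rightarrow> real) \<Rightarrow> real" where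
  "face_mean F f = (\<Sum>(a, b, c)\<in>enum3 F. mean2 a b c f) / 6"

lemma face_mean_eq:
  assumes f: "continuous_on UNIV f" and d: "distinct [a, b, c]"
  shows "face_mean {a, b, c} f = mean2 a b c f"
proof -
  have "mean2 a c b f = mean2 a b c f" "mean2 b a c f = mean2 a b c f" "mean2 b c a f = mean2 a b c f"
     "mean2 c a b f = mean2 a b c f" "mean2 c b a f = mean2 a b c f"
    using mean2_swap12[OF f] mean2_swap23[OF f] by metis+
  then show ?thesis using d by (auto simp: face_mean_def enum3_eq[OF d])
qed

text \<open>
  By the resolution of the identity the divergence is the sum over \<open>z\<close> of the derivatives along
  \<open>z - z0\<close> of \<open>\<nabla>\<lambda>\<^sub>z \<bullet> X\<close>, and \<open>mean3_deriv\<close> integrates each of them to a difference of two face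
  means. The means over the face opposite to \<open>z0\<close> add up to zero since the gradients do.
\<close>

lemma divergence_tet:
  fixes X :: "real ^ 3 \<Rightarrow> real ^ 3"
  assumes T: "tet T" and X: "smooth X"
  shows "integral (convex hull T) (\<lambda>x. \<Sum>j\<in>UNIV. pd j (\<lambda>y. X y $ j) x)
     = - (\<Sum>z\<in>T. face_mean (T - {z}) (\<lambda>x. (hull_vol6 T *\<^sub>R bgrad T z) \<bullet> X x))"
proof -
  have fin: "finite T" by (rule tet_finite[OF T])
  obtain z0 where z0: "z0 \<in> T" using T by (metis tet_def card.empty ex_in_conv zero_neq_numeral)
  define \<phi> where "\<phi> z x = bgrad T z \<bullet> X x" for z x
  have s\<phi>: "smooth (\<phi> z)" for z
    unfolding \<phi>_def[abs_def] by (rule smooth_linear[OF bounded_linear_inner_right X])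
  have c\<phi>: "continuous_on UNIV (\<phi> z)" for z by (rule smooth_continuous_on[OF s\<phi>])
  have cX: "continuous_on UNIV X" by (rule smooth_continuous_on[OF X])
  have s: "smooth (\<lambda>y. X y $ j)" for j by (rule smooth_vec_nth[OF X])
  have div: "(\<Sum>j\<in>UNIV. pd j (\<lambda>y. X y $ j) x) = (\<Sum>z\<in>T - {z0}. dd (z - z0) (\<phi> z) x)" for x
  proof -
    have dX: "dd w (\<phi> z) x = (\<Sum>j\<in>UNIV. bgrad T z $ j * dd w (\<lambda>y. X y $ j) x)" for w z
    proof -
      have "\<phi> z = (\<lambda>x. \<Sum>j\<in>UNIV. bgrad T z $ j * X x $ j)" by (simp add: \<phi>_def inner_vec_def fun_eq_iff)
      then show ?thesis by (simp add: dd_sum smooth_cmult s dd_cmult)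
    qed
    have "(\<Sum>z\<in>T - {z0}. dd (z - z0) (\<phi> z) x) = (\<Sum>z\<in>T. dd (z - z0) (\<phi> z) x)"
      using fin z0 by (subst sum.remove[of T z0]) (auto simp: dd_def)
    also have "\<dots> = (\<Sum>z\<in>T. \<Sum>j\<in>UNIV. \<Sum>i\<in>UNIV. bgrad T z $ j * (z $ i - z0 $ i) * pd i (\<lambda>y. X y $ j) x)"
      unfolding dX by (simp add: dd_def sum_distrib_left algebra_simps)
    also have "\<dots> = (\<Sum>j\<in>UNIV. \<Sum>z\<in>T. \<Sum>i\<in>UNIV. bgrad T z $ j * (z $ i - z0 $ i) * pd i (\<lambda>y. X y $ j) x)"
      by (rule sum.swap)
    also have "\<dots> = (\<Sum>j\<in>UNIV. \<Sum>i\<in>UNIV. \<Sum>z\<in>T. bgrad T z $ j * (z $ i - z0 $ i) * pd i (\<lambda>y. X y $ j) x)"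
      by (rule sum.cong[OF refl], rule sum.swap)
    also have "\<dots> = (\<Sum>j\<in>UNIV. \<Sum>i\<in>UNIV. of_bool (i = j) * pd i (\<lambda>y. X y $ j) x)"
    proof (intro sum.cong refl)
      fix i j :: 3
      have "(\<Sum>z\<in>T. bgrad T z $ j * (z $ i - z0 $ i)) = (\<Sum>z\<in>T. (bgrad T z \<bullet> axis j 1) * z $ i) - (\<Sum>z\<in>T. bgrad T z) $ j * z0 $ i"
        by (simp add: sum_component sum_distrib_left sum_distrib_right sum_subtractf algebra_simps inner_axis)
      also have "(\<Sum>z\<in>T. (bgrad T z \<bullet> axis j 1) * z $ i) = axis j (1::real) $ i"
        using arg_cong[OF bgrad_sum_scaleR[OF T, of "axis j 1"], of "\<lambda>z. z $ i"] by (simp add: sum_component)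
      finally show "(\<Sum>z\<in>T. bgrad T z $ j * (z $ i - z0 $ i) * pd i (\<lambda>y. X y $ j) x) = of_bool (i = j) * pd i (\<lambda>y. X y $ j) x"
        by (simp add: bgrad_sum[OF T] sum_distrib_right[symmetric] axis_def)
    qed
    also have "\<dots> = (\<Sum>j\<in>UNIV. pd j (\<lambda>y. X y $ j) x)"
      by (simp add: of_bool_def if_distribR if_distrib[of "\<lambda>c. c * _"] cong: if_cong)
    finally show ?thesis by simp
  qed
  have each: "integral (convex hull T) (dd (z - z0) (\<phi> z))
     = hull_vol6 T * (face_mean (T - {z0}) (\<phi> z) - face_mean (T - {z}) (\<phi> z))" if z: "z \<in> T - {z0}" for z
  proof -
    obtain b c d where eq: "T = {z0, b, c, d}" and dist: "distinct [z0, b, c, d]" using tet_obtain[OF T z0] .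
    obtain u v where uv: "T = {z0, z, u, v}" "distinct [z0, z, u, v]"
    proof -
      have "z = b \<or> z = c \<or> z = d" using z eq by auto
      then show ?thesis using that[of c d] that[of b d] that[of b c] eq dist by (auto simp: insert_commute)
    qed
    have vol: "vol6 z0 z u v \<noteq> 0" using tet_vol6 T uv(1) by blast
    have "integral (convex hull T) (dd (z - z0) (\<phi> z)) = hull_vol6 T * mean3 z0 z u v (dd (z - z0) (\<phi> z))"
      unfolding uv(1) hull_vol6_eq by (rule integral_hull_mean3[OF vol])
    also have "mean3 z0 z u v (dd (z - z0) (\<phi> z)) = mean2 z u v (\<phi> z) - mean2 z0 u v (\<phi> z)"
      by (rule mean3_deriv[OF s\<phi> vol])
    also have "mean2 z u v (\<phi> z) = face_mean (T - {z0}) (\<phi> z)"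
    proof -
      have "T - {z0} = {z, u, v}" using uv by auto
      then show ?thesis using face_mean_eq[OF c\<phi>[of z], where a=z and b=u and c=v] uv(2) by simp
    qed
    also have "mean2 z0 u v (\<phi> z) = face_mean (T - {z}) (\<phi> z)"
    proof -
      have "T - {z} = {z0, u, v}" using uv by auto
      then show ?thesis using face_mean_eq[OF c\<phi>[of z], where a=z0 and b=u and c=v] uv(2) by simp
    qed
    finally show ?thesis .
  qed
  have face_mean_lin: "face_mean F (\<lambda>x. (c *\<^sub>R bgrad T z) \<bullet> X x) = c * face_mean F (\<phi> z)" for F c z
    unfolding face_mean_def \<phi>_def by (simp add: mean2_cmult sum_distrib_left case_prod_unfold)
  have face_mean_sum: "(\<Sum>z\<in>T. face_mean F (\<phi> z)) = 0" for F
  proof -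
    have "mean2 a b c (\<lambda>x. \<Sum>z\<in>A. \<phi> z x) = (\<Sum>z\<in>A. mean2 a b c (\<phi> z))" if "finite A" for A a b c
      using that
    proof induction
      case empty
      then show ?case by (simp add: mean2_def)
    next
      case (insert x A)
      then show ?case by (simp add: mean2_add c\<phi> continuous_on_sum)
    qed
    then have "(\<Sum>z\<in>T. mean2 a b c (\<phi> z)) = mean2 a b c (\<lambda>x. \<Sum>z\<in>T. \<phi> z x)" for a b c
      using fin by metis
    moreover have "(\<lambda>x. \<Sum>z\<in>T. \<phi> z x) = (\<lambda>x. 0)" by (simp add: \<phi>_def inner_sum_left[symmetric] bgrad_sum[OF T])
    ultimately have "(\<Sum>z\<in>T. mean2 a b c (\<phi> z)) = 0" for a b c by (simp add: mean2_def)
    moreover have "(\<Sum>z\<in>T. face_mean F (\<phi> z)) = (\<Sum>(a, b, c)\<in>enum3 F. \<Sum>z\<in>T. mean2 a b c (\<phi> z)) / 6"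
      unfolding face_mean_def sum_divide_distrib[symmetric] case_prod_unfold by (subst sum.swap) simp
    ultimately show ?thesis by (simp add: case_prod_unfold)
  qed
  have "integral (convex hull T) (\<lambda>x. \<Sum>j\<in>UNIV. pd j (\<lambda>y. X y $ j) x)
      = (\<Sum>z\<in>T - {z0}. integral (convex hull T) (dd (z - z0) (\<phi> z)))"
    unfolding div using fin
    by (intro Henstock_Kurzweil_Integration.integral_sum)
       (auto intro!: continuous_integrable_hull smooth_continuous_on smooth_dd s\<phi>)
  also have "\<dots> = (\<Sum>z\<in>T - {z0}. hull_vol6 T * (face_mean (T - {z0}) (\<phi> z) - face_mean (T - {z}) (\<phi> z)))"
    by (intro sum.cong refl each)
  also have "\<dots> = hull_vol6 T * ((\<Sum>z\<in>T. face_mean (T - {z0}) (\<phi> z)) - (\<Sum>z\<in>T. face_mean (T - {z}) (\<phi> z)))"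
  proof -
    have "(\<Sum>z\<in>T. hull_vol6 T * (face_mean (T - {z0}) (\<phi> z) - face_mean (T - {z}) (\<phi> z)))
        = (\<Sum>z\<in>T - {z0}. hull_vol6 T * (face_mean (T - {z0}) (\<phi> z) - face_mean (T - {z}) (\<phi> z)))"
      using sum.remove[OF fin z0, of "\<lambda>z. hull_vol6 T * (face_mean (T - {z0}) (\<phi> z) - face_mean (T - {z}) (\<phi> z))"] by simp
    then show ?thesis by (simp only: sum_distrib_left sum_subtractf right_diff_distrib)
  qed
  also have "\<dots> = - (\<Sum>z\<in>T. hull_vol6 T * face_mean (T - {z}) (\<phi> z))"
    unfolding face_mean_sum by (simp add: sum_distrib_left)
  finally show ?thesis unfolding face_mean_lin .
qed

lemma affine_has_derivative: "linear A \<Longrightarrow> ((\<lambda>y. A y + b) has_derivative A) (at x)" for A :: "real ^ 3 \<Rightarrow> real ^ 3"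
  using has_derivative_add[OF bounded_linear_imp_has_derivative[of A] has_derivative_const[of b], of "at x"]
  by (simp add: linear_conv_bounded_linear)

lemma smooth_affine: "linear A \<Longrightarrow> smooth (\<lambda>y. A y + b)" for A :: "real ^ 3 \<Rightarrow> real ^ 3"
  unfolding smooth_iff_Ck
proof
  fix n assume A: "linear A"
  have "pd j (\<lambda>y. A y + b) = (\<lambda>x. A (axis j 1))" for j
    by (intro ext) (rule pd_unique[OF affine_has_derivative[OF A]])
  moreover have "(\<lambda>y. A y + b) differentiable_on UNIV"
    using affine_has_derivative[OF A] by (auto simp: differentiable_on_def differentiable_def)
  ultimately show "Ck n (\<lambda>y. A y + b)" by (cases n) (simp_all add: Ck_const)
qed

lemma sym_grad_affine:
  fixes f :: "real ^ 3 \<Rightarrow> real ^ 3"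
  assumes A: "linear A" and f: "\<And>y. y \<in> S \<Longrightarrow> f y = A y + b" and x: "x \<in> interior S"
  shows "sym_grad f x = (\<chi> i j. (A (axis j 1) $ i + A (axis i 1) $ j) / 2)"
proof -
  have "((\<lambda>y. A y + b) has_derivative A) (at x)" by (rule affine_has_derivative[OF A])
  then have "(f has_derivative A) (at x)"
    by (rule has_derivative_transform_within_open[OF _ open_interior x]) (use f interior_subset in force)
  then have "pd j f x = A (axis j 1)" for j by (rule pd_unique)
  then show ?thesis by (simp add: sym_grad_def grad_def vec_eq_iff transpose_def)
qed

lemma mean2_cong:
  assumes "\<And>x. x \<in> convex hull {a, b, c} \<Longrightarrow> f x = g x"
  shows "mean2 a b c f = mean2 a b c g"
  unfolding mean2_def
proof (rule Bochner_Integration.integral_cong[OF refl])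
  fix p
  have "a + fst p *\<^sub>R (b - a) + snd p *\<^sub>R (c - a) \<in> convex hull {a, b, c}" if "p \<in> Tri"
    unfolding convex_hull_3 using that
    by (intro CollectI exI[of _ "1 - fst p - snd p"] exI[of _ "fst p"] exI[of _ "snd p"]) (auto simp: Tri_def algebra_simps)
  then show "indicator Tri p *\<^sub>R f (a + fst p *\<^sub>R (b - a) + snd p *\<^sub>R (c - a)) = indicator Tri p *\<^sub>R g (a + fst p *\<^sub>R (b - a) + snd p *\<^sub>R (c - a))"
    using assms by (cases "p \<in> Tri") auto
qed

lemma mean2_translation: "mean2 (k + a) (k + b) (k + c) f = mean2 a b c (\<lambda>x. f (k + x))"
  unfolding mean2_def by (simp add: add.assoc)

lemma enum3_translation: "enum3 ((+) k ` F) = (\<lambda>(a, b, c). (k + a, k + b, k + c)) ` enum3 F" for k :: "real ^ 3"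
proof -
  have "(a, b, c) \<in> enum3 ((+) k ` F) \<longleftrightarrow> (a, b, c) \<in> (\<lambda>(a, b, c). (k + a, k + b, k + c)) ` enum3 F" for a b c
  proof
    assume "(a, b, c) \<in> enum3 ((+) k ` F)"
    then have "(a - k, b - k, c - k) \<in> enum3 F" by (auto simp: mem_enum3)
    then show "(a, b, c) \<in> (\<lambda>(a, b, c). (k + a, k + b, k + c)) ` enum3 F" by force
  qed (auto simp: mem_enum3)
  then show ?thesis unfolding set_eq_iff split_paired_All by blast
qed

lemma sum_enum3_translation: "(\<Sum>(a, b, c)\<in>enum3 ((+) k ` F). f a b c) = (\<Sum>(a, b, c)\<in>enum3 F. f (k + a) (k + b) (k + c))" for k :: "real ^ 3"
  unfolding enum3_translation by (subst sum.reindex) (auto simp: inj_on_def case_prod_unfold)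

context mesh
begin

lemma vertex_torus_rep: "T \<in> PM \<Longrightarrow> z \<in> T \<Longrightarrow> torus_rep z \<in> vertices \<T>"
proof -
  assume T: "T \<in> PM" "z \<in> T"
  have "(+) (torus_rep z - z) ` T \<in> PM" by (rule PM_translate[OF T(1) torus_rep_diff(2)])
  moreover have "torus_rep z \<in> (+) (torus_rep z - z) ` T" using T(2) by (intro image_eqI[of _ _ z]) auto
  ultimately show ?thesis using torus_rep_range unfolding vertices_def by blast
qed

lemma vertices_torus_rep: "y \<in> vertices \<T> \<Longrightarrow> torus_rep y = y"
  by (rule torus_rep_id) (simp add: vertices_def)

lemma vertices_PM: "y \<in> vertices \<T> \<Longrightarrow> \<exists>T\<in>PM. y \<in> T"
  by (simp add: vertices_def)

lemma finite_vertices: "finite (vertices \<T>)"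
proof (rule finite_subset)
  show "vertices \<T> \<subseteq> torus_rep ` (\<Union>\<T>)"
  proof
    fix y assume y: "y \<in> vertices \<T>"
    then obtain T where T: "T \<in> PM" "y \<in> T" using vertices_PM by blast
    then obtain k T0 where k: "k \<in> lattice" "T0 \<in> \<T>" "T = (+) k ` T0" using PM_D by blast
    then obtain t where t: "t \<in> T0" "y = k + t" using T(2) by auto
    have "y = torus_rep t" using vertices_torus_rep[OF y] torus_rep_add(2)[OF k(1), of t] t(2) by simp
    then show "y \<in> torus_rep ` (\<Union>\<T>)" using t(1) k(2) by blast
  qed
  show "finite (torus_rep ` (\<Union>\<T>))" using finite_mesh tet_finite[OF tet_mesh] by auto
qed

lemma hull_translation: "x \<in> convex hull T \<Longrightarrow> k + x \<in> convex hull ((+) k ` T)"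
  by (simp add: convex_hull_translation)

text \<open>
  The continuous piecewise linear function with given values at the vertices of the torus. The choice of
  \<open>T\<close> is immaterial by \<open>bary_common\<close>.
\<close>

definition pwl :: "(real ^ 3 \<Rightarrow> 'a::real_normed_vector) \<Rightarrow> real ^ 3 \<Rightarrow> 'a" where
  "pwl c x = (let T = SOME T. T \<in> PM \<and> x \<in> convex hull T in \<Sum>z\<in>T. bary T z x *\<^sub>R c (torus_rep z))"

text \<open>
  The point lies in the hull of the common vertices. Its coordinates in \<open>T\<close> vanish off these, so they
  are also valid coordinates in \<open>T'\<close>, hence equal.
\<close>

lemma bary_common:
  assumes T: "T \<in> PM" "T' \<in> PM" and x: "x \<in> convex hull T" "x \<in> convex hull T'"
  shows "(\<Sum>z\<in>T. bary T z x *\<^sub>R f z) = (\<Sum>z\<in>T'. bary T' z x *\<^sub>R (f z :: 'a::real_normed_vector))"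
proof -
  have tT: "tet T" and tT': "tet T'" by (auto intro: tet_PM T)
  have xi: "x \<in> convex hull (T \<inter> T')" using PM_inter[OF T] x by blast
  have 1: "(\<Sum>z\<in>T. bary T z x *\<^sub>R f z) = (\<Sum>z\<in>T \<inter> T'. bary T z x *\<^sub>R f z)"
    using bary_subface(1)[OF tT _ xi] by (intro sum.mono_neutral_right tet_finite tT) auto
  have 2: "(\<Sum>z\<in>T'. bary T' z x *\<^sub>R f z) = (\<Sum>z\<in>T \<inter> T'. bary T' z x *\<^sub>R f z)"
    using bary_subface(1)[OF tT' _ xi] by (intro sum.mono_neutral_right tet_finite tT') auto
  have "bary T z x = bary T' z x" if z: "z \<in> T \<inter> T'" for z
  proof -
    have "(\<Sum>z\<in>T. bary T z x) = (\<Sum>z\<in>T \<inter> T'. bary T z x)"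
      using bary_subface(1)[OF tT _ xi] by (intro sum.mono_neutral_right tet_finite tT) auto
    moreover have "(\<Sum>z\<in>T. bary T z x *\<^sub>R z) = (\<Sum>z\<in>T \<inter> T'. bary T z x *\<^sub>R z)"
      using bary_subface(1)[OF tT _ xi] by (intro sum.mono_neutral_right tet_finite tT) auto
    ultimately have s: "(\<Sum>z\<in>T \<inter> T'. bary T z x) = 1" "(\<Sum>z\<in>T \<inter> T'. bary T z x *\<^sub>R z) = x"
      using bary_sum[OF tT] bary_point[OF tT] by simp_all
    \<comment> \<open>The coordinates in \<open>T\<close>, regarded as coordinates in \<open>T'\<close>.\<close>
    define w where "w z = (if z \<in> T then bary T z x else 0)" for z
    have "sum w T' = 1"
      using s(1) tet_finite[OF tT'] by (simp add: w_def sum.If_cases Int_commute)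
    moreover have "(\<Sum>z\<in>T'. w z *\<^sub>R z) = x"
    proof -
      have "(\<Sum>z\<in>T'. w z *\<^sub>R z) = (\<Sum>z\<in>T \<inter> T'. w z *\<^sub>R z)"
        by (rule sum.mono_neutral_right[OF tet_finite[OF tT']]) (auto simp: w_def)
      also have "\<dots> = (\<Sum>z\<in>T \<inter> T'. bary T z x *\<^sub>R z)" by (intro sum.cong refl) (auto simp: w_def)
      finally show ?thesis using s(2) by simp
    qed
    ultimately show ?thesis using bary_comb[OF tT', of z w] z by (simp add: w_def)
  qed
  then show ?thesis unfolding 1 2 by (intro sum.cong refl) simp
qed

lemma pwl_eq: "T \<in> PM \<Longrightarrow> x \<in> convex hull T \<Longrightarrow> pwl c x = (\<Sum>z\<in>T. bary T z x *\<^sub>R c (torus_rep z))"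
proof -
  assume T: "T \<in> PM" "x \<in> convex hull T"
  define T' where "T' = (SOME T. T \<in> PM \<and> x \<in> convex hull T)"
  have "T' \<in> PM \<and> x \<in> convex hull T'" unfolding T'_def by (rule someI) (use T in blast)
  then show ?thesis using bary_common[of T' T x "\<lambda>z. c (torus_rep z)"] T by (simp add: pwl_def T'_def Let_def)
qed

text \<open>
  Near a point only finitely many closed tetrahedra matter, and on each of them the function is affine.
\<close>

lemma pwl_continuous: "continuous_on UNIV (pwl c)"
proof -
  have "isCont (pwl c) x" for x
  proof -
    define S where "S = {T \<in> PM. convex hull T \<inter> cball x 1 \<noteq> {}}"
    have fin: "finite S" unfolding S_def by (rule locally_finite[OF bounded_cball])
    have "continuous_on (\<Union>T\<in>S. convex hull T) (pwl c)"
    proof (rule continuous_on_closed_Union[OF fin])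
      fix T assume "T \<in> S"
      then have T: "T \<in> PM" by (simp add: S_def)
      show "closed (convex hull T)"
        by (intro compact_imp_closed finite_imp_compact_convex_hull tet_finite tet_PM T)
      have "continuous_on (convex hull T) (\<lambda>x. \<Sum>z\<in>T. bary T z x *\<^sub>R c (torus_rep z))"
        unfolding bary_def by (intro continuous_intros)
      then show "continuous_on (convex hull T) (pwl c)"
        by (rule continuous_on_eq) (simp add: pwl_eq[OF T])
    qed
    moreover have "ball x 1 \<subseteq> (\<Union>T\<in>S. convex hull T)"
    proof
      fix y assume y: "y \<in> ball x 1"
      obtain T where "T \<in> PM" "y \<in> convex hull T" using cover by blast
      then show "y \<in> (\<Union>T\<in>S. convex hull T)" using y ball_subset_cball unfolding S_def by blast
    qed
    ultimately have "continuous_on (ball x 1) (pwl c)" by (rule continuous_on_subset)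
    then show ?thesis by (simp add: continuous_on_eq_continuous_at)
  qed
  then show ?thesis by (simp add: continuous_on_eq_continuous_at)
qed

lemma pwl_periodic: "periodic (pwl c)"
  unfolding periodic_def
proof (intro allI ballI)
  fix x k assume k: "k \<in> lattice"
  obtain T where T: "T \<in> PM" "x \<in> convex hull T" using cover by blast
  have "pwl c (k + x) = (\<Sum>z\<in>(+) k ` T. bary ((+) k ` T) z (k + x) *\<^sub>R c (torus_rep z))"
    by (rule pwl_eq[OF PM_translate[OF T(1) k] hull_translation[OF T(2)]])
  also have "\<dots> = (\<Sum>z\<in>T. bary ((+) k ` T) (k + z) (k + x) *\<^sub>R c (torus_rep (k + z)))"
    by (subst sum.reindex) auto
  also have "\<dots> = pwl c x"
    unfolding pwl_eq[OF T] by (intro sum.cong refl) (simp add: bary_translation[OF tet_PM[OF T(1)]] torus_rep_add(2)[OF k])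
  finally show "pwl c (x + k) = pwl c x" by (simp add: add.commute)
qed

lemma pw_linear_pwl: "pw_linear \<T> (pwl c)"
  unfolding pw_linear_def
proof (intro conjI ballI pwl_continuous pwl_periodic)
  fix T assume "T \<in> \<T>"
  then have T: "T \<in> PM" by (rule mesh_PM)
  have "linear (\<lambda>x. \<Sum>z\<in>T. (bgrad T z \<bullet> x) *\<^sub>R c (torus_rep z))"
    by (rule linearI) (simp_all add: inner_add_right scaleR_add_left sum.distrib scaleR_sum_right)
  moreover have "\<forall>x\<in>convex hull T. pwl c x = (\<Sum>z\<in>T. (bgrad T z \<bullet> x) *\<^sub>R c (torus_rep z)) + (\<Sum>z\<in>T. bary T z 0 *\<^sub>R c (torus_rep z))"
    by (simp add: pwl_eq[OF T] bary_def inner_diff_right algebra_simps flip: sum.distrib)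
  ultimately show "\<exists>A b. linear A \<and> (\<forall>x\<in>convex hull T. pwl c x = A x + b)" by blast
qed

lemma pwl_vertex: "y \<in> vertices \<T> \<Longrightarrow> pwl c y = c y"
proof -
  assume y: "y \<in> vertices \<T>"
  then obtain T where T: "T \<in> PM" "y \<in> T" using vertices_PM by blast
  have tT: "tet T" by (rule tet_PM[OF T(1)])
  have "pwl c y = (\<Sum>z\<in>T. bary T z y *\<^sub>R c (torus_rep z))" by (rule pwl_eq[OF T(1) hull_inc[OF T(2)]])
  also have "\<dots> = (\<Sum>z\<in>T. if z = y then c (torus_rep z) else 0)"
    by (intro sum.cong refl) (auto simp: bary_vertex[OF tT _ T(2)])
  finally show ?thesis using T(2) tet_finite[OF tT] by (simp add: vertices_torus_rep[OF y])
qed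

lemma pw_linear_nodal:
  assumes f: "pw_linear \<T> f" and T: "T \<in> PM" and x: "x \<in> convex hull T"
  shows "f x = (\<Sum>z\<in>T. bary T z x *\<^sub>R f z)"
proof -
  obtain k T0 where k: "k \<in> lattice" "T0 \<in> \<T>" "T = (+) k ` T0" using PM_D[OF T] by blast
  have t0: "tet T0" by (rule tet_mesh[OF k(2)])
  have per: "f (k + y) = f y" for y
    using f k(1) unfolding pw_linear_def periodic_def by (metis add.commute)
  obtain y where y: "y \<in> convex hull T0" "x = k + y" using x k(3) by (auto simp: convex_hull_translation)
  obtain A b where A: "linear A" "\<And>x. x \<in> convex hull T0 \<Longrightarrow> f x = A x + b"
    using f k(2) unfolding pw_linear_def by blast
  have "f x = A (\<Sum>z\<in>T0. bary T0 z y *\<^sub>R z) + b" using A(2)[OF y(1)] per y(2) by (simp add: bary_point[OF t0])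
  also have "\<dots> = (\<Sum>z\<in>T0. bary T0 z y *\<^sub>R (A z + b))"
    by (simp add: linear_sum[OF A(1)] linear_scale[OF A(1)] scaleR_add_right sum.distrib scaleR_sum_left[symmetric] bary_sum[OF t0])
  also have "\<dots> = (\<Sum>z\<in>T0. bary T0 z y *\<^sub>R f z)"
    by (intro sum.cong refl) (simp add: A(2) hull_inc)
  also have "\<dots> = (\<Sum>z\<in>T0. bary T (k + z) x *\<^sub>R f (k + z))"
    by (intro sum.cong refl) (simp add: k(3) y(2) bary_translation[OF t0] per)
  also have "\<dots> = (\<Sum>z\<in>T. bary T z x *\<^sub>R f z)"
    unfolding k(3) by (subst sum.reindex) auto
  finally show ?thesis .
qed

lemma pw_linear_eq_pwl: "pw_linear \<T> f \<Longrightarrow> f = pwl f"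
proof
  fix x assume f: "pw_linear \<T> f"
  obtain T where T: "T \<in> PM" "x \<in> convex hull T" using cover by blast
  have "f (torus_rep z) = f z" for z using f by (intro periodic_torus_rep) (simp add: pw_linear_def)
  then show "f x = pwl f x" by (simp add: pwl_eq[OF T] pw_linear_nodal[OF f T])
qed

lemma pwl_cong: "(\<And>y. y \<in> vertices \<T> \<Longrightarrow> c y = d y) \<Longrightarrow> pwl c = pwl d"
proof
  fix x assume c: "\<And>y. y \<in> vertices \<T> \<Longrightarrow> c y = d y"
  obtain T where T: "T \<in> PM" "x \<in> convex hull T" using cover by blast
  show "pwl c x = pwl d x"
    unfolding pwl_eq[OF T] by (intro sum.cong refl) (simp add: c vertex_torus_rep[OF T(1)])
qed

lemma pw_linear_unique:
  assumes "pw_linear \<T> f" "pw_linear \<T> g" "\<And>y. y \<in> vertices \<T> \<Longrightarrow> f y = g y"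
  shows "f = g"
proof -
  have "f = pwl f" by (rule pw_linear_eq_pwl[OF assms(1)])
  also have "\<dots> = pwl g" by (rule pwl_cong[OF assms(3)])
  also have "\<dots> = g" by (rule pw_linear_eq_pwl[OF assms(2), symmetric])
  finally show ?thesis .
qed

lemma hat_eq:
  assumes y: "y \<in> vertices \<T>"
  shows "hat \<T> y = pwl (\<lambda>z. of_bool (z = y))"
  unfolding hat_def
proof (rule the_equality)
  show "pw_linear \<T> (pwl (\<lambda>z. of_bool (z = y) :: real)) \<and> pwl (\<lambda>z. of_bool (z = y)) y = (1 :: real) \<and>
      (\<forall>z\<in>vertices \<T> - {y}. pwl (\<lambda>z. of_bool (z = y)) z = (0 :: real))"
    using y by (simp add: pw_linear_pwl pwl_vertex)
next
  fix f :: "real ^ 3 \<Rightarrow> real"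
  assume f: "pw_linear \<T> f \<and> f y = 1 \<and> (\<forall>z\<in>vertices \<T> - {y}. f z = 0)"
  show "f = pwl (\<lambda>z. of_bool (z = y))"
  proof (rule pw_linear_unique[OF _ pw_linear_pwl])
    fix z assume "z \<in> vertices \<T>"
    then show "f z = pwl (\<lambda>z. of_bool (z = y)) z" using f by (cases "z = y") (simp_all add: pwl_vertex)
  qed (use f in blast)
qed

lemma pwl_sum_hat: "pwl c x = (\<Sum>y\<in>vertices \<T>. hat \<T> y x *\<^sub>R c y)"
proof -
  obtain T where T: "T \<in> PM" "x \<in> convex hull T" using cover by blast
  have "(\<Sum>y\<in>vertices \<T>. hat \<T> y x *\<^sub>R c y) = (\<Sum>y\<in>vertices \<T>. \<Sum>z\<in>T. (bary T z x * of_bool (torus_rep z = y)) *\<^sub>R c y)"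
    by (intro sum.cong refl) (simp add: hat_eq pwl_eq[OF T] scaleR_sum_left)
  also have "\<dots> = (\<Sum>z\<in>T. \<Sum>y\<in>vertices \<T>. (bary T z x * of_bool (torus_rep z = y)) *\<^sub>R c y)"
    by (rule sum.swap)
  also have "\<dots> = (\<Sum>z\<in>T. bary T z x *\<^sub>R c (torus_rep z))"
  proof (intro sum.cong refl)
    fix z assume z: "z \<in> T"
    have "(\<Sum>y\<in>vertices \<T>. (bary T z x * of_bool (torus_rep z = y)) *\<^sub>R c y)
       = (\<Sum>y\<in>vertices \<T>. if torus_rep z = y then bary T z x *\<^sub>R c y else 0)"
      by (intro sum.cong refl) auto
    then show "(\<Sum>y\<in>vertices \<T>. (bary T z x * of_bool (torus_rep z = y)) *\<^sub>R c y) = bary T z x *\<^sub>R c (torus_rep z)"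
      using finite_vertices vertex_torus_rep[OF T(1) z] by simp
  qed
  finally show ?thesis by (simp add: pwl_eq[OF T])
qed

lemma X0_eq: "f \<in> X0 \<T> \<Longrightarrow> f = pwl f"
  unfolding X0_def mem_Collect_eq by (rule pw_linear_eq_pwl)

lemma pwl_X0: "pwl c \<in> X0 \<T>"
  by (simp add: X0_def pw_linear_pwl)

lemma I0_eq: "I0 \<T> u = pwl u"
  unfolding I0_def
proof (rule the_equality)
  show "pwl u \<in> X0 \<T> \<and> (\<forall>y\<in>vertices \<T>. pwl u y = u y)" by (simp add: pwl_X0 pwl_vertex)
next
  fix v assume "v \<in> X0 \<T> \<and> (\<forall>y\<in>vertices \<T>. v y = u y)"
  then show "v = pwl u"
    by (intro pw_linear_unique pw_linear_pwl) (simp_all add: X0_def pwl_vertex)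
qed

text \<open>
  Integration by parts on each tetrahedron for the field \<open>w f\<close>. Since \<open>w f\<close> is continuous and
  periodic, the boundary terms depend on the tetrahedron only through the area vector and cancel.
\<close>

lemma weak_divergence:
  assumes f: "f \<in> X0 \<T>" and w: "w \<in> smoothS"
  shows "l2 (mat_div w) f = - l2 w (sym_grad_h \<T> f)"
proof -
  have sw: "smooth w" by (rule smoothS_smooth[OF w])
  have sym: "w x $ i $ j = w x $ j $ i" for x i j by (rule smoothS_nth_sym[OF w])
  have f': "pw_linear \<T> f" using f by (simp add: X0_def)
  then have cf: "continuous_on UNIV f" and pf: "periodic f" by (auto simp: pw_linear_def)
  have cw: "continuous_on UNIV w" by (rule smooth_continuous_on[OF sw])
  have cd: "continuous_on UNIV (mat_div w)" using mat_div_smoothV[OF w] smoothV_smooth smooth_continuous_on by blast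
  define X where "X x = w x *v f x" for x
  define \<Phi> where "\<Phi> F N = face_mean F (\<lambda>x. N \<bullet> X x)" for F N
  define I where "I T = integral (convex hull T) (\<lambda>x. mat_div w x \<bullet> f x)" for T
  have el: "((\<lambda>x. w x \<bullet> sym_grad_h \<T> f x) has_integral (- I T - (\<Sum>z\<in>T. \<Phi> (T - {z}) (hull_vol6 T *\<^sub>R bgrad T z)))) (convex hull T)"
    if T: "T \<in> \<T>" for T
  proof -
    have tT: "tet T" by (rule tet_mesh[OF T])
    have fin: "finite T" by (rule tet_finite[OF tT])
    obtain A b where A: "linear A" "\<And>x. x \<in> convex hull T \<Longrightarrow> f x = A x + b"
      using f' T unfolding pw_linear_def by blast
    define G where "G = (\<chi> i j. (A (axis j 1) $ i + A (axis i 1) $ j) / 2 :: real ^ 3 ^ 3)"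
    define E where "E x = A x + b" for x
    have sE: "smooth E"
      unfolding E_def[abs_def] by (rule smooth_affine[OF A(1)])
    define Y where "Y x = w x *v E x" for x
    have Ynth: "Y x $ j = (\<Sum>i\<in>UNIV. w x $ i $ j * E x $ i)" for x j
      unfolding Y_def matrix_vector_mult_def using sym by simp
    have sY: "smooth Y"
    proof (rule smooth_vecI)
      fix j show "smooth (\<lambda>x. Y x $ j)"
        unfolding Ynth by (intro smooth_sum smooth_mult smooth_vec_nth sw sE)
    qed
    have pdE: "pd j (\<lambda>y. E y $ i) x = A (axis j 1) $ i" for i j x
    proof -
      have "(E has_derivative A) (at x)" unfolding E_def[abs_def] by (rule affine_has_derivative[OF A(1)])
      then show ?thesis by (simp add: pd_vec_nth[OF sE, symmetric] pd_unique)
    qed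
    have divY: "(\<Sum>j\<in>UNIV. pd j (\<lambda>y. Y y $ j) x) = mat_div w x \<bullet> E x + w x \<bullet> G" for x
    proof -
      have "pd j (\<lambda>y. Y y $ j) x = (\<Sum>i\<in>UNIV. pd j (\<lambda>y. w y $ i $ j) x * E x $ i + w x $ i $ j * A (axis j 1) $ i)" for j
      proof -
        have "pd j (\<lambda>y. Y y $ j) x = (\<Sum>i\<in>UNIV. pd j (\<lambda>y. w y $ i $ j * E y $ i) x)"
          unfolding Ynth pd_dd by (rule dd_sum) (auto intro!: smooth_mult smooth_vec_nth sw sE)
        also have "\<dots> = (\<Sum>i\<in>UNIV. pd j (\<lambda>y. w y $ i $ j) x * E x $ i + w x $ i $ j * A (axis j 1) $ i)"
        proof (intro sum.cong refl)
          fix i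
          show "pd j (\<lambda>y. w y $ i $ j * E y $ i) x = pd j (\<lambda>y. w y $ i $ j) x * E x $ i + w x $ i $ j * A (axis j 1) $ i"
            using dd_mult[OF smooth_vec_nth[OF smooth_vec_nth[OF sw]] smooth_vec_nth[OF sE]] pdE
            by (simp add: pd_dd)
        qed
        finally show ?thesis .
      qed
      then have "(\<Sum>j\<in>UNIV. pd j (\<lambda>y. Y y $ j) x)
         = (\<Sum>j\<in>UNIV. \<Sum>i\<in>UNIV. pd j (\<lambda>y. w y $ i $ j) x * E x $ i) + (\<Sum>j\<in>UNIV. \<Sum>i\<in>UNIV. w x $ i $ j * A (axis j 1) $ i)"
        by (simp add: sum.distrib)
      also have "(\<Sum>j\<in>UNIV. \<Sum>i\<in>UNIV. pd j (\<lambda>y. w y $ i $ j) x * E x $ i) = mat_div w x \<bullet> E x"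
        by (subst sum.swap) (simp add: inner_vec_def mat_div_nth[OF sw] sum_distrib_right)
      also have "(\<Sum>j\<in>UNIV. \<Sum>i\<in>UNIV. w x $ i $ j * A (axis j 1) $ i) = w x \<bullet> G"
        using sym[of x 2 1] sym[of x 3 1] sym[of x 3 2] by (simp add: inner_vec_def G_def sum_3 field_simps)
      finally show ?thesis .
    qed
    have Iface: "face_mean (T - {z}) (\<lambda>x. N \<bullet> Y x) = \<Phi> (T - {z}) N" for z N
      unfolding \<Phi>_def face_mean_def
    proof (intro arg_cong[where f="\<lambda>r. r / 6"] sum.cong refl, clarify)
      fix a b c assume "(a, b, c) \<in> enum3 (T - {z})"
      then have "convex hull {a, b, c} \<subseteq> convex hull T" by (intro hull_mono) (auto simp: mem_enum3)
      then show "mean2 a b c (\<lambda>x. N \<bullet> Y x) = mean2 a b c (\<lambda>x. N \<bullet> X x)"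
        by (intro mean2_cong) (auto simp: X_def Y_def E_def A(2))
    qed
    have i1: "(\<lambda>x. mat_div w x \<bullet> E x) integrable_on (convex hull T)" and i2: "(\<lambda>x. w x \<bullet> G) integrable_on (convex hull T)"
      by (intro continuous_integrable_hull fin continuous_intros cd cw smooth_continuous_on sE)+
    have "integral (convex hull T) (\<lambda>x. mat_div w x \<bullet> E x) + integral (convex hull T) (\<lambda>x. w x \<bullet> G)
        = - (\<Sum>z\<in>T. \<Phi> (T - {z}) (hull_vol6 T *\<^sub>R bgrad T z))"
      using divergence_tet[OF tT sY] unfolding divY Iface
      by (simp add: Henstock_Kurzweil_Integration.integral_add[OF i1 i2])
    moreover have "integral (convex hull T) (\<lambda>x. mat_div w x \<bullet> E x) = I T"
      unfolding I_def by (rule Henstock_Kurzweil_Integration.integral_cong) (simp add: E_def A(2))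
    ultimately have "integral (convex hull T) (\<lambda>x. w x \<bullet> G) = - I T - (\<Sum>z\<in>T. \<Phi> (T - {z}) (hull_vol6 T *\<^sub>R bgrad T z))"
      by linarith
    then have "((\<lambda>x. w x \<bullet> G) has_integral (- I T - (\<Sum>z\<in>T. \<Phi> (T - {z}) (hull_vol6 T *\<^sub>R bgrad T z)))) (convex hull T)"
      using integrable_integral[OF i2] by simp
    then show ?thesis
    proof (rule has_integral_spike[OF negligible_convex_frontier[OF convex_convex_hull], rotated])
      fix x assume "x \<in> convex hull T - frontier (convex hull T)"
      then have x: "x \<in> interior (convex hull T)" using closure_subset unfolding frontier_def by blast
      then have "x \<in> mesh_interior \<T>" using mesh_PM[OF T] unfolding mesh_interior_def by blast
      then show "w x \<bullet> sym_grad_h \<T> f x = w x \<bullet> G"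
        unfolding sym_grad_h_def using sym_grad_affine[OF A(1) A(2) x] by (simp add: G_def)
    qed
  qed
  have zero: "(\<Sum>T\<in>\<T>. \<Sum>j\<in>T. \<Phi> (T - {j}) (hull_vol6 T *\<^sub>R bgrad T j)) = 0"
  proof (rule flag_cancellation)
    fix F N show "\<Phi> F (- N) = - \<Phi> F N"
      unfolding \<Phi>_def face_mean_def using mean2_cmult[of _ _ _ "-1"] by (simp add: case_prod_unfold sum_negf)
  next
    fix T j k N assume k: "k \<in> lattice"
    have "f (x + k) = f x" "w (x + k) = w x" for x
      using pf w k by (auto simp: periodic_def smoothS_def)
    then have "X (k + x) = X x" for x
      by (simp only: X_def add.commute[of k x])
    then show "\<Phi> ((+) k ` (T - {j})) N = \<Phi> (T - {j}) N"
      unfolding \<Phi>_def face_mean_def sum_enum3_translation mean2_translation by simp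
  qed
  have "((\<lambda>x. w x \<bullet> sym_grad_h \<T> f x) has_integral (\<Sum>T\<in>\<T>. - I T - (\<Sum>z\<in>T. \<Phi> (T - {z}) (hull_vol6 T *\<^sub>R bgrad T z)))) (cbox 0 1)"
    by (rule has_integral_cube[OF el])
  then have "l2 w (sym_grad_h \<T> f) = (\<Sum>T\<in>\<T>. - I T - (\<Sum>z\<in>T. \<Phi> (T - {z}) (hull_vol6 T *\<^sub>R bgrad T z)))"
    unfolding l2_def by (rule integral_unique)
  also have "\<dots> = - (\<Sum>T\<in>\<T>. I T)" by (simp add: sum_subtractf zero sum_negf)
  also have "((\<lambda>x. mat_div w x \<bullet> f x) has_integral (\<Sum>T\<in>\<T>. I T)) (cbox 0 1)"
  proof (rule has_integral_cube)
    fix T assume "T \<in> \<T>"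
    then show "((\<lambda>x. mat_div w x \<bullet> f x) has_integral I T) (convex hull T)"
      unfolding I_def
      by (intro integrable_integral continuous_integrable_hull continuous_intros cd cf tet_finite tet_mesh)
  qed
  then have "(\<Sum>T\<in>\<T>. I T) = l2 (mat_div w) f" unfolding l2_def by (simp add: integral_unique)
  finally show ?thesis by simp
qed

end

section \<open>Piecewise constant matrix fields and their edge values\<close>

lemma Icc_integral_lborel:
  fixes g :: "real \<Rightarrow> real"
  assumes "continuous_on {0..1} g"
  shows "integral {0..1} g = (\<integral>s. indicator {0..1} s *\<^sub>R g s \<partial>lborel)"
proof -
  have "set_integrable lborel {0..1} g"
    unfolding set_integrable_def by (rule borel_integrable_compact[OF compact_Icc assms])
  then show ?thesis using set_borel_integral_eq_integral(2)[of "{0..1}" g] by (simp add: set_lebesgue_integral_def)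
qed

lemma tt_integral_const:
  assumes "a \<noteq> b"
  shows "tt_integral (a, b) (\<lambda>_. M) = ((b - a) \<bullet> (M *v (b - a))) / norm (b - a)"
  using assms by (simp add: tt_integral_def edge_integral_def tangent_def matrix_vector_mult_scaleR)

lemma tt_integral_edge_mean:
  assumes v: "smooth v" and ab: "a \<noteq> b"
  shows "tt_integral (a, b) v = edge_mean a b v / norm (b - a)"
proof -
  let ?n = "norm (b - a)"
  have n: "?n \<noteq> 0" using ab by simp
  have c: "continuous_on UNIV (form v (b - a) (b - a))" by (rule smooth_continuous_on[OF smooth_form[OF v]])
  have c': "continuous_on {0..1} (\<lambda>s. form v (b - a) (b - a) (a + s *\<^sub>R (b - a)))"
    by (rule continuous_compose_UNIV[OF c]) (intro continuous_intros)
  have "(\<lambda>s. tangent (a, b) \<bullet> (v (linepath a b s) *v tangent (a, b)))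
     = (\<lambda>s. (1 / (?n * ?n)) * form v (b - a) (b - a) (a + s *\<^sub>R (b - a)))"
    by (simp add: fun_eq_iff tangent_def form_def matrix_vector_mult_scaleR linepath_def algebra_simps)
  then have "tt_integral (a, b) v = ?n * ((1 / (?n * ?n)) * integral {0..1} (\<lambda>s. form v (b - a) (b - a) (a + s *\<^sub>R (b - a))))"
    by (simp add: tt_integral_def edge_integral_def)
  also have "integral {0..1} (\<lambda>s. form v (b - a) (b - a) (a + s *\<^sub>R (b - a))) = edge_mean a b v"
    unfolding edge_mean_def mean1_def by (rule Icc_integral_lborel[OF c'])
  finally show ?thesis using n by simp
qed

lemma tet_interior: "tet T \<Longrightarrow> \<exists>x. x \<in> interior (convex hull T)"
proof -
  assume T: "tet T"
  define c where "c = (\<Sum>y\<in>T. (1/4 :: real) *\<^sub>R y)"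
  have "sum (\<lambda>z. 1/4 :: real) T = 1" using T by (simp add: tet_def)
  then have b: "bary T z c = 1/4" if "z \<in> T" for z
    unfolding c_def using bary_comb[OF T that, of "\<lambda>_. 1/4"] by blast
  have "0 < bary T z c" if "z \<in> T" for z using b[OF that] by linarith
  then have "c \<in> interior (convex hull T)" unfolding interior_iff_bary[OF T] by simp
  then show ?thesis by blast
qed

lemma edge_mean_translation:
  assumes v: "v \<in> smoothS" and k: "k \<in> lattice"
  shows "edge_mean (k + a) (k + b) v = edge_mean a b v"
proof -
  have pv: "v (x + k) = v x" for x using v k unfolding smoothS_def periodic_def by blast
  have q: "form v c d (k + x) = form v c d x" for c d x using pv[of x] by (simp add: form_def add.commute)
  show ?thesis unfolding edge_mean_def mean1_def by (simp add: add.assoc q)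
qed

lemma face_flux_translation:
  assumes v: "v \<in> smoothS" and k: "k \<in> lattice"
  shows "face_flux (k + p) (k + a) (k + b) v N = face_flux p a b v N"
proof -
  have sm: "smooth v" by (rule smoothS_smooth[OF v])
  have pv: "v (x + k) = v x" for x using v k unfolding smoothS_def periodic_def by blast
  have q: "form v c d (k + x) = form v c d x" for c d x using pv[of x] by (simp add: form_def add.commute)
  have "periodic (form v c d)" for c d
    using v unfolding smoothS_def periodic_def form_def by simp
  then have "periodic (dform v w c d)" for w c d
    unfolding dform_def[abs_def] by (intro periodic_dd smooth_form sm)
  then have dqp: "dform v w c d (k + x) = dform v w c d x" for w c d x
    using k unfolding periodic_def by (metis add.commute)
  have "christoffel (k + p) (k + a) (k + b) v N (k + x) = christoffel p a b v N x" for x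
    unfolding christoffel_def by (simp add: dqp)
  then show ?thesis
    unfolding face_flux_def face_term_def mean2_translation by (simp add: mean1_def add.assoc q)
qed

text \<open>
  The symmetric matrix whose quadratic form has the value \<open>d a b\<close> on the edge \<open>a - b\<close>: the
  expansion in \<open>mat_inner_expand\<close> read as a definition.
\<close>

definition edge_matrix :: "(real ^ 3) set \<Rightarrow> (real ^ 3 \<Rightarrow> real ^ 3 \<Rightarrow> real) \<Rightarrow> real ^ 3 ^ 3" where
  "edge_matrix T d = (\<chi> i j. - (1/2) * (\<Sum>a\<in>T. \<Sum>b\<in>T. d a b * (bgrad T a $ i * bgrad T b $ j)))"

lemma edge_matrix_form:
  "x \<bullet> (edge_matrix T d *v y) = - (1/2) * (\<Sum>a\<in>T. \<Sum>b\<in>T. d a b * ((bgrad T a \<bullet> x) * (bgrad T b \<bullet> y)))"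
proof -
  have "x \<bullet> (edge_matrix T d *v y) = (\<Sum>i\<in>UNIV. \<Sum>j\<in>UNIV. x $ i * edge_matrix T d $ i $ j * y $ j)"
    by (simp add: inner_vec_def matrix_vector_mult_def sum_distrib_left mult.assoc)
  also have "\<dots> = (\<Sum>i\<in>UNIV. \<Sum>j\<in>UNIV. \<Sum>a\<in>T. \<Sum>b\<in>T. - (1/2) * (d a b * (bgrad T a $ i * x $ i * (bgrad T b $ j * y $ j))))"
    by (simp add: edge_matrix_def sum_distrib_left sum_distrib_right sum_negf algebra_simps)
  also have "\<dots> = (\<Sum>i\<in>UNIV. \<Sum>a\<in>T. \<Sum>j\<in>UNIV. \<Sum>b\<in>T. - (1/2) * (d a b * (bgrad T a $ i * x $ i * (bgrad T b $ j * y $ j))))"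
    by (intro sum.cong[OF refl] sum.swap)
  also have "\<dots> = (\<Sum>a\<in>T. \<Sum>i\<in>UNIV. \<Sum>j\<in>UNIV. \<Sum>b\<in>T. - (1/2) * (d a b * (bgrad T a $ i * x $ i * (bgrad T b $ j * y $ j))))"
    by (rule sum.swap)
  also have "\<dots> = (\<Sum>a\<in>T. \<Sum>i\<in>UNIV. \<Sum>b\<in>T. \<Sum>j\<in>UNIV. - (1/2) * (d a b * (bgrad T a $ i * x $ i * (bgrad T b $ j * y $ j))))"
    by (rule sum.cong[OF refl], rule sum.cong[OF refl], rule sum.swap)
  also have "\<dots> = (\<Sum>a\<in>T. \<Sum>b\<in>T. \<Sum>i\<in>UNIV. \<Sum>j\<in>UNIV. - (1/2) * (d a b * (bgrad T a $ i * x $ i * (bgrad T b $ j * y $ j))))"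
    by (rule sum.cong[OF refl], rule sum.swap)
  also have "\<dots> = (\<Sum>a\<in>T. \<Sum>b\<in>T. - (1/2) * (d a b * ((bgrad T a \<bullet> x) * (bgrad T b \<bullet> y))))"
  proof -
    have "(bgrad T a \<bullet> x) * (bgrad T b \<bullet> y) = (\<Sum>i\<in>UNIV. \<Sum>j\<in>UNIV. bgrad T a $ i * x $ i * (bgrad T b $ j * y $ j))" for a b
      by (simp only: inner_vec_def inner_real_def sum_product)
    then show ?thesis by (simp only: sum_distrib_left)
  qed
  finally show ?thesis by (simp only: sum_distrib_left)
qed

lemma edge_matrix_edge:
  assumes T: "tet T" and sym: "\<And>a b. d a b = d b a" and diag: "\<And>a. d a a = 0" and pq: "p \<in> T" "q \<in> T"
  shows "(p - q) \<bullet> (edge_matrix T d *v (p - q)) = d p q"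
proof (cases "p = q")
  case False
  have fin: "finite T" by (rule tet_finite[OF T])
  have row: "(\<Sum>b\<in>T. d a b * ((bgrad T a \<bullet> (p - q)) * (bgrad T b \<bullet> (p - q)))) = (bgrad T a \<bullet> (p - q)) * (d a p - d a q)" for a
  proof -
    have "(\<Sum>b\<in>T. d a b * ((bgrad T a \<bullet> (p - q)) * (bgrad T b \<bullet> (p - q))))
       = (\<Sum>b\<in>T. (if b = p then d a b * (bgrad T a \<bullet> (p - q)) else 0) - (if b = q then d a b * (bgrad T a \<bullet> (p - q)) else 0))"
      using False by (intro sum.cong refl) (auto simp: bgrad_diff[OF T _ pq])
    also have "\<dots> = d a p * (bgrad T a \<bullet> (p - q)) - d a q * (bgrad T a \<bullet> (p - q))"
      using fin pq by (simp add: sum_subtractf)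
    finally show ?thesis by (simp add: algebra_simps)
  qed
  have "(\<Sum>a\<in>T. \<Sum>b\<in>T. d a b * ((bgrad T a \<bullet> (p - q)) * (bgrad T b \<bullet> (p - q))))
      = (\<Sum>a\<in>T. (if a = p then d a p - d a q else 0) - (if a = q then d a p - d a q else 0))"
    unfolding row using False by (intro sum.cong refl) (auto simp: bgrad_diff[OF T _ pq])
  also have "\<dots> = (d p p - d p q) - (d q p - d q q)"
    using fin pq by (simp add: sum_subtractf)
  finally show ?thesis unfolding edge_matrix_form by (simp add: diag sym[of q p])
qed (simp add: diag)

lemma edge_matrix_sym: "(\<And>a b. d a b = d b a) \<Longrightarrow> transpose (edge_matrix T d) = edge_matrix T d"
proof (rule transpose_eqI)
  fix i j assume sym: "\<And>a b. d a b = d b a"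
  have "(\<Sum>a\<in>T. \<Sum>b\<in>T. d a b * (bgrad T a $ i * bgrad T b $ j)) = (\<Sum>b\<in>T. \<Sum>a\<in>T. d a b * (bgrad T a $ i * bgrad T b $ j))"
    by (rule sum.swap)
  also have "\<dots> = (\<Sum>b\<in>T. \<Sum>a\<in>T. d b a * (bgrad T b $ j * bgrad T a $ i))"
    by (intro sum.cong refl) (simp add: sym mult.commute)
  finally show "edge_matrix T d $ i $ j = edge_matrix T d $ j $ i" by (simp add: edge_matrix_def)
qed

lemma mat_eq_edge_matrix:
  assumes T: "tet T" and M: "transpose M = M" and d: "\<And>a b. a \<in> T \<Longrightarrow> b \<in> T \<Longrightarrow> (a - b) \<bullet> (M *v (a - b)) = d a b"
    and sym: "\<And>a b. d a b = d b a" and diag: "\<And>a. d a a = 0"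
  shows "M = edge_matrix T d"
proof -
  have eq: "M \<bullet> W = edge_matrix T d \<bullet> W" for W
    unfolding mat_inner_expand[OF T M] mat_inner_expand[OF T edge_matrix_sym[where d=d, OF sym]]
    using d edge_matrix_edge[where d=d, OF T sym diag] by (simp cong: sum.cong)
  have "(M - edge_matrix T d) \<bullet> (M - edge_matrix T d) = 0"
    using eq[of "M - edge_matrix T d"] by (simp add: inner_diff_left)
  then show ?thesis by simp
qed

lemma edge_matrix_cong: "(\<And>a b. a \<in> T \<Longrightarrow> b \<in> T \<Longrightarrow> d a b = d' a b) \<Longrightarrow> edge_matrix T d = edge_matrix T d'"
  unfolding edge_matrix_def by (simp cong: sum.cong)

lemma edge_matrix_sum: "edge_matrix T (\<lambda>a b. \<Sum>e\<in>E. c e * d e a b) = (\<Sum>e\<in>E. c e *\<^sub>R edge_matrix T (d e))"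
proof (cases "finite E")
  case True
  then show ?thesis
  proof induction
    case empty
    show ?case by (simp add: edge_matrix_def vec_eq_iff)
  next
    case (insert x E)
    have "edge_matrix T (\<lambda>a b. c x * d x a b + (\<Sum>e\<in>E. c e * d e a b)) = c x *\<^sub>R edge_matrix T (d x) + edge_matrix T (\<lambda>a b. \<Sum>e\<in>E. c e * d e a b)"
      by (simp add: edge_matrix_def vec_eq_iff sum.distrib sum_distrib_left algebra_simps)
    then show ?case using insert by simp
  qed
qed (simp add: edge_matrix_def vec_eq_iff)

context mesh
begin

lemma elem_value_eqI:
  assumes T: "T \<in> PM" and M: "\<And>x. x \<in> interior (convex hull T) \<Longrightarrow> m x = M"
  shows "elem_value m T = M"
  unfolding elem_value_def
proof (rule the_equality)
  show "\<forall>x\<in>interior (convex hull T). m x = M" using M by blast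
next
  fix M' assume M': "\<forall>x\<in>interior (convex hull T). m x = M'"
  obtain x where "x \<in> interior (convex hull T)" using tet_interior[OF tet_PM[OF T]] by blast
  then show "M' = M" using M M' by metis
qed

lemma elem_value_eq:
  assumes m: "m \<in> X1 \<T>" and T: "T \<in> PM" and x: "x \<in> interior (convex hull T)"
  shows "m x = elem_value m T"
proof -
  obtain M where M: "\<And>x. x \<in> interior (convex hull T) \<Longrightarrow> m x = M" using m T unfolding X1_def by blast
  then show ?thesis using elem_value_eqI[OF T, of m M] x by simp
qed

lemma elem_value_sym: "m \<in> X1 \<T> \<Longrightarrow> T \<in> PM \<Longrightarrow> transpose (elem_value m T) = elem_value m T"
proof -
  assume m: "m \<in> X1 \<T>" and T: "T \<in> PM"
  obtain x where "x \<in> interior (convex hull T)" using tet_interior[OF tet_PM[OF T]] by blast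
  then have "m x = elem_value m T" by (rule elem_value_eq[OF m T])
  moreover have "transpose (m x) = m x" using m by (simp add: X1_def)
  ultimately show ?thesis by simp
qed

lemma interior_translation_hull: "x \<in> interior (convex hull T) \<Longrightarrow> k + x \<in> interior (convex hull ((+) k ` T))" for x :: "real ^ 3"
  using interior_translation[of k "convex hull T"] by (simp add: convex_hull_translation)

lemma elem_value_translation:
  assumes m: "m \<in> X1 \<T>" and T: "T \<in> PM" and k: "k \<in> lattice"
  shows "elem_value m ((+) k ` T) = elem_value m T"
proof -
  obtain x where x: "x \<in> interior (convex hull T)" using tet_interior[OF tet_PM[OF T]] by blast
  have "elem_value m ((+) k ` T) = m (k + x)"
    by (rule elem_value_eq[OF m PM_translate[OF T k] interior_translation_hull[OF x], symmetric])
  also have "\<dots> = m x"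
  proof -
    have "m (x + k) = m x" using m k unfolding X1_def periodic_def by blast
    then show ?thesis by (simp add: add.commute)
  qed
  also have "\<dots> = elem_value m T" by (rule elem_value_eq[OF m T x])
  finally show ?thesis .
qed

text \<open>
  The quadratic form on the edge vector rather than on the unit tangent. It is independent of the
  tetrahedron by the condition in \<^const>\<open>X1\<close>, and defined for vertices, not for edges of the torus,
  so that it fits the local formula.
\<close>

definition edge_val :: "(real ^ 3 \<Rightarrow> real ^ 3 ^ 3) \<Rightarrow> real ^ 3 \<Rightarrow> real ^ 3 \<Rightarrow> real" where
  "edge_val m a b = (let T = SOME T. T \<in> PM \<and> {a, b} \<subseteq> T in (a - b) \<bullet> (elem_value m T *v (a - b)))"

lemma quad_minus: "(a - b) \<bullet> (M *v (a - b)) = (b - a) \<bullet> (M *v (b - a))" for M :: "real ^ 3 ^ 3"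
proof -
  have "M *v (a - b) = - (M *v (b - a))"
    by (metis minus_diff_eq matrix_vector_mult_diff_distrib)
  then show ?thesis using inner_minus_left[of "b - a" "- (M *v (b - a))"] by simp
qed

lemma edge_val_sym: "edge_val m a b = edge_val m b a"
  unfolding edge_val_def insert_commute[of b a] Let_def by (rule quad_minus)

lemma edge_val_diag: "edge_val m a a = 0" by (simp add: edge_val_def)

lemma X1_edge:
  assumes m: "m \<in> X1 \<T>" and T: "T \<in> PM" "T' \<in> PM" and ab: "a \<in> T \<inter> T'" "b \<in> T \<inter> T'"
  shows "(a - b) \<bullet> (elem_value m T *v (a - b)) = (a - b) \<bullet> (elem_value m T' *v (a - b))"
proof (cases "a = b")
  case False
  have "\<forall>T\<in>PM. \<forall>T'\<in>PM. \<forall>x\<in>T \<inter> T'. \<forall>z\<in>T \<inter> T'. x \<noteq> z \<longrightarrow>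
        tt_integral (x, z) (\<lambda>_. elem_value m T) = tt_integral (x, z) (\<lambda>_. elem_value m T')"
    using m unfolding X1_def by blast
  then have "tt_integral (b, a) (\<lambda>_. elem_value m T) = tt_integral (b, a) (\<lambda>_. elem_value m T')"
    using T ab False by metis
  then show ?thesis using False by (simp add: tt_integral_const)
qed simp

lemma edge_val_eq:
  assumes m: "m \<in> X1 \<T>" and T: "T \<in> PM" and ab: "a \<in> T" "b \<in> T"
  shows "edge_val m a b = (a - b) \<bullet> (elem_value m T *v (a - b))"
proof -
  define T' where "T' = (SOME T. T \<in> PM \<and> {a, b} \<subseteq> T)"
  have "T' \<in> PM \<and> {a, b} \<subseteq> T'" unfolding T'_def by (rule someI[of _ T]) (use T ab in blast)
  then show ?thesis using X1_edge[OF m _ T, of T' a b] ab by (simp add: edge_val_def T'_def Let_def)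
qed

lemma edge_dof_eq:
  assumes m: "m \<in> X1 \<T>" and T: "T \<in> PM" and ab: "a \<in> T" "b \<in> T" "a \<noteq> b"
  shows "edge_dof \<T> m (a, b) = edge_val m a b / norm (b - a)"
  unfolding edge_dof_def
proof (rule the_equality)
  show "\<forall>T\<in>PM. {fst (a, b), snd (a, b)} \<subseteq> T \<longrightarrow> tt_integral (a, b) (\<lambda>_. elem_value m T) = edge_val m a b / norm (b - a)"
    using ab(3) by (auto simp: tt_integral_const edge_val_eq[OF m] quad_minus[of b a])
next
  fix r assume r: "\<forall>T\<in>PM. {fst (a, b), snd (a, b)} \<subseteq> T \<longrightarrow> tt_integral (a, b) (\<lambda>_. elem_value m T) = r"
  then have "tt_integral (a, b) (\<lambda>_. elem_value m T) = r" using T ab by simp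
  then show "r = edge_val m a b / norm (b - a)"
    using ab(3) by (simp add: tt_integral_const edge_val_eq[OF m T ab(1,2)] quad_minus[of b a])
qed

lemma edge_val_translation:
  assumes m: "m \<in> X1 \<T>" and T: "T \<in> PM" and ab: "a \<in> T" "b \<in> T" and k: "k \<in> lattice"
  shows "edge_val m (k + a) (k + b) = edge_val m a b"
proof -
  have "edge_val m (k + a) (k + b) = (a - b) \<bullet> (elem_value m ((+) k ` T) *v (a - b))"
    using edge_val_eq[OF m PM_translate[OF T k], of "k + a" "k + b"] ab by simp
  then show ?thesis by (simp add: elem_value_translation[OF m T k] edge_val_eq[OF m T ab])
qed

lemma elem_value_edge_matrix: "m \<in> X1 \<T> \<Longrightarrow> T \<in> PM \<Longrightarrow> elem_value m T = edge_matrix T (edge_val m)"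
  by (rule mat_eq_edge_matrix[OF tet_PM elem_value_sym _ edge_val_sym edge_val_diag]) (auto simp: edge_val_eq)

lemma X1_has_integral:
  assumes m: "m \<in> X1 \<T>" and w: "continuous_on UNIV w"
  shows "((\<lambda>x. m x \<bullet> w x) has_integral (\<Sum>T\<in>\<T>. integral (convex hull T) (\<lambda>x. elem_value m T \<bullet> w x))) (cbox 0 1)"
proof (rule has_integral_cube)
  fix T assume T: "T \<in> \<T>"
  have "((\<lambda>x. elem_value m T \<bullet> w x) has_integral integral (convex hull T) (\<lambda>x. elem_value m T \<bullet> w x)) (convex hull T)"
    by (intro integrable_integral continuous_integrable_hull continuous_intros w tet_finite tet_mesh T)
  then show "((\<lambda>x. m x \<bullet> w x) has_integral integral (convex hull T) (\<lambda>x. elem_value m T \<bullet> w x)) (convex hull T)"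
  proof (rule has_integral_spike[OF negligible_convex_frontier[OF convex_convex_hull], rotated])
    fix x assume "x \<in> convex hull T - frontier (convex hull T)"
    then have x: "x \<in> interior (convex hull T)" using closure_subset unfolding frontier_def by blast
    show "m x \<bullet> w x = elem_value m T \<bullet> w x" by (simp add: elem_value_eq[OF m mesh_PM[OF T] x])
  qed
qed

lemma l2_X1:
  assumes "m \<in> X1 \<T>" "continuous_on UNIV w"
  shows "l2 m w = (\<Sum>T\<in>\<T>. integral (convex hull T) (\<lambda>x. elem_value m T \<bullet> w x))"
  unfolding l2_def by (rule integral_unique[OF X1_has_integral[OF assms]])

lemma l2_commute: "l2 f g = l2 g f"
  by (simp add: l2_def inner_commute)

text \<open>
  The local formula summed over the mesh. The face terms of \<open>integral_inc_tet\<close> are odd in the area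
  vector and otherwise depend only on the face, because \<open>m\<close> has single-valued edge values and \<open>v\<close> is
  smooth; so they cancel.
\<close>

lemma l2_inc_X1:
  assumes m: "m \<in> X1 \<T>" and v: "v \<in> smoothS"
  shows "l2 m (inc v) = (\<Sum>T\<in>\<T>. local_form T (edge_val m) (\<lambda>a b. edge_mean a b v))"
proof -
  have sm: "smooth v" by (rule smoothS_smooth[OF v])
  define \<Phi> where "\<Phi> F N = face_sum F (edge_val m) v N" for F N
  have zero: "(\<Sum>T\<in>\<T>. \<Sum>j\<in>T. \<Phi> (T - {j}) (hull_vol6 T *\<^sub>R bgrad T j)) = 0"
  proof (rule flag_cancellation)
    fix F N
    have "face_flux p a b v (- N) = - face_flux p a b v N" for p a b
      using face_term_scale[OF sm, of p a b "-1" N] by (simp add: face_flux_def)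
    then show "\<Phi> F (- N) = - \<Phi> F N"
      unfolding \<Phi>_def face_sum_def by (simp add: case_prod_unfold sum_negf)
  next
    fix T j k N assume T: "T \<in> PM" and k: "k \<in> lattice"
    show "\<Phi> ((+) k ` (T - {j})) N = \<Phi> (T - {j}) N"
      unfolding \<Phi>_def face_sum_def sum_enum3_translation face_flux_translation[OF v k]
      by (intro sum.cong refl) (auto simp: mem_enum3 edge_val_translation[OF m T _ _ k])
  qed
  have each: "integral (convex hull T) (\<lambda>x. elem_value m T \<bullet> inc v x)
      = local_form T (edge_val m) (\<lambda>a b. edge_mean a b v) - (1/2) * (\<Sum>j\<in>T. \<Phi> (T - {j}) (hull_vol6 T *\<^sub>R bgrad T j))" if T: "T \<in> \<T>" for T
  proof -
    note P = mesh_PM[OF T]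
    have d: "(a - b) \<bullet> (elem_value m T *v (a - b)) = edge_val m a b" if "a \<in> T" "b \<in> T" for a b
      using edge_val_eq[OF m P that] by simp
    have "face_sum (T - {j}) (\<lambda>a b. (a - b) \<bullet> (elem_value m T *v (a - b))) v N = \<Phi> (T - {j}) N" for j N
      unfolding \<Phi>_def face_sum_def by (intro sum.cong refl) (auto simp: mem_enum3 d)
    moreover have "local_form T (\<lambda>a b. (a - b) \<bullet> (elem_value m T *v (a - b))) (\<lambda>a b. edge_mean a b v) = local_form T (edge_val m) (\<lambda>a b. edge_mean a b v)"
      by (rule local_form_cong) (simp_all add: d)
    ultimately show ?thesis
      using integral_inc_tet[OF tet_mesh[OF T] elem_value_sym[OF m P] v] by simp
  qed
  have "l2 m (inc v) = (\<Sum>T\<in>\<T>. local_form T (edge_val m) (\<lambda>a b. edge_mean a b v) - (1/2) * (\<Sum>j\<in>T. \<Phi> (T - {j}) (hull_vol6 T *\<^sub>R bgrad T j)))"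
    unfolding l2_X1[OF m smooth_continuous_on[OF smooth_inc[OF sm]]] by (intro sum.cong refl each)
  also have "\<dots> = (\<Sum>T\<in>\<T>. local_form T (edge_val m) (\<lambda>a b. edge_mean a b v))"
    by (simp only: sum_subtractf sum_distrib_left[symmetric] zero)
  finally show ?thesis .
qed

definition edge_field :: "(real ^ 3 \<Rightarrow> real ^ 3 \<Rightarrow> real) \<Rightarrow> real ^ 3 \<Rightarrow> real ^ 3 ^ 3" where
  "edge_field d x = (if \<exists>T\<in>PM. x \<in> interior (convex hull T) then edge_matrix (THE T. T \<in> PM \<and> x \<in> interior (convex hull T)) d else 0)"

lemma edge_field_eq: "T \<in> PM \<Longrightarrow> x \<in> interior (convex hull T) \<Longrightarrow> edge_field d x = edge_matrix T d"
proof -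
  assume T: "T \<in> PM" "x \<in> interior (convex hull T)"
  have "(THE T. T \<in> PM \<and> x \<in> interior (convex hull T)) = T"
    by (rule the_equality) (use T same_tet interior_subset in blast)+
  then show ?thesis using T unfolding edge_field_def by auto
qed

lemma elem_value_edge_field: "T \<in> PM \<Longrightarrow> elem_value (edge_field d) T = edge_matrix T d"
  by (rule elem_value_eqI) (auto simp: edge_field_eq)

lemma edge_field_outside: "x \<notin> mesh_interior \<T> \<Longrightarrow> edge_field d x = 0"
  by (auto simp: edge_field_def mesh_interior_def)

lemma edge_matrix_translation:
  assumes T: "tet T" and per: "\<And>a b. d (k + a) (k + b) = d a b"
  shows "edge_matrix ((+) k ` T) d = edge_matrix T d"
proof -
  have "(\<Sum>a\<in>(+) k ` T. \<Sum>b\<in>(+) k ` T. d a b * (bgrad ((+) k ` T) a $ i * bgrad ((+) k ` T) b $ j))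
      = (\<Sum>a\<in>T. \<Sum>b\<in>T. d a b * (bgrad T a $ i * bgrad T b $ j))" for i j
    by (simp add: sum.reindex per bgrad_translation[OF T] cong: sum.cong)
  then show ?thesis unfolding edge_matrix_def by simp
qed

lemma edge_field_X1:
  assumes sym: "\<And>a b. d a b = d b a" and diag: "\<And>a. d a a = 0"
    and per: "\<And>a b k. k \<in> lattice \<Longrightarrow> d (k + a) (k + b) = d a b"
  shows "edge_field d \<in> X1 \<T>"
  unfolding X1_def
proof (intro CollectI conjI allI ballI impI)
  show "periodic (edge_field d)"
    unfolding periodic_def
  proof (intro allI ballI)
    fix x k assume k: "k \<in> lattice"
    have tr: "edge_field d (k + x) = edge_field d x" if "T \<in> PM" "x \<in> interior (convex hull T)" "k \<in> lattice" for T x k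
      using edge_field_eq[OF that(1,2)] edge_field_eq[OF PM_translate[OF that(1,3)] interior_translation_hull[OF that(2)]]
        edge_matrix_translation[OF tet_PM[OF that(1)], of d k] per[OF that(3)] by simp
    show "edge_field d (x + k) = edge_field d x"
    proof (cases "\<exists>T\<in>PM. x \<in> interior (convex hull T)")
      case True
      then show ?thesis using tr k by (metis add.commute)
    next
      case False
      have "\<not> (\<exists>T\<in>PM. k + x \<in> interior (convex hull T))"
      proof
        assume "\<exists>T\<in>PM. k + x \<in> interior (convex hull T)"
        then obtain T where T: "T \<in> PM" "k + x \<in> interior (convex hull T)" by blast
        then have "- k + (k + x) \<in> interior (convex hull ((+) (- k) ` T))" by (intro interior_translation_hull)
        then show False using False PM_translate[OF T(1) lattice_minus[OF k]] by (simp add: add.assoc[symmetric]) 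
      qed
      then show ?thesis using False by (simp add: edge_field_def add.commute)
    qed
  qed
next
  fix x show "transpose (edge_field d x) = edge_field d x"
    unfolding edge_field_def using edge_matrix_sym[where d=d, OF sym] by (auto simp: transpose_def vec_eq_iff)
next
  fix T assume T: "T \<in> PM"
  show "\<exists>M. \<forall>x\<in>interior (convex hull T). edge_field d x = M" using edge_field_eq[OF T] by blast
next
  fix x assume "x \<notin> mesh_interior \<T>"
  then show "edge_field d x = 0" by (rule edge_field_outside)
next
  fix T T' x z assume T: "T \<in> PM" "T' \<in> PM" and xz: "x \<in> T \<inter> T'" "z \<in> T \<inter> T'" "x \<noteq> z"
  then show "tt_integral (x, z) (\<lambda>_. elem_value (edge_field d) T) = tt_integral (x, z) (\<lambda>_. elem_value (edge_field d) T')"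
    by (simp add: tt_integral_const elem_value_edge_field edge_matrix_edge[where d=d, OF tet_PM sym diag])
qed

lemma edge_val_edge_field:
  assumes sym: "\<And>a b. d a b = d b a" and diag: "\<And>a. d a a = 0"
    and per: "\<And>a b k. k \<in> lattice \<Longrightarrow> d (k + a) (k + b) = d a b"
    and T: "T \<in> PM" "a \<in> T" "b \<in> T"
  shows "edge_val (edge_field d) a b = d a b"
  using edge_val_eq[OF edge_field_X1[where d=d, OF sym diag per] T] edge_matrix_edge[where d=d, OF tet_PM[OF T(1)] sym diag T(2,3)] elem_value_edge_field[OF T(1)] by simp

lemma X1_unique:
  assumes m: "m \<in> X1 \<T>" "m' \<in> X1 \<T>"
    and d: "\<And>T a b. T \<in> PM \<Longrightarrow> a \<in> T \<Longrightarrow> b \<in> T \<Longrightarrow> a \<noteq> b \<Longrightarrow> edge_val m a b = edge_val m' a b"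
  shows "m = m'"
proof
  fix x
  show "m x = m' x"
  proof (cases "\<exists>T\<in>PM. x \<in> interior (convex hull T)")
    case True
    then obtain T where T: "T \<in> PM" "x \<in> interior (convex hull T)" by blast
    have "edge_matrix T (edge_val m) = edge_matrix T (edge_val m')"
      by (rule edge_matrix_cong) (metis d[OF T(1)] edge_val_diag)
    then show ?thesis
      using elem_value_eq[OF m(1) T] elem_value_eq[OF m(2) T] elem_value_edge_matrix[OF m(1) T(1)] elem_value_edge_matrix[OF m(2) T(1)] by simp
  next
    case False
    then have "x \<notin> mesh_interior \<T>" by (auto simp: mesh_interior_def)
    then have "m x = 0" "m' x = 0" using m by (auto simp: X1_def)
    then show ?thesis by simp
  qed
qed

text \<open>
  The symmetric gradient on \<open>T\<close> of the affine function with the nodal values of \<open>f\<close>.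
\<close>

definition strain :: "(real ^ 3 \<Rightarrow> real ^ 3) \<Rightarrow> (real ^ 3) set \<Rightarrow> real ^ 3 ^ 3" where
  "strain f T = (\<chi> i j. ((\<Sum>z\<in>T. (bgrad T z \<bullet> axis j 1) *\<^sub>R f z) $ i + (\<Sum>z\<in>T. (bgrad T z \<bullet> axis i 1) *\<^sub>R f z) $ j) / 2)"

lemma strain_form: "x \<bullet> (strain f T *v x) = x \<bullet> (\<Sum>z\<in>T. (bgrad T z \<bullet> x) *\<^sub>R f z)"
proof -
  define A where "A x = (\<Sum>z\<in>T. (bgrad T z \<bullet> x) *\<^sub>R f z)" for x
  have lin: "linear A"
    unfolding A_def by (rule linearI) (simp_all add: inner_add_right scaleR_add_left sum.distrib scaleR_sum_right)
  have Ax: "A x $ i = (\<Sum>j\<in>UNIV. x $ j * A (axis j 1) $ i)" for i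
  proof -
    have "A x = A (\<Sum>j\<in>UNIV. x $ j *\<^sub>R axis j 1)" using vec_axis_sum[of x] by simp
    also have "\<dots> = (\<Sum>j\<in>UNIV. x $ j *\<^sub>R A (axis j 1))" by (simp only: linear_sum[OF lin] linear_scale[OF lin])
    finally show ?thesis by (simp add: sum_component)
  qed
  have "x \<bullet> (strain f T *v x) = (\<Sum>i\<in>UNIV. \<Sum>j\<in>UNIV. x $ i * ((A (axis j 1) $ i + A (axis i 1) $ j) / 2 * x $ j))"
    by (simp add: inner_vec_def matrix_vector_mult_def strain_def A_def sum_distrib_left)
  also have "\<dots> = (\<Sum>i\<in>UNIV. x $ i * (\<Sum>j\<in>UNIV. x $ j * A (axis j 1) $ i))"
    by (simp add: sum_3 field_simps)
  also have "\<dots> = x \<bullet> A x"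
    by (simp only: Ax[symmetric] inner_vec_def inner_real_def)
  finally show ?thesis by (simp only: A_def)
qed

lemma strain_sym: "transpose (strain f T) = strain f T"
  by (rule transpose_eqI) (simp add: strain_def add.commute)

lemma strain_edge: "tet T \<Longrightarrow> a \<in> T \<Longrightarrow> b \<in> T \<Longrightarrow> (a - b) \<bullet> (strain f T *v (a - b)) = (a - b) \<bullet> (f a - f b)"
proof -
  assume T: "tet T" and ab: "a \<in> T" "b \<in> T"
  have "(\<Sum>z\<in>T. (bgrad T z \<bullet> (a - b)) *\<^sub>R f z) = (\<Sum>z\<in>T. (if z = a then f z else 0) - (if z = b then f z else 0))"
    by (intro sum.cong refl) (auto simp: bgrad_diff[OF T _ ab])
  then show ?thesis unfolding strain_form using tet_finite[OF T] ab by (simp add: sum_subtractf)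
qed

lemma mesh_interior_translation: "k \<in> lattice \<Longrightarrow> x \<in> mesh_interior \<T> \<Longrightarrow> k + x \<in> mesh_interior \<T>"
  unfolding mesh_interior_def using interior_translation_hull PM_translate by blast

text \<open>
  In the interior of \<open>T\<close> the field agrees with the affine function \<open>\<Sum> \<lambda>\<^sub>z f(z)\<close>, whose derivative is
  expressed by the barycentric gradients.
\<close>

lemma sym_grad_h_eq:
  assumes f: "f \<in> X0 \<T>" and T: "T \<in> PM" and x: "x \<in> interior (convex hull T)"
  shows "sym_grad_h \<T> f x = strain f T"
proof -
  have tT: "tet T" by (rule tet_PM[OF T])
  have f': "pw_linear \<T> f" using f by (simp add: X0_def)
  define A where "A x = (\<Sum>z\<in>T. (bgrad T z \<bullet> x) *\<^sub>R f z)" for x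
  have lin: "linear A"
    unfolding A_def by (rule linearI) (simp_all add: inner_add_right scaleR_add_left sum.distrib scaleR_sum_right)
  have "f y = A y + (\<Sum>z\<in>T. bary T z 0 *\<^sub>R f z)" if "y \<in> convex hull T" for y
  proof -
    have "A y = (\<Sum>z\<in>T. bary T z y *\<^sub>R f z) - (\<Sum>z\<in>T. bary T z 0 *\<^sub>R f z)"
      unfolding A_def sum_subtractf[symmetric] scaleR_diff_left[symmetric] bary_diff by simp
    then show ?thesis using pw_linear_nodal[OF f' T that] by simp
  qed
  then have "sym_grad f x = (\<chi> i j. (A (axis j 1) $ i + A (axis i 1) $ j) / 2)"
    by (rule sym_grad_affine[OF lin _ x])
  moreover have "x \<in> mesh_interior \<T>" using T x unfolding mesh_interior_def by blast
  ultimately show ?thesis by (simp add: sym_grad_h_def strain_def A_def)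
qed

lemma elem_value_sym_grad_h: "f \<in> X0 \<T> \<Longrightarrow> T \<in> PM \<Longrightarrow> elem_value (sym_grad_h \<T> f) T = strain f T"
  by (rule elem_value_eqI) (auto simp: sym_grad_h_eq)

lemma sym_grad_h_X1:
  assumes f: "f \<in> X0 \<T>"
  shows "sym_grad_h \<T> f \<in> X1 \<T>"
  unfolding X1_def
proof (intro CollectI conjI allI ballI impI)
  have perf: "f (x + k) = f x" if "k \<in> lattice" for x k
    using f that unfolding X0_def pw_linear_def periodic_def by blast
  have strain_tr: "strain f ((+) k ` T) = strain f T" if T: "tet T" and k: "k \<in> lattice" for T k
  proof -
    have "(\<Sum>z\<in>(+) k ` T. (bgrad ((+) k ` T) z \<bullet> w) *\<^sub>R f z) = (\<Sum>z\<in>T. (bgrad T z \<bullet> w) *\<^sub>R f z)" for w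
    proof -
      have "(\<Sum>z\<in>(+) k ` T. (bgrad ((+) k ` T) z \<bullet> w) *\<^sub>R f z) = (\<Sum>z\<in>T. (bgrad ((+) k ` T) (k + z) \<bullet> w) *\<^sub>R f (k + z))"
        by (subst sum.reindex) auto
      also have "\<dots> = (\<Sum>z\<in>T. (bgrad T z \<bullet> w) *\<^sub>R f z)"
      proof (intro sum.cong refl)
        fix z assume "z \<in> T"
        then show "(bgrad ((+) k ` T) (k + z) \<bullet> w) *\<^sub>R f (k + z) = (bgrad T z \<bullet> w) *\<^sub>R f z"
          using perf[OF k, of z] by (simp add: bgrad_translation[OF T] add.commute[of z k])
      qed
      finally show ?thesis .
    qed
    then show ?thesis by (simp add: strain_def)
  qed
  show "periodic (sym_grad_h \<T> f)"
    unfolding periodic_def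
  proof (intro allI ballI)
    fix x k assume k: "k \<in> lattice"
    show "sym_grad_h \<T> f (x + k) = sym_grad_h \<T> f x"
    proof (cases "x \<in> mesh_interior \<T>")
      case True
      then obtain T where T: "T \<in> PM" "x \<in> interior (convex hull T)" unfolding mesh_interior_def by blast
      have "sym_grad_h \<T> f (k + x) = sym_grad_h \<T> f x"
        using sym_grad_h_eq[OF f T] sym_grad_h_eq[OF f PM_translate[OF T(1) k] interior_translation_hull[OF T(2)]]
          strain_tr[OF tet_PM[OF T(1)] k] by simp
      then show ?thesis by (simp add: add.commute)
    next
      case False
      then have "k + x \<notin> mesh_interior \<T>"
        using mesh_interior_translation[OF lattice_minus[OF k], of "k + x"] by (auto simp: add.assoc[symmetric])
      then show ?thesis using False by (simp add: sym_grad_h_def add.commute)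
    qed
  qed
  fix x show "transpose (sym_grad_h \<T> f x) = sym_grad_h \<T> f x"
  proof (cases "x \<in> mesh_interior \<T>")
    case True
    then obtain T where "T \<in> PM" "x \<in> interior (convex hull T)" unfolding mesh_interior_def by blast
    then show ?thesis using sym_grad_h_eq[OF f] strain_sym by simp
  next
    case False
    then show ?thesis by (simp add: sym_grad_h_def transpose_def vec_eq_iff)
  qed
next
  fix T assume "T \<in> PM"
  then show "\<exists>M. \<forall>x\<in>interior (convex hull T). sym_grad_h \<T> f x = M" using sym_grad_h_eq[OF f] by blast
next
  fix x assume "x \<notin> mesh_interior \<T>"
  then show "sym_grad_h \<T> f x = 0" by (simp add: sym_grad_h_def)
next
  fix T T' x z assume T: "T \<in> PM" "T' \<in> PM" and xz: "x \<in> T \<inter> T'" "z \<in> T \<inter> T'" "x \<noteq> z"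
  then show "tt_integral (x, z) (\<lambda>_. elem_value (sym_grad_h \<T> f) T) = tt_integral (x, z) (\<lambda>_. elem_value (sym_grad_h \<T> f) T')"
    by (simp add: tt_integral_const elem_value_sym_grad_h[OF f] strain_edge[OF tet_PM])
qed

lemma edge_val_sym_grad_h: "f \<in> X0 \<T> \<Longrightarrow> T \<in> PM \<Longrightarrow> a \<in> T \<Longrightarrow> b \<in> T \<Longrightarrow>
    edge_val (sym_grad_h \<T> f) a b = (a - b) \<bullet> (f a - f b)"
  by (simp add: edge_val_eq[OF sym_grad_h_X1] elem_value_sym_grad_h strain_edge[OF tet_PM])

end

section \<open>Independence of edge measures and point evaluations\<close>

text \<open>
  A trigonometric polynomial with values in \<open>[0, 1]\<close> that equals \<open>1\<close> exactly on the lattice translates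
  of \<open>p\<close>.
\<close>

definition peak :: "real ^ 3 \<Rightarrow> real ^ 3 \<Rightarrow> real" where
  "peak p x = (3 + (\<Sum>i\<in>UNIV. cos (2 * pi * x $ i + (- 2 * pi * p $ i)))) / 6"

lemma smooth_peak: "smooth (peak p)"
proof -
  have "smooth (\<lambda>x. (1/6) *\<^sub>R (3 + (\<Sum>i\<in>UNIV. cos (2 * pi * x $ i + (- 2 * pi * p $ i)))))"
    by (intro smooth_scaleR smooth_add smooth_const smooth_sum smooth_cos)
  moreover have "peak p = (\<lambda>x. (1/6) *\<^sub>R (3 + (\<Sum>i\<in>UNIV. cos (2 * pi * x $ i + (- 2 * pi * p $ i)))))"
    by (simp add: peak_def fun_eq_iff)
  ultimately show ?thesis by metis
qed

lemma periodic_peak: "periodic (peak p)"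
  unfolding periodic_def
proof (intro allI ballI)
  fix x k assume k: "k \<in> lattice"
  have "cos (2 * pi * (x + k) $ i + (- 2 * pi * p $ i)) = cos (2 * pi * x $ i + (- 2 * pi * p $ i))" for i
  proof -
    obtain n where n: "k $ i = of_int n" using k by (auto simp: lattice_def elim: Ints_cases)
    have "2 * pi * (x + k) $ i + (- 2 * pi * p $ i) = (2 * pi * x $ i + (- 2 * pi * p $ i)) + 2 * pi * of_int n"
      by (simp add: n algebra_simps)
    then show ?thesis by (simp only: cos_add sin_int_2pin cos_int_2pin mult_1_right mult_zero_right diff_zero)
  qed
  then show "peak p (x + k) = peak p x" by (simp only: peak_def)
qed

lemma peak_bounds: "0 \<le> peak p x" "peak p x \<le> 1"
proof -
  have aux: "0 \<le> (3 + (a + b + c)) / 6 \<and> (3 + (a + b + c)) / 6 \<le> 1"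
    if "-1 \<le> a" "-1 \<le> b" "-1 \<le> c" "a \<le> 1" "b \<le> 1" "c \<le> 1" for a b c :: real
    using that by simp
  show "0 \<le> peak p x" "peak p x \<le> 1"
    unfolding peak_def sum_3 by (rule aux[THEN conjunct1] aux[THEN conjunct2]; simp)+
qed

lemma peak_self: "peak p p = 1" by (simp add: peak_def)

lemma peak_less: "x - p \<notin> lattice \<Longrightarrow> peak p x < 1"
proof (rule ccontr)
  assume x: "x - p \<notin> lattice" and "\<not> peak p x < 1"
  then have e: "peak p x = 1" using peak_bounds(2)[of p x] by linarith
  have aux: "a = 1 \<and> b = 1 \<and> c = 1" if "(3 + (a + b + c)) / 6 = 1" "a \<le> 1" "b \<le> 1" "c \<le> 1" for a b c :: real
    using that by (simp add: field_simps)
  have "cos (2 * pi * x $ 1 + (- 2 * pi * p $ 1)) = 1 \<and> cos (2 * pi * x $ 2 + (- 2 * pi * p $ 2)) = 1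
      \<and> cos (2 * pi * x $ 3 + (- 2 * pi * p $ 3)) = 1"
    by (rule aux) (use e in \<open>simp_all add: peak_def sum_3\<close>)
  then have c: "cos (2 * pi * x $ i + (- 2 * pi * p $ i)) = 1" for i
    using exhaust_3[of i] by metis
  have "(x - p) $ i \<in> \<int>" for i
  proof -
    obtain n where "2 * pi * x $ i + (- 2 * pi * p $ i) = of_int n * 2 * pi" using c[of i] cos_one_2pi_int by blast
    then have "(2 * pi) * (x $ i - p $ i) = (2 * pi) * of_int n" by (simp add: algebra_simps)
    then have "x $ i - p $ i = of_int n" using pi_gt_zero by simp
    then show ?thesis by simp
  qed
  then show False using x by (simp add: lattice_def)
qed

lemma weighted_powers_limit:
  fixes q c :: "'a \<Rightarrow> real"
  assumes fin: "finite A" and p: "p \<in> A" "q p = 1" and q: "\<And>y. y \<in> A - {p} \<Longrightarrow> 0 \<le> q y \<and> q y < 1"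
  shows "(\<lambda>N. \<Sum>y\<in>A. c y * q y ^ N) \<longlonglongrightarrow> c p"
proof -
  have "(\<lambda>N. \<Sum>y\<in>A. c y * q y ^ N) \<longlonglongrightarrow> (\<Sum>y\<in>A. if y = p then c y else 0)"
  proof (rule tendsto_sum)
    fix y assume y: "y \<in> A"
    show "(\<lambda>N. c y * q y ^ N) \<longlonglongrightarrow> (if y = p then c y else 0)"
    proof (cases "y = p")
      case True
      then show ?thesis by (simp add: p)
    next
      case False
      then have "(\<lambda>N. q y ^ N) \<longlonglongrightarrow> 0" using q[of y] y by (intro LIMSEQ_realpow_zero) auto
      then show ?thesis using False tendsto_mult_left[of "\<lambda>N. q y ^ N" 0 sequentially "c y"] by simp
    qed
  qed
  then show ?thesis using fin p(1) by simp
qed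

lemma powers_dominate:
  fixes A B q r :: real
  assumes le: "\<And>N. \<bar>A\<bar> * q ^ N \<le> B * r ^ N" and qr: "0 \<le> r" "r < q"
  shows "A = 0"
proof -
  have "(\<lambda>N. B * (r / q) ^ N) \<longlonglongrightarrow> B * 0"
    using qr by (intro tendsto_mult_left LIMSEQ_realpow_zero) auto
  moreover have "\<bar>A\<bar> \<le> B * (r / q) ^ N" for N
    using le[of N] qr by (simp add: power_divide pos_le_divide_eq)
  ultimately have "\<bar>A\<bar> \<le> 0" using LIMSEQ_le_const[of "\<lambda>N. B * (r / q) ^ N" 0 "\<bar>A\<bar>"] by auto
  then show ?thesis by simp
qed

lemma linear_vec_smoothV:
  fixes f :: "real ^ 3 \<Rightarrow> real"
  assumes "smooth f" "periodic f"
  shows "(\<lambda>x. f x *\<^sub>R L) \<in> smoothV"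
  using assms by (simp add: smoothV_def smooth_scaleR_vec periodic_def)

text \<open>
  Tested against the tangent \<open>t\<close> of an edge, this matrix has the value \<open>1\<close>.
\<close>

definition rank_one :: "real ^ 3 \<Rightarrow> real ^ 3 ^ 3" where
  "rank_one t = (\<chi> i j. t $ i * t $ j)"

lemma rank_one_form: "a \<bullet> (rank_one t *v a) = (a \<bullet> t) * (a \<bullet> t)"
  by (simp add: rank_one_def inner_vec_def matrix_vector_mult_def sum_3 algebra_simps)

lemma rank_one_smoothS:
  fixes f :: "real ^ 3 \<Rightarrow> real"
  assumes "smooth f" "periodic f"
  shows "(\<lambda>x. f x *\<^sub>R rank_one t) \<in> smoothS"
  using assms by (auto simp: smoothS_def smooth_scaleR_vec periodic_def rank_one_def intro!: transpose_eqI)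

section \<open>Edges of the torus mesh\<close>

locale mesh_edges = mesh +
  fixes \<E> :: "edge set"
  assumes edges: "edge_system \<T> \<E>"
begin

definition is_edge_rep :: "real ^ 3 \<Rightarrow> real ^ 3 \<Rightarrow> edge \<Rightarrow> bool" where
  "is_edge_rep a b e \<longleftrightarrow> e \<in> \<E> \<and> (\<exists>k\<in>lattice. e = (a + k, b + k) \<or> e = (b + k, a + k))"

definition edge_rep :: "real ^ 3 \<Rightarrow> real ^ 3 \<Rightarrow> edge" where
  "edge_rep a b = (THE e. is_edge_rep a b e)"

lemma is_edge_rep_ex1: "T \<in> PM \<Longrightarrow> a \<in> T \<Longrightarrow> b \<in> T \<Longrightarrow> a \<noteq> b \<Longrightarrow> \<exists>!e. is_edge_rep a b e"
proof -
  assume T: "T \<in> PM" "a \<in> T" "b \<in> T" "a \<noteq> b"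
  have "\<forall>T\<in>PM. \<forall>x\<in>T. \<forall>z\<in>T. x \<noteq> z \<longrightarrow> (\<exists>!e. is_edge_rep x z e)"
    using edges unfolding edge_system_def is_edge_rep_def by (rule conjunct2)
  then show ?thesis using T by simp
qed

lemma edge_rep: "T \<in> PM \<Longrightarrow> a \<in> T \<Longrightarrow> b \<in> T \<Longrightarrow> a \<noteq> b \<Longrightarrow> is_edge_rep a b (edge_rep a b)"
  unfolding edge_rep_def by (rule theI') (rule is_edge_rep_ex1)

lemma edge_rep_eqI: "T \<in> PM \<Longrightarrow> a \<in> T \<Longrightarrow> b \<in> T \<Longrightarrow> a \<noteq> b \<Longrightarrow> is_edge_rep a b e \<Longrightarrow> edge_rep a b = e"
  using is_edge_rep_ex1 edge_rep by blast

lemma is_edge_rep_sym: "is_edge_rep a b e \<longleftrightarrow> is_edge_rep b a e"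
  unfolding is_edge_rep_def by blast

lemma is_edge_rep_translation: "k \<in> lattice \<Longrightarrow> is_edge_rep (k + a) (k + b) e \<longleftrightarrow> is_edge_rep a b e"
proof -
  have *: "is_edge_rep a b e" if "is_edge_rep (k + a) (k + b) e" "k \<in> lattice" for k a b
  proof -
    have "\<exists>l\<in>lattice. e = (k + a + l, k + b + l) \<or> e = (k + b + l, k + a + l)"
      using that(1) by (simp add: is_edge_rep_def)
    then obtain l where l: "l \<in> lattice" and e: "e = (k + a + l, k + b + l) \<or> e = (k + b + l, k + a + l)"
      by (rule bexE)
    have "e = (a + (k + l), b + (k + l)) \<or> e = (b + (k + l), a + (k + l))"
      using e by (simp only: add_ac)
    moreover have "e \<in> \<E>" using that(1) by (simp add: is_edge_rep_def)
    ultimately show ?thesis using lattice_add[OF that(2) l] unfolding is_edge_rep_def by (intro conjI bexI)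
  qed
  assume k: "k \<in> lattice"
  show ?thesis
    using *[of k a b] *[of "- k" "k + a" "k + b"] k lattice_minus[OF k] by (auto simp: add.assoc[symmetric])
qed

lemma edge_rep_sym: "edge_rep a b = edge_rep b a"
proof -
  have "is_edge_rep a b = is_edge_rep b a" by (rule ext) (rule is_edge_rep_sym)
  then show ?thesis by (simp only: edge_rep_def)
qed

lemma edge_rep_translation: "k \<in> lattice \<Longrightarrow> edge_rep (k + a) (k + b) = edge_rep a b"
proof -
  assume k: "k \<in> lattice"
  have "is_edge_rep (k + a) (k + b) = is_edge_rep a b" by (rule ext) (rule is_edge_rep_translation[OF k])
  then show ?thesis by (simp only: edge_rep_def)
qed

lemma edge_D: "(x, z) \<in> \<E> \<Longrightarrow> x \<noteq> z \<and> (\<exists>T\<in>PM. x \<in> T \<and> z \<in> T)"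
proof -
  assume "(x, z) \<in> \<E>"
  moreover have "\<forall>(x, z)\<in>\<E>. x \<noteq> z \<and> (\<exists>T\<in>PM. {x, z} \<subseteq> T)"
    using edges unfolding edge_system_def by (rule conjunct1)
  ultimately show ?thesis by auto
qed

lemma is_edge_rep_self: "(x, z) \<in> \<E> \<Longrightarrow> is_edge_rep x z (x, z)"
  unfolding is_edge_rep_def using lattice_0 by (auto intro!: bexI[of _ 0])

lemma edge_rep_self: "(x, z) \<in> \<E> \<Longrightarrow> edge_rep x z = (x, z)"
  using edge_D is_edge_rep_self edge_rep_eqI by blast

lemma finite_edges: "finite \<E>"
proof (rule finite_subset)
  show "\<E> \<subseteq> (\<lambda>(a, b). edge_rep a b) ` (\<Union>T\<in>\<T>. T \<times> T)"
  proof
    fix e assume e: "e \<in> \<E>"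
    obtain x z where xz: "e = (x, z)" by (cases e)
    obtain T where T: "T \<in> PM" "x \<in> T" "z \<in> T" "x \<noteq> z" using edge_D e xz by blast
    obtain k T0 where k: "k \<in> lattice" "T0 \<in> \<T>" "T = (+) k ` T0" using PM_D[OF T(1)] by blast
    obtain a b where ab: "a \<in> T0" "b \<in> T0" "x = k + a" "z = k + b" using T k(3) by auto
    have "edge_rep a b = e" using edge_rep_translation[OF k(1), of a b] edge_rep_self[of x z] e xz ab by simp
    then show "e \<in> (\<lambda>(a, b). edge_rep a b) ` (\<Union>T\<in>\<T>. T \<times> T)" using ab k(2) by force
  qed
  show "finite ((\<lambda>(a, b). edge_rep a b) ` (\<Union>T\<in>\<T>. T \<times> T))"
    using finite_mesh tet_finite[OF tet_mesh] by auto
qed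

lemma edge_val_edge_rep:
  assumes m: "m \<in> X1 \<T>" and T: "T \<in> PM" "a \<in> T" "b \<in> T" "a \<noteq> b"
  shows "edge_val m a b = norm (b - a) * edge_dof \<T> m (edge_rep a b)"
proof -
  have "norm (b - a) \<noteq> 0" using T(4) by simp
  obtain k where k: "k \<in> lattice" "edge_rep a b = (a + k, b + k) \<or> edge_rep a b = (b + k, a + k)"
    using edge_rep[OF T] unfolding is_edge_rep_def by blast
  have T': "(+) k ` T \<in> PM" "a + k \<in> (+) k ` T" "b + k \<in> (+) k ` T"
    using PM_translate[OF T(1) k(1)] T by (auto simp: add.commute)
  have tr: "edge_val m (a + k) (b + k) = edge_val m a b"
    using edge_val_translation[OF m T(1-3) k(1)] by (simp add: add.commute)
  from k(2) show ?thesis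
  proof
    assume "edge_rep a b = (a + k, b + k)"
    then show ?thesis using edge_dof_eq[OF m T'] T(4) tr by simp
  next
    assume "edge_rep a b = (b + k, a + k)"
    then show ?thesis using edge_dof_eq[OF m T'(1,3,2)] T(4) tr edge_val_sym[of m "b + k" "a + k"] by (simp add: norm_minus_commute)
  qed
qed

lemma X1_unique_dof:
  assumes m: "m \<in> X1 \<T>" "m' \<in> X1 \<T>" and e: "\<And>e. e \<in> \<E> \<Longrightarrow> edge_dof \<T> m e = edge_dof \<T> m' e"
  shows "m = m'"
proof (rule X1_unique[OF m])
  fix T a b assume T: "T \<in> PM" "a \<in> T" "b \<in> T" "a \<noteq> b"
  have "edge_rep a b \<in> \<E>" using edge_rep[OF T] by (simp add: is_edge_rep_def)
  then show "edge_val m a b = edge_val m' a b" using edge_val_edge_rep[OF m(1) T] edge_val_edge_rep[OF m(2) T] e by simp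
qed

text \<open>
  The factor is the length because \<^const>\<open>edge_dof\<close> is an integral of a quadratic form in the unit
  tangent, and the values \<open>edge_val\<close> are those of the form on the edge vector.
\<close>

definition edge_ext :: "(edge \<Rightarrow> real) \<Rightarrow> real ^ 3 \<Rightarrow> real ^ 3 \<Rightarrow> real" where
  "edge_ext c a b = norm (b - a) * c (edge_rep a b)"

lemma edge_ext_sym: "edge_ext c a b = edge_ext c b a" and edge_ext_diag: "edge_ext c a a = 0"
  and edge_ext_translation: "k \<in> lattice \<Longrightarrow> edge_ext c (k + a) (k + b) = edge_ext c a b"
  by (simp_all add: edge_ext_def edge_rep_sym[of a b] norm_minus_commute edge_rep_translation)

lemma edge_field_ext_X1: "edge_field (edge_ext c) \<in> X1 \<T>"
  by (intro edge_field_X1 edge_ext_sym edge_ext_diag edge_ext_translation)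

lemma edge_val_edge_field_ext: "T \<in> PM \<Longrightarrow> a \<in> T \<Longrightarrow> b \<in> T \<Longrightarrow> edge_val (edge_field (edge_ext c)) a b = edge_ext c a b"
  by (intro edge_val_edge_field edge_ext_sym edge_ext_diag edge_ext_translation)

lemma edge_dof_edge_field_ext: "e \<in> \<E> \<Longrightarrow> edge_dof \<T> (edge_field (edge_ext c)) e = c e"
proof -
  assume e: "e \<in> \<E>"
  obtain x z where xz: "e = (x, z)" by (cases e)
  obtain T where T: "T \<in> PM" "x \<in> T" "z \<in> T" "x \<noteq> z" using edge_D e xz by blast
  show ?thesis
    using edge_dof_eq[OF edge_field_ext_X1 T] edge_val_edge_field_ext[OF T(1-3)] edge_rep_self[of x z] e xz T(4) by (simp add: edge_ext_def)
qed

lemma psi_eq: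
  assumes e: "e \<in> \<E>"
  shows "psi \<T> \<E> e = edge_field (edge_ext (\<lambda>g. of_bool (g = e)))"
  unfolding psi_def
proof (rule the_equality)
  show "edge_field (edge_ext (\<lambda>g. of_bool (g = e))) \<in> X1 \<T> \<and> edge_dof \<T> (edge_field (edge_ext (\<lambda>g. of_bool (g = e)))) e = 1 \<and>
     (\<forall>g\<in>\<E> - {e}. edge_dof \<T> (edge_field (edge_ext (\<lambda>g. of_bool (g = e)))) g = 0)"
    using e by (simp add: edge_field_ext_X1 edge_dof_edge_field_ext)
next
  fix m assume m: "m \<in> X1 \<T> \<and> edge_dof \<T> m e = 1 \<and> (\<forall>g\<in>\<E> - {e}. edge_dof \<T> m g = 0)"
  show "m = edge_field (edge_ext (\<lambda>g. of_bool (g = e)))"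
  proof (rule X1_unique_dof[OF _ edge_field_ext_X1])
    fix g assume "g \<in> \<E>"
    then show "edge_dof \<T> m g = edge_dof \<T> (edge_field (edge_ext (\<lambda>g. of_bool (g = e)))) g"
      using m by (cases "g = e") (simp_all add: edge_dof_edge_field_ext)
  qed (use m in blast)
qed

lemma psi_X1: "e \<in> \<E> \<Longrightarrow> psi \<T> \<E> e \<in> X1 \<T>"
  by (simp add: psi_eq edge_field_ext_X1)

lemma edge_dof_psi: "e \<in> \<E> \<Longrightarrow> g \<in> \<E> \<Longrightarrow> edge_dof \<T> (psi \<T> \<E> e) g = of_bool (g = e)"
  by (simp add: psi_eq edge_dof_edge_field_ext)

lemma I1_eq: "Defs.I1 \<T> \<E> u = edge_field (edge_ext (\<lambda>e. tt_integral e u))"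
  unfolding Defs.I1_def
proof (rule the_equality)
  show "edge_field (edge_ext (\<lambda>e. tt_integral e u)) \<in> X1 \<T> \<and> (\<forall>e\<in>\<E>. edge_dof \<T> (edge_field (edge_ext (\<lambda>e. tt_integral e u))) e = tt_integral e u)"
    by (simp add: edge_field_ext_X1 edge_dof_edge_field_ext)
next
  fix m assume m: "m \<in> X1 \<T> \<and> (\<forall>e\<in>\<E>. edge_dof \<T> m e = tt_integral e u)"
  show "m = edge_field (edge_ext (\<lambda>e. tt_integral e u))"
    by (rule X1_unique_dof[OF _ edge_field_ext_X1]) (use m in \<open>simp_all add: edge_dof_edge_field_ext\<close>)
qed

lemma I1_X1: "Defs.I1 \<T> \<E> u \<in> X1 \<T>"
  by (simp add: I1_eq edge_field_ext_X1)

lemma edge_dof_I1: "e \<in> \<E> \<Longrightarrow> edge_dof \<T> (Defs.I1 \<T> \<E> u) e = tt_integral e u"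
  by (simp add: I1_eq edge_dof_edge_field_ext)

text \<open>
  The two normalizations of the edge integral match: interpolation preserves the mean of the form over
  each edge, here for an arbitrary lift of the edge.
\<close>

lemma edge_val_I1:
  assumes u: "u \<in> smoothS" and T: "T \<in> PM" "a \<in> T" "b \<in> T" "a \<noteq> b"
  shows "edge_val (Defs.I1 \<T> \<E> u) a b = edge_mean a b u"
proof -
  have n: "norm (b - a) \<noteq> 0" using T(4) by simp
  obtain k where k: "k \<in> lattice" "edge_rep a b = (a + k, b + k) \<or> edge_rep a b = (b + k, a + k)"
    using edge_rep[OF T] unfolding is_edge_rep_def by blast
  have tr: "edge_mean (a + k) (b + k) u = edge_mean a b u"
    using edge_mean_translation[OF u k(1), of a b] by (simp add: add.commute)
  have "tt_integral (edge_rep a b) u = edge_mean a b u / norm (b - a)"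
    using k(2)
  proof
    assume "edge_rep a b = (a + k, b + k)"
    then show ?thesis using tt_integral_edge_mean[OF smoothS_smooth[OF u], of "a + k" "b + k"] T(4) tr by simp
  next
    assume "edge_rep a b = (b + k, a + k)"
    then show ?thesis using tt_integral_edge_mean[OF smoothS_smooth[OF u], of "b + k" "a + k"] T(4) tr edge_mean_swap[of "b + k" "a + k" u]
      by (simp add: norm_minus_commute)
  qed
  then show ?thesis using n unfolding I1_eq edge_val_edge_field_ext[OF T(1-3)] edge_ext_def by simp
qed

text \<open>
  By \<open>l2_inc_X1\<close> both sides are sums of the symmetric local forms in the edge means of \<open>u\<close> and \<open>v\<close>.
\<close>

lemma l2_inc_I1_symmetric:
  assumes u: "u \<in> smoothS" and v: "v \<in> smoothS"
  shows "l2 (Defs.I1 \<T> \<E> u) (inc v) = l2 (Defs.I1 \<T> \<E> v) (inc u)"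
proof -
  have eq: "l2 (Defs.I1 \<T> \<E> u) (inc v) = (\<Sum>T\<in>\<T>. local_form T (\<lambda>a b. edge_mean a b u) (\<lambda>a b. edge_mean a b v))"
    if "u \<in> smoothS" "v \<in> smoothS" for u v
    unfolding l2_inc_X1[OF I1_X1 that(2)]
    by (intro sum.cong refl local_form_cong) (auto intro: edge_val_I1[OF that(1)] mesh_PM)
  show ?thesis unfolding eq[OF u v] eq[OF v u]
    by (intro sum.cong refl local_form_sym edge_mean_swap)
qed

lemma l2_psi_expand:
  assumes m: "m \<in> X1 \<T>" and w: "continuous_on UNIV w"
  shows "l2 w m = (\<Sum>e\<in>\<E>. l2 w (psi \<T> \<E> e) * edge_dof \<T> m e)"
proof -
  have ev: "elem_value m T = (\<Sum>e\<in>\<E>. edge_dof \<T> m e *\<^sub>R elem_value (psi \<T> \<E> e) T)" if T: "T \<in> PM" for T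
  proof -
    have "elem_value m T = edge_matrix T (\<lambda>a b. \<Sum>e\<in>\<E>. edge_dof \<T> m e * edge_val (psi \<T> \<E> e) a b)"
      unfolding elem_value_edge_matrix[OF m T]
    proof (rule edge_matrix_cong)
      fix a b assume ab: "a \<in> T" "b \<in> T"
      show "edge_val m a b = (\<Sum>e\<in>\<E>. edge_dof \<T> m e * edge_val (psi \<T> \<E> e) a b)"
      proof (cases "a = b")
        case False
        have c: "edge_rep a b \<in> \<E>" using edge_rep[OF T ab False] by (simp add: is_edge_rep_def)
        have "(\<Sum>e\<in>\<E>. edge_dof \<T> m e * edge_val (psi \<T> \<E> e) a b) = (\<Sum>e\<in>\<E>. if edge_rep a b = e then edge_dof \<T> m e * norm (b - a) else 0)"
          by (intro sum.cong refl) (simp add: psi_eq edge_val_edge_field_ext[OF T ab] edge_ext_def)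
        then show ?thesis using edge_val_edge_rep[OF m T ab False] finite_edges c by simp
      qed (simp add: edge_val_diag)
    qed
    also have "\<dots> = (\<Sum>e\<in>\<E>. edge_dof \<T> m e *\<^sub>R edge_matrix T (edge_val (psi \<T> \<E> e)))" by (rule edge_matrix_sum)
    also have "\<dots> = (\<Sum>e\<in>\<E>. edge_dof \<T> m e *\<^sub>R elem_value (psi \<T> \<E> e) T)"
      by (intro sum.cong refl) (simp add: elem_value_edge_matrix[OF psi_X1 T])
    finally show ?thesis .
  qed
  have "l2 m w = (\<Sum>T\<in>\<T>. integral (convex hull T) (\<lambda>x. \<Sum>e\<in>\<E>. edge_dof \<T> m e * (elem_value (psi \<T> \<E> e) T \<bullet> w x)))"
    unfolding l2_X1[OF m w] by (intro sum.cong refl) (simp add: ev[OF mesh_PM] inner_sum_left)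
  also have "\<dots> = (\<Sum>T\<in>\<T>. \<Sum>e\<in>\<E>. edge_dof \<T> m e * integral (convex hull T) (\<lambda>x. elem_value (psi \<T> \<E> e) T \<bullet> w x))"
  proof (intro sum.cong refl)
    fix T assume T: "T \<in> \<T>"
    have "(\<lambda>x. elem_value (psi \<T> \<E> e) T \<bullet> w x) integrable_on (convex hull T)" for e
      by (intro continuous_integrable_hull continuous_intros w tet_finite tet_mesh T)
    then show "integral (convex hull T) (\<lambda>x. \<Sum>e\<in>\<E>. edge_dof \<T> m e * (elem_value (psi \<T> \<E> e) T \<bullet> w x))
      = (\<Sum>e\<in>\<E>. edge_dof \<T> m e * integral (convex hull T) (\<lambda>x. elem_value (psi \<T> \<E> e) T \<bullet> w x))"
      by (simp add: Henstock_Kurzweil_Integration.integral_sum finite_edges integrable_on_mult_right)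
  qed
  also have "\<dots> = (\<Sum>e\<in>\<E>. edge_dof \<T> m e * l2 (psi \<T> \<E> e) w)"
    by (subst sum.swap) (intro sum.cong refl, simp add: l2_X1[OF psi_X1 w] sum_distrib_left)
  finally show ?thesis by (simp add: l2_commute[of w] mult.commute)
qed

text \<open>
  The midpoint has coordinates \<open>1/2\<close> at both ends of its edge. Coordinates do not depend on the
  tetrahedron, so any edge through the midpoint has the same two ends.
\<close>

lemma edge_midpoint_separated:
  assumes e: "(x, z) \<in> \<E>" and g: "(x', z') \<in> \<E>" "(x', z') \<noteq> (x, z)" and s: "0 \<le> s" "s \<le> 1"
  shows "x' + s *\<^sub>R (z' - x') - (1/2) *\<^sub>R (x + z) \<notin> lattice"
proof
  define k where "k = x' + s *\<^sub>R (z' - x') - (1/2) *\<^sub>R (x + z)"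
  define y where "y = x' + s *\<^sub>R (z' - x')"
  assume "x' + s *\<^sub>R (z' - x') - (1/2) *\<^sub>R (x + z) \<in> lattice"
  then have k: "k \<in> lattice" by (simp add: k_def)
  obtain T where T: "T \<in> PM" "x' \<in> T" "z' \<in> T" "x' \<noteq> z'" using edge_D[OF g(1)] by blast
  obtain T0 where T0: "T0 \<in> PM" "x \<in> T0" "z \<in> T0" "x \<noteq> z" using edge_D[OF e] by blast
  define T' where "T' = (+) k ` T0"
  have T': "T' \<in> PM" "k + x \<in> T'" "k + z \<in> T'"
    using PM_translate[OF T0(1) k] T0 by (auto simp: T'_def)
  have tT: "tet T" and tT': "tet T'" using tet_PM T T' by auto
  have y1: "y = (1 - s) *\<^sub>R x' + s *\<^sub>R z'" by (simp add: y_def algebra_simps)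
  have y2: "y = (1/2) *\<^sub>R (k + x) + (1/2) *\<^sub>R (k + z)"
  proof -
    have "y = k + (1/2) *\<^sub>R (x + z)" by (simp add: y_def k_def)
    also have "\<dots> = (1/2) *\<^sub>R (k + x) + (1/2) *\<^sub>R (k + z)"
      by (simp add: scaleR_add_right scaleR_add_left[symmetric])
    finally show ?thesis .
  qed
  have yT: "y \<in> convex hull T"
    unfolding y1 using s T by (intro convexD_alt convex_convex_hull hull_inc) auto
  have yT': "y \<in> convex hull T'"
    unfolding y2 using T' convexD[OF convex_convex_hull[of T'], of "k + x" "k + z" "1/2" "1/2"] by (simp add: hull_inc)
  have aff: "bary T w ((1 - r) *\<^sub>R a + r *\<^sub>R b) = (1 - r) * bary T w a + r * bary T w b" for T w a b r
    by (simp add: bary_def inner_diff_right inner_add_right algebra_simps)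
  have mem: "c \<in> {x', z'}" if c: "c \<in> {k + x, k + z}" for c
  proof -
    have cT': "c \<in> T'" using c T' by blast
    have "bary T' c y = 1/2"
      using aff[of T' c "1/2" "k + x" "k + z"] c T0(4) T' unfolding y2
      by (auto simp: bary_vertex[OF tT'])
    moreover have "(\<Sum>w\<in>T. bary T w y *\<^sub>R (of_bool (w = c) :: real)) = (\<Sum>w\<in>T'. bary T' w y *\<^sub>R of_bool (w = c))"
      by (rule bary_common[OF T(1) T'(1) yT yT'])
    moreover have "(\<Sum>w\<in>T'. bary T' w y *\<^sub>R (of_bool (w = c) :: real)) = bary T' c y"
      using cT' tet_finite[OF tT'] by (simp add: of_bool_def if_distrib[of "(*) _"] cong: if_cong)
    moreover have "(\<Sum>w\<in>T. bary T w y *\<^sub>R (of_bool (w = c) :: real)) = (if c \<in> T then bary T c y else 0)"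
      using tet_finite[OF tT] by (simp add: of_bool_def if_distrib[of "(*) _"] cong: if_cong)
    ultimately have "c \<in> T" "bary T c y \<noteq> 0" by (auto split: if_splits)
    then show ?thesis
      using aff[of T c s x' z'] T unfolding y1 by (auto simp: bary_vertex[OF tT] split: if_splits)
  qed
  then have "k + x \<in> {x', z'}" "k + z \<in> {x', z'}" by blast+
  then have "(x', z') = (x + k, z + k) \<or> (x', z') = (z + k, x + k)" using T0(4) by (auto simp: add.commute)
  then have "is_edge_rep x z (x', z')" using g(1) k unfolding is_edge_rep_def by blast
  then have "edge_rep x z = (x', z')" by (rule edge_rep_eqI[OF T0])
  then show False using edge_rep_self[OF e] g(2) by simp
qed

lemma peak_field_tt_integral:
  assumes e: "x \<noteq> z"
  shows "tt_integral (x, z) (\<lambda>y. peak p y ^ N *\<^sub>R rank_one t)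
    = norm (z - x) * ((tangent (x, z) \<bullet> t) * (tangent (x, z) \<bullet> t)) * integral {0..1} (\<lambda>s. peak p (x + s *\<^sub>R (z - x)) ^ N)"
proof -
  have "tangent (x, z) \<bullet> ((c *\<^sub>R rank_one t) *v tangent (x, z)) = ((tangent (x, z) \<bullet> t) * (tangent (x, z) \<bullet> t)) * c" for c
    by (simp add: scaleR_matrix_vector_assoc[symmetric] rank_one_form)
  moreover have "linepath x z s = x + s *\<^sub>R (z - x)" for s by (simp add: linepath_def algebra_simps)
  ultimately show ?thesis by (simp add: tt_integral_def edge_integral_def)
qed

text \<open>
  Test with \<open>peak\<^sup>N\<close> times a rank-one matrix, for a peak at the midpoint of \<open>e0\<close>. On all other edges
  \<open>peak\<close> is bounded by some \<open>\<rho> < 1\<close>, as they avoid the midpoint, while on \<open>e0\<close> it exceeds some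
  \<open>q > \<rho>\<close> on an interval. So the contribution of \<open>e0\<close> would dominate as \<open>N\<close> grows.
\<close>

lemma edge_functionals_independent:
  assumes zero: "\<And>v. v \<in> smoothS \<Longrightarrow> (\<Sum>e\<in>\<E>. D e * tt_integral e v) = 0" and e0: "e0 \<in> \<E>"
  shows "D e0 = 0"
proof -
  obtain x z where xz: "e0 = (x, z)" by (cases e0)
  have ne: "x \<noteq> z" using edge_D e0 xz by blast
  define p where "p = (1/2) *\<^sub>R (x + z)"
  define t where "t = tangent e0"
  define \<gamma> where "\<gamma> e s = fst e + s *\<^sub>R (snd e - fst e)" for e :: edge and s :: real
  define J where "J e N = integral {0..1} (\<lambda>s. peak p (\<gamma> e s) ^ N)" for e N
  define C where "C e = D e * (norm (snd e - fst e) * ((tangent e \<bullet> t) * (tangent e \<bullet> t)))" for e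
  have cont: "continuous_on S (\<lambda>s. peak p (\<gamma> e s) ^ N)" for S e N
    unfolding \<gamma>_def
    by (intro continuous_on_power continuous_compose_UNIV[OF smooth_continuous_on[OF smooth_peak]] continuous_intros)
  have int: "(\<lambda>s. peak p (\<gamma> e s) ^ N) integrable_on {0..1}" for e N
    by (rule integrable_continuous_interval[OF cont])
  have eq: "(\<Sum>e\<in>\<E>. C e * J e N) = 0" for N
  proof -
    have per: "periodic (\<lambda>y. peak p y ^ N)" using periodic_peak[of p] by (simp add: periodic_def)
    have "(\<Sum>e\<in>\<E>. D e * tt_integral e (\<lambda>y. peak p y ^ N *\<^sub>R rank_one t)) = 0"
      by (intro zero rank_one_smoothS smooth_power smooth_peak per)
    moreover have "D e * tt_integral e (\<lambda>y. peak p y ^ N *\<^sub>R rank_one t) = C e * J e N" if "e \<in> \<E>" for e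
      using peak_field_tt_integral[of "fst e" "snd e" p N t] edge_D[of "fst e" "snd e"] that
      by (simp add: C_def J_def \<gamma>_def)
    ultimately show ?thesis by simp
  qed
  have "\<forall>e\<in>\<E> - {e0}. \<exists>r<1. \<forall>s\<in>{0..1}. peak p (\<gamma> e s) \<le> r"
  proof
    fix e assume e: "e \<in> \<E> - {e0}"
    obtain s0 where s0: "s0 \<in> {0..1}" "\<And>s. s \<in> {0..1} \<Longrightarrow> peak p (\<gamma> e s) \<le> peak p (\<gamma> e s0)"
      using continuous_attains_sup[of "{0..1}" "\<lambda>s. peak p (\<gamma> e s)"] cont[of "{0..1}" e 1] by auto
    have "\<gamma> e s0 - p \<notin> lattice"
      unfolding \<gamma>_def p_def using edge_midpoint_separated[of x z "fst e" "snd e" s0] e e0 xz s0(1) by auto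
    then have "peak p (\<gamma> e s0) < 1" by (rule peak_less)
    then show "\<exists>r<1. \<forall>s\<in>{0..1}. peak p (\<gamma> e s) \<le> r" using s0(2) by blast
  qed
  then obtain r where r: "\<And>e. e \<in> \<E> - {e0} \<Longrightarrow> r e < 1 \<and> (\<forall>s\<in>{0..1}. peak p (\<gamma> e s) \<le> r e)" by metis
  define \<rho> where "\<rho> = Max (insert 0 (r ` (\<E> - {e0})))"
  have fin: "finite (insert 0 (r ` (\<E> - {e0})))" using finite_edges by simp
  have \<rho>: "0 \<le> \<rho>" "\<rho> < 1" "\<And>e. e \<in> \<E> - {e0} \<Longrightarrow> r e \<le> \<rho>"
    unfolding \<rho>_def using fin r by (auto simp: Max_ge)
  have upper: "0 \<le> J e N \<and> J e N \<le> \<rho> ^ N" if e: "e \<in> \<E> - {e0}" for e N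
  proof
    show "0 \<le> J e N" unfolding J_def by (intro Henstock_Kurzweil_Integration.integral_nonneg int zero_le_power peak_bounds)
    have "J e N \<le> integral {0..1} (\<lambda>s::real. \<rho> ^ N)"
      unfolding J_def
    proof (rule integral_le[OF int])
      fix s :: real assume "s \<in> {0..1}"
      then have "peak p (\<gamma> e s) \<le> \<rho>" using r[OF e] \<rho>(3)[OF e] by force
      then show "peak p (\<gamma> e s) ^ N \<le> \<rho> ^ N" by (intro power_mono peak_bounds)
    qed (rule integrable_const_ivl)
    then show "J e N \<le> \<rho> ^ N" by simp
  qed
  \<comment> \<open>Any value strictly between \<open>\<rho>\<close> and the maximum \<open>1\<close>.\<close>
  define q where "q = (1 + \<rho>) / 2"
  have q: "\<rho> < q" "q < 1" using \<rho> by (auto simp: q_def)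
  have mid: "\<gamma> e0 (1/2) = p" by (simp add: \<gamma>_def p_def xz vec_eq_iff field_simps)
  have "isCont (\<lambda>s. peak p (\<gamma> e0 s)) (1/2)"
    using cont[of UNIV e0 1] by (simp add: continuous_on_eq_continuous_at)
  then have "\<forall>\<epsilon>>0. \<exists>\<delta>>0. \<forall>s. \<bar>s - 1/2\<bar> < \<delta> \<longrightarrow> \<bar>peak p (\<gamma> e0 s) - 1\<bar> < \<epsilon>"
    unfolding continuous_at_eps_delta by (simp add: mid peak_self dist_real_def)
  then obtain \<delta> where \<delta>: "\<delta> > 0" "\<And>s. \<bar>s - 1/2\<bar> < \<delta> \<Longrightarrow> \<bar>peak p (\<gamma> e0 s) - 1\<bar> < 1 - q"
    using q(2) by (metis diff_gt_0_iff_gt)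
  define \<eta> where "\<eta> = min (\<delta> / 2) (1/2)"
  have \<eta>: "0 < \<eta>" "\<eta> < \<delta>" "\<eta> \<le> 1/2" using \<delta>(1) by (auto simp: \<eta>_def)
  have lower: "\<eta> * q ^ N \<le> J e0 N" for N
  proof -
    have sub: "{1/2..1/2 + \<eta>} \<subseteq> {0..1}" using \<eta> by auto
    have "\<eta> * q ^ N = integral {1/2..1/2 + \<eta>} (\<lambda>s::real. q ^ N)" using \<eta> by simp
    also have "\<dots> \<le> integral {1/2..1/2 + \<eta>} (\<lambda>s. peak p (\<gamma> e0 s) ^ N)"
    proof (rule integral_le)
      show "(\<lambda>s. peak p (\<gamma> e0 s) ^ N) integrable_on {1/2..1/2 + \<eta>}" by (rule integrable_continuous_interval[OF cont])
      fix s assume "s \<in> {1/2..1/2 + \<eta>}"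
      then have "\<bar>s - 1/2\<bar> < \<delta>" using \<eta> by auto
      then have "q \<le> peak p (\<gamma> e0 s)" using \<delta>(2)[of s] by linarith
      then show "q ^ N \<le> peak p (\<gamma> e0 s) ^ N" using q \<rho> by (intro power_mono) auto
    qed (rule integrable_const_ivl)
    also have "\<dots> \<le> J e0 N"
      unfolding J_def
      by (rule integral_subset_le[OF sub]) (auto intro!: int integrable_continuous_interval[OF cont] zero_le_power peak_bounds)
    finally show ?thesis .
  qed
  define B where "B = (\<Sum>e\<in>\<E> - {e0}. \<bar>C e\<bar>)"
  have "\<bar>C e0 * \<eta>\<bar> * q ^ N \<le> B * \<rho> ^ N" for N
  proof -
    have "\<bar>C e0 * \<eta>\<bar> * q ^ N = \<bar>C e0\<bar> * (\<eta> * q ^ N)" using \<eta>(1) by (simp add: abs_mult)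
    also have "\<dots> \<le> \<bar>C e0\<bar> * J e0 N" by (intro mult_left_mono lower) simp
    also have "\<dots> = \<bar>C e0 * J e0 N\<bar>" using lower[of N] \<eta> q \<rho> by (simp add: abs_mult abs_of_nonneg order_trans[OF _ lower[of N]])
    also have "C e0 * J e0 N = - (\<Sum>e\<in>\<E> - {e0}. C e * J e N)"
      using eq[of N] sum.remove[OF finite_edges e0, of "\<lambda>e. C e * J e N"] by simp
    also have "\<bar>- (\<Sum>e\<in>\<E> - {e0}. C e * J e N)\<bar> \<le> (\<Sum>e\<in>\<E> - {e0}. \<bar>C e * J e N\<bar>)"
      by (simp add: sum_abs)
    also have "\<dots> \<le> (\<Sum>e\<in>\<E> - {e0}. \<bar>C e\<bar> * \<rho> ^ N)"
      by (intro sum_mono) (use upper in \<open>auto simp: abs_mult intro!: mult_left_mono\<close>)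
    finally show ?thesis by (simp add: B_def sum_distrib_right)
  qed
  then have "C e0 * \<eta> = 0" using \<rho>(1) q(1) by (rule powers_dominate)
  then have C0: "C e0 = 0" using \<eta>(1) by simp
  have "tangent e0 \<bullet> tangent e0 = 1"
    using ne by (simp add: tangent_def xz dot_square_norm power2_eq_square)
  then show ?thesis using C0 ne by (simp add: C_def t_def xz)
qed

end

section \<open>Interpolants, chains and the commuting diagram\<close>

lemma l2_sum_right:
  fixes v :: "real ^ 3 \<Rightarrow> 'a::euclidean_space"
  assumes v: "continuous_on UNIV v" and g: "\<And>i. i \<in> A \<Longrightarrow> continuous_on UNIV (g i)" and A: "finite A"
  shows "l2 v (\<lambda>x. \<Sum>i\<in>A. g i x) = (\<Sum>i\<in>A. l2 v (g i))"
proof -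
  have "(\<lambda>x. v x \<bullet> g i x) integrable_on (cbox 0 1)" if "i \<in> A" for i
    by (intro integrable_continuous continuous_on_inner continuous_on_subset[OF v] continuous_on_subset[OF g[OF that]]) auto
  then show ?thesis
    unfolding l2_def by (simp add: inner_sum_right Henstock_Kurzweil_Integration.integral_sum[OF A])
qed

lemma l2_scaleR_right: "l2 v (\<lambda>x. c *\<^sub>R g x) = c * l2 v g"
  by (simp add: l2_def)

lemma form_sym_grad:
  assumes u: "u \<in> smoothV"
  shows "form (sym_grad u) w w = dd w (\<lambda>x. w \<bullet> u x)"
proof
  fix x
  have sm: "smooth u" by (rule smoothV_smooth[OF u])
  have "dd w (\<lambda>x. w \<bullet> u x) x = w \<bullet> dd w u x"
    by (rule dd_linear[OF bounded_linear_inner_right sm])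
  also have "\<dots> = (\<Sum>i\<in>UNIV. \<Sum>j\<in>UNIV. w $ i * (w $ j * pd j (\<lambda>y. u y $ i) x))"
    by (simp add: dd_def inner_vec_def sum_component sum_distrib_left pd_vec_nth[OF sm])
  finally show "form (sym_grad u) w w x = dd w (\<lambda>x. w \<bullet> u x) x"
    unfolding form_nth sym_grad_nth[OF sm] by (simp add: sum_3 field_simps)
qed

text \<open>
  In the direction of the edge, \<open>sym_grad u\<close> is the derivative of \<open>(b - a) \<bullet> u\<close>.
\<close>

lemma edge_mean_sym_grad:
  assumes u: "u \<in> smoothV"
  shows "edge_mean a b (sym_grad u) = (b - a) \<bullet> (u b - u a)"
proof -
  have "smooth (\<lambda>x. (b - a) \<bullet> u x)"
    by (rule smooth_linear[OF bounded_linear_inner_right smoothV_smooth[OF u]])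
  then show ?thesis
    unfolding edge_mean_def form_sym_grad[OF u] by (simp add: mean1_deriv inner_diff_right)
qed

lemma sum_single:
  assumes "finite A" "y \<in> A"
  shows "(\<Sum>z\<in>A. c z \<bullet> single y L z) = c y \<bullet> (L :: real ^ 3)" "(\<Sum>z\<in>A. single y L z \<bullet> c z) = L \<bullet> c y"
proof -
  have "(\<Sum>z\<in>A. c z \<bullet> single y L z) = (\<Sum>z\<in>A. if y = z then c z \<bullet> L else 0)"
    by (intro sum.cong refl) (auto simp: single_def)
  then show "(\<Sum>z\<in>A. c z \<bullet> single y L z) = c y \<bullet> L" using assms by simp
  have "(\<Sum>z\<in>A. single y L z \<bullet> c z) = (\<Sum>z\<in>A. if y = z then L \<bullet> c z else 0)"
    by (intro sum.cong refl) (auto simp: single_def)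
  then show "(\<Sum>z\<in>A. single y L z \<bullet> c z) = L \<bullet> c y" using assms by simp
qed

lemma cochain_expand:
  assumes fin: "finite \<E>" and \<phi>: "\<phi> \<in> cochains1 \<E>" and c: "c \<in> chains1 \<E>"
  shows "\<phi> c = (\<Sum>e\<in>\<E>. c e * \<phi> (single e 1))"
proof -
  have add: "\<phi> (\<lambda>e. c e + d e) = \<phi> c + \<phi> d" if "c \<in> chains1 \<E>" "d \<in> chains1 \<E>" for c d
    using \<phi> that unfolding cochains1_def by blast
  have scale: "\<phi> (\<lambda>e. r * c e) = r * \<phi> c" if "c \<in> chains1 \<E>" for r c
    using \<phi> that unfolding cochains1_def by blast
  have part: "\<phi> (\<lambda>e. if e \<in> A then c e else 0) = (\<Sum>e\<in>A. c e * \<phi> (single e 1))" if "finite A" "A \<subseteq> \<E>" for A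
    using that
  proof induction
    case empty
    have "\<phi> (\<lambda>e. 0 * c e) = 0 * \<phi> c" by (rule scale[OF c])
    then show ?case by simp
  next
    case (insert x A)
    have s: "single x (1::real) \<in> chains1 \<E>" using insert.prems by (auto simp: chains1_def single_def)
    have "(\<lambda>e. if e \<in> insert x A then c e else 0) = (\<lambda>e. c x * single x 1 e + (if e \<in> A then c e else 0))"
      using insert.hyps by (auto simp: single_def fun_eq_iff)
    moreover have "(\<lambda>e. c x * single x 1 e) \<in> chains1 \<E>" "(\<lambda>e. if e \<in> A then c e else 0) \<in> chains1 \<E>"
      using s insert.prems by (auto simp: chains1_def)
    ultimately show ?case using insert by (simp add: add scale[OF s])
  qed
  have "(\<lambda>e. if e \<in> \<E> then c e else 0) = c" using c by (auto simp: chains1_def fun_eq_iff)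
  then show ?thesis using part[OF fin subset_refl] by simp
qed

context mesh
begin

text \<open>
  High powers of a peak at \<open>p\<close> annihilate all other vertices in the limit.
\<close>

lemma point_dist_inj:
  assumes eq: "point_dist \<T> a = point_dist \<T> b" and p: "p \<in> vertices \<T>"
  shows "a p = b p"
proof -
  define L where "L = a p - b p"
  have "(\<lambda>N. \<Sum>y\<in>vertices \<T>. ((a y - b y) \<bullet> L) * peak p y ^ N) \<longlonglongrightarrow> (a p - b p) \<bullet> L"
  proof (rule weighted_powers_limit[OF finite_vertices p peak_self])
    fix y assume y: "y \<in> vertices \<T> - {p}"
    have "y - p \<notin> lattice"
    proof
      assume "y - p \<in> lattice"
      then have "torus_rep (y - p + p) = torus_rep p" by (rule torus_rep_add(2))
      then show False using y vertices_torus_rep[of y] vertices_torus_rep[OF p] by simp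
    qed
    then show "0 \<le> peak p y \<and> peak p y < 1" using peak_bounds(1) peak_less by blast
  qed
  moreover have "(\<Sum>y\<in>vertices \<T>. ((a y - b y) \<bullet> L) * peak p y ^ N) = 0" for N
  proof -
    have "periodic (\<lambda>y. peak p y ^ N)" using periodic_peak[of p] by (simp add: periodic_def)
    then have v: "(\<lambda>x. peak p x ^ N *\<^sub>R L) \<in> smoothV"
      by (intro linear_vec_smoothV smooth_power smooth_peak)
    have "(\<Sum>y\<in>vertices \<T>. (c y \<bullet> L) * peak p y ^ N) = point_dist \<T> c (\<lambda>x. peak p x ^ N *\<^sub>R L)" for c
      using v by (simp add: point_dist_def mult.commute)
    then have "(\<Sum>y\<in>vertices \<T>. (a y \<bullet> L) * peak p y ^ N) = (\<Sum>y\<in>vertices \<T>. (b y \<bullet> L) * peak p y ^ N)"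
      by (simp only: eq)
    then show ?thesis
      by (simp only: inner_diff_left left_diff_distrib sum_subtractf diff_self)
  qed
  ultimately have "(\<lambda>N::nat. 0) \<longlonglongrightarrow> (a p - b p) \<bullet> L" by (simp only:)
  then have "(a p - b p) \<bullet> L = 0" by (rule LIMSEQ_unique[OF _ tendsto_const])
  then show ?thesis by (simp add: L_def)
qed

lemma point_dist_cong: "(\<And>y. y \<in> vertices \<T> \<Longrightarrow> a y = b y) \<Longrightarrow> point_dist \<T> a = point_dist \<T> b"
  unfolding point_dist_def by (simp cong: sum.cong)

text \<open>
  The coefficients are determined by the functional, so the definite description denotes.
\<close>

lemma pair3_eq: "pair3 \<T> (point_dist \<T> a) u = (\<Sum>y\<in>vertices \<T>. a y \<bullet> u y)"
  unfolding pair3_def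
proof (rule the_equality)
  show "\<exists>b. point_dist \<T> a = point_dist \<T> b \<and> (\<Sum>y\<in>vertices \<T>. a y \<bullet> u y) = (\<Sum>y\<in>vertices \<T>. b y \<bullet> u y)" by blast
next
  fix s assume "\<exists>b. point_dist \<T> a = point_dist \<T> b \<and> s = (\<Sum>y\<in>vertices \<T>. b y \<bullet> u y)"
  then obtain b where b: "point_dist \<T> a = point_dist \<T> b" "s = (\<Sum>y\<in>vertices \<T>. b y \<bullet> u y)" by blast
  show "s = (\<Sum>y\<in>vertices \<T>. a y \<bullet> u y)"
    unfolding b(2) by (intro sum.cong refl) (simp add: point_dist_inj[OF b(1)])
qed

lemma continuous_hat: "y \<in> vertices \<T> \<Longrightarrow> continuous_on UNIV (hat \<T> y)"
  by (simp add: hat_eq pwl_continuous)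

text \<open>
  The coefficients of the interpolant \<open>I3 v\<close>.
\<close>

definition moment :: "(real ^ 3 \<Rightarrow> real ^ 3) \<Rightarrow> real ^ 3 \<Rightarrow> real ^ 3" where
  "moment v y = (\<chi> i. l2 v (\<lambda>x. hat \<T> y x *\<^sub>R axis i 1))"

lemma l2_hat:
  assumes v: "continuous_on UNIV v" and y: "y \<in> vertices \<T>"
  shows "l2 v (\<lambda>x. hat \<T> y x *\<^sub>R L) = moment v y \<bullet> L"
proof -
  have "(\<lambda>x. hat \<T> y x *\<^sub>R L) = (\<lambda>x. \<Sum>i\<in>UNIV. L $ i *\<^sub>R (hat \<T> y x *\<^sub>R axis i 1))"
  proof
    fix x
    have "hat \<T> y x *\<^sub>R L = hat \<T> y x *\<^sub>R (\<Sum>i\<in>UNIV. L $ i *\<^sub>R axis i 1)"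
      by (rule arg_cong[OF vec_axis_sum])
    then show "hat \<T> y x *\<^sub>R L = (\<Sum>i\<in>UNIV. L $ i *\<^sub>R (hat \<T> y x *\<^sub>R axis i 1))"
      by (simp only: scaleR_sum_right scaleR_left_commute[of "L $ _"])
  qed
  then have "l2 v (\<lambda>x. hat \<T> y x *\<^sub>R L) = l2 v (\<lambda>x. \<Sum>i\<in>UNIV. L $ i *\<^sub>R (hat \<T> y x *\<^sub>R axis i 1))"
    by (rule arg_cong)
  also have "\<dots> = (\<Sum>i\<in>UNIV. l2 v (\<lambda>x. L $ i *\<^sub>R (hat \<T> y x *\<^sub>R axis i 1)))"
    by (rule l2_sum_right[OF v]) (auto intro!: continuous_intros continuous_hat[OF y])
  also have "\<dots> = moment v y \<bullet> L"
    unfolding l2_scaleR_right by (simp add: moment_def inner_vec_def mult.commute)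
  finally show ?thesis .
qed

lemma l2_X0_expand:
  assumes v: "continuous_on UNIV v" and u: "u \<in> X0 \<T>"
  shows "l2 v u = (\<Sum>y\<in>vertices \<T>. moment v y \<bullet> u y)"
proof -
  have "u = (\<lambda>x. \<Sum>y\<in>vertices \<T>. hat \<T> y x *\<^sub>R u y)"
  proof
    fix x
    have "u x = pwl u x" by (rule fun_cong[OF X0_eq[OF u]])
    then show "u x = (\<Sum>y\<in>vertices \<T>. hat \<T> y x *\<^sub>R u y)" by (simp only: pwl_sum_hat)
  qed
  then have "l2 v u = l2 v (\<lambda>x. \<Sum>y\<in>vertices \<T>. hat \<T> y x *\<^sub>R u y)" by (rule arg_cong)
  also have "\<dots> = (\<Sum>y\<in>vertices \<T>. l2 v (\<lambda>x. hat \<T> y x *\<^sub>R u y))"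
    by (rule l2_sum_right[OF v _ finite_vertices]) (auto intro!: continuous_intros continuous_hat)
  also have "\<dots> = (\<Sum>y\<in>vertices \<T>. moment v y \<bullet> u y)"
    by (intro sum.cong refl l2_hat[OF v])
  finally show ?thesis .
qed

lemma I3_eq:
  assumes v: "continuous_on UNIV v"
  shows "Defs.I3 \<T> v = point_dist \<T> (moment v)"
  unfolding Defs.I3_def
proof (rule the_equality)
  show "point_dist \<T> (moment v) \<in> X3 \<T> \<and> (\<forall>u\<in>X0 \<T>. pair3 \<T> (point_dist \<T> (moment v)) u = l2 v u)"
    by (simp add: X3_def pair3_eq l2_X0_expand[OF v])
next
  fix W assume W: "W \<in> X3 \<T> \<and> (\<forall>u\<in>X0 \<T>. pair3 \<T> W u = l2 v u)"
  then obtain a where a: "W = point_dist \<T> a" by (auto simp: X3_def)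
  have "a y = moment v y" if y: "y \<in> vertices \<T>" for y
  proof -
    have "a y \<bullet> L = moment v y \<bullet> L" for L
    proof -
      have "(\<Sum>z\<in>vertices \<T>. a z \<bullet> pwl (single y L) z) = (\<Sum>z\<in>vertices \<T>. moment v z \<bullet> pwl (single y L) z)"
        using W pwl_X0[of "single y L"] l2_X0_expand[OF v pwl_X0[of "single y L"]] unfolding a pair3_eq by simp
      then show ?thesis
        by (simp add: pwl_vertex sum_single[OF finite_vertices y] cong: sum.cong)
    qed
    then show ?thesis using vector_eq_rdot by blast
  qed
  then show "W = point_dist \<T> (moment v)" unfolding a by (rule point_dist_cong)
qed

lemma J0_eq: "J0 \<T> u = (\<lambda>y. if y \<in> vertices \<T> then u y else 0)"
  unfolding J0_def
proof (rule the_equality)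
  show "(\<lambda>y. if y \<in> vertices \<T> then u y else 0) \<in> cochains0V \<T> \<and>
      (\<forall>y\<in>vertices \<T>. \<forall>L. pair0V \<T> (\<lambda>y. if y \<in> vertices \<T> then u y else 0) (single y L) = L \<bullet> u y)"
    by (simp add: cochains0V_def pair0V_def sum_single[OF finite_vertices] inner_commute)
next
  fix c assume c: "c \<in> cochains0V \<T> \<and> (\<forall>y\<in>vertices \<T>. \<forall>L. pair0V \<T> c (single y L) = L \<bullet> u y)"
  have "c y = u y" if "y \<in> vertices \<T>" for y
  proof -
    have "c y \<bullet> L = u y \<bullet> L" for L
    proof -
      have "pair0V \<T> c (single y L) = L \<bullet> u y" using c that by blast
      then show ?thesis by (simp add: pair0V_def sum_single[OF finite_vertices that] inner_commute)
    qed
    then show ?thesis using vector_eq_rdot by blast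
  qed
  then show "c = (\<lambda>y. if y \<in> vertices \<T> then u y else 0)"
    using c by (auto simp: cochains0V_def fun_eq_iff)
qed

lemma J0_inj: "inj_on (J0 \<T>) (X0 \<T>)"
proof (rule inj_onI)
  fix u v assume u: "u \<in> X0 \<T>" and v: "v \<in> X0 \<T>" and eq: "J0 \<T> u = J0 \<T> v"
  show "u = v"
  proof (rule pw_linear_unique)
    show "pw_linear \<T> u" "pw_linear \<T> v" using u v by (simp_all add: X0_def)
    fix y assume "y \<in> vertices \<T>"
    then show "u y = v y" using fun_cong[OF eq, of y] by (simp add: J0_eq)
  qed
qed

lemma J3_eq: "J3 \<T> (point_dist \<T> a) = (\<lambda>y. if y \<in> vertices \<T> then a y else 0)"
proof -
  have p: "pair3 \<T> (point_dist \<T> a) (\<lambda>x. hat \<T> y x *\<^sub>R L) = L \<bullet> a y" if y: "y \<in> vertices \<T>" for y L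
  proof -
    have "pair3 \<T> (point_dist \<T> a) (\<lambda>x. hat \<T> y x *\<^sub>R L) = (\<Sum>z\<in>vertices \<T>. if y = z then a z \<bullet> L else 0)"
      unfolding pair3_eq by (intro sum.cong refl) (auto simp: hat_eq[OF y] pwl_vertex)
    then show ?thesis using finite_vertices y by (simp add: inner_commute)
  qed
  show ?thesis
    unfolding J3_def
  proof (rule the_equality)
    show "(\<lambda>y. if y \<in> vertices \<T> then a y else 0) \<in> chains0V \<T> \<and>
        (\<forall>y\<in>vertices \<T>. \<forall>L. pair0V \<T> (single y L) (\<lambda>y. if y \<in> vertices \<T> then a y else 0) = pair3 \<T> (point_dist \<T> a) (\<lambda>x. hat \<T> y x *\<^sub>R L))"
      by (simp add: chains0V_def pair0V_def sum_single[OF finite_vertices] p)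
  next
    fix b assume b: "b \<in> chains0V \<T> \<and> (\<forall>y\<in>vertices \<T>. \<forall>L. pair0V \<T> (single y L) b = pair3 \<T> (point_dist \<T> a) (\<lambda>x. hat \<T> y x *\<^sub>R L))"
    have "b y = a y" if y: "y \<in> vertices \<T>" for y
    proof -
      have "L \<bullet> b y = L \<bullet> a y" for L
      proof -
        have "pair0V \<T> (single y L) b = pair3 \<T> (point_dist \<T> a) (\<lambda>x. hat \<T> y x *\<^sub>R L)" using b y by blast
        then show ?thesis by (simp add: pair0V_def sum_single[OF finite_vertices y] p[OF y])
      qed
      then show ?thesis using vector_eq_ldot by blast
    qed
    then show "b = (\<lambda>y. if y \<in> vertices \<T> then a y else 0)"
      using b by (auto simp: chains0V_def fun_eq_iff)
  qed
qed

lemma pwl_mesh_vertex: "periodic u \<Longrightarrow> T \<in> PM \<Longrightarrow> z \<in> T \<Longrightarrow> pwl u z = u z"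
  using pwl_vertex[OF vertex_torus_rep, of T z u] periodic_torus_rep[OF pwl_periodic, of u z] periodic_torus_rep[of u z] by simp

end

context mesh_edges
begin

lemma edge_dist_inj:
  assumes eq: "edge_dist \<E> a = edge_dist \<E> b" and e: "e \<in> \<E>"
  shows "a e = b e"
proof -
  have "(\<Sum>e\<in>\<E>. (a e - b e) * tt_integral e v) = 0" if "v \<in> smoothS" for v
    using fun_cong[OF eq, of v] that by (simp add: edge_dist_def left_diff_distrib sum_subtractf)
  then have "a e - b e = 0" by (rule edge_functionals_independent[OF _ e])
  then show ?thesis by simp
qed

lemma edge_dist_cong: "(\<And>e. e \<in> \<E> \<Longrightarrow> a e = b e) \<Longrightarrow> edge_dist \<E> a = edge_dist \<E> b"
  unfolding edge_dist_def by (simp cong: sum.cong)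

lemma pair2_eq: "pair2 \<T> \<E> (edge_dist \<E> a) m = (\<Sum>e\<in>\<E>. a e * edge_dof \<T> m e)"
  unfolding pair2_def
proof (rule the_equality)
  show "\<exists>b. edge_dist \<E> a = edge_dist \<E> b \<and> (\<Sum>e\<in>\<E>. a e * edge_dof \<T> m e) = (\<Sum>e\<in>\<E>. b e * edge_dof \<T> m e)" by blast
next
  fix s assume "\<exists>b. edge_dist \<E> a = edge_dist \<E> b \<and> s = (\<Sum>e\<in>\<E>. b e * edge_dof \<T> m e)"
  then obtain b where b: "edge_dist \<E> a = edge_dist \<E> b" "s = (\<Sum>e\<in>\<E>. b e * edge_dof \<T> m e)" by blast
  show "s = (\<Sum>e\<in>\<E>. a e * edge_dof \<T> m e)"
    unfolding b(2) by (intro sum.cong refl) (simp add: edge_dist_inj[OF b(1)])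
qed

lemma pair2_psi: "e \<in> \<E> \<Longrightarrow> pair2 \<T> \<E> (edge_dist \<E> a) (psi \<T> \<E> e) = a e"
proof -
  assume e: "e \<in> \<E>"
  have "pair2 \<T> \<E> (edge_dist \<E> a) (psi \<T> \<E> e) = (\<Sum>g\<in>\<E>. if e = g then a g else 0)"
    unfolding pair2_eq by (intro sum.cong refl) (auto simp: edge_dof_psi[OF e])
  then show ?thesis using finite_edges e by simp
qed

lemma I2_eq:
  assumes w: "continuous_on UNIV w"
  shows "Defs.I2 \<T> \<E> w = edge_dist \<E> (\<lambda>e. l2 w (psi \<T> \<E> e))"
  unfolding Defs.I2_def
proof (rule the_equality)
  show "edge_dist \<E> (\<lambda>e. l2 w (psi \<T> \<E> e)) \<in> X2 \<E> \<and> (\<forall>m\<in>X1 \<T>. pair2 \<T> \<E> (edge_dist \<E> (\<lambda>e. l2 w (psi \<T> \<E> e))) m = l2 w m)"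
    by (simp add: X2_def pair2_eq l2_psi_expand[OF _ w])
next
  fix W assume W: "W \<in> X2 \<E> \<and> (\<forall>m\<in>X1 \<T>. pair2 \<T> \<E> W m = l2 w m)"
  then obtain a where a: "W = edge_dist \<E> a" by (auto simp: X2_def)
  have "a e = l2 w (psi \<T> \<E> e)" if e: "e \<in> \<E>" for e
    using W psi_X1[OF e] pair2_psi[OF e, of a] unfolding a by simp
  then show "W = edge_dist \<E> (\<lambda>e. l2 w (psi \<T> \<E> e))" unfolding a by (rule edge_dist_cong)
qed

lemma J1_eq: "J1 \<T> \<E> m = (\<lambda>c\<in>chains1 \<E>. \<Sum>e\<in>\<E>. c e * edge_dof \<T> m e)"
proof -
  define \<phi> where "\<phi> = (\<lambda>c\<in>chains1 \<E>. \<Sum>e\<in>\<E>. c e * edge_dof \<T> m e)"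
  have \<phi>: "\<phi> \<in> cochains1 \<E>"
    unfolding cochains1_def \<phi>_def
    by (auto simp: chains1_def distrib_right sum.distrib sum_distrib_left mult.assoc)
  have s: "single e (1::real) \<in> chains1 \<E>" if "e \<in> \<E>" for e using that by (auto simp: chains1_def single_def)
  have val: "\<phi> (single e 1) = edge_dof \<T> m e" if e: "e \<in> \<E>" for e
  proof -
    have "\<phi> (single e 1) = (\<Sum>g\<in>\<E>. if e = g then edge_dof \<T> m g else 0)"
      unfolding \<phi>_def restrict_apply'[OF s[OF e]] by (intro sum.cong refl) (auto simp: single_def)
    then show ?thesis using finite_edges e by simp
  qed
  show ?thesis
    unfolding J1_def \<phi>_def[symmetric]
  proof (rule the_equality)
    show "\<phi> \<in> cochains1 \<E> \<and> (\<forall>e\<in>\<E>. \<phi> (single e 1) = edge_dof \<T> m e)" using \<phi> val by blast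
  next
    fix \<omega> assume \<omega>: "\<omega> \<in> cochains1 \<E> \<and> (\<forall>e\<in>\<E>. \<omega> (single e 1) = edge_dof \<T> m e)"
    show "\<omega> = \<phi>"
    proof (rule extensionalityI)
      show "\<omega> \<in> extensional (chains1 \<E>)" "\<phi> \<in> extensional (chains1 \<E>)" using \<omega> \<phi> by (simp_all add: cochains1_def)
      fix c assume c: "c \<in> chains1 \<E>"
      show "\<omega> c = \<phi> c"
        using cochain_expand[OF finite_edges _ c, of \<omega>] cochain_expand[OF finite_edges \<phi> c] \<omega> val by (simp cong: sum.cong)
    qed
  qed
qed

lemma J1_single: "e \<in> \<E> \<Longrightarrow> J1 \<T> \<E> m (single e 1) = edge_dof \<T> m e"
proof -
  assume e: "e \<in> \<E>"
  have "single e (1::real) \<in> chains1 \<E>" using e by (auto simp: chains1_def single_def)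
  then have "J1 \<T> \<E> m (single e 1) = (\<Sum>g\<in>\<E>. if e = g then edge_dof \<T> m g else 0)"
    unfolding J1_eq by (simp, intro sum.cong refl) (auto simp: single_def)
  then show ?thesis using finite_edges e by simp
qed

lemma J1_cochains: "J1 \<T> \<E> m \<in> cochains1 \<E>"
  unfolding cochains1_def J1_eq
  by (auto simp: chains1_def distrib_right sum.distrib sum_distrib_left mult.assoc)

lemma J1_inj: "inj_on (J1 \<T> \<E>) (X1 \<T>)"
proof (rule inj_onI)
  fix m m' assume m: "m \<in> X1 \<T>" "m' \<in> X1 \<T>" and eq: "J1 \<T> \<E> m = J1 \<T> \<E> m'"
  show "m = m'"
    by (rule X1_unique_dof[OF m]) (metis J1_single eq)
qed

lemma J2_eq: "J2 \<T> \<E> W = (\<lambda>e. if e \<in> \<E> then pair2 \<T> \<E> W (psi \<T> \<E> e) else 0)"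
proof -
  have d: "dual_edge \<E> e c = c e" if "c \<in> chains1 \<E>" for e c using that by (simp add: dual_edge_def)
  define c where "c = (\<lambda>e. if e \<in> \<E> then pair2 \<T> \<E> W (psi \<T> \<E> e) else 0)"
  have c: "c \<in> chains1 \<E>" by (simp add: c_def chains1_def)
  show ?thesis
    unfolding J2_def c_def[symmetric]
  proof (rule the_equality)
    show "c \<in> chains1 \<E> \<and> (\<forall>e\<in>\<E>. dual_edge \<E> e c = pair2 \<T> \<E> W (psi \<T> \<E> e))"
      using c d[OF c] by (simp add: c_def)
  next
    fix b assume b: "b \<in> chains1 \<E> \<and> (\<forall>e\<in>\<E>. dual_edge \<E> e b = pair2 \<T> \<E> W (psi \<T> \<E> e))"
    then show "b = c" using d[of b] by (auto simp: c_def chains1_def fun_eq_iff)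
  qed
qed

lemma J2_chains: "J2 \<T> \<E> W \<in> chains1 \<E>"
  by (simp add: J2_eq chains1_def)

lemma J2_edge_dist: "J2 \<T> \<E> (edge_dist \<E> a) = (\<lambda>e. if e \<in> \<E> then a e else 0)"
  by (auto simp: J2_eq pair2_psi fun_eq_iff)

lemma J2_inj: "inj_on (J2 \<T> \<E>) (X2 \<E>)"
proof (rule inj_onI)
  fix W W' assume "W \<in> X2 \<E>" "W' \<in> X2 \<E>" and eq: "J2 \<T> \<E> W = J2 \<T> \<E> W'"
  then obtain a b where ab: "W = edge_dist \<E> a" "W' = edge_dist \<E> b" by (auto simp: X2_def)
  have "a e = b e" if "e \<in> \<E>" for e
    using fun_cong[OF eq, of e] that by (simp add: ab J2_edge_dist)
  then show "W = W'" unfolding ab by (rule edge_dist_cong)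
qed

lemma tt_integral_sym_grad:
  assumes u: "u \<in> smoothV" and e: "e \<in> \<E>"
  shows "tt_integral e (sym_grad u) = tangent e \<bullet> (u (snd e) - u (fst e))"
proof -
  obtain x z where xz: "e = (x, z)" by (cases e)
  have ne: "x \<noteq> z" using edge_D e xz by blast
  show ?thesis
    using tt_integral_edge_mean[OF smoothS_smooth[OF sym_grad_smoothS[OF u]] ne] edge_mean_sym_grad[OF u, of x z]
    by (simp add: xz tangent_def)
qed

text \<open>
  Both sides lie in \<open>X1\<close> and have the edge values \<open>t \<bullet> (u z - u x)\<close>.
\<close>

lemma sym_grad_h_I0:
  assumes u: "u \<in> smoothV"
  shows "sym_grad_h \<T> (I0 \<T> u) = Defs.I1 \<T> \<E> (sym_grad u)"
proof (rule X1_unique_dof)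
  have X0: "I0 \<T> u \<in> X0 \<T>" by (simp add: I0_eq pwl_X0)
  show "sym_grad_h \<T> (I0 \<T> u) \<in> X1 \<T>" by (rule sym_grad_h_X1[OF X0])
  show "Defs.I1 \<T> \<E> (sym_grad u) \<in> X1 \<T>" by (rule I1_X1)
  fix e assume e: "e \<in> \<E>"
  obtain x z where xz: "e = (x, z)" by (cases e)
  obtain T where T: "T \<in> PM" "x \<in> T" "z \<in> T" "x \<noteq> z" using edge_D e xz by blast
  have per: "periodic u" using u by (simp add: smoothV_def)
  have "edge_dof \<T> (sym_grad_h \<T> (I0 \<T> u)) e = ((x - z) \<bullet> (u x - u z)) / norm (z - x)"
    unfolding xz edge_dof_eq[OF sym_grad_h_X1[OF X0] T] edge_val_sym_grad_h[OF X0 T(1-3)]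
    by (simp add: I0_eq pwl_mesh_vertex[OF per T(1)] T)
  also have "\<dots> = tt_integral e (sym_grad u)"
    unfolding tt_integral_sym_grad[OF u e]
    by (simp add: xz tangent_def inner_commute inner_diff_left inner_diff_right diff_divide_distrib)
  finally show "edge_dof \<T> (sym_grad_h \<T> (I0 \<T> u)) e = edge_dof \<T> (Defs.I1 \<T> \<E> (sym_grad u)) e"
    by (simp add: edge_dof_I1[OF e])
qed

text \<open>
  With the edge values of \<open>v\<close> as coefficients, the right-hand side applied to \<open>v\<close> is
  \<open>l2 (I1 v) (inc u)\<close>; symmetry exchanges \<open>u\<close> and \<open>v\<close>.
\<close>

lemma inc_h_I1:
  assumes u: "u \<in> smoothS"
  shows "inc_h (Defs.I1 \<T> \<E> u) = Defs.I2 \<T> \<E> (inc u)"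
proof
  fix v
  have c: "continuous_on UNIV (inc u)" by (intro smooth_continuous_on smooth_inc smoothS_smooth[OF u])
  show "inc_h (Defs.I1 \<T> \<E> u) v = Defs.I2 \<T> \<E> (inc u) v"
  proof (cases "v \<in> smoothS")
    case True
    have "inc_h (Defs.I1 \<T> \<E> u) v = l2 (Defs.I1 \<T> \<E> v) (inc u)"
      using True by (simp add: inc_h_def l2_inc_I1_symmetric[OF u True])
    also have "\<dots> = (\<Sum>e\<in>\<E>. l2 (inc u) (psi \<T> \<E> e) * edge_dof \<T> (Defs.I1 \<T> \<E> v) e)"
      unfolding l2_commute[of _ "inc u"] by (rule l2_psi_expand[OF I1_X1 c])
    also have "\<dots> = Defs.I2 \<T> \<E> (inc u) v"
      using True by (simp add: I2_eq[OF c] edge_dist_def edge_dof_I1 cong: sum.cong)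
    finally show ?thesis .
  next
    case False
    then show ?thesis by (simp add: inc_h_def I2_eq[OF c] edge_dist_def)
  qed
qed

text \<open>
  Transposition of \<open>sym_grad_h_I0\<close>, with \<open>weak_divergence\<close> on the way back.
\<close>

lemma div_h_I2:
  assumes w: "w \<in> smoothS"
  shows "div_h (Defs.I2 \<T> \<E> w) = Defs.I3 \<T> (mat_div w)"
proof
  fix v
  have c: "continuous_on UNIV w" by (rule smooth_continuous_on[OF smoothS_smooth[OF w]])
  have cd: "continuous_on UNIV (mat_div w)" by (rule smooth_continuous_on[OF smoothV_smooth[OF mat_div_smoothV[OF w]]])
  show "div_h (Defs.I2 \<T> \<E> w) v = Defs.I3 \<T> (mat_div w) v"
  proof (cases "v \<in> smoothV")
    case True
    have "div_h (Defs.I2 \<T> \<E> w) v = - (\<Sum>e\<in>\<E>. l2 w (psi \<T> \<E> e) * tt_integral e (sym_grad v))"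
      using True sym_grad_smoothS[OF True] by (simp add: div_h_def I2_eq[OF c] edge_dist_def)
    also have "\<dots> = - (\<Sum>e\<in>\<E>. l2 w (psi \<T> \<E> e) * edge_dof \<T> (Defs.I1 \<T> \<E> (sym_grad v)) e)"
      by (simp add: edge_dof_I1 cong: sum.cong)
    also have "\<dots> = - l2 w (Defs.I1 \<T> \<E> (sym_grad v))"
      by (simp add: l2_psi_expand[OF I1_X1 c])
    also have "\<dots> = - l2 w (sym_grad_h \<T> (I0 \<T> v))" by (simp add: sym_grad_h_I0[OF True])
    also have "\<dots> = l2 (mat_div w) (I0 \<T> v)"
      using weak_divergence[OF _ w, of "I0 \<T> v"] by (simp add: I0_eq pwl_X0)
    also have "\<dots> = (\<Sum>y\<in>vertices \<T>. moment (mat_div w) y \<bullet> v y)"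
      unfolding I0_eq l2_X0_expand[OF cd pwl_X0] by (simp add: pwl_vertex cong: sum.cong)
    also have "\<dots> = Defs.I3 \<T> (mat_div w) v"
      using True by (simp add: I3_eq[OF cd] point_dist_def)
    finally show ?thesis .
  next
    case False
    then show ?thesis by (simp add: div_h_def I3_eq[OF cd] point_dist_def)
  qed
qed

text \<open>
  The divergence of an edge measure sits at the two ends of the edge, which have to be replaced by their
  representatives among the vertices of the torus.
\<close>

lemma div_h_X3: "div_h (edge_dist \<E> a) \<in> X3 \<T>"
proof -
  define b where "b y = (\<Sum>e\<in>\<E>. (a e * (of_bool (torus_rep (fst e) = y) - of_bool (torus_rep (snd e) = y))) *\<^sub>R tangent e)" for y
  have "div_h (edge_dist \<E> a) = point_dist \<T> b"
  proof
    fix v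
    show "div_h (edge_dist \<E> a) v = point_dist \<T> b v"
    proof (cases "v \<in> smoothV")
      case True
      have per: "v (torus_rep x) = v x" for x using True by (intro periodic_torus_rep) (simp add: smoothV_def)
      have pick: "(\<Sum>y\<in>vertices \<T>. of_bool (torus_rep x = y) * (t \<bullet> v y)) = t \<bullet> v x" if "torus_rep x \<in> vertices \<T>" for x t
        using finite_vertices that by (simp add: of_bool_def if_distribR if_distrib[of "\<lambda>c. c * _"] per cong: if_cong)
      have "div_h (edge_dist \<E> a) v = (\<Sum>e\<in>\<E>. a e * (tangent e \<bullet> v (fst e) - tangent e \<bullet> v (snd e)))"
        using True sym_grad_smoothS[OF True]
        by (simp add: div_h_def edge_dist_def tt_integral_sym_grad[OF True] inner_diff_right sum_negf[symmetric] algebra_simps cong: sum.cong)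
      also have "\<dots> = (\<Sum>e\<in>\<E>. \<Sum>y\<in>vertices \<T>. (a e * (of_bool (torus_rep (fst e) = y) - of_bool (torus_rep (snd e) = y))) * (tangent e \<bullet> v y))"
      proof (intro sum.cong refl)
        fix e assume e: "e \<in> \<E>"
        obtain T where T: "T \<in> PM" "fst e \<in> T" "snd e \<in> T" using edge_D[of "fst e" "snd e"] e by auto
        have "(\<Sum>y\<in>vertices \<T>. (a e * (of_bool (torus_rep (fst e) = y) - of_bool (torus_rep (snd e) = y))) * (tangent e \<bullet> v y))
          = a e * ((\<Sum>y\<in>vertices \<T>. of_bool (torus_rep (fst e) = y) * (tangent e \<bullet> v y)) - (\<Sum>y\<in>vertices \<T>. of_bool (torus_rep (snd e) = y) * (tangent e \<bullet> v y)))"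
          by (simp only: sum_subtractf[symmetric] sum_distrib_left left_diff_distrib right_diff_distrib mult.assoc)
        then show "a e * (tangent e \<bullet> v (fst e) - tangent e \<bullet> v (snd e))
          = (\<Sum>y\<in>vertices \<T>. (a e * (of_bool (torus_rep (fst e) = y) - of_bool (torus_rep (snd e) = y))) * (tangent e \<bullet> v y))"
          by (simp only: pick[OF vertex_torus_rep[OF T(1,2)]] pick[OF vertex_torus_rep[OF T(1,3)]])
      qed
      also have "\<dots> = (\<Sum>y\<in>vertices \<T>. b y \<bullet> v y)"
        unfolding b_def inner_sum_left inner_scaleR_left by (rule sum.swap)
      finally show ?thesis using True by (simp add: point_dist_def)
    qed (simp add: div_h_def point_dist_def)
  qed
  then show ?thesis by (simp add: X3_def)
qed

lemma E0_val: "E0 \<T> u = (\<lambda>y. if y \<in> vertices \<T> then u y else 0)"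
  by (auto simp: E0_def J0_eq I0_eq pwl_vertex fun_eq_iff)

lemma E2_val: "w \<in> smoothS \<Longrightarrow> E2 \<T> \<E> w = (\<lambda>e. if e \<in> \<E> then l2 w (psi \<T> \<E> e) else 0)"
  by (simp add: E2_def I2_eq[OF smooth_continuous_on[OF smoothS_smooth]] J2_edge_dist)

lemma E3_val: "u \<in> smoothV \<Longrightarrow> E3 \<T> u = (\<lambda>y. if y \<in> vertices \<T> then moment u y else 0)"
  by (simp add: E3_def I3_eq[OF smooth_continuous_on[OF smoothV_smooth]] J3_eq)

lemma square_sym_grad: "u \<in> smoothV \<Longrightarrow> r0 \<T> \<E> (E0 \<T> u) = E1 \<T> \<E> (sym_grad u)"
  by (simp add: r0_def E0_def E1_def inv_into_f_f[OF J0_inj] I0_eq[of u] pwl_X0 sym_grad_h_I0[unfolded I0_eq])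

lemma square_inc: "u \<in> smoothS \<Longrightarrow> r1 \<T> \<E> (E1 \<T> \<E> u) = E2 \<T> \<E> (inc u)"
  by (simp add: r1_def E1_def E2_def inv_into_f_f[OF J1_inj I1_X1] inc_h_I1)

lemma square_div:
  assumes w: "w \<in> smoothS"
  shows "r2 \<T> \<E> (E2 \<T> \<E> w) = E3 \<T> (mat_div w)"
proof -
  have "Defs.I2 \<T> \<E> w \<in> X2 \<E>"
    by (simp add: I2_eq[OF smooth_continuous_on[OF smoothS_smooth[OF w]]] X2_def)
  then show ?thesis by (simp add: r2_def E2_def E3_def inv_into_f_f[OF J2_inj] div_h_I2[OF w])
qed

text \<open>
  Values of \<^const>\<open>J3\<close> are known on \<open>X3\<close> only, so the preimage under \<^const>\<open>J2\<close> and its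
  divergence have to be located first.
\<close>

lemma r2_chains0V:
  assumes c: "c \<in> chains1 \<E>"
  shows "r2 \<T> \<E> c \<in> chains0V \<T>"
proof -
  have "J2 \<T> \<E> (edge_dist \<E> c) = c" using c by (auto simp: J2_edge_dist chains1_def fun_eq_iff)
  then have "c \<in> J2 \<T> \<E> ` X2 \<E>" by (auto simp: X2_def intro!: image_eqI[of _ _ "edge_dist \<E> c"])
  then have "inv_into (X2 \<E>) (J2 \<T> \<E>) c \<in> X2 \<E>" by (rule inv_into_into)
  then obtain a where "inv_into (X2 \<E>) (J2 \<T> \<E>) c = edge_dist \<E> a" by (auto simp: X2_def)
  moreover obtain b where "div_h (edge_dist \<E> a) = point_dist \<T> b" using div_h_X3[of a] by (auto simp: X3_def)
  ultimately show ?thesis by (simp add: r2_def J3_eq chains0V_def)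
qed

end

theorem mainTheorem2:
  fixes \<T> :: "(real ^ 3) set set" and \<E> :: "edge set"
  assumes mesh: "torus_mesh \<T>"
    and edges: "edge_system \<T> \<E>"
  shows
    "(\<forall>u\<in>smoothV. r0 \<T> \<E> (E0 \<T> u) = E1 \<T> \<E> (sym_grad u)) \<and>
     (\<forall>u\<in>smoothS. r1 \<T> \<E> (E1 \<T> \<E> u) = E2 \<T> \<E> (inc u)) \<and>
     (\<forall>w\<in>smoothS. r2 \<T> \<E> (E2 \<T> \<E> w) = E3 \<T> (mat_div w)) \<and>
     sym_grad \<in> smoothV \<rightarrow> smoothS \<and>
     inc \<in> smoothS \<rightarrow> smoothS \<and>
     mat_div \<in> smoothS \<rightarrow> smoothV \<and>
     r0 \<T> \<E> \<in> cochains0V \<T> \<rightarrow> cochains1 \<E> \<and>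
     r1 \<T> \<E> \<in> cochains1 \<E> \<rightarrow> chains1 \<E> \<and>
     r2 \<T> \<E> \<in> chains1 \<E> \<rightarrow> chains0V \<T> \<and>
     E0 \<T> \<in> smoothV \<rightarrow> cochains0V \<T> \<and>
     (\<forall>u\<in>smoothV. \<forall>y\<in>vertices \<T>. \<forall>L.
        pair0V \<T> (E0 \<T> u) (single y L) = L \<bullet> u y) \<and>
     E1 \<T> \<E> \<in> smoothS \<rightarrow> cochains1 \<E> \<and>
     (\<forall>u\<in>smoothS. \<forall>e\<in>\<E>. E1 \<T> \<E> u (single e 1) = tt_integral e u) \<and>
     E2 \<T> \<E> \<in> smoothS \<rightarrow> chains1 \<E> \<and>
     (\<forall>w\<in>smoothS. \<forall>e\<in>\<E>. dual_edge \<E> e (E2 \<T> \<E> w) = l2 w (psi \<T> \<E> e)) \<and>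
     E3 \<T> \<in> smoothV \<rightarrow> chains0V \<T> \<and>
     (\<forall>u\<in>smoothV. \<forall>y\<in>vertices \<T>. \<forall>L.
        pair0V \<T> (single y L) (E3 \<T> u) = l2 u (\<lambda>x. hat \<T> y x *\<^sub>R L))"
proof -
  interpret mesh_edges \<T> \<E> using mesh edges by unfold_locales
  show ?thesis
  proof (intro conjI ballI allI funcsetI)
    fix u assume u: "u \<in> smoothV"
    show "r0 \<T> \<E> (E0 \<T> u) = E1 \<T> \<E> (sym_grad u)" by (rule square_sym_grad[OF u])
    show "sym_grad u \<in> smoothS" by (rule sym_grad_smoothS[OF u])
    show "E0 \<T> u \<in> cochains0V \<T>" by (simp add: E0_val cochains0V_def)
    show "E3 \<T> u \<in> chains0V \<T>" by (simp add: E3_val[OF u] chains0V_def)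
    fix y L assume y: "y \<in> vertices \<T>"
    show "pair0V \<T> (E0 \<T> u) (single y L) = L \<bullet> u y"
      using y by (simp add: E0_val pair0V_def sum_single[OF finite_vertices y] inner_commute)
    show "pair0V \<T> (single y L) (E3 \<T> u) = l2 u (\<lambda>x. hat \<T> y x *\<^sub>R L)"
      using y by (simp add: E3_val[OF u] pair0V_def sum_single[OF finite_vertices y] inner_commute
          l2_hat[OF smooth_continuous_on[OF smoothV_smooth[OF u]] y])
  next
    fix w assume w: "w \<in> smoothS"
    show "r1 \<T> \<E> (E1 \<T> \<E> w) = E2 \<T> \<E> (inc w)" by (rule square_inc[OF w])
    show "r2 \<T> \<E> (E2 \<T> \<E> w) = E3 \<T> (mat_div w)" by (rule square_div[OF w])
    show "inc w \<in> smoothS" by (rule inc_smoothS[OF w])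
    show "mat_div w \<in> smoothV" by (rule mat_div_smoothV[OF w])
    show "E1 \<T> \<E> w \<in> cochains1 \<E>" by (simp add: E1_def J1_cochains)
    show "E2 \<T> \<E> w \<in> chains1 \<E>" by (simp add: E2_def J2_chains)
    fix e assume e: "e \<in> \<E>"
    show "E1 \<T> \<E> w (single e 1) = tt_integral e w" by (simp add: E1_def J1_single[OF e] edge_dof_I1[OF e])
    show "dual_edge \<E> e (E2 \<T> \<E> w) = l2 w (psi \<T> \<E> e)"
      using e by (simp add: E2_val[OF w] dual_edge_def chains1_def)
  next
    fix c show "r0 \<T> \<E> c \<in> cochains1 \<E>" by (simp add: r0_def J1_cochains)
  next
    fix \<phi> show "r1 \<T> \<E> \<phi> \<in> chains1 \<E>" by (simp add: r1_def J2_chains)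
  next
    fix c assume "c \<in> chains1 \<E>"
    then show "r2 \<T> \<E> c \<in> chains0V \<T>" by (rule r2_chains0V)
  qed
qed

end
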